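(* Let $\mathbb K$ be a field, $\alpha,\beta,s\in\mathbb N$. For every $\alpha\times\beta$ matrix valued nc rational function $\mathfrak r=[\mathfrak R_{ij}]_{1\le i\le\alpha,1\le j\le\beta}$ in $x_1,\dots,x_d$ over $\mathbb K$ and every $\underline Y=(Y_1,\dots,Y_d)\in dom_s(\mathfrak r)$, there exist unique (up to unique similarity) $L\in\mathbb N$, $D\in\mathbb K^{\alpha s\times\beta s}$, $C\in\mathbb K^{\alpha s\times L}$ and linear mappings $\mathbf A_1,\dots,\mathbf A_d:\mathbb K^{s\times s}\to\mathbb K^{L\times L}$, $\mathbf B_1,\dots,\mathbf B_d:\mathbb K^{s\times s}\to\mathbb K^{L\times\beta s}$ such that $(\underline{\mathbf A},\underline{\mathbf B})$ is controllable, $(C,\underline{\mathbf A})$ is observable, and for every $m\in\mathbb N$ $$dom_{sm}(\mathfrak r)\subseteq\Big\{\underline X\in(\mathbb K^{sm\times sm})^d:\det\Big(I_{Lm}-\sum_{k=1}^d(X_k-I_m\otimes Y_k)\mathbf A_k\Big)\ne0\Big\}$$ and $\mathfrak r(\underline X)=\mathcal R(\underline X)$ for every $\underline X\in dom_{sm}(\mathfrak r)$, where $$\mathcal R(\underline X)=I_m\otimes D+(I_m\otimes C)\Big(I_{Lm}-\sum_{k=1}^d(X_k-I_m\otimes Y_k)\mathbf A_k\Big)^{-1}\sum_{k=1}^d(X_k-I_m\otimes Y_k)\mathbf B_k .$$ Moreover, for every $n\in\mathbb N$, $$dom_n(\mathfrak r)\subseteq\Big\{\underline X\in(\mathbb K^{n\times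 n})^d:\det\Big(I_{nL}-\sum_{k=1}^d(I_s\otimes X_k-I_n\otimes Y_k)\mathbf A_k\Big)\ne0\Big\}$$ and $I_s\otimes\mathfrak r(\underline X)=\mathcal R(I_s\otimes\underline X)$ for every $\underline X\in dom_n(\mathfrak r)$. Furthermore, for every unital stably finite $\mathbb K$-algebra $\mathcal A$, $$dom^{\mathcal A}(\mathfrak r)\subseteq\Big\{\underline{\mathfrak a}\in\mathcal A^d: I_L\otimes1_{\mathcal A}-\sum_{k=1}^d(I_s\otimes\mathfrak a_k-Y_k\otimes1_{\mathcal A})\mathbf A_k^{\mathcal A}\ \text{is invertible in }\mathcal A^{L\times L}\Big\}$$ and for every $\underline{\mathfrak a}\in dom^{\mathcal A}(\mathfrak r)$ one has $I_s\otimes\mathfrak r^{\mathcal A}(\underline{\mathfrak a})=\mathcal R^{\mathcal A}(I_s\otimes\underline{\mathfrak a})$, i.e. $$I_s\otimes\mathfrak r^{\mathcal A}(\underline{\mathfrak a})=D\otimes1_{\mathcal A}+(C\otimes1_{\mathcal A})\Big(I_L\otimes1_{\mathcal A}-\sum_{k=1}^d(I_s\otimes\mathfrak a_k-Y_k\otimes1_{\mathcal A})\mathbf A_k^{\mathcal A}\Big)^{-1}\sum_{k=1}^d(I_s\otimes\mathfrak a_k-Y_k\otimes1_{\mathcal A})\mathbf B_k^{\mathcal A}.$$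
   Context: $\mathbb N=\{1,2,\dots\}$, $d\in\mathbb N$; underlined letters denote tuples and operations such as $I_s\otimes\underline X$ act componentwise ($\otimes$ is the Kronecker product). NC rational expressions and functions. A nc rational expression $R$ in $x_1,\dots,x_d$ over $\mathbb K$ is a formal expression obtained from nc polynomials in $\mathbb K\langle x_1,\dots,x_d\rangle$ by successive additions, multiplications and inversions. For a unital $\mathbb K$-algebra $\mathcal A$, $dom^{\mathcal A}(R)\subseteq\mathcal A^d$ and $R^{\mathcal A}(\underline{\mathfrak a})\in\mathcal A$ are defined recursively: for a nc polynomial the domain is $\mathcal A^d$ and evaluation is substitution; for $R=R_1+R_2$ or $R=R_1R_2$ the domain is $dom^{\mathcal A}(R_1)\cap dom^{\mathcal A}(R_2)$ and the value is the sum, resp. product; for $R=R_1^{-1}$ the domain is $\{\underline{\mathfrak a}\in dom^{\mathcal A}(R_1): R_1^{\mathcal A}(\underline{\mathfrak a})\text{ invertible}\}$ and the value is the inverse. For $\mathcal A=\mathbb K^{n\times n}$ write $dom_n(R)$, $R(\underline X)$; $dom(R)=\coprod_n dom_n(R)$; $R$ is non-degenerate if $dom(R)\ne\emptyset$. A nc rational function $\mathfrak R$ is an equivalence class of non-degenerate expressions, where $R_1\sim R_2$ iff $R_1(\underline X)=R_2(\underline X)$ for all $\underline X\in dom(R_1)\cap dom(R_2)$; $dom_n(\mathfrak R)=\bigcup_{R\in\mathfrak R}dom_n(R)$, $dom^{\mathcal A}(\mathfrak R)=\bigcup_{R\in\mathfrak R}dom^{\mathcal A}(R)$, and $\mathfrak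 R(\underline X)$, $\mathfrak R^{\mathcal A}(\underline{\mathfrak a})$ are the values of any $R\in\mathfrak R$ defined there (independent of choice for stably finite $\mathcal A$). $\mathcal A$ is stably finite if for all $m\in\mathbb N$ and $\mathfrak A,\mathfrak B\in\mathcal A^{m\times m}$: $\mathfrak A\mathfrak B=I_m\otimes1_{\mathcal A}$ iff $\mathfrak B\mathfrak A=I_m\otimes1_{\mathcal A}$. Matrix valued nc rational functions. An $\alpha\times\beta$ matrix valued nc rational function is a matrix $\mathfrak r=[\mathfrak R_{ij}]$ of nc rational functions; $dom_n(\mathfrak r)=\bigcap_{i,j}dom_n(\mathfrak R_{ij})$, and for $\underline X\in dom_n(\mathfrak r)$ $$\mathfrak r(\underline X)=E(n,\alpha)\,[\mathfrak R_{ij}(\underline X)]_{1\le i\le\alpha,1\le j\le\beta}\,E(n,\beta)^T\in\mathbb K^{\alpha n\times\beta n},$$ where $E(n_1,n_2)$ is the permutation matrix with $E(n_1,n_2)(a\otimes b)=b\otimes a$ for $a\in\mathbb K^{n_2},b\in\mathbb K^{n_1}$ (equivalently, $\mathfrak r(\underline X)=\sum_{i,j}\mathfrak R_{ij}(\underline X)\otimes E_{ij}$ with $E_{ij}\in\mathbb K^{\alpha\times\beta}$ the matrix units). $dom^{\mathcal A}(\mathfrak r)=\bigcap_{i,j}dom^{\mathcal A}(\mathfrak R_{ij})$ and $\mathfrak r^{\mathcal A}(\underline{\mathfrak a})=[\mathfrak R_{ij}^{\mathcal A}(\underline{\mathfrak a})]_{i,j}\in\mathcal A^{\alpha\times\beta}$.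 Extension of linear mappings. For a linear mapping $\mathbf T$ on $\mathbb K^{s\times s}$ and $X=[X_{ij}]_{i,j=1}^m\in\mathbb K^{sm\times sm}$ with $X_{ij}\in\mathbb K^{s\times s}$, $(X)\mathbf T=[\mathbf T(X_{ij})]_{i,j=1}^m$. For $\mathfrak A=\sum_{i,j}E_{ij}\otimes\mathfrak a_{ij}\in\mathcal A^{s\times s}$, $(\mathfrak A)\mathbf T^{\mathcal A}=\sum_{i,j}\mathbf T(E_{ij})\otimes\mathfrak a_{ij}$. Controllable: the vectors $\mathbf A_{i_1}(X_1)\cdots\mathbf A_{i_\ell}(X_\ell)\mathbf B_k(X_{\ell+1})u$ ($\ell\ge0$, $1\le i_j,k\le d$, $X_j\in\mathbb K^{s\times s}$, $u\in\mathbb K^{\beta s}$) span $\mathbb K^L$. Observable: $\bigcap\ker(C\mathbf A_{i_1}(X_1)\cdots\mathbf A_{i_\ell}(X_\ell))=\{0\}$ over all $\ell\ge0$, $1\le i_j\le d$, $X_j\in\mathbb K^{s\times s}$. Uniqueness up to unique similarity: if $(L',D',C',\underline{\mathbf A}',\underline{\mathbf B}')$ is another such controllable and observable system (satisfying the domain inclusion and equality for all $dom_{sm}(\mathfrak r)$, $m\in\mathbb N$), then $L'=L$, $D'=D$ and there is a unique invertible $T\in\mathbb K^{L\times L}$ with $C'=CT^{-1}$, $\mathbf B'_k(X)=T\mathbf B_k(X)$, $\mathbf A'_k(X)=T\mathbf A_k(X)T^{-1}$ for all $k$ and $X\in\mathbb K^{s\times s}$.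
   Formalization: The dimension L is allowed to be 0, since for a constant function a controllable and observable realization exists only with L = 0, so L ≥ 1 would be false; the zero algebra, where the claim is trivial, is not included among the stably finite algebras. *)

theory Defs
  imports
    "Jordan_Normal_Form.VS_Connect"
    "Jordan_Normal_Form.Matrix_Kernel"
    "HOL-Library.Poly_Mapping"
begin

section \<open>Algebras\<close>

text \<open>
  Noncommutative expressions are evaluated in algebras presented as HOL-Algebra \<^typ>\<open>('k, 'a) module\<close>
  records. Two kinds of records are used: the matrix algebra of all \<open>n \<times> n\<close> matrices over a field,
  and the record of an algebra given by a type \<open>'a\<close> of class \<^class>\<open>ring_1\<close> with a scalar
  multiplication \<open>scale\<close>.
\<close>

abbreviation mat_algebra :: "nat \<Rightarrow> ('a::semiring_1, 'a mat) module" where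
  "mat_algebra n \<equiv> module_mat TYPE('a) n n"

definition type_algebra :: "('k \<Rightarrow> 'a \<Rightarrow> 'a) \<Rightarrow> ('k, 'a::ring_1) module" where
  "type_algebra scale = \<lparr>carrier = UNIV, mult = (*), one = 1, zero = 0, add = (+), smult = scale\<rparr>"

locale unital_algebra = vector_space scale
  for scale :: "'k::field \<Rightarrow> 'a::ring_1 \<Rightarrow> 'a" +
  assumes scale_mult_left: "scale c x * y = scale c (x * y)"
    and scale_mult_right: "x * scale c y = scale c (x * y)"

definition stably_finite :: "'a::ring_1 itself \<Rightarrow> bool" where
  "stably_finite _ \<longleftrightarrow>
     (\<forall>m\<ge>1. \<forall>P \<in> carrier_mat m m. \<forall>Q \<in> carrier_mat m m.
        P * Q = (1\<^sub>m m :: 'a mat) \<longleftrightarrow> Q * P = 1\<^sub>m m)"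


section \<open>Noncommutative rational expressions and functions\<close>

text \<open>
  The variables are indexed by a type \<open>'d\<close> (a finite one in the theorem, so \<open>d = CARD('d) \<ge> 1\<close>).
  An element of the free algebra is a finitely supported map from words to coefficients.
\<close>

declare [[typedef_overloaded = true]]

datatype ('d, 'k::zero) nc_expr =
    Poly "'d list \<Rightarrow>\<^sub>0 'k"
  | Add "('d, 'k) nc_expr" "('d, 'k) nc_expr"
  | Mul "('d, 'k) nc_expr" "('d, 'k) nc_expr"
  | Inv "('d, 'k) nc_expr"

definition word_eval :: "('a, 'm) monoid_scheme \<Rightarrow> 'd list \<Rightarrow> ('d \<Rightarrow> 'a) \<Rightarrow> 'a" where
  "word_eval \<A> w a = foldr (\<lambda>k b. a k \<otimes>\<^bsub>\<A>\<^esub> b) w \<one>\<^bsub>\<A>\<^esub>"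

definition poly_eval :: "('k::zero, 'a, 'm) module_scheme \<Rightarrow> ('d list \<Rightarrow>\<^sub>0 'k) \<Rightarrow> ('d \<Rightarrow> 'a) \<Rightarrow> 'a" where
  "poly_eval \<A> p a =
     (\<Oplus>\<^bsub>\<A>\<^esub>w\<in>Poly_Mapping.keys p. Poly_Mapping.lookup p w \<odot>\<^bsub>\<A>\<^esub> word_eval \<A> w a)"

primrec expr_eval :: "('k::zero, 'a, 'm) module_scheme \<Rightarrow> ('d, 'k) nc_expr \<Rightarrow> ('d \<Rightarrow> 'a) \<Rightarrow> 'a" where
  "expr_eval \<A> (Poly p) a = poly_eval \<A> p a"
| "expr_eval \<A> (Add R1 R2) a = expr_eval \<A> R1 a \<oplus>\<^bsub>\<A>\<^esub> expr_eval \<A> R2 a"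
| "expr_eval \<A> (Mul R1 R2) a = expr_eval \<A> R1 a \<otimes>\<^bsub>\<A>\<^esub> expr_eval \<A> R2 a"
| "expr_eval \<A> (Inv R) a = inv\<^bsub>\<A>\<^esub> (expr_eval \<A> R a)"

primrec expr_dom :: "('k::zero, 'a, 'm) module_scheme \<Rightarrow> ('d, 'k) nc_expr \<Rightarrow> ('d \<Rightarrow> 'a) set" where
  "expr_dom \<A> (Poly p) = {a. \<forall>k. a k \<in> carrier \<A>}"
| "expr_dom \<A> (Add R1 R2) = expr_dom \<A> R1 \<inter> expr_dom \<A> R2"
| "expr_dom \<A> (Mul R1 R2) = expr_dom \<A> R1 \<inter> expr_dom \<A> R2"
| "expr_dom \<A> (Inv R) = {a \<in> expr_dom \<A> R. expr_eval \<A> R a \<in> Units \<A>}"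

definition nondegenerate :: "('d, 'k::field) nc_expr \<Rightarrow> bool" where
  "nondegenerate R \<longleftrightarrow> (\<exists>n\<ge>1. expr_dom (mat_algebra n) R \<noteq> {})"

definition expr_equiv :: "(('d, 'k::field) nc_expr \<times> ('d, 'k) nc_expr) set" where
  "expr_equiv = {(R1, R2). nondegenerate R1 \<and> nondegenerate R2 \<and>
     (\<forall>n\<ge>1. \<forall>X \<in> expr_dom (mat_algebra n) R1 \<inter> expr_dom (mat_algebra n) R2.
        expr_eval (mat_algebra n) R1 X = expr_eval (mat_algebra n) R2 X)}"

definition nc_rational_functions :: "('d, 'k::field) nc_expr set set" where
  "nc_rational_functions = {R. nondegenerate R} // expr_equiv"

definition rat_dom :: "('k::zero, 'a, 'm) module_scheme \<Rightarrow> ('d, 'k) nc_expr set \<Rightarrow> ('d \<Rightarrow> 'a) set" where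
  "rat_dom \<A> \<RR> = (\<Union>R\<in>\<RR>. expr_dom \<A> R)"

definition rat_eval :: "('k::zero, 'a, 'm) module_scheme \<Rightarrow> ('d, 'k) nc_expr set \<Rightarrow> ('d \<Rightarrow> 'a) \<Rightarrow> 'a" where
  "rat_eval \<A> \<RR> a = (THE v. \<exists>R\<in>\<RR>. a \<in> expr_dom \<A> R \<and> v = expr_eval \<A> R a)"


section \<open>Kronecker products and matrix units\<close>

definition kron :: "'a::times mat \<Rightarrow> 'a mat \<Rightarrow> 'a mat" (infixl "\<otimes>\<^sub>K" 70) where
  "P \<otimes>\<^sub>K Q = mat (dim_row P * dim_row Q) (dim_col P * dim_col Q)
     (\<lambda>(i, j). P $$ (i div dim_row Q, j div dim_col Q) * Q $$ (i mod dim_row Q, j mod dim_col Q))"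

definition mat_unit :: "nat \<Rightarrow> nat \<Rightarrow> nat \<Rightarrow> nat \<Rightarrow> 'a::zero_neq_one mat" where
  "mat_unit p q i j = mat p q (\<lambda>(u, v). if u = i \<and> v = j then 1 else 0)"

text \<open>\<open>scalar_tensor scale P a\<close> is \<open>P \<otimes> a\<close> for a scalar matrix \<open>P\<close> and an element \<open>a\<close> of the algebra.\<close>

definition scalar_tensor :: "('k \<Rightarrow> 'a \<Rightarrow> 'a) \<Rightarrow> 'k mat \<Rightarrow> 'a \<Rightarrow> 'a mat" where
  "scalar_tensor scale P a = map_mat (\<lambda>c. scale c a) P"


section \<open>Matrix valued noncommutative rational functions\<close>

definition nc_rational_matrices :: "nat \<Rightarrow> nat \<Rightarrow> ('d, 'k::field) nc_expr set mat set" where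
  "nc_rational_matrices \<alpha> \<beta> = {r \<in> carrier_mat \<alpha> \<beta>. elements_mat r \<subseteq> nc_rational_functions}"

definition rat_mat_dom :: "('k::zero, 'a, 'm) module_scheme \<Rightarrow> ('d, 'k) nc_expr set mat \<Rightarrow> ('d \<Rightarrow> 'a) set" where
  "rat_mat_dom \<A> r = (\<Inter>\<RR>\<in>elements_mat r. rat_dom \<A> \<RR>)"

definition rat_mat_eval :: "('k::zero, 'a, 'm) module_scheme \<Rightarrow> ('d, 'k) nc_expr set mat \<Rightarrow> ('d \<Rightarrow> 'a) \<Rightarrow> 'a mat" where
  "rat_mat_eval \<A> r a = map_mat (\<lambda>\<RR>. rat_eval \<A> \<RR> a) r"

text \<open>
  On tuples of \<open>n \<times> n\<close> matrices the value is \<open>\<Sum>\<^sub>i\<^sub>j \<RR>\<^sub>i\<^sub>j(X) \<otimes> E\<^sub>i\<^sub>j\<close>, i.e. the block matrix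
  \<open>rat_mat_eval (mat_algebra n) r X\<close> after the permutation exchanging the order of the tensor factors.
\<close>

definition rat_mat_value :: "nat \<Rightarrow> ('d, 'k::field) nc_expr set mat \<Rightarrow> ('d \<Rightarrow> 'k mat) \<Rightarrow> 'k mat" where
  "rat_mat_value n r X =
     finsum (module_mat TYPE('k) (n * dim_row r) (n * dim_col r))
       (\<lambda>(i, j). rat_mat_eval (mat_algebra n) r X $$ (i, j) \<otimes>\<^sub>K mat_unit (dim_row r) (dim_col r) i j)
       ({..<dim_row r} \<times> {..<dim_col r})"


section \<open>Extension of linear mappings\<close>

definition mat_block :: "nat \<Rightarrow> 'a mat \<Rightarrow> nat \<Rightarrow> nat \<Rightarrow> 'a mat" where
  "mat_block s X i j = mat s s (\<lambda>(u, v). X $$ (i * s + u, j * s + v))"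

text \<open>
  For \<open>T\<close> from \<open>s \<times> s\<close> to \<open>p \<times> q\<close> matrices: \<open>T\<close> is applied to each of the \<open>m \<times> m\<close> many
  \<open>s \<times> s\<close> blocks of \<open>X\<close>.
\<close>

definition ext_map :: "nat \<Rightarrow> nat \<Rightarrow> nat \<Rightarrow> nat \<Rightarrow> ('a mat \<Rightarrow> 'a mat) \<Rightarrow> 'a mat \<Rightarrow> 'a mat" where
  "ext_map s p q m T X = mat (m * p) (m * q)
     (\<lambda>(i, j). T (mat_block s X (i div p) (j div q)) $$ (i mod p, j mod q))"

definition ext_map_alg ::
  "('k::field \<Rightarrow> 'a::ring_1 \<Rightarrow> 'a) \<Rightarrow> nat \<Rightarrow> nat \<Rightarrow> nat \<Rightarrow> ('k mat \<Rightarrow> 'k mat) \<Rightarrow> 'a mat \<Rightarrow> 'a mat" where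
  "ext_map_alg scale s p q T \<AA> =
     finsum (module_mat TYPE('a) p q)
       (\<lambda>(i, j). scalar_tensor scale (T (mat_unit s s i j)) (\<AA> $$ (i, j)))
       ({..<s} \<times> {..<s})"


section \<open>Realizations centred at a tuple of matrices\<close>

definition linear_mat_map :: "nat \<Rightarrow> nat \<Rightarrow> nat \<Rightarrow> ('k::field mat \<Rightarrow> 'k mat) \<Rightarrow> bool" where
  "linear_mat_map s p q T \<longleftrightarrow>
     T \<in> LinearCombinations.module_hom class_ring (module_mat TYPE('k) s s) (module_mat TYPE('k) p q)"

definition fm_system ::
  "nat \<Rightarrow> nat \<Rightarrow> nat \<Rightarrow> nat \<Rightarrow> 'k::field mat \<Rightarrow> 'k mat \<Rightarrow>
   ('d \<Rightarrow> 'k mat \<Rightarrow> 'k mat) \<Rightarrow> ('d \<Rightarrow> 'k mat \<Rightarrow> 'k mat) \<Rightarrow> bool" where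
  "fm_system \<alpha> \<beta> s L D C A B \<longleftrightarrow>
     D \<in> carrier_mat (\<alpha> * s) (\<beta> * s) \<and> C \<in> carrier_mat (\<alpha> * s) L \<and>
     (\<forall>k. linear_mat_map s L L (A k)) \<and> (\<forall>k. linear_mat_map s L (\<beta> * s) (B k))"

text \<open>\<open>A\<^bsub>i\<^sub>1\<^esub>(X\<^sub>1) \<cdots> A\<^bsub>i\<^sub>l\<^esub>(X\<^sub>l)\<close>, the identity for the empty list.\<close>

definition word_prod :: "nat \<Rightarrow> ('d \<Rightarrow> 'k mat \<Rightarrow> 'k mat) \<Rightarrow> ('d \<times> 'k mat) list \<Rightarrow> 'k::field mat" where
  "word_prod L A w = foldr (\<lambda>(i, X) M. A i X * M) w (1\<^sub>m L)"

definition controllable ::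
  "nat \<Rightarrow> nat \<Rightarrow> nat \<Rightarrow> ('d \<Rightarrow> 'k::field mat \<Rightarrow> 'k mat) \<Rightarrow> ('d \<Rightarrow> 'k mat \<Rightarrow> 'k mat) \<Rightarrow> bool" where
  "controllable \<beta> s L A B \<longleftrightarrow>
     LinearCombinations.module.span class_ring (module_vec TYPE('k) L)
       {(word_prod L A w * B k X) *\<^sub>v u | w k X u.
          w \<in> lists (UNIV \<times> carrier_mat s s) \<and> X \<in> carrier_mat s s \<and> u \<in> carrier_vec (\<beta> * s)}
     = carrier_vec L"

definition observable ::
  "nat \<Rightarrow> nat \<Rightarrow> 'k::field mat \<Rightarrow> ('d \<Rightarrow> 'k mat \<Rightarrow> 'k mat) \<Rightarrow> bool" where
  "observable s L C A \<longleftrightarrow>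
     (\<Inter>w\<in>lists (UNIV \<times> carrier_mat s s). mat_kernel (C * word_prod L A w)) = {0\<^sub>v L}"

definition fm_pencil ::
  "nat \<Rightarrow> ('d \<Rightarrow> 'k::field mat) \<Rightarrow> nat \<Rightarrow> ('d \<Rightarrow> 'k mat \<Rightarrow> 'k mat) \<Rightarrow> nat \<Rightarrow> ('d \<Rightarrow> 'k mat) \<Rightarrow> 'k mat" where
  "fm_pencil s Y L A m X =
     1\<^sub>m (m * L) -
     (\<Oplus>\<^bsub>module_mat TYPE('k) (m * L) (m * L)\<^esub>k\<in>UNIV. ext_map s L L m (A k) (X k - 1\<^sub>m m \<otimes>\<^sub>K Y k))"

definition fm_value ::
  "nat \<Rightarrow> nat \<Rightarrow> ('d \<Rightarrow> 'k::field mat) \<Rightarrow> nat \<Rightarrow> 'k mat \<Rightarrow> 'k mat \<Rightarrow>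
   ('d \<Rightarrow> 'k mat \<Rightarrow> 'k mat) \<Rightarrow> ('d \<Rightarrow> 'k mat \<Rightarrow> 'k mat) \<Rightarrow> nat \<Rightarrow> ('d \<Rightarrow> 'k mat) \<Rightarrow> 'k mat" where
  "fm_value \<beta> s Y L D C A B m X =
     1\<^sub>m m \<otimes>\<^sub>K D +
     (1\<^sub>m m \<otimes>\<^sub>K C) * inv\<^bsub>mat_algebra (m * L)\<^esub> (fm_pencil s Y L A m X) *
     (\<Oplus>\<^bsub>module_mat TYPE('k) (m * L) (m * (\<beta> * s))\<^esub>k\<in>UNIV.
        ext_map s L (\<beta> * s) m (B k) (X k - 1\<^sub>m m \<otimes>\<^sub>K Y k))"

text \<open>The evaluation over an algebra takes a tuple \<open>\<XX>\<close> of \<open>s \<times> s\<close> matrices over the algebra.\<close>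

definition fm_pencil_alg ::
  "('k::field \<Rightarrow> 'a::ring_1 \<Rightarrow> 'a) \<Rightarrow> nat \<Rightarrow> ('d \<Rightarrow> 'k mat) \<Rightarrow> nat \<Rightarrow> ('d \<Rightarrow> 'k mat \<Rightarrow> 'k mat) \<Rightarrow>
   ('d \<Rightarrow> 'a mat) \<Rightarrow> 'a mat" where
  "fm_pencil_alg scale s Y L A \<XX> =
     scalar_tensor scale (1\<^sub>m L) 1 -
     (\<Oplus>\<^bsub>module_mat TYPE('a) L L\<^esub>k\<in>UNIV.
        ext_map_alg scale s L L (A k) (\<XX> k - scalar_tensor scale (Y k) 1))"

definition fm_value_alg ::
  "('k::field \<Rightarrow> 'a::ring_1 \<Rightarrow> 'a) \<Rightarrow> nat \<Rightarrow> nat \<Rightarrow> ('d \<Rightarrow> 'k mat) \<Rightarrow> nat \<Rightarrow> 'k mat \<Rightarrow> 'k mat \<Rightarrow>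
   ('d \<Rightarrow> 'k mat \<Rightarrow> 'k mat) \<Rightarrow> ('d \<Rightarrow> 'k mat \<Rightarrow> 'k mat) \<Rightarrow> ('d \<Rightarrow> 'a mat) \<Rightarrow> 'a mat" where
  "fm_value_alg scale \<beta> s Y L D C A B \<XX> =
     scalar_tensor scale D 1 +
     scalar_tensor scale C 1 * inv\<^bsub>mat_algebra L\<^esub> (fm_pencil_alg scale s Y L A \<XX>) *
     (\<Oplus>\<^bsub>module_mat TYPE('a) L (\<beta> * s)\<^esub>k\<in>UNIV.
        ext_map_alg scale s L (\<beta> * s) (B k) (\<XX> k - scalar_tensor scale (Y k) 1))"

text \<open>
  The state dimension \<open>L\<close> may be \<open>0\<close>: for a constant function a controllable and observable
  realization exists only with \<open>L = 0\<close>.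
\<close>

definition minimal_realization ::
  "nat \<Rightarrow> nat \<Rightarrow> nat \<Rightarrow> ('d, 'k::field) nc_expr set mat \<Rightarrow> ('d \<Rightarrow> 'k mat) \<Rightarrow> nat \<Rightarrow> 'k mat \<Rightarrow> 'k mat \<Rightarrow>
   ('d \<Rightarrow> 'k mat \<Rightarrow> 'k mat) \<Rightarrow> ('d \<Rightarrow> 'k mat \<Rightarrow> 'k mat) \<Rightarrow> bool" where
  "minimal_realization \<alpha> \<beta> s r Y L D C A B \<longleftrightarrow>
     fm_system \<alpha> \<beta> s L D C A B \<and> controllable \<beta> s L A B \<and> observable s L C A \<and>
     (\<forall>m\<ge>1. \<forall>X \<in> rat_mat_dom (mat_algebra (s * m)) r.
        det (fm_pencil s Y L A m X) \<noteq> 0 \<and>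
        rat_mat_value (s * m) r X = fm_value \<beta> s Y L D C A B m X)"

definition uniquely_similar ::
  "nat \<Rightarrow>
   nat \<Rightarrow> 'k::field mat \<Rightarrow> 'k mat \<Rightarrow> ('d \<Rightarrow> 'k mat \<Rightarrow> 'k mat) \<Rightarrow> ('d \<Rightarrow> 'k mat \<Rightarrow> 'k mat) \<Rightarrow>
   nat \<Rightarrow> 'k mat \<Rightarrow> 'k mat \<Rightarrow> ('d \<Rightarrow> 'k mat \<Rightarrow> 'k mat) \<Rightarrow> ('d \<Rightarrow> 'k mat \<Rightarrow> 'k mat) \<Rightarrow> bool" where
  "uniquely_similar s L D C A B L' D' C' A' B' \<longleftrightarrow>
     L' = L \<and> D' = D \<and>
     (\<exists>!T. T \<in> Units (mat_algebra L) \<and> C' = C * inv\<^bsub>mat_algebra L\<^esub> T \<and>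
        (\<forall>k. \<forall>X \<in> carrier_mat s s.
           B' k X = T * B k X \<and> A' k X = T * A k X * inv\<^bsub>mat_algebra L\<^esub> T))"

end

theory Submission
  imports Defs
begin

text \<open>
  A rational expression is realised by a linear pencil built along its sums, products and inverses by Schur
  complements, so that over a stably finite algebra the pencil is invertible exactly where the expression is
  defined. Expanding the pencil at \<open>Y\<close> in the matrix entries of the variables gives a system with constant
  state term \<open>1\<close>, whose minimal reduction is the realization; uniqueness is the state space isomorphism
  theorem, because values at strictly upper triangular points recover the Markov parameters.

  The point to prove is that the pencil of the minimal system is invertible on the domain of \<^emph>\<open>every\<close>
  representative of the function, although only some representative is defined at \<open>Y\<close>. Stable finiteness makes a
  minimal system regular wherever some system with the same Markov parameters is regular. Minimality survives
  recentring at any regular matrix point, so another representative is compared after recentring both systems at a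
  common regular point \<open>Z\<close>. Such a \<open>Z\<close> exists even over finite fields because an indeterminate may be specialised
  to a companion matrix. Replacing \<open>X\<close> by \<open>1 \<otimes> X\<close> adjusts the sizes.
\<close>

section \<open>Kronecker products with scalar matrices\<close>

text \<open>A representative R' other than the one chosen at Y may be undefined at Y, so its pencil
  can be singular there and cannot be expanded. It is only rewritten in the matrix entries of X - 1
  \<otimes> Y, which takes no inverse, and normalised at Z. Membership in a class relates R and R'
  to a common R0, so they are known to agree only where R0 is defined too; Z is therefore chosen in
  the domains of all three, and so are the nilpotent perturbations of Z that read off Markov
  parameters. These stay in the domains because an expression is defined exactly where its pencil is
  invertible. The bare Schur complement pencil violates this: it can be invertible where the pencil
  of the inner expression is singular. The inverse is therefore realised by that pencil together
  with the inner one. Matrices have entries in an algebra whose scalar action is a parameter, so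
  that one argument covers evaluation at matrices and over stably finite algebras. Replacing a
  matrix variable by e*e entry variables turns a matrix centre into the centre 0 of an ordinary
  linear system, for which reachability and observability are statements about invariant
  subspaces.\<close>

abbreviation grid :: "'i set \<Rightarrow> nat \<Rightarrow> ('i \<times> nat \<times> nat) set" where
  "grid I e \<equiv> I \<times> {..<e} \<times> {..<e}"

section \<open>Matrix arithmetic guarded by equations between dimensions, which rewriting can
  discharge, instead of carrier sets\<close>

named_theorems mat_dim_simps

lemma mat_mult_assoc [mat_dim_simps]:
  fixes A :: "'a::semiring_0 mat"
  assumes "dim_col A = dim_row B" "dim_col B = dim_row C"
  shows "A * B * C = A * (B * C)"
  by (rule assoc_mult_mat[of A "dim_row A" "dim_row B" B "dim_row C" C "dim_col C"]) (use assms in auto)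

lemma mat_add_assoc [mat_dim_simps]:
  fixes A :: "'a::monoid_add mat"
  assumes "dim_row A = dim_row C" "dim_col A = dim_col C" "dim_row B = dim_row C" "dim_col B = dim_col C"
  shows "A + B + C = A + (B + C)"
  by (rule eq_matI) (use assms in \<open>auto simp: add.assoc\<close>)

lemma mat_add_comm:
  fixes A :: "'a::ab_semigroup_add mat"
  assumes "dim_row A = dim_row B" "dim_col A = dim_col B"
  shows "A + B = B + A"
  by (rule eq_matI) (use assms in \<open>auto simp: add.commute\<close>)

lemma mat_add_left_comm:
  fixes A :: "'a::comm_monoid_add mat"
  assumes "dim_row A = dim_row C" "dim_col A = dim_col C" "dim_row B = dim_row C" "dim_col B = dim_col C"
  shows "A + (B + C) = B + (A + C)"
  by (rule eq_matI) (use assms in \<open>auto simp: add.left_commute\<close>)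

lemma mat_add_mult_distrib [mat_dim_simps]:
  fixes A :: "'a::semiring_0 mat"
  assumes "dim_row A = dim_row B" "dim_col A = dim_col B" "dim_col B = dim_row C"
  shows "(A + B) * C = A * C + B * C"
  by (rule add_mult_distrib_mat[of A "dim_row A" "dim_row C"  B C "dim_col C"]) (use assms in auto)

lemma mat_mult_add_distrib [mat_dim_simps]:
  fixes A :: "'a::semiring_0 mat"
  assumes "dim_row C = dim_row B" "dim_col C = dim_col B" "dim_col A = dim_row B"
  shows "A * (B + C) = A * B + A * C"
  by (rule mult_add_distrib_mat[of A "dim_row A" "dim_row B"  B "dim_col B" C]) (use assms in auto)

lemma mat_minus_eq [mat_dim_simps]:
  fixes A :: "'a::group_add mat"
  assumes "dim_row A = dim_row B" "dim_col A = dim_col B"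
  shows "A - B = A + (- B)"
  by (rule eq_matI) (use assms in auto)

lemma mat_uminus_mult_left [mat_dim_simps]:
  fixes A :: "'a::ring mat"
  assumes "dim_col A = dim_row B"
  shows "(- A) * B = - (A * B)"
  using assms by simp

lemma mat_uminus_mult_right [mat_dim_simps]:
  fixes A :: "'a::ring mat"
  assumes "dim_col A = dim_row B"
  shows "A * (- B) = - (A * B)"
  using assms by simp

lemma mat_uminus_add [mat_dim_simps]:
  fixes A :: "'a::ab_group_add mat"
  assumes "dim_row A = dim_row B" "dim_col A = dim_col B"
  shows "- (A + B) = - A + - B"
  by (rule eq_matI) (use assms in auto)

lemma mat_uminus_uminus [mat_dim_simps]: "- (- A) = (A :: 'a::group_add mat)"
  by (rule eq_matI) auto

lemma mat_add_zero [mat_dim_simps]: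
  fixes A :: "'a::monoid_add mat"
  shows "dim_row A = p \<Longrightarrow> dim_col A = q \<Longrightarrow> A + 0\<^sub>m p q = A"
    and "dim_row A = p \<Longrightarrow> dim_col A = q \<Longrightarrow> 0\<^sub>m p q + A = A"
  by auto

lemma mat_uminus_zero [mat_dim_simps]: "- 0\<^sub>m p q = (0\<^sub>m p q :: 'a::group_add mat)"
  by (rule eq_matI) auto

lemma mat_add_uminus_cancel [mat_dim_simps]:
  fixes A :: "'a::ab_group_add mat"
  shows "dim_row A = dim_row B \<Longrightarrow> dim_col A = dim_col B \<Longrightarrow> A + (- A + B) = B"
    and "dim_row A = dim_row B \<Longrightarrow> dim_col A = dim_col B \<Longrightarrow> - A + (A + B) = B"
    and "A + - A = 0\<^sub>m (dim_row A) (dim_col A)"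
    and "- A + A = 0\<^sub>m (dim_row A) (dim_col A)"
  by (auto intro!: eq_matI)

text \<open>An index below a*b is i*b + j with block i and position j inside the block. The sums in
  the Kronecker computations below are split this way.\<close>

lemma sum_mult_blocks:
  fixes g :: "nat \<Rightarrow> 'a::comm_monoid_add"
  shows "(\<Sum>i<a*b. g i) = (\<Sum>i<a. \<Sum>j<b. g (i * b + j))"
proof -
  have "sum g {i*b..<i*b+b} = (\<Sum>j<b. g (i * b + j))" for i
    using sum.shift_bounds_nat_ivl[of g 0 "i*b" b] by (simp add: atLeast0LessThan add.commute)
  thus ?thesis using sum.nat_group[of g b a] by simp
qed

lemma div_mult_lt: "i < a * b \<Longrightarrow> i div b < (a::nat)"
  by (simp add: less_mult_imp_div_less)

lemma mod_mult_lt: "i < a * b \<Longrightarrow> i mod b < (b::nat)"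
  by (metis mod_less_divisor mult_0_right not_gr_zero not_less0)

lemma block_index_lt: "i < a \<Longrightarrow> j < b \<Longrightarrow> i * b + j < a * (b::nat)"
proof -
  assume "i < a" "j < b"
  hence "i * b + j < Suc i * b" by simp
  also have "\<dots> \<le> a * b" using \<open>i < a\<close> by (intro mult_right_mono) auto
  finally show ?thesis .
qed

lemma block_div_mod [simp]: "j < b \<Longrightarrow> (i * b + j) div b = (i::nat)" "j < b \<Longrightarrow> (i * b + j) mod b = (j::nat)"
  by auto

lemma index_mult_mat_sum:
  "i < dim_row A \<Longrightarrow> j < dim_col B \<Longrightarrow> dim_col A = dim_row B \<Longrightarrow>
   (A * B) $$ (i, j) = (\<Sum>k<dim_row B. A $$ (i, k) * B $$ (k, j))"
  by (auto simp: scalar_prod_def atLeast0LessThan intro!: sum.cong)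

text \<open>Entries of \<open>X\<close> lie in the algebra and entries of \<open>P\<close> in the
  field, so two entries are combined by the scalar action. The outer index belongs to
  \<open>X\<close>; over the field this is the ordinary Kronecker product.\<close>

definition kron_scalar :: "('k \<Rightarrow> 'a \<Rightarrow> 'a) \<Rightarrow> 'a mat \<Rightarrow> 'k mat \<Rightarrow> 'a mat" where
  "kron_scalar scale X P = mat (dim_row X * dim_row P) (dim_col X * dim_col P)
     (\<lambda>(i, j). scale (P $$ (i mod dim_row P, j mod dim_col P)) (X $$ (i div dim_row P, j div dim_col P)))"

lemma dim_kron [simp]:
  "dim_row (P \<otimes>\<^sub>K Q) = dim_row P * dim_row Q" "dim_col (P \<otimes>\<^sub>K Q) = dim_col P * dim_col Q"
  by (auto simp: kron_def)

lemma index_kron: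
  "i < dim_row P * dim_row Q \<Longrightarrow> j < dim_col P * dim_col Q \<Longrightarrow>
   (P \<otimes>\<^sub>K Q) $$ (i, j) = P $$ (i div dim_row Q, j div dim_col Q) * Q $$ (i mod dim_row Q, j mod dim_col Q)"
  by (auto simp: kron_def)

lemma dim_kron_scalar [simp]:
  "dim_row (kron_scalar scale X P) = dim_row X * dim_row P"
  "dim_col (kron_scalar scale X P) = dim_col X * dim_col P"
  by (auto simp: kron_scalar_def)

lemma index_kron_scalar:
  "i < dim_row X * dim_row P \<Longrightarrow> j < dim_col X * dim_col P \<Longrightarrow>
   kron_scalar scale X P $$ (i, j) =
     scale (P $$ (i mod dim_row P, j mod dim_col P)) (X $$ (i div dim_row P, j div dim_col P))"
  by (auto simp: kron_scalar_def)

lemma kron_scalar_field: "kron_scalar (*) X P = X \<otimes>\<^sub>K (P :: 'k::comm_semiring_1 mat)"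
  by (auto simp: kron_def kron_scalar_def mult.commute)

text \<open>The linear part of a pencil: the sum of \<open>x \<kappa> \<otimes> P \<kappa>\<close>
  over \<open>I\<close>. The sizes are arguments because they cannot be read off when
  \<open>I\<close> is empty.\<close>

definition lin :: "('k \<Rightarrow> 'a \<Rightarrow> 'a) \<Rightarrow> 'i set \<Rightarrow> nat \<Rightarrow> nat \<Rightarrow> nat \<Rightarrow> ('i \<Rightarrow> 'a::comm_monoid_add mat) \<Rightarrow> ('i \<Rightarrow> 'k mat) \<Rightarrow> 'a mat" where
  "lin scale I m p q x P = mat (m * p) (m * q)
     (\<lambda>(i, j). \<Sum>\<kappa>\<in>I. scale (P \<kappa> $$ (i mod p, j mod q)) (x \<kappa> $$ (i div p, j div q)))"

lemma dim_lin [simp]: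
  "dim_row (lin scale I m p q x P) = m * p" "dim_col (lin scale I m p q x P) = m * q"
  by (auto simp: lin_def)

lemma index_lin:
  "i < m * p \<Longrightarrow> j < m * q \<Longrightarrow> lin scale I m p q x P $$ (i, j) =
     (\<Sum>\<kappa>\<in>I. scale (P \<kappa> $$ (i mod p, j mod q)) (x \<kappa> $$ (i div p, j div q)))"
  by (auto simp: lin_def)

lemma lin_empty: "lin scale {} m p q x P = 0\<^sub>m (m * p) (m * q)"
  by (auto simp: lin_def)

lemma lin_insert:
  assumes "finite I" "\<kappa> \<notin> I" "x \<kappa> \<in> carrier_mat m m" "P \<kappa> \<in> carrier_mat p q"
  shows "lin scale (insert \<kappa> I) m p q x P = kron_scalar scale (x \<kappa>) (P \<kappa>) + lin scale I m p q x P"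
  using assms by (intro eq_matI) (auto simp: index_lin index_kron_scalar)

lemma lin_cong:
  assumes "\<And>\<kappa>. \<kappa> \<in> I \<Longrightarrow> x \<kappa> = x' \<kappa>" "\<And>\<kappa>. \<kappa> \<in> I \<Longrightarrow> P \<kappa> = P' \<kappa>"
  shows "lin scale I m p q x P = lin scale I m p q x' P'"
  unfolding lin_def using assms by (auto intro!: cong_mat sum.cong)

text \<open>For \<open>X\<close> seen as an m by m array of e by e blocks, this collects the (i, j)
  entries of all blocks. Thus \<open>X\<close> is the sum of
  \<open>entry_block e m X i j \<otimes> E_ij\<close>.\<close>

definition entry_block :: "nat \<Rightarrow> nat \<Rightarrow> 'a mat \<Rightarrow> nat \<Rightarrow> nat \<Rightarrow> 'a mat" where
  "entry_block e m X i j = mat m m (\<lambda>(a, b). X $$ (a * e + i, b * e + j))"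

lemma dim_entry_block [simp]:
  "dim_row (entry_block e m X i j) = m" "dim_col (entry_block e m X i j) = m"
  by (auto simp: entry_block_def)

lemma index_entry_block [simp]:
  "a < m \<Longrightarrow> b < m \<Longrightarrow> entry_block e m X i j $$ (a, b) = X $$ (a * e + i, b * e + j)"
  by (auto simp: entry_block_def)

lemma entry_block_carrier [simp]: "entry_block e m X i j \<in> carrier_mat m m"
  by (auto simp: entry_block_def)

lemma dim_mat_unit [simp]: "dim_row (mat_unit p q i j) = p" "dim_col (mat_unit p q i j) = q"
  by (auto simp: mat_unit_def)

lemma index_mat_unit [simp]: "u < p \<Longrightarrow> v < q \<Longrightarrow> mat_unit p q i j $$ (u, v) = (if u = i \<and> v = j then 1 else 0)"
  by (auto simp: mat_unit_def)

lemma mat_unit_carrier [simp]: "mat_unit p q i j \<in> carrier_mat p q"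
  by (auto simp: mat_unit_def)

lemma mat_unit_mult:
  assumes "j < q" "j' < q"
  shows "mat_unit p q i j * mat_unit q r j' k = (if j = j' then mat_unit p r i k else (0\<^sub>m p r :: 'a::semiring_1 mat))"
proof (rule eq_matI)
  fix u v assume "u < dim_row (if j = j' then mat_unit p r i k else (0\<^sub>m p r :: 'a mat))"
    "v < dim_col (if j = j' then mat_unit p r i k else (0\<^sub>m p r :: 'a mat))"
  hence uv: "u < p" "v < r" by (auto split: if_splits)
  have "(mat_unit p q i j * mat_unit q r j' k) $$ (u, v) =
    (\<Sum>l<q. mat_unit p q i j $$ (u, l) * mat_unit q r j' k $$ (l, v) :: 'a)"
    using uv by (subst index_mult_mat_sum) simp_all
  also have "\<dots> = (\<Sum>l<q. (if l = j then (if u = i \<and> l = j' \<and> v = k then 1 else 0) else (0::'a)))"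
    using uv by (intro sum.cong) auto
  also have "\<dots> = (if u = i \<and> j = j' \<and> v = k then 1 else 0)"
    using assms by simp
  finally show "(mat_unit p q i j * mat_unit q r j' k) $$ (u, v) =
    (if j = j' then mat_unit p r i k else (0\<^sub>m p r :: 'a mat)) $$ (u, v)"
    using uv by auto
qed auto

lemma one_kron_one: "1\<^sub>m m \<otimes>\<^sub>K 1\<^sub>m p = (1\<^sub>m (m * p) :: 'a::semiring_1 mat)"
proof (rule eq_matI)
  fix i j assume "i < dim_row (1\<^sub>m (m * p) :: 'a mat)" "j < dim_col (1\<^sub>m (m * p) :: 'a mat)"
  hence ij: "i < m * p" "j < m * p" by auto
  have "i = j \<longleftrightarrow> i div p = j div p \<and> i mod p = j mod p"
    by (metis div_mult_mod_eq)
  thus "(1\<^sub>m m \<otimes>\<^sub>K 1\<^sub>m p) $$ (i, j) = (1\<^sub>m (m * p) :: 'a mat) $$ (i, j)"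
    using ij by (auto simp: index_kron div_mult_lt mod_mult_lt)
qed auto

context unital_algebra begin

abbreviation kron_sc (infixl "\<star>" 70) where "X \<star> P \<equiv> kron_scalar scale X P"

text \<open>Scalars move freely through products by \<open>scale_mult_left\<close> and
  \<open>scale_mult_right\<close>, so the mixed product rule survives although entries of
  \<open>X\<close> and \<open>X'\<close> need not commute.\<close>

lemma kron_scalar_mult:
  assumes "dim_col X = dim_row X'" "dim_col P = dim_row P'"
  shows "(X \<star> P) * (X' \<star> P') = (X * X') \<star> (P * P')"
proof (rule eq_matI)
  fix i j assume "i < dim_row ((X * X') \<star> (P * P'))" "j < dim_col ((X * X') \<star> (P * P'))"
  hence ij: "i < dim_row X * dim_row P" "j < dim_col X' * dim_col P'" by auto
  let ?i = "i div dim_row P" and ?i' = "i mod dim_row P" and ?j = "j div dim_col P'" and ?j' = "j mod dim_col P'"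
  have b: "?i < dim_row X" "?i' < dim_row P" "?j < dim_col X'" "?j' < dim_col P'"
    using ij div_mult_lt mod_mult_lt by blast+
  have "((X \<star> P) * (X' \<star> P')) $$ (i, j) =
     (\<Sum>k<dim_row X' * dim_row P'. scale (P $$ (?i', k mod dim_col P)) (X $$ (?i, k div dim_col P)) *
        scale (P' $$ (k mod dim_row P', ?j')) (X' $$ (k div dim_row P', ?j)))"
    using ij assms by (subst index_mult_mat_sum) (auto simp: index_kron_scalar intro!: sum.cong)
  also have "\<dots> = (\<Sum>k<dim_row X'. \<Sum>l<dim_row P'. scale (P $$ (?i', l)) (X $$ (?i, k)) *
        scale (P' $$ (l, ?j')) (X' $$ (k, ?j)))"
    unfolding sum_mult_blocks using assms by (auto intro!: sum.cong)
  also have "\<dots> = (\<Sum>k<dim_row X'. \<Sum>l<dim_row P'. scale (P $$ (?i', l) * P' $$ (l, ?j'))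
        (X $$ (?i, k) * X' $$ (k, ?j)))"
    by (auto simp: scale_mult_left scale_mult_right mult.commute)
  also have "\<dots> = scale ((P * P') $$ (?i', ?j')) ((X * X') $$ (?i, ?j))"
    using assms b by (simp add: index_mult_mat_sum scale_sum_left scale_sum_right del: index_mult_mat(1))
  also have "\<dots> = ((X * X') \<star> (P * P')) $$ (i, j)"
    using ij by (simp add: index_kron_scalar)
  finally show "((X \<star> P) * (X' \<star> P')) $$ (i, j) = ((X * X') \<star> (P * P')) $$ (i, j)" .
qed (use assms in auto)

lemma kron_scalar_add_right:
  "dim_row P = dim_row P' \<Longrightarrow> dim_col P = dim_col P' \<Longrightarrow> X \<star> (P + P') = X \<star> P + X \<star> P'"
  by (auto intro!: eq_matI simp: index_kron_scalar div_mult_lt mod_mult_lt scale_left_distrib)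

lemma kron_scalar_uminus_right: "X \<star> (- P) = - (X \<star> P)"
  by (auto intro!: eq_matI simp: index_kron_scalar div_mult_lt mod_mult_lt)

lemma kron_scalar_zero_right: "X \<star> 0\<^sub>m a b = 0\<^sub>m (dim_row X * a) (dim_col X * b)"
  by (auto intro!: eq_matI simp: index_kron_scalar div_mult_lt mod_mult_lt)

lemma kron_scalar_one: "1\<^sub>m m \<star> 1\<^sub>m p = 1\<^sub>m (m * p)"
proof (rule eq_matI)
  fix i j assume "i < dim_row (1\<^sub>m (m * p) :: 'a mat)" "j < dim_col (1\<^sub>m (m * p) :: 'a mat)"
  hence ij: "i < m * p" "j < m * p" by auto
  have "i = j \<longleftrightarrow> i div p = j div p \<and> i mod p = j mod p"
    by (metis div_mult_mod_eq)
  thus "(1\<^sub>m m \<star> 1\<^sub>m p) $$ (i, j) = (1\<^sub>m (m * p) :: 'a mat) $$ (i, j)"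
    using ij by (auto simp: index_kron_scalar div_mult_lt mod_mult_lt)
qed auto

lemma kron_scalar_one_right [simp]: "X \<star> 1\<^sub>m (Suc 0) = X"
  by (auto intro!: eq_matI simp: index_kron_scalar)

lemma kron_scalar_assoc: "(X \<star> P) \<star> P' = X \<star> (P \<otimes>\<^sub>K P')"
proof (rule eq_matI)
  fix i j assume "i < dim_row (X \<star> (P \<otimes>\<^sub>K P'))" "j < dim_col (X \<star> (P \<otimes>\<^sub>K P'))"
  hence ij: "i < dim_row X * dim_row P * dim_row P'" "j < dim_col X * dim_col P * dim_col P'"
    by (auto simp: mult.assoc)
  have m: "i mod (dim_row P * dim_row P') < dim_row P * dim_row P'" "j mod (dim_col P * dim_col P') < dim_col P * dim_col P'"
    using ij by (metis mod_mult_lt mult.assoc)+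
  have mm: "i mod (a * b) mod b = i mod b" "i mod (a * b) div b = i div b mod a" "i div b div a = i div (a * b)"
    if "0 < b" for i a b :: nat
    using that by (auto simp: mod_mult2_eq mult.commute[of a] div_mult2_eq)
  have pos: "0 < dim_row P'" "0 < dim_col P'" using ij by (auto intro: gr0I)
  show "((X \<star> P) \<star> P') $$ (i, j) = (X \<star> (P \<otimes>\<^sub>K P')) $$ (i, j)"
    using ij m pos
    by (simp add: index_kron_scalar index_kron div_mult_lt mm mult.assoc mult.commute[of "P $$ _"])
qed (auto simp: mult.assoc)

end

section \<open>Descriptor systems\<close>

lemma unital_algebra_field: "unital_algebra ((*) :: 'k::field \<Rightarrow> 'k \<Rightarrow> 'k)"
  by unfold_locales (auto simp: algebra_simps)

interpretation field_algebra: unital_algebra "(*) :: 'k::field \<Rightarrow> 'k \<Rightarrow> 'k"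
  by (rule unital_algebra_field)

lemma kron_mult:
  fixes X :: "'k::field mat"
  assumes "dim_col X = dim_row X'" "dim_col P = dim_row P'"
  shows "(X \<otimes>\<^sub>K P) * (X' \<otimes>\<^sub>K P') = (X * X') \<otimes>\<^sub>K (P * P')"
  using field_algebra.kron_scalar_mult[OF assms] by (simp add: kron_scalar_field)

text \<open>Invertibility with a named inverse. One relation serves field matrices, where it is
  equivalent to a nonzero determinant, and matrices over noncommutative rings, where no determinant
  is available.\<close>

definition inverse_pair :: "nat \<Rightarrow> 'a::semiring_1 mat \<Rightarrow> 'a mat \<Rightarrow> bool" where
  "inverse_pair n A B \<longleftrightarrow> A \<in> carrier_mat n n \<and> B \<in> carrier_mat n n \<and> A * B = 1\<^sub>m n \<and> B * A = 1\<^sub>m n"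

lemma inverse_pair_unique:
  assumes "inverse_pair n A B" "inverse_pair n A B'"
  shows "B' = B"
proof -
  have c: "A \<in> carrier_mat n n" "B \<in> carrier_mat n n" "B' \<in> carrier_mat n n"
    using assms by (auto simp: inverse_pair_def)
  have "B' = B' * (A * B)" using assms c by (simp add: inverse_pair_def)
  also have "\<dots> = (B' * A) * B" using c by simp
  also have "\<dots> = B" using assms(2) c by (simp add: inverse_pair_def)
  finally show ?thesis .
qed

lemma inverse_pair_cancel:
  assumes "inverse_pair n A B" "dim_row Z = n"
  shows "A * (B * Z) = Z" "B * (A * Z) = Z"
proof -
  have c: "A \<in> carrier_mat n n" "B \<in> carrier_mat n n" using assms by (auto simp: inverse_pair_def)
  show "A * (B * Z) = Z"
    using mat_mult_assoc[of A B Z] c assms by (auto simp: inverse_pair_def)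
  show "B * (A * Z) = Z"
    using mat_mult_assoc[of B A Z] c assms by (auto simp: inverse_pair_def)
qed

lemma inverse_pair_dims:
  assumes "inverse_pair n A B"
  shows "dim_row A = n" "dim_col A = n" "dim_row B = n" "dim_col B = n" "A * B = 1\<^sub>m n" "B * A = 1\<^sub>m n"
  using assms by (auto simp: inverse_pair_def)

lemma inverse_pair_sym: "inverse_pair n A B \<Longrightarrow> inverse_pair n B A"
  by (auto simp: inverse_pair_def)

lemma inverse_pair_mult:
  assumes "inverse_pair n A B" "inverse_pair n A' B'"
  shows "inverse_pair n (A * A') (B' * B)"
  using assms
  by (auto simp: inverse_pair_dims inverse_pair_cancel mat_mult_assoc inverse_pair_def[of n "A * A'"])

lemma Units_mat_algebra_iff: "A \<in> Units (mat_algebra n) \<longleftrightarrow> (\<exists>B. inverse_pair n A B)"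
  by (auto simp: Units_def inverse_pair_def module_mat_def)

lemma monoid_mat_algebra: "Group.monoid (mat_algebra n :: ('a::semiring_1, 'a mat) module)"
  by (rule Group.monoidI) (auto simp: module_mat_def)

lemma inv_mat_algebra:
  assumes "inverse_pair n A B"
  shows "inv\<^bsub>mat_algebra n\<^esub> A = B"
  by (rule Group.monoid.inv_unique'[OF monoid_mat_algebra, symmetric])
    (use assms in \<open>auto simp: module_mat_def inverse_pair_def\<close>)

lemma det_nonzero_iff_inverse_pair:
  assumes "(A :: 'k::field mat) \<in> carrier_mat n n"
  shows "det A \<noteq> 0 \<longleftrightarrow> (\<exists>B. inverse_pair n A B)"
proof
  assume "det A \<noteq> 0"
  from det_non_zero_imp_unit[OF assms this]
  show "\<exists>B. inverse_pair n A B"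
    using assms by (auto simp: Units_def ring_mat_def inverse_pair_def)
next
  assume "\<exists>B. inverse_pair n A B"
  then obtain B where B: "inverse_pair n A B" ..
  hence "det A * det B = 1"
    using det_mult[of A n B] by (auto simp: inverse_pair_def)
  thus "det A \<noteq> 0" by auto
qed

lemma inverse_pair_kernel:
  assumes A: "(A :: 'k::field mat) \<in> carrier_mat n n"
    and "\<And>v. v \<in> carrier_vec n \<Longrightarrow> A *\<^sub>v v = 0\<^sub>v n \<Longrightarrow> v = 0\<^sub>v n"
  shows "\<exists>B. inverse_pair n A B"
  unfolding det_nonzero_iff_inverse_pair[OF A, symmetric]
  using assms det_0_iff_vec_prod_zero_field[OF A] by blast

lemma mat_add_add_cancel:
  fixes A :: "'a::ab_group_add mat"
  assumes "dim_row A = dim_row B" "dim_col A = dim_col B" "dim_row C = dim_row B" "dim_col C = dim_col B"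
  shows "A + B + (C + - B) = A + C"
  by (rule eq_matI) (use assms in auto)

lemma mat_add_minus_cancel:
  fixes A :: "'a::ab_group_add mat"
  assumes "dim_row A = dim_row B" "dim_col A = dim_col B" "dim_row C = dim_row B" "dim_col C = dim_col B"
  shows "C + A + - (C + B) = A + - B"
  by (rule eq_matI) (use assms in auto)

lemma lin_add_coeff:
  fixes x :: "'i \<Rightarrow> 'a::ring_1 mat"
  assumes "unital_algebra scale" "\<And>\<kappa>. \<kappa> \<in> I \<Longrightarrow> P \<kappa> \<in> carrier_mat p q" "\<And>\<kappa>. \<kappa> \<in> I \<Longrightarrow> P' \<kappa> \<in> carrier_mat p q"
  shows "lin scale I m p q x (\<lambda>\<kappa>. P \<kappa> + P' \<kappa>) = lin scale I m p q x P + lin scale I m p q x P'"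
proof -
  interpret unital_algebra scale by fact
  have d: "dim_row (P \<kappa>) = p" "dim_col (P \<kappa>) = q" "dim_row (P' \<kappa>) = p" "dim_col (P' \<kappa>) = q" if "\<kappa> \<in> I" for \<kappa>
    using assms(2,3)[OF that] by auto
  show ?thesis
  proof (rule eq_matI)
    fix i j assume "i < dim_row (lin scale I m p q x P + lin scale I m p q x P')"
      "j < dim_col (lin scale I m p q x P + lin scale I m p q x P')"
    hence ij: "i < m * p" "j < m * q" by auto
    have "(\<Sum>\<kappa>\<in>I. scale ((P \<kappa> + P' \<kappa>) $$ (i mod p, j mod q)) (x \<kappa> $$ (i div p, j div q))) =
      (\<Sum>\<kappa>\<in>I. scale (P \<kappa> $$ (i mod p, j mod q)) (x \<kappa> $$ (i div p, j div q)) + scale (P' \<kappa> $$ (i mod p, j mod q)) (x \<kappa> $$ (i div p, j div q)))"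
      using ij by (intro sum.cong) (auto simp: d mod_mult_lt scale_left_distrib)
    thus "lin scale I m p q x (\<lambda>\<kappa>. P \<kappa> + P' \<kappa>) $$ (i, j) = (lin scale I m p q x P + lin scale I m p q x P') $$ (i, j)"
      using ij by (simp add: index_lin sum.distrib)
  qed auto
qed

context unital_algebra begin

lemma lin_uminus_coeff:
  assumes "\<And>\<kappa>. \<kappa> \<in> I \<Longrightarrow> P \<kappa> \<in> carrier_mat p q"
  shows "lin scale I m p q x (\<lambda>\<kappa>. - P \<kappa>) = - lin scale I m p q x P"
proof -
  have d: "dim_row (P \<kappa>) = p" "dim_col (P \<kappa>) = q" if "\<kappa> \<in> I" for \<kappa> using assms[OF that] by auto
  show ?thesis
    by (auto intro!: sum.cong simp: index_lin mod_mult_lt sum_negf[symmetric] d)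
qed

lemma lin_minus_point:
  assumes "\<And>\<kappa>. \<kappa> \<in> I \<Longrightarrow> x \<kappa> \<in> carrier_mat m m" "\<And>\<kappa>. \<kappa> \<in> I \<Longrightarrow> x' \<kappa> \<in> carrier_mat m m"
  shows "lin scale I m p q (\<lambda>\<kappa>. x \<kappa> - x' \<kappa>) P = lin scale I m p q x P - lin scale I m p q x' P"
proof -
  have d: "dim_row (x \<kappa>) = m" "dim_col (x \<kappa>) = m" "dim_row (x' \<kappa>) = m" "dim_col (x' \<kappa>) = m" if "\<kappa> \<in> I" for \<kappa>
    using assms[OF that] by auto
  show ?thesis
    by (auto intro!: sum.cong simp: index_lin div_mult_lt scale_right_diff_distrib sum_subtractf[symmetric] d)
qed

lemma lin_zero_coeff:
  "lin scale I m p q x (\<lambda>\<kappa>. 0\<^sub>m p q) = 0\<^sub>m (m * p) (m * q)"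
  by (auto intro!: eq_matI simp: index_lin mod_mult_lt)

lemma lin_mult_left:
  assumes "finite I" "\<And>\<kappa>. \<kappa> \<in> I \<Longrightarrow> x \<kappa> \<in> carrier_mat m m" "\<And>\<kappa>. \<kappa> \<in> I \<Longrightarrow> P \<kappa> \<in> carrier_mat p q"
    "G \<in> carrier_mat r p"
  shows "(1\<^sub>m m \<star> G) * lin scale I m p q x P = lin scale I m r q x (\<lambda>\<kappa>. G * P \<kappa>)"
  using assms(1-3)
proof (induction I rule: finite_induct)
  case (insert \<kappa> I)
  have c: "x \<kappa> \<in> carrier_mat m m" "P \<kappa> \<in> carrier_mat p q" "G * P \<kappa> \<in> carrier_mat r q" using insert assms(4) by auto
  have IH: "(1\<^sub>m m \<star> G) * lin scale I m p q x P = lin scale I m r q x (\<lambda>\<kappa>. G * P \<kappa>)"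
    using insert by auto
  show ?case
    using insert(1,2) c carrier_matD[OF c(1)] carrier_matD[OF c(2)] carrier_matD[OF assms(4)] IH
    by (simp add: lin_insert mat_mult_add_distrib kron_scalar_mult)
qed (use assms(4) in \<open>auto simp: lin_empty\<close>)

lemma lin_mult_right:
  assumes "finite I" "\<And>\<kappa>. \<kappa> \<in> I \<Longrightarrow> x \<kappa> \<in> carrier_mat m m" "\<And>\<kappa>. \<kappa> \<in> I \<Longrightarrow> P \<kappa> \<in> carrier_mat p q"
    "G \<in> carrier_mat q r"
  shows "lin scale I m p q x P * (1\<^sub>m m \<star> G) = lin scale I m p r x (\<lambda>\<kappa>. P \<kappa> * G)"
  using assms(1-3)
proof (induction I rule: finite_induct)
  case (insert \<kappa> I)
  have c: "x \<kappa> \<in> carrier_mat m m" "P \<kappa> \<in> carrier_mat p q" "P \<kappa> * G \<in> carrier_mat p r"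
    using insert(4)[of \<kappa>] insert(5)[of \<kappa>] assms(4) by (auto intro: mult_carrier_mat)
  have IH: "lin scale I m p q x P * (1\<^sub>m m \<star> G) = lin scale I m p r x (\<lambda>\<kappa>. P \<kappa> * G)"
    using insert by auto
  show ?case
    using insert(1,2) c carrier_matD[OF c(1)] carrier_matD[OF c(2)] carrier_matD[OF assms(4)] IH
    by (simp add: lin_insert mat_add_mult_distrib kron_scalar_mult)
qed (use assms(4) in \<open>auto simp: lin_empty\<close>)

text \<open>With X the sum of X_ij \<otimes> E_ij, associativity turns X \<otimes> P into the sum of
  X_ij \<otimes> (E_ij \<otimes> P): one variable of size m*e becomes e*e variables of size m, with
  larger coefficients.\<close>

lemma lin_entry_block:
  assumes x: "\<And>\<kappa>. \<kappa> \<in> I \<Longrightarrow> x \<kappa> \<in> carrier_mat (m * e) (m * e)" and P: "\<And>\<kappa>. \<kappa> \<in> I \<Longrightarrow> P \<kappa> \<in> carrier_mat p q"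
  shows "lin scale (grid I e) m (e * p) (e * q)
     (\<lambda>(\<kappa>, i, j). entry_block e m (x \<kappa>) i j) (\<lambda>(\<kappa>, i, j). mat_unit e e i j \<otimes>\<^sub>K P \<kappa>) = lin scale I (m * e) p q x P"
proof (rule eq_matI)
  fix r c assume "r < dim_row (lin scale I (m * e) p q x P)" "c < dim_col (lin scale I (m * e) p q x P)"
  hence rc: "r < m * (e * p)" "c < m * (e * q)" by (auto simp: mult.assoc)
  have rc': "r < m * e * p" "c < m * e * q" using rc by (auto simp: mult.assoc)
  have pos: "0 < p" "0 < q" "0 < e" using rc by (auto intro: gr0I)
  define r1 c1 where "r1 = r mod (e * p)" and "c1 = c mod (e * q)"
  have r1: "r1 < e * p" "c1 < e * q" using rc unfolding r1_def c1_def by (metis mod_mult_lt)+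
  have r1': "r1 div p < e" "c1 div q < e" using r1 div_mult_lt by blast+
  have r2: "r div (e * p) < m" "c div (e * q) < m" using rc by (auto intro: div_mult_lt)
  \<comment> \<open>A row index has three levels: block of \<open>m\<close>, row among the
    \<open>e\<close>, row of \<open>P \<kappa>\<close>. The first two together give the row of
    \<open>x \<kappa>\<close>.\<close>
  have e1: "r div (e * p) * e + r1 div p = r div p" "r1 mod p = r mod p"
     "c div (e * q) * e + c1 div q = c div q" "c1 mod q = c mod q"
  proof -
    have *: "i div (e * p) * e + i mod (e * p) div p = i div p" "i mod (e * p) mod p = i mod p"
      if "0 < p" for i p :: nat
    proof -
      have a: "i mod (e * p) = p * (i div p mod e) + i mod p"
        using mod_mult2_eq[of i p e] by (simp add: mult.commute[of e])
      have b: "i div (e * p) = i div p div e" using div_mult2_eq[of i p e] by (simp add: mult.commute[of e])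
      show "i div (e * p) * e + i mod (e * p) div p = i div p" "i mod (e * p) mod p = i mod p"
        using that by (simp_all add: a b)
    qed
    show "r div (e * p) * e + r1 div p = r div p" "r1 mod p = r mod p"
     "c div (e * q) * e + c1 div q = c div q" "c1 mod q = c mod q"
      unfolding r1_def c1_def using * pos by auto
  qed
  let ?g = "\<lambda>\<kappa> i j. scale ((mat_unit e e i j \<otimes>\<^sub>K P \<kappa>) $$ (r1, c1)) (entry_block e m (x \<kappa>) i j $$ (r div (e * p), c div (e * q)))"
  have "(\<Sum>i<e. \<Sum>j<e. ?g \<kappa> i j) = scale (P \<kappa> $$ (r mod p, c mod q)) (x \<kappa> $$ (r div p, c div q))" if k: "\<kappa> \<in> I" for \<kappa>
  proof -
    have "?g \<kappa> i j = (if j = c1 div q then if i = r1 div p then scale (P \<kappa> $$ (r mod p, c mod q)) (x \<kappa> $$ (r div p, c div q)) else 0 else 0)"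
      if "i < e" "j < e" for i j
      using that r1 r1' r2 P[OF k] e1 by (auto simp: index_kron)
    hence "(\<Sum>i<e. \<Sum>j<e. ?g \<kappa> i j) = (\<Sum>i<e. \<Sum>j<e. (if j = c1 div q then if i = r1 div p then scale (P \<kappa> $$ (r mod p, c mod q)) (x \<kappa> $$ (r div p, c div q)) else 0 else 0))"
      by (intro sum.cong) auto
    thus ?thesis using r1' by (simp add: sum.delta)
  qed
  hence "(\<Sum>\<kappa>\<in>I. \<Sum>i<e. \<Sum>j<e. ?g \<kappa> i j) = (\<Sum>\<kappa>\<in>I. scale (P \<kappa> $$ (r mod p, c mod q)) (x \<kappa> $$ (r div p, c div q)))"
    by (intro sum.cong) auto
  thus "lin scale (grid I e) m (e * p) (e * q)
     (\<lambda>(\<kappa>, i, j). entry_block e m (x \<kappa>) i j) (\<lambda>(\<kappa>, i, j). mat_unit e e i j \<otimes>\<^sub>K P \<kappa>) $$ (r, c) = lin scale I (m * e) p q x P $$ (r, c)"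
    using rc rc' by (simp add: index_lin r1_def c1_def sum.cartesian_product case_prod_unfold)
qed (auto simp: mult.assoc)

lemma one_kron_scalar_assoc: "1\<^sub>m (m * e) \<star> P = 1\<^sub>m m \<star> (1\<^sub>m e \<otimes>\<^sub>K P)"
  by (metis kron_scalar_assoc kron_scalar_one)

lemma lin_const_point:
  assumes "finite I" "\<And>\<kappa>. \<kappa> \<in> I \<Longrightarrow> z \<kappa> \<in> carrier_mat e e" "\<And>\<kappa>. \<kappa> \<in> I \<Longrightarrow> P \<kappa> \<in> carrier_mat p q"
  shows "lin scale I (m * e) p q (\<lambda>\<kappa>. 1\<^sub>m m \<star> z \<kappa>) P = 1\<^sub>m m \<star> lin (*) I e p q z P"
  using assms
proof (induction I rule: finite_induct)
  case empty
  then show ?case by (simp add: lin_empty kron_scalar_zero_right mult.assoc)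
next
  case (insert \<kappa> I)
  have c: "z \<kappa> \<in> carrier_mat e e" "P \<kappa> \<in> carrier_mat p q" using insert by auto
  have "1\<^sub>m m \<star> z \<kappa> \<in> carrier_mat (m * e) (m * e)" using carrier_matD[OF c(1)] by (auto intro!: carrier_matI)
  with insert c carrier_matD[OF c(1)] carrier_matD[OF c(2)] show ?case
    by (simp add: lin_insert kron_scalar_add_right kron_scalar_assoc kron_scalar_field)
qed

end

text \<open>Encodes the function feed + outp * pencil(x)^-1 * input(x) with pencil and input affine
  in x. Constant terms are arbitrary at this stage; \<open>centered\<close> singles out the shape of
  the theorem, with constant terms 1 and 0.\<close>

datatype ('i, 'k) descriptor = Descriptor (state_dim: nat) (feed: "'k mat") (outp: "'k mat")
  (pen_const: "'k mat") (pen_coeff: "'i \<Rightarrow> 'k mat") (inp_const: "'k mat") (inp_coeff: "'i \<Rightarrow> 'k mat")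

definition wf_descr :: "'i set \<Rightarrow> nat \<Rightarrow> nat \<Rightarrow> ('i, 'k) descriptor \<Rightarrow> bool" where
  "wf_descr I p q S \<longleftrightarrow> feed S \<in> carrier_mat p q \<and> outp S \<in> carrier_mat p (state_dim S) \<and>
     pen_const S \<in> carrier_mat (state_dim S) (state_dim S) \<and> inp_const S \<in> carrier_mat (state_dim S) q \<and>
     (\<forall>\<kappa>\<in>I. pen_coeff S \<kappa> \<in> carrier_mat (state_dim S) (state_dim S) \<and> inp_coeff S \<kappa> \<in> carrier_mat (state_dim S) q)"

definition pencil :: "('k \<Rightarrow> 'a \<Rightarrow> 'a) \<Rightarrow> 'i set \<Rightarrow> nat \<Rightarrow> ('i, 'k) descriptor \<Rightarrow> ('i \<Rightarrow> 'a mat) \<Rightarrow> 'a::ring_1 mat" where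
  "pencil scale I m S x = kron_scalar scale (1\<^sub>m m) (pen_const S) +
     lin scale I m (state_dim S) (state_dim S) x (pen_coeff S)"

definition input :: "('k \<Rightarrow> 'a \<Rightarrow> 'a) \<Rightarrow> 'i set \<Rightarrow> nat \<Rightarrow> ('i, 'k) descriptor \<Rightarrow> ('i \<Rightarrow> 'a mat) \<Rightarrow> 'a::ring_1 mat" where
  "input scale I m S x = kron_scalar scale (1\<^sub>m m) (inp_const S) +
     lin scale I m (state_dim S) (dim_col (inp_const S)) x (inp_coeff S)"

text \<open>A relation instead of a partial function: it says at once that the pencil is invertible
  and that the value is \<open>V\<close>, so that domain inclusions and equalities of values are
  transported together.\<close>

definition descr_at :: "('k \<Rightarrow> 'a \<Rightarrow> 'a) \<Rightarrow> 'i set \<Rightarrow> nat \<Rightarrow> ('i, 'k) descriptor \<Rightarrow> ('i \<Rightarrow> 'a mat) \<Rightarrow> 'a::ring_1 mat \<Rightarrow> bool" where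
  "descr_at scale I m S x V \<longleftrightarrow> (\<exists>M. inverse_pair (m * state_dim S) (pencil scale I m S x) M \<and>
     V = kron_scalar scale (1\<^sub>m m) (feed S) + kron_scalar scale (1\<^sub>m m) (outp S) * (M * input scale I m S x))"

lemma descr_at_unique: "descr_at scale I m S x V \<Longrightarrow> descr_at scale I m S x W \<Longrightarrow> V = W"
  unfolding descr_at_def using inverse_pair_unique by blast

lemma dim_pencil [simp]: "dim_row (pencil scale I m S x) = m * state_dim S" "dim_col (pencil scale I m S x) = m * state_dim S"
  by (auto simp: pencil_def)

lemma dim_input [simp]: "dim_row (input scale I m S x) = m * state_dim S"
   "dim_col (input scale I m S x) = m * dim_col (inp_const S)"
  by (auto simp: input_def)

lemma wf_descr_dims:
  assumes "wf_descr I p q S"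
  shows "dim_row (feed S) = p" "dim_col (feed S) = q" "dim_row (outp S) = p" "dim_col (outp S) = state_dim S"
    "dim_row (pen_const S) = state_dim S" "dim_col (pen_const S) = state_dim S"
    "dim_row (inp_const S) = state_dim S" "dim_col (inp_const S) = q"
    "\<And>\<kappa>. \<kappa> \<in> I \<Longrightarrow> dim_row (pen_coeff S \<kappa>) = state_dim S" "\<And>\<kappa>. \<kappa> \<in> I \<Longrightarrow> dim_col (pen_coeff S \<kappa>) = state_dim S"
    "\<And>\<kappa>. \<kappa> \<in> I \<Longrightarrow> dim_row (inp_coeff S \<kappa>) = state_dim S" "\<And>\<kappa>. \<kappa> \<in> I \<Longrightarrow> dim_col (inp_coeff S \<kappa>) = q"
  using assms by (auto simp: wf_descr_def)

lemma wf_descr_carrier: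
  assumes "wf_descr I p q S"
  shows "feed S \<in> carrier_mat p q" "outp S \<in> carrier_mat p (state_dim S)"
    "pen_const S \<in> carrier_mat (state_dim S) (state_dim S)" "inp_const S \<in> carrier_mat (state_dim S) q"
    "\<And>\<kappa>. \<kappa> \<in> I \<Longrightarrow> pen_coeff S \<kappa> \<in> carrier_mat (state_dim S) (state_dim S)"
    "\<And>\<kappa>. \<kappa> \<in> I \<Longrightarrow> inp_coeff S \<kappa> \<in> carrier_mat (state_dim S) q"
  using assms by (auto simp: wf_descr_def)

lemma descr_at_carrier:
  assumes "wf_descr I p q S" "descr_at scale I m S x V"
  shows "V \<in> carrier_mat (m * p) (m * q)"
  using assms wf_descr_dims[OF assms(1)] by (auto simp: descr_at_def)

text \<open>The same function in the e*e entry variables of each letter. The constant terms are the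
  pencil and the input of \<open>S\<close> at \<open>z\<close>, so the new variables measure the
  deviation from \<open>z\<close>; no inverse enters.\<close>

definition amplify :: "'i set \<Rightarrow> nat \<Rightarrow> ('i, 'k::field) descriptor \<Rightarrow> ('i \<Rightarrow> 'k mat) \<Rightarrow> ('i \<times> nat \<times> nat, 'k) descriptor" where
  "amplify I e S z = Descriptor (e * state_dim S) (1\<^sub>m e \<otimes>\<^sub>K feed S) (1\<^sub>m e \<otimes>\<^sub>K outp S)
     (pencil (*) I e S z) (\<lambda>(\<kappa>, i, j). mat_unit e e i j \<otimes>\<^sub>K pen_coeff S \<kappa>)
     (input (*) I e S z) (\<lambda>(\<kappa>, i, j). mat_unit e e i j \<otimes>\<^sub>K inp_coeff S \<kappa>)"

definition coords :: "('k \<Rightarrow> 'a \<Rightarrow> 'a) \<Rightarrow> nat \<Rightarrow> nat \<Rightarrow> ('i \<Rightarrow> 'k mat) \<Rightarrow> ('i \<Rightarrow> 'a::ring_1 mat) \<Rightarrow> 'i \<times> nat \<times> nat \<Rightarrow> 'a mat" where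
  "coords scale e m z x = (\<lambda>(\<kappa>, i, j). entry_block e m (x \<kappa> - kron_scalar scale (1\<^sub>m m) (z \<kappa>)) i j)"

lemma coords_carrier [simp]: "coords scale e m z x \<kappa> \<in> carrier_mat m m"
  by (cases \<kappa>) (auto simp: coords_def)

text \<open>\<open>Q\<close> stands for the inverse of the constant term of the pencil.
  Multiplication by \<open>Q\<close> makes that term 1. Subtracting from the new input the new
  pencil times Q * b0, with b0 the constant input, makes the constant input 0, and the feed term
  gains outp * Q * b0 in compensation.\<close>

definition normalize_descr :: "'k::field mat \<Rightarrow> ('i, 'k) descriptor \<Rightarrow> ('i, 'k) descriptor" where
  "normalize_descr Q S = Descriptor (state_dim S) (feed S + outp S * (Q * inp_const S)) (outp S) (1\<^sub>m (state_dim S))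
     (\<lambda>\<kappa>. Q * pen_coeff S \<kappa>) (0\<^sub>m (state_dim S) (dim_col (inp_const S)))
     (\<lambda>\<kappa>. Q * inp_coeff S \<kappa> + - (Q * (pen_coeff S \<kappa> * (Q * inp_const S))))"

lemma wf_amplify: "wf_descr I p q S \<Longrightarrow> wf_descr (grid I e) (e * p) (e * q) (amplify I e S z)"
  by (auto simp: wf_descr_def amplify_def intro!: carrier_matI)

lemma wf_normalize_descr:
  "wf_descr I p q S \<Longrightarrow> Q \<in> carrier_mat (state_dim S) (state_dim S) \<Longrightarrow> wf_descr I p q (normalize_descr Q S)"
  by (auto simp: wf_descr_def normalize_descr_def intro!: carrier_matI)

lemma state_dim_amplify [simp]: "state_dim (amplify I e S z) = e * state_dim S"
  by (simp add: amplify_def)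

lemma state_dim_normalize_descr [simp]: "state_dim (normalize_descr Q S) = state_dim S"
  by (simp add: normalize_descr_def)

section \<open>Amplification and normalisation preserve regularity and value\<close>

context unital_algebra begin

text \<open>The constant term contributes the linear part at 1 \<otimes> z, the new variables
  contribute the linear part at x - 1 \<otimes> z, and the two z-terms cancel.\<close>

lemma affine_amplify:
  assumes "finite I" "\<And>\<kappa>. \<kappa> \<in> I \<Longrightarrow> z \<kappa> \<in> carrier_mat e e" "\<And>\<kappa>. \<kappa> \<in> I \<Longrightarrow> x \<kappa> \<in> carrier_mat (m * e) (m * e)"
    "PC \<in> carrier_mat p q" "\<And>\<kappa>. \<kappa> \<in> I \<Longrightarrow> P \<kappa> \<in> carrier_mat p q"
  shows "1\<^sub>m m \<star> (1\<^sub>m e \<otimes>\<^sub>K PC + lin (*) I e p q z P) +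
     lin scale (grid I e) m (e * p) (e * q) (coords scale e m z x) (\<lambda>(\<kappa>, i, j). mat_unit e e i j \<otimes>\<^sub>K P \<kappa>)
     = 1\<^sub>m (m * e) \<star> PC + lin scale I (m * e) p q x P"
proof -
  have zd: "dim_row (z \<kappa>) = e" "dim_col (z \<kappa>) = e" "dim_row (x \<kappa>) = m * e" "dim_col (x \<kappa>) = m * e" if "\<kappa> \<in> I" for \<kappa>
    using assms(2,3)[OF that] by auto
  have "lin scale (grid I e) m (e * p) (e * q) (coords scale e m z x) (\<lambda>(\<kappa>, i, j). mat_unit e e i j \<otimes>\<^sub>K P \<kappa>)
     = lin scale I (m * e) p q (\<lambda>\<kappa>. x \<kappa> - 1\<^sub>m m \<star> z \<kappa>) P"
    unfolding coords_def using assms zd by (intro lin_entry_block) (auto intro!: carrier_matI)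
  also have "\<dots> = lin scale I (m * e) p q x P - 1\<^sub>m m \<star> lin (*) I e p q z P"
    using assms zd by (subst lin_minus_point) (auto simp: lin_const_point intro!: carrier_matI)
  finally show ?thesis
    using assms(4) by (simp add: one_kron_scalar_assoc kron_scalar_add_right mat_minus_eq mat_add_add_cancel mult.assoc)
qed

lemma pencil_amplify:
  assumes "finite I" "\<And>\<kappa>. \<kappa> \<in> I \<Longrightarrow> z \<kappa> \<in> carrier_mat e e" "\<And>\<kappa>. \<kappa> \<in> I \<Longrightarrow> x \<kappa> \<in> carrier_mat (m * e) (m * e)"
    "wf_descr I p q S"
  shows "pencil scale (grid I e) m (amplify I e S z) (coords scale e m z x) = pencil scale I (m * e) S x"
  using affine_amplify[where PC = "pen_const S" and P = "pen_coeff S", OF assms(1-3)] wf_descr_carrier[OF assms(4)]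
  by (auto simp: amplify_def pencil_def kron_scalar_field)

lemma input_amplify:
  assumes "finite I" "\<And>\<kappa>. \<kappa> \<in> I \<Longrightarrow> z \<kappa> \<in> carrier_mat e e" "\<And>\<kappa>. \<kappa> \<in> I \<Longrightarrow> x \<kappa> \<in> carrier_mat (m * e) (m * e)"
    "wf_descr I p q S"
  shows "input scale (grid I e) m (amplify I e S z) (coords scale e m z x) = input scale I (m * e) S x"
  using affine_amplify[where PC = "inp_const S" and P = "inp_coeff S", OF assms(1-3)] wf_descr_carrier[OF assms(4)]
  by (auto simp: amplify_def input_def kron_scalar_field)

lemma descr_at_amplify:
  assumes "finite I" "\<And>\<kappa>. \<kappa> \<in> I \<Longrightarrow> z \<kappa> \<in> carrier_mat e e" "\<And>\<kappa>. \<kappa> \<in> I \<Longrightarrow> x \<kappa> \<in> carrier_mat (m * e) (m * e)"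
    "wf_descr I p q S"
  shows "descr_at scale (grid I e) m (amplify I e S z) (coords scale e m z x) V \<longleftrightarrow> descr_at scale I (m * e) S x V"
proof -
  have f: "feed (amplify I e S z) = 1\<^sub>m e \<otimes>\<^sub>K feed S" "outp (amplify I e S z) = 1\<^sub>m e \<otimes>\<^sub>K outp S"
    by (simp_all add: amplify_def)
  have m: "m * state_dim (amplify I e S z) = m * e * state_dim S" by simp
  show ?thesis
    by (simp only: descr_at_def pencil_amplify[OF assms] input_amplify[OF assms] f m one_kron_scalar_assoc)
qed

lemma inverse_pair_const:
  "inverse_pair n P Q \<Longrightarrow> inverse_pair (m * n) (1\<^sub>m m \<star> P) (1\<^sub>m m \<star> Q)"
  by (auto simp: inverse_pair_def kron_scalar_mult kron_scalar_one)

lemma pencil_normalize: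
  assumes "finite I" "\<And>\<kappa>. \<kappa> \<in> I \<Longrightarrow> x \<kappa> \<in> carrier_mat m m" "wf_descr I p q S"
    "inverse_pair (state_dim S) (pen_const S) Q"
  shows "pencil scale I m (normalize_descr Q S) x = (1\<^sub>m m \<star> Q) * pencil scale I m S x"
proof -
  note c = wf_descr_carrier[OF assms(3)] inverse_pair_dims[OF assms(4)]
  have Q: "Q \<in> carrier_mat (state_dim S) (state_dim S)" using c by auto
  have *: "(1\<^sub>m m \<star> Q) * lin scale I m (state_dim S) (state_dim S) x (pen_coeff S) =
     lin scale I m (state_dim S) (state_dim S) x (\<lambda>\<kappa>. Q * pen_coeff S \<kappa>)"
    by (rule lin_mult_left) (use assms c Q in auto)
  show ?thesis using c by (simp add: pencil_def normalize_descr_def mat_mult_add_distrib kron_scalar_mult *)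
qed

lemma input_normalize:
  assumes "finite I" "\<And>\<kappa>. \<kappa> \<in> I \<Longrightarrow> x \<kappa> \<in> carrier_mat m m" "wf_descr I p q S"
    "inverse_pair (state_dim S) (pen_const S) Q"
  shows "input scale I m (normalize_descr Q S) x = (1\<^sub>m m \<star> Q) * input scale I m S x +
     - (pencil scale I m (normalize_descr Q S) x * (1\<^sub>m m \<star> (Q * inp_const S)))"
proof -
  note c = wf_descr_carrier[OF assms(3)] inverse_pair_dims[OF assms(4)] wf_descr_dims[OF assms(3)]
  have Q: "Q \<in> carrier_mat (state_dim S) (state_dim S)" using c by auto
  let ?N = "state_dim S"
  have 1: "(1\<^sub>m m \<star> Q) * lin scale I m ?N q x (inp_coeff S) = lin scale I m ?N q x (\<lambda>\<kappa>. Q * inp_coeff S \<kappa>)"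
    by (rule lin_mult_left) (use assms c Q in auto)
  have 2: "lin scale I m ?N ?N x (\<lambda>\<kappa>. Q * pen_coeff S \<kappa>) * (1\<^sub>m m \<star> (Q * inp_const S)) =
     lin scale I m ?N q x (\<lambda>\<kappa>. Q * pen_coeff S \<kappa> * (Q * inp_const S))"
    by (rule lin_mult_right) (use assms c Q in \<open>auto intro!: carrier_matI\<close>)
  have 3: "lin scale I m ?N q x (\<lambda>\<kappa>. Q * inp_coeff S \<kappa> + - (Q * (pen_coeff S \<kappa> * (Q * inp_const S)))) =
    lin scale I m ?N q x (\<lambda>\<kappa>. Q * inp_coeff S \<kappa>) + - lin scale I m ?N q x (\<lambda>\<kappa>. Q * (pen_coeff S \<kappa> * (Q * inp_const S)))"
  proof -
    have "Q * inp_coeff S \<kappa> \<in> carrier_mat ?N q" "Q * (pen_coeff S \<kappa> * (Q * inp_const S)) \<in> carrier_mat ?N q"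
      "- (Q * (pen_coeff S \<kappa> * (Q * inp_const S))) \<in> carrier_mat ?N q"
      if "\<kappa> \<in> I" for \<kappa>
      using Q wf_descr_dims[OF assms(3)] that by (auto intro!: carrier_matI)
    thus ?thesis by (simp add: lin_add_coeff[OF unital_algebra_axioms] lin_uminus_coeff)
  qed
  have 4: "lin scale I m ?N q x (\<lambda>\<kappa>. Q * pen_coeff S \<kappa> * (Q * inp_const S)) = lin scale I m ?N q x (\<lambda>\<kappa>. Q * (pen_coeff S \<kappa> * (Q * inp_const S)))"
    by (rule lin_cong) (use c in \<open>auto simp: mat_mult_assoc\<close>)
  have 5: "input scale I m (normalize_descr Q S) x =
    lin scale I m ?N q x (\<lambda>\<kappa>. Q * inp_coeff S \<kappa>) + - lin scale I m ?N q x (\<lambda>\<kappa>. Q * (pen_coeff S \<kappa> * (Q * inp_const S)))"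
  proof -
    have "dim_col (inp_const S) = q" using c by blast
    thus ?thesis by (simp add: input_def normalize_descr_def 3 kron_scalar_zero_right mat_add_zero)
  qed
  have 6: "(1\<^sub>m m \<star> Q) * input scale I m S x = 1\<^sub>m m \<star> (Q * inp_const S) + lin scale I m ?N q x (\<lambda>\<kappa>. Q * inp_coeff S \<kappa>)"
    using c by (simp add: input_def mat_mult_add_distrib kron_scalar_mult 1)
  have 7: "pencil scale I m (normalize_descr Q S) x * (1\<^sub>m m \<star> (Q * inp_const S)) =
    1\<^sub>m m \<star> (Q * inp_const S) + lin scale I m ?N q x (\<lambda>\<kappa>. Q * (pen_coeff S \<kappa> * (Q * inp_const S)))"
    using c by (simp add: pencil_def normalize_descr_def mat_add_mult_distrib kron_scalar_mult 2 4)
  have "dim_col (inp_const S) = q" using c by blast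
  thus ?thesis unfolding 5 6 7 by (subst mat_add_minus_cancel) (simp_all add: inverse_pair_dims[OF assms(4)])
qed

text \<open>Multiplying the pencil by 1 \<otimes> Q changes its inverse M into M * (1 \<otimes> P),
  with P the constant term. The correction of the input passes through the new inverse as the
  constant 1 \<otimes> (Q * b0), which the correction of the feed term cancels.\<close>

lemma descr_at_normalize:
  assumes "finite I" "\<And>\<kappa>. \<kappa> \<in> I \<Longrightarrow> x \<kappa> \<in> carrier_mat m m" "wf_descr I p q S"
    "inverse_pair (state_dim S) (pen_const S) Q"
  shows "descr_at scale I m (normalize_descr Q S) x V \<longleftrightarrow> descr_at scale I m S x V"
proof -
  note c = inverse_pair_dims[OF assms(4)] wf_descr_dims[OF assms(3)]
  let ?N = "state_dim S" and ?P = "1\<^sub>m m \<star> pen_const S" and ?Q = "1\<^sub>m m \<star> Q"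
  note PQ = inverse_pair_const[OF assms(4), of m]
  have val: "1\<^sub>m m \<star> feed (normalize_descr Q S) + (1\<^sub>m m \<star> outp (normalize_descr Q S)) * (M * input scale I m (normalize_descr Q S) x) =
     1\<^sub>m m \<star> feed S + (1\<^sub>m m \<star> outp S) * (M * ?Q * input scale I m S x)"
    if M: "inverse_pair (m * ?N) (pencil scale I m (normalize_descr Q S) x) M" for M
  proof -
    note d = inverse_pair_dims[OF M]
    have "M * input scale I m (normalize_descr Q S) x = M * (?Q * input scale I m S x) + - (1\<^sub>m m \<star> (Q * inp_const S))"
      apply (subst input_normalize[OF assms], assumption)
      using c d by (simp add: mat_mult_add_distrib mat_uminus_mult_right inverse_pair_cancel[OF M])
    moreover have "1\<^sub>m m \<star> feed (normalize_descr Q S) = 1\<^sub>m m \<star> feed S + (1\<^sub>m m \<star> outp S) * (1\<^sub>m m \<star> (Q * inp_const S))"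
      using c by (simp add: normalize_descr_def kron_scalar_add_right kron_scalar_mult)
    moreover have "outp (normalize_descr Q S) = outp S" by (simp add: normalize_descr_def)
    ultimately show ?thesis using c d
      by (simp add: mat_mult_add_distrib mat_mult_assoc mat_uminus_mult_right mat_add_add_cancel)
  qed
  show ?thesis
  proof
    assume "descr_at scale I m (normalize_descr Q S) x V"
    then obtain M where M: "inverse_pair (m * ?N) (pencil scale I m (normalize_descr Q S) x) M"
      and V: "V = 1\<^sub>m m \<star> feed (normalize_descr Q S) + (1\<^sub>m m \<star> outp (normalize_descr Q S)) * (M * input scale I m (normalize_descr Q S) x)"
      by (auto simp: descr_at_def)
    have "pencil scale I m S x = ?P * pencil scale I m (normalize_descr Q S) x"
      using inverse_pair_cancel(1)[OF PQ, of "pencil scale I m S x"] by (simp add: pencil_normalize[OF assms])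
    hence "inverse_pair (m * ?N) (pencil scale I m S x) (M * ?Q)"
      using inverse_pair_mult[OF PQ M] by simp
    thus "descr_at scale I m S x V" using V val[OF M] by (auto simp: descr_at_def)
  next
    assume "descr_at scale I m S x V"
    then obtain M where M: "inverse_pair (m * ?N) (pencil scale I m S x) M"
      and V: "V = 1\<^sub>m m \<star> feed S + (1\<^sub>m m \<star> outp S) * (M * input scale I m S x)"
      by (auto simp: descr_at_def)
    note M' = inverse_pair_mult[OF inverse_pair_sym[OF PQ] M]
    have M'': "inverse_pair (m * ?N) (pencil scale I m (normalize_descr Q S) x) (M * ?P)"
      using M' by (simp add: pencil_normalize[OF assms])
    have "M * ?P * ?Q = M" using inverse_pair_dims[OF M] inverse_pair_dims(5,6)[OF PQ] c(1-4,9,10) by (simp add: mat_mult_assoc)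
    thus "descr_at scale I m (normalize_descr Q S) x V" using V val[OF M''] M'' by (auto simp: descr_at_def)
  qed
qed

end

section \<open>Invariant subspaces\<close>

definition lin_subspace :: "nat \<Rightarrow> 'k::field vec set \<Rightarrow> bool" where
  "lin_subspace n V \<longleftrightarrow> V \<subseteq> carrier_vec n \<and> 0\<^sub>v n \<in> V \<and> (\<forall>x\<in>V. \<forall>y\<in>V. x + y \<in> V) \<and> (\<forall>c. \<forall>x\<in>V. c \<cdot>\<^sub>v x \<in> V)"

lemma lin_subspaceD:
  assumes "lin_subspace n V"
  shows "x \<in> V \<Longrightarrow> x \<in> carrier_vec n" "0\<^sub>v n \<in> V" "x \<in> V \<Longrightarrow> y \<in> V \<Longrightarrow> x + y \<in> V" "x \<in> V \<Longrightarrow> c \<cdot>\<^sub>v x \<in> V"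
  using assms by (auto simp: lin_subspace_def)

lemma lin_subspace_minus:
  assumes "lin_subspace n V" "x \<in> V" "y \<in> V"
  shows "x - y \<in> V"
proof -
  have c: "x \<in> carrier_vec n" "y \<in> carrier_vec n" using assms lin_subspaceD by blast+
  have "x + (-1) \<cdot>\<^sub>v y \<in> V" using assms lin_subspaceD by blast
  moreover have "x + (-1) \<cdot>\<^sub>v y = x - y" using c by auto
  ultimately show ?thesis by simp
qed

lemma mat_eq_vecI:
  fixes A :: "'k::comm_ring_1 mat"
  assumes "A \<in> carrier_mat p q" "B \<in> carrier_mat p q" "\<And>u. u \<in> carrier_vec q \<Longrightarrow> A *\<^sub>v u = B *\<^sub>v u"
  shows "A = B"
proof (rule eq_matI)
  fix i j assume "i < dim_row B" "j < dim_col B"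
  hence ij: "i < p" "j < q" using assms by auto
  have "(M *\<^sub>v unit_vec q j) $ i = M $$ (i, j)" if "M \<in> carrier_mat p q" for M :: "'k mat"
    using that ij by (auto simp: scalar_prod_right_unit row_def)
  thus "A $$ (i, j) = B $$ (i, j)" using assms by (metis unit_vec_carrier)
qed (use assms in auto)

lemma mult_mat_vec_assoc:
  fixes A :: "'k::comm_ring_1 mat"
  assumes "dim_col A = dim_row B" "dim_col B = dim_vec v"
  shows "(A * B) *\<^sub>v v = A *\<^sub>v (B *\<^sub>v v)"
  by (rule assoc_mult_mat_vec[of A "dim_row A" "dim_row B" B "dim_vec v"]) (use assms in auto)

text \<open>If n < q, padding both matrices with zeros to size q keeps the product equal to 1. A
  left inverse of a square matrix over a field is two-sided, but the last row of the padded
  \<open>J\<close> is zero.\<close>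

lemma left_inverse_dim_le:
  fixes J :: "'k::field mat"
  assumes J: "J \<in> carrier_mat n q" and Jm: "Jm \<in> carrier_mat q n" and 1: "Jm * J = 1\<^sub>m q"
  shows "q \<le> n"
proof (rule ccontr)
  assume "\<not> q \<le> n"
  hence n: "n < q" by simp
  define J' where "J' = mat q q (\<lambda>(i, j). if i < n then J $$ (i, j) else 0)"
  define K' where "K' = mat q q (\<lambda>(i, j). if j < n then Jm $$ (i, j) else 0)"
  have "K' * J' = 1\<^sub>m q"
  proof (rule eq_matI)
    fix i j assume "i < dim_row (1\<^sub>m q :: 'k mat)" "j < dim_col (1\<^sub>m q :: 'k mat)"
    hence ij: "i < q" "j < q" by auto
    have "(K' * J') $$ (i, j) = (\<Sum>k<q. K' $$ (i, k) * J' $$ (k, j))"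
      using ij by (subst index_mult_mat_sum) (auto simp: J'_def K'_def)
    also have "\<dots> = (\<Sum>k\<in>{..<q}. if k \<in> {..<n} then Jm $$ (i, k) * J $$ (k, j) else 0)"
      using ij by (intro sum.cong) (auto simp: J'_def K'_def)
    also have "\<dots> = (\<Sum>k<n. Jm $$ (i, k) * J $$ (k, j))"
      using n by (subst sum.inter_restrict[symmetric]) (auto intro!: sum.cong)
    also have "\<dots> = (Jm * J) $$ (i, j)" using ij J Jm by (subst index_mult_mat_sum) auto
    finally show "(K' * J') $$ (i, j) = (1\<^sub>m q :: 'k mat) $$ (i, j)" by (simp add: 1)
  qed (auto simp: J'_def K'_def)
  moreover have "K' \<in> carrier_mat q q" "J' \<in> carrier_mat q q" by (simp_all add: J'_def K'_def)
  ultimately have "J' * K' = 1\<^sub>m q" using mat_mult_left_right_inverse by blast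
  hence "(J' * K') $$ (q - 1, q - 1) = 1" using n by simp
  moreover have "(J' * K') $$ (q - 1, q - 1) = (\<Sum>k<q. J' $$ (q - 1, k) * K' $$ (k, q - 1))"
    using n by (subst index_mult_mat_sum) (auto simp: J'_def K'_def)
  moreover have "\<dots> = 0" using n by (intro sum.neutral) (auto simp: J'_def)
  ultimately show False by simp
qed

text \<open>Coordinates on a subspace: the columns of \<open>J\<close> form a basis of
  \<open>V\<close>, and \<open>Jm\<close> is a left inverse defined on the whole space. With such a
  pair, restricting an operator to an invariant subspace becomes a product of matrices.\<close>

lemma lin_subspace_basis:
  fixes V :: "'k::field vec set"
  assumes V: "lin_subspace n V"
  obtains q J Jm where "J \<in> carrier_mat n q" "Jm \<in> carrier_mat q n" "Jm * J = 1\<^sub>m q"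
    "\<And>u. u \<in> carrier_vec q \<Longrightarrow> J *\<^sub>v u \<in> V" "\<And>v. v \<in> V \<Longrightarrow> J *\<^sub>v (Jm *\<^sub>v v) = v"
proof -
  \<comment> \<open>The largest q with a left invertible map into \<open>V\<close> is taken; if its
    range missed a vector of \<open>V\<close>, one more column could be added.\<close>
  define P where "P q \<longleftrightarrow> (\<exists>J Jm. J \<in> carrier_mat n q \<and> Jm \<in> carrier_mat q n \<and> Jm * J = 1\<^sub>m q \<and>
     (\<forall>u\<in>carrier_vec q. J *\<^sub>v u \<in> V))" for q
  have bound: "q \<le> n" if "P q" for q using that left_inverse_dim_le unfolding P_def by blast
  have "P 0" unfolding P_def
    by (rule exI[of _ "0\<^sub>m n 0"], rule exI[of _ "0\<^sub>m 0 n"])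
      (use lin_subspaceD(2)[OF V] in \<open>auto simp: mult_mat_vec_def scalar_prod_def zero_vec_def\<close>)
  hence "P (Greatest P)" by (rule GreatestI_nat[where b = n]) (use bound in auto)
  then obtain J Jm where J: "J \<in> carrier_mat n (Greatest P)" and Jm: "Jm \<in> carrier_mat (Greatest P) n"
    and JJ: "Jm * J = 1\<^sub>m (Greatest P)" and ran: "\<forall>u\<in>carrier_vec (Greatest P). J *\<^sub>v u \<in> V"
    unfolding P_def by blast
  have "J *\<^sub>v (Jm *\<^sub>v v) = v" if v: "v \<in> V" for v
  proof (rule ccontr)
    assume neq: "J *\<^sub>v (Jm *\<^sub>v v) \<noteq> v"
    define q where "q = Greatest P"
    note J = J[folded q_def] and Jm = Jm[folded q_def] and JJ = JJ[folded q_def] and ran = ran[folded q_def]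
    have vc: "v \<in> carrier_vec n" using v V lin_subspaceD by blast
    define a where "a = Jm *\<^sub>v v"
    have ac: "a \<in> carrier_vec q" using Jm vc by (simp add: a_def)
    define w where "w = v - J *\<^sub>v a"
    have Ja: "J *\<^sub>v a \<in> carrier_vec n" using J ac by simp
    have wV: "w \<in> V" unfolding w_def using lin_subspace_minus[OF V v] ran ac by blast
    have wc: "w \<in> carrier_vec n" using wV V lin_subspaceD by blast
    have "w \<noteq> 0\<^sub>v n"
    proof
      assume w0: "w = 0\<^sub>v n"
      have "v $ i = (J *\<^sub>v a) $ i" if "i < n" for i
        using arg_cong[OF w0, of "\<lambda>x. x $ i"] that vc carrier_matD[OF J] by (simp add: w_def)
      hence "v = J *\<^sub>v a" using carrier_matD[OF J] vc by (intro eq_vecI) auto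
      thus False using neq by (simp add: a_def)
    qed
    then obtain i where i: "i < n" "w $ i \<noteq> 0" using wc by (metis carrier_vecD eq_vecI index_zero_vec)
    have Jmw: "Jm *\<^sub>v w = 0\<^sub>v q"
    proof -
      have "Jm *\<^sub>v w = Jm *\<^sub>v v - Jm *\<^sub>v (J *\<^sub>v a)"
        unfolding w_def by (rule mult_minus_distrib_mat_vec[OF Jm vc Ja])
      also have "Jm *\<^sub>v (J *\<^sub>v a) = a"
        using assoc_mult_mat_vec[OF Jm J ac] JJ ac by simp
      finally show ?thesis using ac by (simp add: a_def[symmetric])
    qed
    \<comment> \<open>\<open>R\<close> projects onto the kernel of \<open>Jm\<close> along the range
      of \<open>J\<close>: it kills \<open>J\<close> and fixes \<open>w\<close>. A row of
      \<open>R\<close> at an index where \<open>w\<close> is nonzero, rescaled, is a functional that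
      vanishes on the range of \<open>J\<close> and takes the value 1 at \<open>w\<close>.\<close>
    define R where "R = 1\<^sub>m n + - (J * Jm)"
    have Rc: "R \<in> carrier_mat n n" using J Jm by (auto simp: R_def)
    have RJ: "R * J = 0\<^sub>m n q"
      using J Jm JJ by (simp add: R_def mat_add_mult_distrib mat_mult_assoc mat_uminus_mult_left mat_add_uminus_cancel)
    have Rw: "R *\<^sub>v w = w"
    proof -
      have "R *\<^sub>v w = w + (- (J * Jm)) *\<^sub>v w"
        unfolding R_def using J Jm wc by (subst add_mult_distrib_mat_vec[of _ n n]) auto
      also have "(- (J * Jm)) *\<^sub>v w = - (J *\<^sub>v (Jm *\<^sub>v w))"
        using J Jm wc by (simp add: assoc_mult_mat_vec[OF J Jm wc])
      also have "\<dots> = 0\<^sub>v n" unfolding Jmw using J by (auto simp: scalar_prod_def)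
      finally show ?thesis using wc by simp
    qed
    define f where "f = (1 / (w $ i)) \<cdot>\<^sub>v row R i"
    have fc: "f \<in> carrier_vec n" using Rc i by (simp add: f_def)
    have fJ: "f \<bullet> col J b = 0" if "b < q" for b
    proof -
      have "row R i \<bullet> col J b = (R * J) $$ (i, b)" using Rc J i that by simp
      thus ?thesis using Rc J i that by (simp add: f_def RJ)
    qed
    have fw: "f \<bullet> w = 1"
    proof -
      have "row R i \<bullet> w = (R *\<^sub>v w) $ i" using Rc i by simp
      thus ?thesis using Rc wc i by (simp add: f_def Rw)
    qed
    define J' where "J' = mat n (Suc q) (\<lambda>(r, c). if c < q then J $$ (r, c) else w $ r)"
    define K' where "K' = mat (Suc q) n (\<lambda>(r, c). if r < q then Jm $$ (r, c) else f $ c)"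
    have rK: "row K' r = (if r < q then row Jm r else f)" if "r < Suc q" for r
      using that Jm fc by (intro eq_vecI) (auto simp: K'_def)
    have cJ: "col J' c = (if c < q then col J c else w)" if "c < Suc q" for c
      using that J wc by (intro eq_vecI) (auto simp: J'_def)
    have JmJ: "row Jm r \<bullet> col J c = (if r = c then 1 else 0)" if "r < q" "c < q" for r c
    proof -
      have "row Jm r \<bullet> col J c = (Jm * J) $$ (r, c)" using Jm J that by simp
      thus ?thesis using that by (simp add: JJ)
    qed
    have Jmw': "row Jm r \<bullet> w = 0" if "r < q" for r
    proof -
      have "row Jm r \<bullet> w = (Jm *\<^sub>v w) $ r" using Jm that by simp
      thus ?thesis using that by (simp add: Jmw)
    qed
    have "K' * J' = 1\<^sub>m (Suc q)"
    proof (rule eq_matI)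
      fix r c assume "r < dim_row (1\<^sub>m (Suc q) :: 'k mat)" "c < dim_col (1\<^sub>m (Suc q) :: 'k mat)"
      hence rc: "r < Suc q" "c < Suc q" by auto
      have "(K' * J') $$ (r, c) = row K' r \<bullet> col J' c" using rc by (simp add: K'_def J'_def)
      also have "\<dots> = (if r = c then 1 else 0)"
        unfolding rK[OF rc(1)] cJ[OF rc(2)] using rc by (auto simp: JmJ Jmw' fJ fw less_Suc_eq)
      finally show "(K' * J') $$ (r, c) = (1\<^sub>m (Suc q) :: 'k mat) $$ (r, c)" using rc by simp
    qed (auto simp: K'_def J'_def)
    moreover have "J' *\<^sub>v u \<in> V" if u: "u \<in> carrier_vec (Suc q)" for u
    proof -
      have "J' *\<^sub>v u = J *\<^sub>v vec q (\<lambda>i. u $ i) + (u $ q) \<cdot>\<^sub>v w"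
        using u J wc
        by (intro eq_vecI) (auto simp: J'_def mult_mat_vec_def scalar_prod_def row_def mult.commute intro!: sum.cong)
      moreover have "J *\<^sub>v vec q (\<lambda>i. u $ i) \<in> V" using ran by auto
      ultimately show ?thesis using lin_subspaceD[OF V] wV by auto
    qed
    ultimately have "P (Suc q)" unfolding P_def
      by (intro exI[of _ J'] exI[of _ K']) (auto simp: J'_def K'_def)
    hence "Suc q \<le> q" unfolding q_def using bound by (intro Greatest_le_nat[where b = n]) auto
    thus False by simp
  qed
  thus ?thesis using that[OF J Jm JJ] ran by blast
qed

text \<open>Invariant subspaces replace the span of all products of operators, so that each
  application only has to exhibit one subspace. \<open>controllable_iff\<close> recovers the wording
  by products; \<open>distinguishable\<close> is the dual notion, recovered by
  \<open>observable_iff\<close>.\<close>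

definition reachable :: "'i set \<Rightarrow> nat \<Rightarrow> ('i \<Rightarrow> 'k::field mat) \<Rightarrow> 'k vec set \<Rightarrow> bool" where
  "reachable I n A X \<longleftrightarrow> (\<forall>V. lin_subspace n V \<and> (\<forall>\<kappa>\<in>I. \<forall>x\<in>V. A \<kappa> *\<^sub>v x \<in> V) \<and> X \<subseteq> V \<longrightarrow> V = carrier_vec n)"

definition distinguishable :: "'i set \<Rightarrow> nat \<Rightarrow> nat \<Rightarrow> 'k::field mat \<Rightarrow> ('i \<Rightarrow> 'k mat) \<Rightarrow> bool" where
  "distinguishable I n p C A \<longleftrightarrow>
     (\<forall>V. lin_subspace n V \<and> (\<forall>\<kappa>\<in>I. \<forall>x\<in>V. A \<kappa> *\<^sub>v x \<in> V) \<and> (\<forall>x\<in>V. C *\<^sub>v x = 0\<^sub>v p) \<longrightarrow> V = {0\<^sub>v n})"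

lemma mult_mat_zero_vec: "A \<in> carrier_mat p q \<Longrightarrow> A *\<^sub>v 0\<^sub>v q = (0\<^sub>v p :: 'k::comm_ring_1 vec)"
  by (auto simp: mult_mat_vec_def scalar_prod_def)

lemma lin_subspace_vimage:
  assumes "A \<in> carrier_mat p q" "lin_subspace p V"
  shows "lin_subspace q {x \<in> carrier_vec q. A *\<^sub>v x \<in> V}"
  unfolding lin_subspace_def
  using assms lin_subspaceD[OF assms(2)]
  by (auto simp: mult_mat_zero_vec mult_add_distrib_mat_vec mult_mat_vec)

lemma lin_subspace_image:
  assumes "A \<in> carrier_mat p q" "lin_subspace q V"
  shows "lin_subspace p ((*\<^sub>v) A ` V)"
proof -
  note c = lin_subspaceD[OF assms(2)]
  have "A *\<^sub>v x + A *\<^sub>v y \<in> (*\<^sub>v) A ` V" if "x \<in> V" "y \<in> V" for x y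
    using mult_add_distrib_mat_vec[OF assms(1) c(1)[OF that(1)] c(1)[OF that(2)]] c(3)[OF that]
    by (metis imageI)
  moreover have "k \<cdot>\<^sub>v (A *\<^sub>v x) \<in> (*\<^sub>v) A ` V" if "x \<in> V" for x k
    using mult_mat_vec[OF assms(1) c(1)[OF that], of k] c(4)[OF that] by (metis imageI)
  moreover have "0\<^sub>v p \<in> (*\<^sub>v) A ` V"
    using mult_mat_zero_vec[OF assms(1)] c(2) by (metis imageI)
  ultimately show ?thesis unfolding lin_subspace_def using assms(1) c(1)
    by (auto simp: mult_mat_vec_carrier)
qed

text \<open>Restriction to the smallest invariant subspace containing \<open>X\<close>, in
  coordinates. The restriction is reachable because \<open>J\<close> maps an invariant subspace of
  the coordinate space that contains the inputs to such a subspace of the original space, which then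
  contains the smallest one.\<close>

lemma reachable_part:
  fixes A :: "'i \<Rightarrow> 'k::field mat"
  assumes A: "\<And>\<kappa>. \<kappa> \<in> I \<Longrightarrow> A \<kappa> \<in> carrier_mat n n" and X: "X \<subseteq> carrier_vec n"
  obtains q J Jm where "J \<in> carrier_mat n q" "Jm \<in> carrier_mat q n" "Jm * J = 1\<^sub>m q"
    "\<And>\<kappa>. \<kappa> \<in> I \<Longrightarrow> A \<kappa> * J = J * (Jm * (A \<kappa> * J))" "\<And>x. x \<in> X \<Longrightarrow> J *\<^sub>v (Jm *\<^sub>v x) = x"
    "reachable I q (\<lambda>\<kappa>. Jm * (A \<kappa> * J)) ((*\<^sub>v) Jm ` X)"
proof -
  define invsp where "invsp V \<longleftrightarrow> lin_subspace n V \<and> (\<forall>\<kappa>\<in>I. \<forall>x\<in>V. A \<kappa> *\<^sub>v x \<in> V) \<and> X \<subseteq> V" for V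
  define R where "R = {x \<in> carrier_vec n. \<forall>V. invsp V \<longrightarrow> x \<in> V}"
  have R: "lin_subspace n R" unfolding R_def lin_subspace_def invsp_def by auto
  have RA: "A \<kappa> *\<^sub>v x \<in> R" if "\<kappa> \<in> I" "x \<in> R" for \<kappa> x
    using that A[OF that(1)] unfolding R_def invsp_def by auto
  have RX: "X \<subseteq> R" using X unfolding R_def invsp_def by auto
  obtain q J Jm where J: "J \<in> carrier_mat n q" and Jm: "Jm \<in> carrier_mat q n" and JJ: "Jm * J = 1\<^sub>m q"
    and ran: "\<And>u. u \<in> carrier_vec q \<Longrightarrow> J *\<^sub>v u \<in> R" and fixv: "\<And>v. v \<in> R \<Longrightarrow> J *\<^sub>v (Jm *\<^sub>v v) = v"
    using lin_subspace_basis[OF R] by metis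
  have AJ: "A \<kappa> * J = J * (Jm * (A \<kappa> * J))" if k: "\<kappa> \<in> I" for \<kappa>
  proof (rule mat_eq_vecI)
    show "A \<kappa> * J \<in> carrier_mat n q" "J * (Jm * (A \<kappa> * J)) \<in> carrier_mat n q" using A[OF k] J Jm by auto
    fix u :: "'k vec" assume u: "u \<in> carrier_vec q"
    have d: "dim_row (A \<kappa>) = n" "dim_col (A \<kappa>) = n" using A[OF k] by auto
    have "J *\<^sub>v (Jm *\<^sub>v (A \<kappa> *\<^sub>v (J *\<^sub>v u))) = A \<kappa> *\<^sub>v (J *\<^sub>v u)"
      by (rule fixv[OF RA[OF k ran[OF u]]])
    thus "(A \<kappa> * J) *\<^sub>v u = (J * (Jm * (A \<kappa> * J))) *\<^sub>v u"
      using d carrier_matD[OF J] carrier_matD[OF Jm] carrier_vecD[OF u] by (simp add: mult_mat_vec_assoc)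
  qed
  have "reachable I q (\<lambda>\<kappa>. Jm * (A \<kappa> * J)) ((*\<^sub>v) Jm ` X)"
    unfolding reachable_def
  proof (intro allI impI, elim conjE)
    fix W assume W: "lin_subspace q W" and WA: "\<forall>\<kappa>\<in>I. \<forall>x\<in>W. (Jm * (A \<kappa> * J)) *\<^sub>v x \<in> W"
      and WX: "(*\<^sub>v) Jm ` X \<subseteq> W"
    have "invsp ((*\<^sub>v) J ` W)" unfolding invsp_def
    proof (intro conjI ballI)
      show "lin_subspace n ((*\<^sub>v) J ` W)" by (rule lin_subspace_image[OF J W])
    next
      fix \<kappa> x assume k: "\<kappa> \<in> I" and "x \<in> (*\<^sub>v) J ` W"
      then obtain y where y: "y \<in> W" "x = J *\<^sub>v y" by auto
      have yc: "y \<in> carrier_vec q" using y W lin_subspaceD by blast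
      have d: "dim_row (A \<kappa>) = n" "dim_col (A \<kappa>) = n" using A[OF k] by auto
      have "A \<kappa> *\<^sub>v x = (J * (Jm * (A \<kappa> * J))) *\<^sub>v y"
        unfolding AJ[OF k, symmetric] y(2)
        using d carrier_matD[OF J] carrier_vecD[OF yc] by (simp add: mult_mat_vec_assoc)
      also have "\<dots> = J *\<^sub>v ((Jm * (A \<kappa> * J)) *\<^sub>v y)"
        using d carrier_matD[OF J] carrier_matD[OF Jm] carrier_vecD[OF yc] by (subst mult_mat_vec_assoc) auto
      finally show "A \<kappa> *\<^sub>v x \<in> (*\<^sub>v) J ` W" using WA k y by auto
    next
      show "X \<subseteq> (*\<^sub>v) J ` W"
      proof
        fix x assume x: "x \<in> X"
        hence "J *\<^sub>v (Jm *\<^sub>v x) = x" using fixv RX by blast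
        thus "x \<in> (*\<^sub>v) J ` W" using WX x by (metis image_eqI image_subset_iff)
      qed
    qed
    have "u \<in> W" if u: "u \<in> carrier_vec q" for u
    proof -
      have "J *\<^sub>v u \<in> (*\<^sub>v) J ` W" using ran[OF u] \<open>invsp _\<close> unfolding R_def by blast
      then obtain y where y: "y \<in> W" "J *\<^sub>v u = J *\<^sub>v y" by auto
      have yc: "y \<in> carrier_vec q" using y W lin_subspaceD by blast
      have "Jm *\<^sub>v (J *\<^sub>v u) = Jm *\<^sub>v (J *\<^sub>v y)" by (simp add: y(2))
      hence "u = y"
        using u yc JJ assoc_mult_mat_vec[OF Jm J u] assoc_mult_mat_vec[OF Jm J yc] by simp
      thus ?thesis using y by simp
    qed
    thus "W = carrier_vec q" using lin_subspaceD[OF W] by auto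
  qed
  thus ?thesis using that[OF J Jm JJ AJ] fixv RX by blast
qed

text \<open>Duality: for an invariant W inside the kernel of \<open>C\<close>, the vectors
  orthogonal to W form a subspace that is invariant under the transposes and contains the range of
  the transpose of \<open>C\<close>. Being everything, it forces W = 0.\<close>

lemma distinguishable_of_reachable_transpose:
  fixes A :: "'i \<Rightarrow> 'k::field mat"
  assumes A: "\<And>\<kappa>. \<kappa> \<in> I \<Longrightarrow> A \<kappa> \<in> carrier_mat n n" and C: "C \<in> carrier_mat p n"
    and reach: "reachable I n (\<lambda>\<kappa>. (A \<kappa>)\<^sup>T) ((*\<^sub>v) C\<^sup>T ` carrier_vec p)"
  shows "distinguishable I n p C A"
  unfolding distinguishable_def
proof (intro allI impI, elim conjE)
  fix W assume W: "lin_subspace n W" and WA: "\<forall>\<kappa>\<in>I. \<forall>x\<in>W. A \<kappa> *\<^sub>v x \<in> W" and WC: "\<forall>x\<in>W. C *\<^sub>v x = 0\<^sub>v p"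
  note Wc = lin_subspaceD(1)[OF W]
  define U where "U = {v \<in> carrier_vec n. \<forall>w\<in>W. v \<bullet> w = 0}"
  have "lin_subspace n U" unfolding lin_subspace_def U_def
    using Wc by (auto simp: add_scalar_prod_distrib[of _ n])
  moreover have "\<forall>\<kappa>\<in>I. \<forall>x\<in>U. (A \<kappa>)\<^sup>T *\<^sub>v x \<in> U"
  proof (intro ballI)
    fix \<kappa> x assume k: "\<kappa> \<in> I" and x: "x \<in> U"
    have "((A \<kappa>)\<^sup>T *\<^sub>v x) \<bullet> w = 0" if w: "w \<in> W" for w
      using transpose_vec_mult_scalar[OF A[OF k] Wc[OF w], of x] x WA k w by (auto simp: U_def)
    thus "(A \<kappa>)\<^sup>T *\<^sub>v x \<in> U" using A[OF k] x by (auto simp: U_def)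
  qed
  moreover have "(*\<^sub>v) C\<^sup>T ` carrier_vec p \<subseteq> U"
  proof (rule image_subsetI)
    fix u :: "'k vec" assume u: "u \<in> carrier_vec p"
    have "(C\<^sup>T *\<^sub>v u) \<bullet> w = 0" if w: "w \<in> W" for w
      using transpose_vec_mult_scalar[OF C Wc[OF w] u] WC w u by auto
    thus "C\<^sup>T *\<^sub>v u \<in> U" using C u by (auto simp: U_def)
  qed
  ultimately have U: "U = carrier_vec n" using reach unfolding reachable_def by blast
  have "w = 0\<^sub>v n" if w: "w \<in> W" for w
  proof (rule eq_vecI)
    fix i assume "i < dim_vec (0\<^sub>v n :: 'k vec)"
    hence i: "i < n" by simp
    have "unit_vec n i \<in> U" using U by auto
    hence "unit_vec n i \<bullet> w = 0" using w by (auto simp: U_def)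
    thus "w $ i = 0\<^sub>v n $ i" using Wc[OF w] i by simp
  qed (use Wc[OF w] in auto)
  thus "W = {0\<^sub>v n}" using lin_subspaceD(2)[OF W] by blast
qed

section \<open>Markov parameters and minimality\<close>

definition run_word :: "('i \<Rightarrow> 'k::semiring_0 mat) \<Rightarrow> 'i list \<Rightarrow> 'k vec \<Rightarrow> 'k vec" where
  "run_word A w x = foldr (\<lambda>\<kappa> v. A \<kappa> *\<^sub>v v) w x"

lemma run_word_simps [simp]:
  "run_word A [] x = x" "run_word A (\<kappa> # w) x = A \<kappa> *\<^sub>v run_word A w x"
  "run_word A (w @ [\<kappa>]) x = run_word A w (A \<kappa> *\<^sub>v x)"
  by (auto simp: run_word_def)

lemma run_word_carrier:
  assumes "\<And>\<kappa>. \<kappa> \<in> I \<Longrightarrow> A \<kappa> \<in> carrier_mat n n" "w \<in> lists I" "x \<in> carrier_vec n"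
  shows "run_word A w x \<in> carrier_vec n"
  using assms(2)
proof (induction w)
  case (Cons \<kappa> w)
  thus ?case using mult_mat_vec_carrier[OF assms(1)] by auto
qed (use assms in auto)

lemma run_word_add:
  assumes "\<And>\<kappa>. \<kappa> \<in> I \<Longrightarrow> A \<kappa> \<in> carrier_mat n n" "w \<in> lists I" "x \<in> carrier_vec n" "y \<in> carrier_vec n"
  shows "run_word A w (x + y) = run_word A w x + run_word A w y"
  using assms(2)
proof (induction w)
  case (Cons \<kappa> w)
  thus ?case
    using run_word_carrier[where A = A and I = I and w = w and n = n and x = x]
      run_word_carrier[where A = A and I = I and w = w and n = n and x = y] assms(1,3,4)
      mult_add_distrib_mat_vec[OF assms(1)] by auto
qed auto

lemma run_word_smult:
  fixes A :: "'i \<Rightarrow> 'k::field mat"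
  assumes "\<And>\<kappa>. \<kappa> \<in> I \<Longrightarrow> A \<kappa> \<in> carrier_mat n n" "w \<in> lists I" "x \<in> carrier_vec n"
  shows "run_word A w (c \<cdot>\<^sub>v x) = c \<cdot>\<^sub>v run_word A w x"
  using assms(2)
proof (induction w)
  case (Cons \<kappa> w)
  thus ?case
    using run_word_carrier[where A = A and I = I and w = w and n = n and x = x] assms(1,3) mult_mat_vec[OF assms(1)] by auto
qed auto

lemma run_word_zero:
  fixes A :: "'i \<Rightarrow> 'k::field mat"
  assumes "\<And>\<kappa>. \<kappa> \<in> I \<Longrightarrow> A \<kappa> \<in> carrier_mat n n" "w \<in> lists I"
  shows "run_word A w (0\<^sub>v n) = 0\<^sub>v n"
  using assms(2)
proof (induction w)
  case (Cons \<kappa> w)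
  thus ?case using mult_mat_zero_vec[OF assms(1)] by auto
qed auto

definition centered :: "('i, 'k::field) descriptor \<Rightarrow> bool" where
  "centered S \<longleftrightarrow> pen_const S = 1\<^sub>m (state_dim S) \<and> inp_const S = 0\<^sub>m (state_dim S) (dim_col (inp_const S))"

definition input_range :: "'i set \<Rightarrow> ('i, 'k::field) descriptor \<Rightarrow> 'k vec set" where
  "input_range I S = {inp_coeff S \<kappa> *\<^sub>v u | \<kappa> u. \<kappa> \<in> I \<and> u \<in> carrier_vec (dim_col (inp_const S))}"

definition minimal :: "'i set \<Rightarrow> ('i, 'k::field) descriptor \<Rightarrow> bool" where
  "minimal I S \<longleftrightarrow> reachable I (state_dim S) (pen_coeff S) (input_range I S) \<and>
     distinguishable I (state_dim S) (dim_row (outp S)) (outp S) (pen_coeff S)"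

text \<open>For centered systems these vectors are, up to sign, the coefficients of the power series
  of the function at its centre; equality is the formal counterpart of agreement near the
  centre.\<close>

definition same_markov :: "'i set \<Rightarrow> ('i, 'k::field) descriptor \<Rightarrow> ('i, 'k) descriptor \<Rightarrow> bool" where
  "same_markov I S S' \<longleftrightarrow> feed S = feed S' \<and>
     (\<forall>w\<in>lists I. \<forall>\<kappa>\<in>I. \<forall>u\<in>carrier_vec (dim_col (inp_const S)).
        outp S *\<^sub>v run_word (pen_coeff S) w (inp_coeff S \<kappa> *\<^sub>v u) =
        outp S' *\<^sub>v run_word (pen_coeff S') w (inp_coeff S' \<kappa> *\<^sub>v u))"

text \<open>A morphism of systems from \<open>S\<close> to \<open>S'\<close> acting on states.
  Injective morphisms are inclusions of subsystems, surjective ones are quotient maps; in both cases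
  the Markov parameters stay the same.\<close>

definition intertwines :: "'i set \<Rightarrow> 'k::field mat \<Rightarrow> ('i, 'k) descriptor \<Rightarrow> ('i, 'k) descriptor \<Rightarrow> bool" where
  "intertwines I G S S' \<longleftrightarrow> G \<in> carrier_mat (state_dim S') (state_dim S) \<and> feed S' = feed S \<and> outp S' * G = outp S \<and>
     (\<forall>\<kappa>\<in>I. pen_coeff S' \<kappa> * G = G * pen_coeff S \<kappa> \<and> G * inp_coeff S \<kappa> = inp_coeff S' \<kappa>)"

lemma input_range_carrier:
  assumes "wf_descr I p q S"
  shows "input_range I S \<subseteq> carrier_vec (state_dim S)"
  using mult_mat_vec_carrier[OF wf_descr_carrier(6)[OF assms]] wf_descr_dims(8)[OF assms]
  by (auto simp: input_range_def)

lemma same_markov_sym: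
  assumes "wf_descr I p q S" "wf_descr I p q S'" "same_markov I S S'"
  shows "same_markov I S' S"
  using assms(3) wf_descr_dims(8)[OF assms(1)] wf_descr_dims(8)[OF assms(2)] by (auto simp: same_markov_def)

lemma same_markov_trans:
  assumes "wf_descr I p q S" "wf_descr I p q S'" "same_markov I S S'" "same_markov I S' S''"
  shows "same_markov I S S''"
  using assms(3,4) wf_descr_dims(8)[OF assms(1)] wf_descr_dims(8)[OF assms(2)] by (auto simp: same_markov_def)

lemma intertwines_run_word:
  assumes wf: "wf_descr I p q S" "wf_descr I p q S'" and G: "intertwines I G S S'"
    and w: "w \<in> lists I" and x: "x \<in> carrier_vec (state_dim S)"
  shows "run_word (pen_coeff S') w (G *\<^sub>v x) = G *\<^sub>v run_word (pen_coeff S) w x"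
  using w
proof (induction w)
  case (Cons \<kappa> w)
  have Gc: "G \<in> carrier_mat (state_dim S') (state_dim S)" using G by (simp add: intertwines_def)
  have k: "\<kappa> \<in> I" "w \<in> lists I" using Cons by auto
  define v where "v = run_word (pen_coeff S) w x"
  have v: "v \<in> carrier_vec (state_dim S)"
    unfolding v_def by (rule run_word_carrier[where A = "pen_coeff S" and I = I, OF wf_descr_carrier(5)[OF wf(1)] k(2) x])
  have "pen_coeff S' \<kappa> *\<^sub>v (G *\<^sub>v v) = (pen_coeff S' \<kappa> * G) *\<^sub>v v"
    by (rule assoc_mult_mat_vec[symmetric, OF wf_descr_carrier(5)[OF wf(2) k(1)] Gc v])
  also have "\<dots> = (G * pen_coeff S \<kappa>) *\<^sub>v v" using G k by (simp add: intertwines_def)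
  also have "\<dots> = G *\<^sub>v (pen_coeff S \<kappa> *\<^sub>v v)"
    by (rule assoc_mult_mat_vec[OF Gc wf_descr_carrier(5)[OF wf(1) k(1)] v])
  finally show ?case using Cons by (simp add: v_def)
qed auto

lemma intertwines_same_markov:
  fixes S :: "('i, 'k::field) descriptor"
  assumes wf: "wf_descr I p q S" "wf_descr I p q S'" and G: "intertwines I G S S'"
  shows "same_markov I S S'"
  unfolding same_markov_def
proof (intro conjI ballI)
  show "feed S = feed S'" using G by (simp add: intertwines_def)
  fix w \<kappa> and u :: "'k vec"
  assume w: "w \<in> lists I" and k: "\<kappa> \<in> I" and u: "u \<in> carrier_vec (dim_col (inp_const S))"
  have uc: "u \<in> carrier_vec q" using u wf_descr_dims(8)[OF wf(1)] by simp
  have Gc: "G \<in> carrier_mat (state_dim S') (state_dim S)" using G by (simp add: intertwines_def)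
  have x: "inp_coeff S \<kappa> *\<^sub>v u \<in> carrier_vec (state_dim S)"
    using wf_descr_carrier(6)[OF wf(1) k] uc by simp
  have "inp_coeff S' \<kappa> *\<^sub>v u = (G * inp_coeff S \<kappa>) *\<^sub>v u" using G k by (simp add: intertwines_def)
  also have "\<dots> = G *\<^sub>v (inp_coeff S \<kappa> *\<^sub>v u)"
    by (rule assoc_mult_mat_vec[OF Gc wf_descr_carrier(6)[OF wf(1) k] uc])
  finally have 1: "run_word (pen_coeff S') w (inp_coeff S' \<kappa> *\<^sub>v u) = G *\<^sub>v run_word (pen_coeff S) w (inp_coeff S \<kappa> *\<^sub>v u)"
    using intertwines_run_word[OF wf G w x] by simp
  have "outp S' *\<^sub>v (G *\<^sub>v run_word (pen_coeff S) w (inp_coeff S \<kappa> *\<^sub>v u)) =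
     (outp S' * G) *\<^sub>v run_word (pen_coeff S) w (inp_coeff S \<kappa> *\<^sub>v u)"
    by (rule assoc_mult_mat_vec[symmetric, OF wf_descr_carrier(2)[OF wf(2)] Gc
        run_word_carrier[where A = "pen_coeff S" and I = I, OF wf_descr_carrier(5)[OF wf(1)] w x]])
  thus "outp S *\<^sub>v run_word (pen_coeff S) w (inp_coeff S \<kappa> *\<^sub>v u) =
    outp S' *\<^sub>v run_word (pen_coeff S') w (inp_coeff S' \<kappa> *\<^sub>v u)"
    using G by (simp add: 1 intertwines_def)
qed

text \<open>The graph of the intended intertwiner: the smallest subspace of the product of the state
  spaces that contains the simultaneous inputs and is closed under simultaneous steps.\<close>

inductive joint_reach :: "'i set \<Rightarrow> ('i, 'k::field) descriptor \<Rightarrow> ('i, 'k) descriptor \<Rightarrow> 'k vec \<Rightarrow> 'k vec \<Rightarrow> bool"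
  for I S S' where
  zero: "joint_reach I S S' (0\<^sub>v (state_dim S)) (0\<^sub>v (state_dim S'))"
| inp: "\<kappa> \<in> I \<Longrightarrow> u \<in> carrier_vec (dim_col (inp_const S)) \<Longrightarrow>
     joint_reach I S S' (inp_coeff S \<kappa> *\<^sub>v u) (inp_coeff S' \<kappa> *\<^sub>v u)"
| step: "\<kappa> \<in> I \<Longrightarrow> joint_reach I S S' x y \<Longrightarrow> joint_reach I S S' (pen_coeff S \<kappa> *\<^sub>v x) (pen_coeff S' \<kappa> *\<^sub>v y)"
| add: "joint_reach I S S' x y \<Longrightarrow> joint_reach I S S' x' y' \<Longrightarrow> joint_reach I S S' (x + x') (y + y')"
| smult: "joint_reach I S S' x y \<Longrightarrow> joint_reach I S S' (c \<cdot>\<^sub>v x) (c \<cdot>\<^sub>v y)"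

lemma joint_reach_carrier:
  assumes wf: "wf_descr I p q S" "wf_descr I p q S'" and "joint_reach I S S' x y"
  shows "x \<in> carrier_vec (state_dim S) \<and> y \<in> carrier_vec (state_dim S')"
  using assms(3)
proof induction
  case (inp \<kappa> u)
  hence "u \<in> carrier_vec q" using wf_descr_dims(8)[OF wf(1)] by simp
  thus ?case using inp mult_mat_vec_carrier[OF wf_descr_carrier(6)[OF wf(1)]]
    mult_mat_vec_carrier[OF wf_descr_carrier(6)[OF wf(2)]] by blast
next
  case (step \<kappa> x y)
  thus ?case using mult_mat_vec_carrier[OF wf_descr_carrier(5)[OF wf(1)]]
    mult_mat_vec_carrier[OF wf_descr_carrier(5)[OF wf(2)]] by blast
qed auto

lemma joint_reach_output:
  assumes wf: "wf_descr I p q S" "wf_descr I p q S'" and mk: "same_markov I S S'"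
    and "joint_reach I S S' x y" and "w \<in> lists I"
  shows "outp S *\<^sub>v run_word (pen_coeff S) w x = outp S' *\<^sub>v run_word (pen_coeff S') w y"
  using assms(4,5)
proof (induction arbitrary: w)
  case zero
  thus ?case using run_word_zero[where A = "pen_coeff S" and I = I, OF wf_descr_carrier(5)[OF wf(1)]] run_word_zero[where A = "pen_coeff S'" and I = I, OF wf_descr_carrier(5)[OF wf(2)]]
    mult_mat_zero_vec[OF wf_descr_carrier(2)[OF wf(1)]] mult_mat_zero_vec[OF wf_descr_carrier(2)[OF wf(2)]] by simp
next
  case (inp \<kappa> u)
  thus ?case using mk by (simp add: same_markov_def)
next
  case (step \<kappa> x y)
  have "w @ [\<kappa>] \<in> lists I" using step by auto
  from step(3)[OF this] show ?case by simp
next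
  case (add x y x' y')
  note c = joint_reach_carrier[OF wf add(1)] joint_reach_carrier[OF wf add(2)]
  note w = \<open>w \<in> lists I\<close>
  show ?case
    using c add(3,4)[OF w] run_word_add[where A = "pen_coeff S" and I = I, OF wf_descr_carrier(5)[OF wf(1)] w, of x x']
      run_word_add[where A = "pen_coeff S'" and I = I, OF wf_descr_carrier(5)[OF wf(2)] w, of y y']
      mult_add_distrib_mat_vec[OF wf_descr_carrier(2)[OF wf(1)] run_word_carrier[where A = "pen_coeff S" and I = I, OF wf_descr_carrier(5)[OF wf(1)] w] run_word_carrier[where A = "pen_coeff S" and I = I, OF wf_descr_carrier(5)[OF wf(1)] w], of x x']
      mult_add_distrib_mat_vec[OF wf_descr_carrier(2)[OF wf(2)] run_word_carrier[where A = "pen_coeff S'" and I = I, OF wf_descr_carrier(5)[OF wf(2)] w] run_word_carrier[where A = "pen_coeff S'" and I = I, OF wf_descr_carrier(5)[OF wf(2)] w], of y y']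
    by auto
next
  case (smult x y c)
  note cc = joint_reach_carrier[OF wf smult(1)]
  note w = \<open>w \<in> lists I\<close>
  show ?case
    using cc smult(2)[OF w] run_word_smult[where A = "pen_coeff S" and I = I, OF wf_descr_carrier(5)[OF wf(1)] w, of x c]
      run_word_smult[where A = "pen_coeff S'" and I = I, OF wf_descr_carrier(5)[OF wf(2)] w, of y c]
      mult_mat_vec[OF wf_descr_carrier(2)[OF wf(1)] run_word_carrier[where A = "pen_coeff S" and I = I, OF wf_descr_carrier(5)[OF wf(1)] w], of x c]
      mult_mat_vec[OF wf_descr_carrier(2)[OF wf(2)] run_word_carrier[where A = "pen_coeff S'" and I = I, OF wf_descr_carrier(5)[OF wf(2)] w], of y c]
    by auto
qed

text \<open>Reachability of \<open>S\<close> makes \<open>joint_reach\<close> total. Equal Markov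
  parameters and distinguishability of \<open>S'\<close> make it single valued, since the states
  related to 0 form an invariant subspace with zero output. A total, single valued linear relation
  is given by a matrix.\<close>

lemma intertwiner_exists:
  assumes wf: "wf_descr I p q S" "wf_descr I p q S'" and mk: "same_markov I S S'"
    and reach: "reachable I (state_dim S) (pen_coeff S) (input_range I S)"
    and dist: "distinguishable I (state_dim S') p (outp S') (pen_coeff S')"
  obtains F where "intertwines I F S S'"
proof -
  let ?n = "state_dim S" and ?n' = "state_dim S'" and ?R = "joint_reach I S S'"
  note rc = joint_reach_carrier[OF wf]
  have dom: "\<exists>y. ?R x y" if x: "x \<in> carrier_vec ?n" for x
  proof -
    have "{x. \<exists>y. ?R x y} = carrier_vec ?n"
    proof (rule reach[unfolded reachable_def, rule_format], intro conjI)
      show "lin_subspace ?n {x. \<exists>y. ?R x y}"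
        unfolding lin_subspace_def using rc joint_reach.zero joint_reach.add joint_reach.smult by fast
      show "\<forall>\<kappa>\<in>I. \<forall>x\<in>{x. \<exists>y. ?R x y}. pen_coeff S \<kappa> *\<^sub>v x \<in> {x. \<exists>y. ?R x y}"
        using joint_reach.step by fast
      show "input_range I S \<subseteq> {x. \<exists>y. ?R x y}"
        unfolding input_range_def using joint_reach.inp by fast
    qed
    thus ?thesis using x by auto
  qed
  have minus: "?R (x - x') (y - y')" if "?R x y" "?R x' y'" for x y x' y'
  proof -
    have "?R (x + (-1) \<cdot>\<^sub>v x') (y + (-1) \<cdot>\<^sub>v y')"
      by (intro joint_reach.add joint_reach.smult that)
    moreover have "x + (-1) \<cdot>\<^sub>v x' = x - x'" "y + (-1) \<cdot>\<^sub>v y' = y - y'"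
      using rc[OF that(1)] rc[OF that(2)] by auto
    ultimately show ?thesis by simp
  qed
  have null: "y = 0\<^sub>v ?n'" if "?R (0\<^sub>v ?n) y" for y
  proof -
    have "{y. ?R (0\<^sub>v ?n) y} = {0\<^sub>v ?n'}"
    proof (rule dist[unfolded distinguishable_def, rule_format], intro conjI)
      show "lin_subspace ?n' {y. ?R (0\<^sub>v ?n) y}"
        unfolding lin_subspace_def
      proof (intro conjI allI ballI)
        fix y y' assume "y \<in> {y. ?R (0\<^sub>v ?n) y}" "y' \<in> {y. ?R (0\<^sub>v ?n) y}"
        thus "y + y' \<in> {y. ?R (0\<^sub>v ?n) y}" using joint_reach.add[of I S S' "0\<^sub>v ?n" y "0\<^sub>v ?n" y'] by simp
      next
        fix c y assume "y \<in> {y. ?R (0\<^sub>v ?n) y}"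
        hence "?R (c \<cdot>\<^sub>v 0\<^sub>v ?n) (c \<cdot>\<^sub>v y)" by (intro joint_reach.smult) simp
        moreover have "c \<cdot>\<^sub>v 0\<^sub>v ?n = 0\<^sub>v ?n" by auto
        ultimately show "c \<cdot>\<^sub>v y \<in> {y. ?R (0\<^sub>v ?n) y}" by simp
      qed (use rc joint_reach.zero in auto)
      show "\<forall>\<kappa>\<in>I. \<forall>y\<in>{y. ?R (0\<^sub>v ?n) y}. pen_coeff S' \<kappa> *\<^sub>v y \<in> {y. ?R (0\<^sub>v ?n) y}"
      proof (intro ballI)
        fix \<kappa> y assume k: "\<kappa> \<in> I" and "y \<in> {y. ?R (0\<^sub>v ?n) y}"
        hence "?R (pen_coeff S \<kappa> *\<^sub>v 0\<^sub>v ?n) (pen_coeff S' \<kappa> *\<^sub>v y)" by (intro joint_reach.step) auto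
        thus "pen_coeff S' \<kappa> *\<^sub>v y \<in> {y. ?R (0\<^sub>v ?n) y}"
          using mult_mat_zero_vec[OF wf_descr_carrier(5)[OF wf(1) k]] by simp
      qed
      show "\<forall>y\<in>{y. ?R (0\<^sub>v ?n) y}. outp S' *\<^sub>v y = 0\<^sub>v p"
        using joint_reach_output[OF wf mk, where w = "[]"] mult_mat_zero_vec[OF wf_descr_carrier(2)[OF wf(1)]] by fastforce
    qed
    thus ?thesis using that by auto
  qed
  have uniq: "y = y'" if "?R x y" "?R x y'" for x y y'
  proof -
    have "x - x = 0\<^sub>v ?n" using rc[OF that(1)] by auto
    hence z: "y - y' = 0\<^sub>v ?n'" using null minus[OF that] by simp
    show ?thesis
    proof (rule eq_vecI)
      fix i assume i: "i < dim_vec y'"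
      have "(y - y') $ i = 0" unfolding z using i rc[OF that(2)] by auto
      thus "y $ i = y' $ i" using i by simp
    qed (use rc[OF that(1)] rc[OF that(2)] in auto)
  qed
  define f where "f x = (SOME y. ?R x y)" for x
  have f: "?R x (f x)" if "x \<in> carrier_vec ?n" for x
    unfolding f_def using someI_ex[OF dom[OF that]] .
  define F where "F = mat ?n' ?n (\<lambda>(i, j). f (unit_vec ?n j) $ i)"
  have Fc: "F \<in> carrier_mat ?n' ?n" by (simp add: F_def)
  \<comment> \<open>\<open>F\<close> is prescribed on unit vectors only; closure of the relation
    under sums and multiples, along the partial sums of \<open>x\<close>, shows that it contains the
    pair of \<open>x\<close> and \<open>F *\<^sub>v x\<close>.\<close>
  have FR: "?R x (F *\<^sub>v x)" if x: "x \<in> carrier_vec ?n" for x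
  proof -
    have "?R (vec ?n (\<lambda>i. if i < k then x $ i else 0)) (vec ?n' (\<lambda>i. \<Sum>j<k. F $$ (i, j) * x $ j))" if "k \<le> ?n" for k
      using that
    proof (induction k)
      case 0
      have "vec ?n (\<lambda>i. if i < 0 then x $ i else 0) = 0\<^sub>v ?n" "vec ?n' (\<lambda>i. \<Sum>j<0. F $$ (i, j) * x $ j) = 0\<^sub>v ?n'" by auto
      thus ?case using joint_reach.zero by metis
    next
      case (Suc k)
      have u: "?R (unit_vec ?n k) (f (unit_vec ?n k))" by (rule f) simp
      have "?R (vec ?n (\<lambda>i. if i < k then x $ i else 0) + (x $ k) \<cdot>\<^sub>v unit_vec ?n k)
           (vec ?n' (\<lambda>i. \<Sum>j<k. F $$ (i, j) * x $ j) + (x $ k) \<cdot>\<^sub>v f (unit_vec ?n k))"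
        using Suc by (intro joint_reach.add joint_reach.smult u) auto
      moreover have "vec ?n (\<lambda>i. if i < k then x $ i else 0) + (x $ k) \<cdot>\<^sub>v unit_vec ?n k = vec ?n (\<lambda>i. if i < Suc k then x $ i else 0)"
        using Suc by (intro eq_vecI) (auto simp: less_Suc_eq)
      moreover have "vec ?n' (\<lambda>i. \<Sum>j<k. F $$ (i, j) * x $ j) + (x $ k) \<cdot>\<^sub>v f (unit_vec ?n k) = vec ?n' (\<lambda>i. \<Sum>j<Suc k. F $$ (i, j) * x $ j)"
        using Suc rc[OF u] by (intro eq_vecI) (auto simp: F_def mult.commute)
      ultimately show ?case by simp
    qed
    from this[of ?n] have "?R (vec ?n (\<lambda>i. if i < ?n then x $ i else 0)) (vec ?n' (\<lambda>i. \<Sum>j<?n. F $$ (i, j) * x $ j))" by simp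
    moreover have "vec ?n (\<lambda>i. if i < ?n then x $ i else 0) = x" using x by (intro eq_vecI) auto
    moreover have "vec ?n' (\<lambda>i. \<Sum>j<?n. F $$ (i, j) * x $ j) = F *\<^sub>v x"
      using x Fc by (intro eq_vecI) (auto simp: mult_mat_vec_def scalar_prod_def atLeast0LessThan intro!: sum.cong)
    ultimately show ?thesis by simp
  qed
  have "intertwines I F S S'"
    unfolding intertwines_def
  proof (intro conjI ballI)
    show "feed S' = feed S" using mk by (simp add: same_markov_def)
    show "outp S' * F = outp S"
    proof (rule mat_eq_vecI)
      show "outp S' * F \<in> carrier_mat p ?n" "outp S \<in> carrier_mat p ?n" using wf_descr_carrier(2)[OF wf(1)] wf_descr_carrier(2)[OF wf(2)] Fc by auto
      fix u :: "'b vec" assume u: "u \<in> carrier_vec ?n"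
      show "(outp S' * F) *\<^sub>v u = outp S *\<^sub>v u"
        using joint_reach_output[OF wf mk FR[OF u], of "[]"] assoc_mult_mat_vec[OF wf_descr_carrier(2)[OF wf(2)] Fc u] by simp
    qed
  next
    fix \<kappa> assume k: "\<kappa> \<in> I"
    note A = wf_descr_carrier(5)[OF wf(1) k] and A' = wf_descr_carrier(5)[OF wf(2) k]
    note B = wf_descr_carrier(6)[OF wf(1) k] and B' = wf_descr_carrier(6)[OF wf(2) k]
    show "pen_coeff S' \<kappa> * F = F * pen_coeff S \<kappa>"
    proof (rule mat_eq_vecI)
      show "pen_coeff S' \<kappa> * F \<in> carrier_mat ?n' ?n" "F * pen_coeff S \<kappa> \<in> carrier_mat ?n' ?n" using A A' Fc by auto
      fix u :: "'b vec" assume u: "u \<in> carrier_vec ?n"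
      have "F *\<^sub>v (pen_coeff S \<kappa> *\<^sub>v u) = pen_coeff S' \<kappa> *\<^sub>v (F *\<^sub>v u)"
        by (rule uniq[OF FR joint_reach.step[OF k FR[OF u]]]) (use A u in simp)
      thus "(pen_coeff S' \<kappa> * F) *\<^sub>v u = (F * pen_coeff S \<kappa>) *\<^sub>v u"
        using assoc_mult_mat_vec[OF A' Fc u] assoc_mult_mat_vec[OF Fc A u] by simp
    qed
    show "F * inp_coeff S \<kappa> = inp_coeff S' \<kappa>"
    proof (rule mat_eq_vecI)
      show "F * inp_coeff S \<kappa> \<in> carrier_mat ?n' q" "inp_coeff S' \<kappa> \<in> carrier_mat ?n' q" using B B' Fc by auto
      fix u :: "'b vec" assume u: "u \<in> carrier_vec q"
      have "F *\<^sub>v (inp_coeff S \<kappa> *\<^sub>v u) = inp_coeff S' \<kappa> *\<^sub>v u"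
        by (rule uniq[OF FR joint_reach.inp[OF k]]) (use B u wf_descr_dims(8)[OF wf(1)] in simp_all)
      thus "(F * inp_coeff S \<kappa>) *\<^sub>v u = inp_coeff S' \<kappa> *\<^sub>v u"
        using assoc_mult_mat_vec[OF Fc B u] by simp
    qed
  qed (rule Fc)
  thus ?thesis using that by blast
qed

text \<open>The image of \<open>F\<close> is an invariant subspace containing the inputs of
  \<open>S'\<close>, hence everything; preimages of the unit vectors are the columns of the right
  inverse.\<close>

lemma intertwiner_right_inverse:
  assumes wf: "wf_descr I p q S" "wf_descr I p q S'" and F: "intertwines I F S S'"
    and reach: "reachable I (state_dim S') (pen_coeff S') (input_range I S')"
  obtains G where "G \<in> carrier_mat (state_dim S) (state_dim S')" "F * G = 1\<^sub>m (state_dim S')"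
proof -
  let ?n = "state_dim S" and ?n' = "state_dim S'"
  have Fc: "F \<in> carrier_mat ?n' ?n" using F by (simp add: intertwines_def)
  let ?V = "(*\<^sub>v) F ` carrier_vec ?n"
  have V: "?V = carrier_vec ?n'"
  proof (rule reach[unfolded reachable_def, rule_format], intro conjI)
    show "lin_subspace ?n' ?V" by (rule lin_subspace_image[OF Fc]) (auto simp: lin_subspace_def)
    show "\<forall>\<kappa>\<in>I. \<forall>x\<in>?V. pen_coeff S' \<kappa> *\<^sub>v x \<in> ?V"
    proof (intro ballI)
      fix \<kappa> x assume k: "\<kappa> \<in> I" and "x \<in> ?V"
      then obtain y where y: "y \<in> carrier_vec ?n" "x = F *\<^sub>v y" by auto
      have "pen_coeff S' \<kappa> *\<^sub>v x = F *\<^sub>v (pen_coeff S \<kappa> *\<^sub>v y)"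
        using intertwines_run_word[OF wf F, of "[\<kappa>]" y] k y by simp
      thus "pen_coeff S' \<kappa> *\<^sub>v x \<in> ?V" using wf_descr_carrier(5)[OF wf(1) k] y by auto
    qed
    show "input_range I S' \<subseteq> ?V"
    proof
      fix x assume "x \<in> input_range I S'"
      then obtain \<kappa> u where k: "\<kappa> \<in> I" and u: "u \<in> carrier_vec q" and x: "x = inp_coeff S' \<kappa> *\<^sub>v u"
        using wf_descr_dims(8)[OF wf(2)] by (auto simp: input_range_def)
      have "x = (F * inp_coeff S \<kappa>) *\<^sub>v u" using F k x by (simp add: intertwines_def)
      also have "\<dots> = F *\<^sub>v (inp_coeff S \<kappa> *\<^sub>v u)"
        by (rule assoc_mult_mat_vec[OF Fc wf_descr_carrier(6)[OF wf(1) k] u])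
      finally show "x \<in> ?V" using wf_descr_carrier(6)[OF wf(1) k] u by auto
    qed
  qed
  have "\<exists>x. x \<in> carrier_vec ?n \<and> F *\<^sub>v x = unit_vec ?n' i" for i
  proof -
    have "unit_vec ?n' i \<in> ?V" unfolding V by simp
    thus ?thesis by force
  qed
  then obtain g where g: "\<And>i. g i \<in> carrier_vec ?n" "\<And>i. F *\<^sub>v g i = unit_vec ?n' i" by metis
  define G where "G = mat ?n ?n' (\<lambda>(i, j). g j $ i)"
  have "F * G = 1\<^sub>m ?n'"
  proof (rule eq_matI)
    fix i j assume "i < dim_row (1\<^sub>m ?n' :: 'b mat)" "j < dim_col (1\<^sub>m ?n' :: 'b mat)"
    hence ij: "i < ?n'" "j < ?n'" by auto
    have "col G j = g j" using g(1)[of j] ij by (intro eq_vecI) (auto simp: G_def)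
    hence "(F * G) $$ (i, j) = (F *\<^sub>v g j) $ i" using Fc ij by (simp add: G_def)
    thus "(F * G) $$ (i, j) = (1\<^sub>m ?n' :: 'b mat) $$ (i, j)" using ij by (simp add: g(2))
  qed (use Fc in \<open>auto simp: G_def\<close>)
  thus ?thesis using that[of G] by (simp add: G_def)
qed

text \<open>Intertwiners exist in both directions. A composite fixes the inputs and commutes with
  the coefficients, so its fixed vectors form an invariant subspace containing the inputs, and
  reachability makes it the identity.\<close>

lemma minimal_unique:
  assumes wf: "wf_descr I p q S" "wf_descr I p q S'" and mk: "same_markov I S S'"
    and min: "minimal I S" "minimal I S'"
  obtains F G where "intertwines I F S S'" "inverse_pair (state_dim S) F G" "state_dim S' = state_dim S"
proof -
  have d: "reachable I (state_dim S) (pen_coeff S) (input_range I S)"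
    "distinguishable I (state_dim S) p (outp S) (pen_coeff S)"
    "reachable I (state_dim S') (pen_coeff S') (input_range I S')"
    "distinguishable I (state_dim S') p (outp S') (pen_coeff S')"
    using min wf_descr_dims(3)[OF wf(1)] wf_descr_dims(3)[OF wf(2)] by (auto simp: minimal_def)
  obtain F where F: "intertwines I F S S'" using intertwiner_exists[OF wf mk d(1,4)] .
  obtain G where G: "intertwines I G S' S"
    using intertwiner_exists[OF wf(2,1) same_markov_sym[OF wf mk] d(3,2)] .
  have left: "G * F = 1\<^sub>m (state_dim S)" if wf: "wf_descr I p q S" "wf_descr I p q S'"
    and F: "intertwines I F S S'" and G: "intertwines I G S' S"
    and r: "reachable I (state_dim S) (pen_coeff S) (input_range I S)" for S S' :: "('a, 'b) descriptor" and F G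
  proof (rule mat_eq_vecI)
    let ?n = "state_dim S" and ?n' = "state_dim S'"
    have c: "F \<in> carrier_mat ?n' ?n" "G \<in> carrier_mat ?n ?n'" using F G by (auto simp: intertwines_def)
    let ?V = "{x \<in> carrier_vec ?n. G *\<^sub>v (F *\<^sub>v x) = x}"
    have V: "?V = carrier_vec ?n"
    proof (rule r[unfolded reachable_def, rule_format], intro conjI)
      show "lin_subspace ?n ?V" unfolding lin_subspace_def
        using c by (auto simp: mult_mat_zero_vec mult_add_distrib_mat_vec mult_mat_vec)
      show "\<forall>\<kappa>\<in>I. \<forall>x\<in>?V. pen_coeff S \<kappa> *\<^sub>v x \<in> ?V"
      proof (intro ballI)
        fix \<kappa> x assume k: "\<kappa> \<in> I" and x: "x \<in> ?V"
        have "F *\<^sub>v (pen_coeff S \<kappa> *\<^sub>v x) = pen_coeff S' \<kappa> *\<^sub>v (F *\<^sub>v x)"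
          using intertwines_run_word[OF wf F, of "[\<kappa>]" x] k x by simp
        moreover have "G *\<^sub>v (pen_coeff S' \<kappa> *\<^sub>v (F *\<^sub>v x)) = pen_coeff S \<kappa> *\<^sub>v (G *\<^sub>v (F *\<^sub>v x))"
          using intertwines_run_word[OF wf(2,1) G, of "[\<kappa>]" "F *\<^sub>v x"] k x c by simp
        ultimately show "pen_coeff S \<kappa> *\<^sub>v x \<in> ?V" using x wf_descr_carrier(5)[OF wf(1) k] by simp
      qed
      show "input_range I S \<subseteq> ?V"
      proof
        fix x assume xi: "x \<in> input_range I S"
        then obtain \<kappa> u where k: "\<kappa> \<in> I" and u: "u \<in> carrier_vec q" and x: "x = inp_coeff S \<kappa> *\<^sub>v u"
          using wf_descr_dims(8)[OF wf(1)] by (auto simp: input_range_def)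
        have "F *\<^sub>v x = inp_coeff S' \<kappa> *\<^sub>v u"
          using F k x assoc_mult_mat_vec[OF c(1) wf_descr_carrier(6)[OF wf(1) k] u] by (simp add: intertwines_def)
        moreover have "G *\<^sub>v (inp_coeff S' \<kappa> *\<^sub>v u) = x"
          using G k x assoc_mult_mat_vec[OF c(2) wf_descr_carrier(6)[OF wf(2) k] u] by (simp add: intertwines_def)
        ultimately show "x \<in> ?V" using input_range_carrier[OF wf(1)] xi by auto
      qed
    qed
    show "G * F \<in> carrier_mat ?n ?n" "1\<^sub>m ?n \<in> carrier_mat ?n ?n" using c by auto
    fix u :: "'b vec" assume u: "u \<in> carrier_vec ?n"
    hence "u \<in> ?V" using V by simp
    thus "(G * F) *\<^sub>v u = 1\<^sub>m ?n *\<^sub>v u" using assoc_mult_mat_vec[OF c(2,1) u] u by simp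
  qed
  have GF: "G * F = 1\<^sub>m (state_dim S)" by (rule left[OF wf F G d(1)])
  have FG: "F * G = 1\<^sub>m (state_dim S')" by (rule left[OF wf(2,1) G F d(3)])
  have c: "F \<in> carrier_mat (state_dim S') (state_dim S)" "G \<in> carrier_mat (state_dim S) (state_dim S')"
    using F G by (auto simp: intertwines_def)
  have "state_dim S' = state_dim S"
    using left_inverse_dim_le[OF c GF] left_inverse_dim_le[OF c(2,1) FG] by simp
  thus ?thesis using that[OF F, of G] c GF FG by (simp add: inverse_pair_def)
qed

section \<open>Minimal systems over stably finite algebras\<close>

lemma reachable_cong:
  assumes "\<And>\<kappa>. \<kappa> \<in> I \<Longrightarrow> A \<kappa> = A' \<kappa>"
  shows "reachable I n A X = reachable I n A' X"
  using assms by (auto simp: reachable_def)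

text \<open>Reachability passes to quotients: the preimage under the surjective \<open>G\<close> of
  an invariant subspace that contains the inputs is again such a subspace.\<close>

lemma reachable_intertwines:
  assumes wf: "wf_descr I p q S" "wf_descr I p q S'" and G: "intertwines I G S S'"
    and H: "H \<in> carrier_mat (state_dim S) (state_dim S')" "G * H = 1\<^sub>m (state_dim S')"
    and reach: "reachable I (state_dim S) (pen_coeff S) (input_range I S)"
  shows "reachable I (state_dim S') (pen_coeff S') (input_range I S')"
  unfolding reachable_def
proof (intro allI impI, elim conjE)
  fix V assume V: "lin_subspace (state_dim S') V" and VA: "\<forall>\<kappa>\<in>I. \<forall>x\<in>V. pen_coeff S' \<kappa> *\<^sub>v x \<in> V"
    and VB: "input_range I S' \<subseteq> V"
  have Gc: "G \<in> carrier_mat (state_dim S') (state_dim S)" using G by (simp add: intertwines_def)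
  let ?W = "{x \<in> carrier_vec (state_dim S). G *\<^sub>v x \<in> V}"
  have W: "?W = carrier_vec (state_dim S)"
  proof (rule reach[unfolded reachable_def, rule_format], intro conjI)
    show "lin_subspace (state_dim S) ?W" by (rule lin_subspace_vimage[OF Gc V])
    show "\<forall>\<kappa>\<in>I. \<forall>x\<in>?W. pen_coeff S \<kappa> *\<^sub>v x \<in> ?W"
    proof (intro ballI)
      fix \<kappa> x assume k: "\<kappa> \<in> I" and x: "x \<in> ?W"
      have "G *\<^sub>v (pen_coeff S \<kappa> *\<^sub>v x) = pen_coeff S' \<kappa> *\<^sub>v (G *\<^sub>v x)"
        using intertwines_run_word[OF wf G, of "[\<kappa>]" x] k x by simp
      thus "pen_coeff S \<kappa> *\<^sub>v x \<in> ?W" using VA k x mult_mat_vec_carrier[OF wf_descr_carrier(5)[OF wf(1) k]] by auto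
    qed
    show "input_range I S \<subseteq> ?W"
    proof
      fix x assume xi: "x \<in> input_range I S"
      then obtain \<kappa> u where k: "\<kappa> \<in> I" and u: "u \<in> carrier_vec q" and x: "x = inp_coeff S \<kappa> *\<^sub>v u"
        using wf_descr_dims(8)[OF wf(1)] by (auto simp: input_range_def)
      have "G *\<^sub>v x = inp_coeff S' \<kappa> *\<^sub>v u"
        using G k x assoc_mult_mat_vec[OF Gc wf_descr_carrier(6)[OF wf(1) k] u] by (simp add: intertwines_def)
      moreover have "inp_coeff S' \<kappa> *\<^sub>v u \<in> input_range I S'"
        using k u wf_descr_dims(8)[OF wf(2)] by (auto simp: input_range_def)
      ultimately show "x \<in> ?W" using input_range_carrier[OF wf(1)] xi VB by auto
    qed
  qed
  have "y \<in> V" if y: "y \<in> carrier_vec (state_dim S')" for y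
  proof -
    have "H *\<^sub>v y \<in> ?W" unfolding W using H(1) y by simp
    hence "G *\<^sub>v (H *\<^sub>v y) \<in> V" by simp
    thus ?thesis using assoc_mult_mat_vec[OF Gc H(1) y] H(2) y by simp
  qed
  thus "V = carrier_vec (state_dim S')" using lin_subspaceD(1)[OF V] by blast
qed

text \<open>The reachable subsystem, with \<open>J\<close> as its inclusion. Feed, output and
  coefficients come from \<open>S\<close>, while the constant terms are set to those of a centered
  system.\<close>

lemma reachable_realization:
  fixes S :: "('i, 'k::field) descriptor"
  assumes wf: "wf_descr I p q S"
  obtains S1 J Jm where "wf_descr I p q S1" "centered S1" "intertwines I J S1 S"
    "Jm \<in> carrier_mat (state_dim S1) (state_dim S)" "Jm * J = 1\<^sub>m (state_dim S1)"
    "reachable I (state_dim S1) (pen_coeff S1) (input_range I S1)"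
proof -
  let ?n = "state_dim S"
  note A = wf_descr_carrier(5)[OF wf] and B = wf_descr_carrier(6)[OF wf]
  obtain n1 J Jm where J: "J \<in> carrier_mat ?n n1" and Jm: "Jm \<in> carrier_mat n1 ?n" and JJ: "Jm * J = 1\<^sub>m n1"
    and AJ: "\<And>\<kappa>. \<kappa> \<in> I \<Longrightarrow> pen_coeff S \<kappa> * J = J * (Jm * (pen_coeff S \<kappa> * J))"
    and X: "\<And>x. x \<in> input_range I S \<Longrightarrow> J *\<^sub>v (Jm *\<^sub>v x) = x"
    and reach: "reachable I n1 (\<lambda>\<kappa>. Jm * (pen_coeff S \<kappa> * J)) ((*\<^sub>v) Jm ` input_range I S)"
  proof (rule reachable_part[where I = I and A = "pen_coeff S" and n = ?n and X = "input_range I S"])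
    show "pen_coeff S \<kappa> \<in> carrier_mat ?n ?n" if "\<kappa> \<in> I" for \<kappa> by (rule A[OF that])
    show "input_range I S \<subseteq> carrier_vec ?n" by (rule input_range_carrier[OF wf])
  qed (use that in blast)
  define S1 where "S1 = Descriptor n1 (feed S) (outp S * J) (1\<^sub>m n1) (\<lambda>\<kappa>. Jm * (pen_coeff S \<kappa> * J)) (0\<^sub>m n1 q) (\<lambda>\<kappa>. Jm * inp_coeff S \<kappa>)"
  have s: "state_dim S1 = n1" "feed S1 = feed S" "outp S1 = outp S * J" "pen_const S1 = 1\<^sub>m n1"
    "pen_coeff S1 = (\<lambda>\<kappa>. Jm * (pen_coeff S \<kappa> * J))" "inp_const S1 = 0\<^sub>m n1 q" "inp_coeff S1 = (\<lambda>\<kappa>. Jm * inp_coeff S \<kappa>)"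
    by (simp_all add: S1_def)
  have wf1: "wf_descr I p q S1"
    unfolding wf_descr_def s using wf_descr_carrier(1,2)[OF wf] J Jm mult_carrier_mat[OF A J] mult_carrier_mat[OF Jm B] by auto
  have JB: "J * (Jm * inp_coeff S \<kappa>) = inp_coeff S \<kappa>" if k: "\<kappa> \<in> I" for \<kappa>
  proof (rule mat_eq_vecI)
    show "J * (Jm * inp_coeff S \<kappa>) \<in> carrier_mat ?n q" "inp_coeff S \<kappa> \<in> carrier_mat ?n q" using J Jm B[OF k] by auto
    fix u :: "'k vec" assume u: "u \<in> carrier_vec q"
    have "inp_coeff S \<kappa> *\<^sub>v u \<in> input_range I S" using k u wf_descr_dims(8)[OF wf] by (auto simp: input_range_def)
    from X[OF this] show "(J * (Jm * inp_coeff S \<kappa>)) *\<^sub>v u = inp_coeff S \<kappa> *\<^sub>v u"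
      using carrier_matD[OF J] carrier_matD[OF Jm] carrier_matD[OF B[OF k]] carrier_vecD[OF u] by (simp add: mult_mat_vec_assoc)
  qed
  have int: "intertwines I J S1 S" unfolding intertwines_def s using J AJ JB by auto
  have "input_range I S1 = (*\<^sub>v) Jm ` input_range I S"
  proof -
    have "(Jm * inp_coeff S \<kappa>) *\<^sub>v u = Jm *\<^sub>v (inp_coeff S \<kappa> *\<^sub>v u)" if "\<kappa> \<in> I" "u \<in> carrier_vec q" for \<kappa> u
      by (rule assoc_mult_mat_vec[OF Jm B[OF that(1)] that(2)])
    thus ?thesis unfolding input_range_def s using wf_descr_dims(8)[OF wf] by (auto simp: image_iff) metis+
  qed
  thus ?thesis using that[OF wf1 _ int, of Jm] Jm JJ reach by (simp add: s centered_def)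
qed

text \<open>The reachable part is taken first, then the reachable part of the transposed system. The
  transpose of the second inclusion is a surjection onto the final system, so reachability is
  inherited, while duality gives distinguishability.\<close>

lemma minimal_realization_exists:
  fixes S :: "('i, 'k::field) descriptor"
  assumes wf: "wf_descr I p q S"
  obtains S' where "wf_descr I p q S'" "centered S'" "same_markov I S S'" "minimal I S'"
proof -
  obtain S1 J Jm where wf1: "wf_descr I p q S1" and int1: "intertwines I J S1 S"
    and reach1: "reachable I (state_dim S1) (pen_coeff S1) (input_range I S1)"
    using reachable_realization[OF wf] by metis
  let ?n = "state_dim S1"
  note A = wf_descr_carrier(5)[OF wf1] and B = wf_descr_carrier(6)[OF wf1]
    and C = wf_descr_carrier(2)[OF wf1]
  have CT: "(outp S1)\<^sup>T \<in> carrier_mat ?n p" using C by simp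
  obtain n2 K Km where K: "K \<in> carrier_mat ?n n2" and Km: "Km \<in> carrier_mat n2 ?n" and KK: "Km * K = 1\<^sub>m n2"
    and AK: "\<And>\<kappa>. \<kappa> \<in> I \<Longrightarrow> (pen_coeff S1 \<kappa>)\<^sup>T * K = K * (Km * ((pen_coeff S1 \<kappa>)\<^sup>T * K))"
    and X: "\<And>x. x \<in> (*\<^sub>v) (outp S1)\<^sup>T ` carrier_vec p \<Longrightarrow> K *\<^sub>v (Km *\<^sub>v x) = x"
    and reach: "reachable I n2 (\<lambda>\<kappa>. Km * ((pen_coeff S1 \<kappa>)\<^sup>T * K)) ((*\<^sub>v) Km ` (*\<^sub>v) (outp S1)\<^sup>T ` carrier_vec p)"
  proof (rule reachable_part[where I = I and A = "\<lambda>\<kappa>. (pen_coeff S1 \<kappa>)\<^sup>T" and n = ?n and X = "(*\<^sub>v) (outp S1)\<^sup>T ` carrier_vec p"])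
    show "(pen_coeff S1 \<kappa>)\<^sup>T \<in> carrier_mat ?n ?n" if "\<kappa> \<in> I" for \<kappa> using A[OF that] by simp
    show "(*\<^sub>v) (outp S1)\<^sup>T ` carrier_vec p \<subseteq> carrier_vec ?n" using CT by auto
  qed (use that in blast)
  define S2 where "S2 = Descriptor n2 (feed S1) (outp S1 * Km\<^sup>T) (1\<^sub>m n2) (\<lambda>\<kappa>. K\<^sup>T * (pen_coeff S1 \<kappa> * Km\<^sup>T)) (0\<^sub>m n2 q) (\<lambda>\<kappa>. K\<^sup>T * inp_coeff S1 \<kappa>)"
  have s: "state_dim S2 = n2" "feed S2 = feed S1" "outp S2 = outp S1 * Km\<^sup>T" "pen_const S2 = 1\<^sub>m n2"
    "pen_coeff S2 = (\<lambda>\<kappa>. K\<^sup>T * (pen_coeff S1 \<kappa> * Km\<^sup>T))" "inp_const S2 = 0\<^sub>m n2 q" "inp_coeff S2 = (\<lambda>\<kappa>. K\<^sup>T * inp_coeff S1 \<kappa>)"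
    by (simp_all add: S2_def)
  have KT: "K\<^sup>T \<in> carrier_mat n2 ?n" "Km\<^sup>T \<in> carrier_mat ?n n2" using K Km by auto
  have wf2: "wf_descr I p q S2"
    unfolding wf_descr_def s using wf_descr_carrier(1)[OF wf1] C KT mult_carrier_mat[OF A KT(2)] mult_carrier_mat[OF KT(1) B] by auto
  have KKT: "K\<^sup>T * Km\<^sup>T = 1\<^sub>m n2"
    using transpose_mult[OF Km K] KK by simp
  have A2T: "(pen_coeff S2 \<kappa>)\<^sup>T = Km * ((pen_coeff S1 \<kappa>)\<^sup>T * K)" if "\<kappa> \<in> I" for \<kappa>
    unfolding s using transpose_mult[OF KT(1) mult_carrier_mat[OF A[OF that] KT(2)]] transpose_mult[OF A[OF that] KT(2)]
      A[OF that] K Km by simp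
  have C2T: "(outp S2)\<^sup>T = Km * (outp S1)\<^sup>T"
    unfolding s using transpose_mult[OF C KT(2)] by simp
  have int2: "intertwines I K\<^sup>T S1 S2"
    unfolding intertwines_def
  proof (intro conjI ballI)
    show "outp S2 * K\<^sup>T = outp S1"
    proof -
      have "K * (Km * (outp S1)\<^sup>T) = (outp S1)\<^sup>T"
      proof (rule mat_eq_vecI)
        show "K * (Km * (outp S1)\<^sup>T) \<in> carrier_mat ?n p" using K Km CT by auto
        fix u :: "'k vec" assume u: "u \<in> carrier_vec p"
        show "(K * (Km * (outp S1)\<^sup>T)) *\<^sub>v u = (outp S1)\<^sup>T *\<^sub>v u"
          using X[OF imageI[OF u]] carrier_matD[OF K] carrier_matD[OF Km] carrier_matD[OF CT] carrier_vecD[OF u]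
          by (simp add: mult_mat_vec_assoc)
      qed (rule CT)
      hence "(K * (outp S2)\<^sup>T)\<^sup>T = outp S1" by (simp add: C2T)
      moreover have "(outp S2)\<^sup>T \<in> carrier_mat n2 p" unfolding C2T using Km CT by simp
      ultimately show ?thesis using transpose_mult[OF K] by simp
    qed
  next
    fix \<kappa> assume k: "\<kappa> \<in> I"
    have c: "(pen_coeff S2 \<kappa>)\<^sup>T \<in> carrier_mat n2 n2" "(pen_coeff S1 \<kappa>)\<^sup>T \<in> carrier_mat ?n ?n" using A2T[OF k] A[OF k] K Km by auto
    have "(pen_coeff S1 \<kappa>)\<^sup>T * K = K * (pen_coeff S2 \<kappa>)\<^sup>T" using AK[OF k] A2T[OF k] by simp
    hence "((pen_coeff S1 \<kappa>)\<^sup>T * K)\<^sup>T = (K * (pen_coeff S2 \<kappa>)\<^sup>T)\<^sup>T" by simp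
    thus "pen_coeff S2 \<kappa> * K\<^sup>T = K\<^sup>T * pen_coeff S1 \<kappa>"
      using transpose_mult[OF c(2) K] transpose_mult[OF K c(1)] by simp
  qed (use KT s in auto)
  have "reachable I (state_dim S2) (pen_coeff S2) (input_range I S2)"
    by (rule reachable_intertwines[OF wf1 wf2 int2 _ _ reach1]) (use KT KKT s in auto)
  moreover have "distinguishable I (state_dim S2) p (outp S2) (pen_coeff S2)"
  proof (rule distinguishable_of_reachable_transpose)
    have "(*\<^sub>v) Km ` (*\<^sub>v) (outp S1)\<^sup>T ` carrier_vec p = (*\<^sub>v) (outp S2)\<^sup>T ` carrier_vec p"
    proof -
      have "Km *\<^sub>v ((outp S1)\<^sup>T *\<^sub>v u) = (outp S2)\<^sup>T *\<^sub>v u" if "u \<in> carrier_vec p" for u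
        unfolding C2T using assoc_mult_mat_vec[OF Km CT that] by simp
      thus ?thesis by (auto simp: image_iff)
    qed
    thus "reachable I (state_dim S2) (\<lambda>\<kappa>. (pen_coeff S2 \<kappa>)\<^sup>T) ((*\<^sub>v) (outp S2)\<^sup>T ` carrier_vec p)"
      using reach reachable_cong[of I "\<lambda>\<kappa>. (pen_coeff S2 \<kappa>)\<^sup>T" "\<lambda>\<kappa>. Km * ((pen_coeff S1 \<kappa>)\<^sup>T * K)" n2] A2T by (simp add: s(1))
  qed (use wf_descr_carrier[OF wf2] in auto)
  ultimately have "minimal I S2" using wf_descr_dims(3)[OF wf2] by (simp add: minimal_def)
  moreover have "same_markov I S S2"
    using same_markov_trans[OF wf wf1 same_markov_sym[OF wf1 wf intertwines_same_markov[OF wf1 wf int1]]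
       intertwines_same_markov[OF wf1 wf2 int2]] .
  moreover have "centered S2" by (simp add: s centered_def)
  ultimately show ?thesis using that wf2 by blast
qed

text \<open>Size 0 is treated apart because \<open>stably_finite\<close> quantifies over positive
  sizes, while the state dimension of a minimal system may be 0.\<close>

lemma stably_finite_inverse_pair:
  assumes "stably_finite TYPE('a::ring_1)" "(A :: 'a mat) \<in> carrier_mat n n" "B \<in> carrier_mat n n" "A * B = 1\<^sub>m n"
  shows "inverse_pair n A B"
proof (cases "n = 0")
  case True
  thus ?thesis using assms by (auto simp: inverse_pair_def intro!: eq_matI)
next
  case False
  hence "B * A = 1\<^sub>m n" using assms unfolding stably_finite_def by (metis One_nat_def Suc_leI neq0_conv)
  thus ?thesis using assms by (simp add: inverse_pair_def)
qed

lemma stably_finite_field: "stably_finite TYPE('k::field)"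
  unfolding stably_finite_def using mat_mult_left_right_inverse by blast

section \<open>Pencils of systems related by an intertwiner\<close>

context unital_algebra begin

lemma pencil_centered: "centered S \<Longrightarrow> pencil scale I m S y = 1\<^sub>m (m * state_dim S) + lin scale I m (state_dim S) (state_dim S) y (pen_coeff S)"
  by (simp add: pencil_def centered_def kron_scalar_one)

lemma input_centered: "centered S \<Longrightarrow> input scale I m S y = lin scale I m (state_dim S) (dim_col (inp_const S)) y (inp_coeff S)"
  unfolding centered_def input_def by (metis (no_types, lifting) kron_scalar_zero_right mat_add_zero(2) dim_lin index_one_mat(2,3))

lemma pencil_intertwines:
  assumes fin: "finite I" and y: "\<And>\<kappa>. \<kappa> \<in> I \<Longrightarrow> y \<kappa> \<in> carrier_mat m m" and wf: "wf_descr I p q S" "wf_descr I p q S'"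
    and G: "intertwines I G S S'" and cen: "centered S" "centered S'"
  shows "pencil scale I m S' y * (1\<^sub>m m \<star> G) = (1\<^sub>m m \<star> G) * pencil scale I m S y"
    and "(1\<^sub>m m \<star> G) * input scale I m S y = input scale I m S' y"
proof -
  have Gc: "G \<in> carrier_mat (state_dim S') (state_dim S)" using G by (simp add: intertwines_def)
  note c = wf_descr_carrier[OF wf(1)] and c' = wf_descr_carrier[OF wf(2)]
  have 1: "lin scale I m (state_dim S') (state_dim S') y (pen_coeff S') * (1\<^sub>m m \<star> G) = lin scale I m (state_dim S') (state_dim S) y (\<lambda>\<kappa>. pen_coeff S' \<kappa> * G)"
    by (rule lin_mult_right[OF fin y c'(5) Gc])
  have 2: "(1\<^sub>m m \<star> G) * lin scale I m (state_dim S) (state_dim S) y (pen_coeff S) = lin scale I m (state_dim S') (state_dim S) y (\<lambda>\<kappa>. G * pen_coeff S \<kappa>)"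
    by (rule lin_mult_left[OF fin y c(5) Gc])
  have 3: "lin scale I m (state_dim S') (state_dim S) y (\<lambda>\<kappa>. pen_coeff S' \<kappa> * G) = lin scale I m (state_dim S') (state_dim S) y (\<lambda>\<kappa>. G * pen_coeff S \<kappa>)"
    by (rule lin_cong) (use G in \<open>auto simp: intertwines_def\<close>)
  show "pencil scale I m S' y * (1\<^sub>m m \<star> G) = (1\<^sub>m m \<star> G) * pencil scale I m S y"
    using Gc by (simp add: pencil_centered cen mat_add_mult_distrib mat_mult_add_distrib 1 2 3)
  have 4: "(1\<^sub>m m \<star> G) * lin scale I m (state_dim S) q y (inp_coeff S) = lin scale I m (state_dim S') q y (\<lambda>\<kappa>. G * inp_coeff S \<kappa>)"
    by (rule lin_mult_left[OF fin y c(6) Gc])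
  have 5: "lin scale I m (state_dim S') q y (\<lambda>\<kappa>. G * inp_coeff S \<kappa>) = lin scale I m (state_dim S') q y (inp_coeff S')"
    by (rule lin_cong) (use G in \<open>auto simp: intertwines_def\<close>)
  show "(1\<^sub>m m \<star> G) * input scale I m S y = input scale I m S' y"
    by (simp add: input_centered cen wf_descr_dims(8)[OF wf(1)] wf_descr_dims(8)[OF wf(2)] 4 5)
qed

text \<open>From pencil' * G = G * pencil the inverses satisfy M' * G = G * M. The intertwiner
  carries input to input, and the output of \<open>S'\<close> composed with it is the output of
  \<open>S\<close>.\<close>

lemma value_intertwines:
  assumes fin: "finite I" and y: "\<And>\<kappa>. \<kappa> \<in> I \<Longrightarrow> y \<kappa> \<in> carrier_mat m m" and wf: "wf_descr I p q S" "wf_descr I p q S'"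
    and G: "intertwines I G S S'" and cen: "centered S" "centered S'"
    and M: "inverse_pair (m * state_dim S) (pencil scale I m S y) M"
    and M': "inverse_pair (m * state_dim S') (pencil scale I m S' y) M'"
  shows "(1\<^sub>m m \<star> outp S') * (M' * input scale I m S' y) = (1\<^sub>m m \<star> outp S) * (M * input scale I m S y)"
proof -
  have Gc: "dim_row G = state_dim S'" "dim_col G = state_dim S" using G by (auto simp: intertwines_def)
  note PI = pencil_intertwines[OF fin y wf G cen]
  note d = inverse_pair_dims[OF M] inverse_pair_dims[OF M'] wf_descr_dims[OF wf(1)] wf_descr_dims[OF wf(2)] Gc
  let ?G = "1\<^sub>m m \<star> G" and ?v = "M * input scale I m S y"
  have PI1: "?G * pencil scale I m S y = pencil scale I m S' y * ?G" using PI(1) by simp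
  have "M' * input scale I m S' y = M' * (?G * (pencil scale I m S y * ?v))"
    using d by (simp add: inverse_pair_cancel[OF M] PI(2))
  also have "\<dots> = M' * (pencil scale I m S' y * (?G * ?v))"
  proof -
    have "?G * (pencil scale I m S y * ?v) = (?G * pencil scale I m S y) * ?v"
      using d by (intro mat_mult_assoc[symmetric]) simp_all
    also have "\<dots> = pencil scale I m S' y * (?G * ?v)"
      unfolding PI1 using d by (intro mat_mult_assoc) simp_all
    finally show ?thesis by simp
  qed
  also have "\<dots> = ?G * ?v" using d by (intro inverse_pair_cancel[OF M']) simp
  finally have "(1\<^sub>m m \<star> outp S') * (M' * input scale I m S' y) = (1\<^sub>m m \<star> outp S') * (?G * ?v)" by simp
  also have "\<dots> = ((1\<^sub>m m \<star> outp S') * ?G) * ?v" using d by (intro mat_mult_assoc[symmetric]) simp_all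
  also have "(1\<^sub>m m \<star> outp S') * ?G = 1\<^sub>m m \<star> outp S"
    using d G by (simp add: kron_scalar_mult intertwines_def)
  finally show ?thesis .
qed

text \<open>
  Stable finiteness turns the one-sided inverses of the pencils of a subsystem and of a quotient
  system into two-sided ones.
\<close>

theorem descr_at_minimal:
  assumes sf: "stably_finite TYPE('a)" and fin: "finite I" and y: "\<And>\<kappa>. \<kappa> \<in> I \<Longrightarrow> y \<kappa> \<in> carrier_mat m m"
    and wf: "wf_descr I p q S" "wf_descr I p q S'" and cen: "centered S" "centered S'"
    and mk: "same_markov I S S'" and min: "minimal I S'" and V: "descr_at scale I m S y V"
  shows "descr_at scale I m S' y V"
proof -
  let ?n = "state_dim S" and ?n' = "state_dim S'"
  obtain S1 J Jm where wf1: "wf_descr I p q S1" and cen1: "centered S1" and J: "intertwines I J S1 S"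
    and Jm: "Jm \<in> carrier_mat (state_dim S1) ?n" and JJ: "Jm * J = 1\<^sub>m (state_dim S1)"
    and reach1: "reachable I (state_dim S1) (pen_coeff S1) (input_range I S1)"
    using reachable_realization[OF wf(1)] by metis
  let ?n1 = "state_dim S1"
  have mk1: "same_markov I S1 S'"
    by (rule same_markov_trans[OF wf1 wf(1) intertwines_same_markov[OF wf1 wf(1) J] mk])
  have dist: "distinguishable I ?n' p (outp S') (pen_coeff S')" and reach': "reachable I ?n' (pen_coeff S') (input_range I S')"
    using min wf_descr_dims(3)[OF wf(2)] by (auto simp: minimal_def)
  obtain F where F: "intertwines I F S1 S'" using intertwiner_exists[OF wf1 wf(2) mk1 reach1 dist] .
  obtain G where G: "G \<in> carrier_mat ?n1 ?n'" and FG: "F * G = 1\<^sub>m ?n'"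
    using intertwiner_right_inverse[OF wf1 wf(2) F reach'] .
  obtain M where M: "inverse_pair (m * ?n) (pencil scale I m S y) M"
    and Veq: "V = 1\<^sub>m m \<star> feed S + (1\<^sub>m m \<star> outp S) * (M * input scale I m S y)"
    using V by (auto simp: descr_at_def)
  have Jc: "dim_row J = ?n" "dim_col J = ?n1" using J by (auto simp: intertwines_def)
  have Fc: "dim_row F = ?n'" "dim_col F = ?n1" using F by (auto simp: intertwines_def)
  note dM = inverse_pair_dims[OF M]
  define X where "X = (1\<^sub>m m \<star> Jm) * (M * (1\<^sub>m m \<star> J))"
  have "X * pencil scale I m S1 y = (1\<^sub>m m \<star> Jm) * (M * ((1\<^sub>m m \<star> J) * pencil scale I m S1 y))"
    unfolding X_def using dM Jm Jc by (simp add: mat_mult_assoc)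
  also have "(1\<^sub>m m \<star> J) * pencil scale I m S1 y = pencil scale I m S y * (1\<^sub>m m \<star> J)"
    by (rule pencil_intertwines(1)[OF fin y wf1 wf(1) J cen1 cen(1), symmetric])
  also have "M * (pencil scale I m S y * (1\<^sub>m m \<star> J)) = 1\<^sub>m m \<star> J"
    by (rule inverse_pair_cancel(2)[OF M]) (simp add: Jc)
  also have "(1\<^sub>m m \<star> Jm) * (1\<^sub>m m \<star> J) = 1\<^sub>m (m * ?n1)"
    using Jm Jc JJ by (simp add: kron_scalar_mult kron_scalar_one)
  finally have "X * pencil scale I m S1 y = 1\<^sub>m (m * ?n1)" .
  moreover have "X \<in> carrier_mat (m * ?n1) (m * ?n1)" "pencil scale I m S1 y \<in> carrier_mat (m * ?n1) (m * ?n1)"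
    using Jm Jc by (auto simp: X_def intro!: carrier_matI)
  ultimately have "inverse_pair (m * ?n1) X (pencil scale I m S1 y)"
    by (intro stably_finite_inverse_pair[OF sf])
  hence M1: "inverse_pair (m * ?n1) (pencil scale I m S1 y) X" by (rule inverse_pair_sym)
  note dX = inverse_pair_dims[OF M1]
  have PF: "pencil scale I m S' y * (1\<^sub>m m \<star> F) = (1\<^sub>m m \<star> F) * pencil scale I m S1 y"
    using pencil_intertwines(1)[OF fin y wf1 wf(2) F cen1 cen(2)] by simp
  define X' where "X' = (1\<^sub>m m \<star> F) * (X * (1\<^sub>m m \<star> G))"
  have "pencil scale I m S' y * X' = (pencil scale I m S' y * (1\<^sub>m m \<star> F)) * (X * (1\<^sub>m m \<star> G))"
    unfolding X'_def using Fc dX G by (intro mat_mult_assoc[symmetric]) auto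
  also have "\<dots> = (1\<^sub>m m \<star> F) * (pencil scale I m S1 y * (X * (1\<^sub>m m \<star> G)))"
    unfolding PF using Fc dX G by (intro mat_mult_assoc) auto
  also have "pencil scale I m S1 y * (X * (1\<^sub>m m \<star> G)) = 1\<^sub>m m \<star> G"
    by (rule inverse_pair_cancel(1)[OF M1]) (use G in simp)
  also have "(1\<^sub>m m \<star> F) * (1\<^sub>m m \<star> G) = 1\<^sub>m (m * ?n')"
    using Fc G FG by (simp add: kron_scalar_mult kron_scalar_one)
  finally have "pencil scale I m S' y * X' = 1\<^sub>m (m * ?n')" .
  moreover have "X' \<in> carrier_mat (m * ?n') (m * ?n')" "pencil scale I m S' y \<in> carrier_mat (m * ?n') (m * ?n')"
    using Fc G by (auto simp: X'_def intro!: carrier_matI)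
  ultimately have M': "inverse_pair (m * ?n') (pencil scale I m S' y) X'"
    by (intro stably_finite_inverse_pair[OF sf])
  have "V = 1\<^sub>m m \<star> feed S' + (1\<^sub>m m \<star> outp S') * (X' * input scale I m S' y)"
    using value_intertwines[OF fin y wf1 wf(1) J cen1 cen(1) M1 M]
      value_intertwines[OF fin y wf1 wf(2) F cen1 cen(2) M1 M'] mk by (simp add: Veq same_markov_def)
  thus ?thesis using M' by (auto simp: descr_at_def)
qed

end

text \<open>In finite dimension an invertible operator mapping \<open>V\<close> into itself maps it
  onto itself: in coordinates on \<open>V\<close> the compression of \<open>R\<close> is a left
  inverse of the restriction of \<open>Q\<close>, and for square matrices over a field a left
  inverse is two-sided.\<close>

lemma inverse_invariant_subspace:
  fixes Q :: "'k::field mat"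
  assumes V: "lin_subspace n V" and QR: "inverse_pair n Q R" and QV: "\<And>x. x \<in> V \<Longrightarrow> Q *\<^sub>v x \<in> V" and x: "x \<in> V"
  shows "R *\<^sub>v x \<in> V"
proof -
  obtain q J Jm where J: "J \<in> carrier_mat n q" and Jm: "Jm \<in> carrier_mat q n" and JJ: "Jm * J = 1\<^sub>m q"
    and ran: "\<And>u. u \<in> carrier_vec q \<Longrightarrow> J *\<^sub>v u \<in> V" and fixv: "\<And>v. v \<in> V \<Longrightarrow> J *\<^sub>v (Jm *\<^sub>v v) = v"
    using lin_subspace_basis[OF V] by metis
  note d = inverse_pair_dims[OF QR] carrier_matD[OF J] carrier_matD[OF Jm]
  have c: "Q \<in> carrier_mat n n" "R \<in> carrier_mat n n" using QR by (auto simp: inverse_pair_def)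
  have QJ: "J * (Jm * (Q * J)) = Q * J"
  proof (rule mat_eq_vecI)
    show "J * (Jm * (Q * J)) \<in> carrier_mat n q" "Q * J \<in> carrier_mat n q" using J Jm c by auto
    fix u :: "'k vec" assume u: "u \<in> carrier_vec q"
    show "(J * (Jm * (Q * J))) *\<^sub>v u = (Q * J) *\<^sub>v u"
      using fixv[OF QV[OF ran[OF u]]] d carrier_vecD[OF u] by (simp add: mult_mat_vec_assoc)
  qed
  let ?G = "Jm * (Q * J)" and ?H = "Jm * (R * J)"
  have "?H * ?G = Jm * (R * (J * (Jm * (Q * J))))" using d by (simp add: mat_mult_assoc)
  also have "\<dots> = 1\<^sub>m q" unfolding QJ using d JJ by (simp add: inverse_pair_cancel[OF QR])
  finally have "?H * ?G = 1\<^sub>m q" .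
  moreover have H: "?H \<in> carrier_mat q q" and "?G \<in> carrier_mat q q" using J Jm c by auto
  ultimately have GH: "?G * ?H = 1\<^sub>m q" using mat_mult_left_right_inverse by blast
  have "R * (J * (?G * ?H)) = R * ((J * ?G) * ?H)" using d by (simp add: mat_mult_assoc)
  also have "\<dots> = R * (Q * (J * ?H))" unfolding QJ using d by (simp add: mat_mult_assoc)
  also have "\<dots> = J * ?H" using d by (simp add: inverse_pair_cancel[OF QR])
  finally have RJ: "R * J = J * ?H" using d by (simp add: GH)
  have xc: "x \<in> carrier_vec n" using x V lin_subspaceD by blast
  define u where "u = Jm *\<^sub>v x"
  have u: "u \<in> carrier_vec q" using Jm xc by (simp add: u_def)
  have "R *\<^sub>v x = R *\<^sub>v (J *\<^sub>v u)" using fixv[OF x] by (simp add: u_def)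
  also have "\<dots> = (J * ?H) *\<^sub>v u" unfolding RJ[symmetric] using assoc_mult_mat_vec[OF c(2) J u] by simp
  also have "\<dots> = J *\<^sub>v (?H *\<^sub>v u)" by (rule assoc_mult_mat_vec[OF J H u])
  also have "\<dots> \<in> V" by (rule ran[OF mult_mat_vec_carrier[OF H u]])
  finally show ?thesis .
qed

text \<open>At a point of size 1 the linear part of a pencil is a linear combination of its
  coefficients. With the entries of a centre as weights, a subspace stable under the coefficients
  becomes stable under the linear part at that centre.\<close>

lemma lin_one_mem_subspace:
  fixes P :: "'i \<Rightarrow> 'k::field mat"
  assumes "finite K" and V: "lin_subspace p V" and "x \<in> carrier_vec q"
    and "\<And>\<kappa>. \<kappa> \<in> K \<Longrightarrow> P \<kappa> \<in> carrier_mat p q" "\<And>\<kappa>. \<kappa> \<in> K \<Longrightarrow> P \<kappa> *\<^sub>v x \<in> V" "\<And>\<kappa>. \<kappa> \<in> K \<Longrightarrow> y \<kappa> \<in> carrier_mat 1 1"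
  shows "lin (*) K 1 p q y P *\<^sub>v x \<in> V"
  using assms(1,4,5,6)
proof (induction K rule: finite_induct)
  case empty
  have "0\<^sub>m p q *\<^sub>v x = 0\<^sub>v p" using assms(3) by (auto simp: mult_mat_vec_def)
  thus ?case using lin_subspaceD(2)[OF V] by (simp add: lin_empty)
next
  case (insert \<kappa> K)
  have c: "y \<kappa> \<in> carrier_mat 1 1" "P \<kappa> \<in> carrier_mat p q" using insert by auto
  have k: "kron_scalar (*) (y \<kappa>) (P \<kappa>) = (y \<kappa> $$ (0, 0)) \<cdot>\<^sub>m P \<kappa>"
    using c by (intro eq_matI) (auto simp: index_kron_scalar mult.commute)
  have "lin (*) (insert \<kappa> K) 1 p q y P *\<^sub>v x = ((y \<kappa> $$ (0, 0)) \<cdot>\<^sub>m P \<kappa>) *\<^sub>v x + lin (*) K 1 p q y P *\<^sub>v x"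
    unfolding lin_insert[where x = y and P = P, OF insert(1,2) c] k
    by (rule add_mult_distrib_mat_vec[of _ p q]) (use c assms(3) in \<open>auto intro!: carrier_matI\<close>)
  also have "((y \<kappa> $$ (0, 0)) \<cdot>\<^sub>m P \<kappa>) *\<^sub>v x = (y \<kappa> $$ (0, 0)) \<cdot>\<^sub>v (P \<kappa> *\<^sub>v x)"
    using c assms(3) by (intro eq_vecI) auto
  finally show ?case using lin_subspaceD[OF V] insert by auto
qed

lemma lin_subspace_units:
  assumes V: "lin_subspace n V" and u: "\<And>i. i < n \<Longrightarrow> unit_vec n i \<in> V"
  shows "V = carrier_vec n"
proof -
  have "x \<in> V" if x: "x \<in> carrier_vec n" for x
  proof -
    have "vec n (\<lambda>i. if i < k then x $ i else 0) \<in> V" if "k \<le> n" for k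
      using that
    proof (induction k)
      case 0
      have "vec n (\<lambda>i. if i < 0 then x $ i else 0) = 0\<^sub>v n" by auto
      thus ?case using lin_subspaceD(2)[OF V] by simp
    next
      case (Suc k)
      have "vec n (\<lambda>i. if i < k then x $ i else 0) + (x $ k) \<cdot>\<^sub>v unit_vec n k = vec n (\<lambda>i. if i < Suc k then x $ i else 0)"
        using Suc by (intro eq_vecI) (auto simp: less_Suc_eq)
      thus ?case using Suc u lin_subspaceD(3,4)[OF V] by (metis Suc_le_eq less_imp_le)
    qed
    from this[of n] have "vec n (\<lambda>i. if i < n then x $ i else 0) \<in> V" by simp
    moreover have "vec n (\<lambda>i. if i < n then x $ i else 0) = x" using x by (intro eq_vecI) auto
    ultimately show ?thesis by simp
  qed
  thus ?thesis using lin_subspaceD(1)[OF V] by blast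
qed

lemma one_kron_left: "1\<^sub>m (Suc 0) \<otimes>\<^sub>K A = (A :: 'a::semiring_1 mat)"
  by (auto intro!: eq_matI simp: index_kron)

section \<open>Recentring at a matrix point\<close>

text \<open>The embedding e_i \<otimes> 1 of the i-th block intertwines P with E_ii \<otimes> P, so
  the amplified coefficients contain a copy of the original ones for each i. The next lemma is the
  version for projections onto a block.\<close>

lemma mat_unit_block_left:
  fixes P :: "'k::field mat"
  assumes "i < e"
  shows "(mat_unit e e i i \<otimes>\<^sub>K P) * (mat_unit e 1 i 0 \<otimes>\<^sub>K 1\<^sub>m (dim_col P)) = (mat_unit e 1 i 0 \<otimes>\<^sub>K 1\<^sub>m (dim_row P)) * P"
proof -
  have "(mat_unit e 1 i 0 \<otimes>\<^sub>K 1\<^sub>m (dim_row P)) * P = (mat_unit e 1 i 0 \<otimes>\<^sub>K 1\<^sub>m (dim_row P)) * (1\<^sub>m 1 \<otimes>\<^sub>K P)"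
    by (simp add: one_kron_left)
  also have "\<dots> = mat_unit e 1 i 0 \<otimes>\<^sub>K P" by (subst kron_mult) auto
  finally show ?thesis using assms by (subst kron_mult) (auto simp: mat_unit_mult)
qed

lemma mat_unit_block_right:
  fixes P :: "'k::field mat"
  assumes "i < e"
  shows "(mat_unit 1 e 0 i \<otimes>\<^sub>K 1\<^sub>m (dim_row P)) * (mat_unit e e i i \<otimes>\<^sub>K P) = P * (mat_unit 1 e 0 i \<otimes>\<^sub>K 1\<^sub>m (dim_col P))"
    and "(mat_unit 1 e 0 i \<otimes>\<^sub>K 1\<^sub>m (dim_row P)) * (1\<^sub>m e \<otimes>\<^sub>K P) = P * (mat_unit 1 e 0 i \<otimes>\<^sub>K 1\<^sub>m (dim_col P))"
proof -
  have "P * (mat_unit 1 e 0 i \<otimes>\<^sub>K 1\<^sub>m (dim_col P)) = (1\<^sub>m 1 \<otimes>\<^sub>K P) * (mat_unit 1 e 0 i \<otimes>\<^sub>K 1\<^sub>m (dim_col P))"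
    by (simp add: one_kron_left)
  also have "\<dots> = mat_unit 1 e 0 i \<otimes>\<^sub>K P" by (subst kron_mult) auto
  finally have 1: "P * (mat_unit 1 e 0 i \<otimes>\<^sub>K 1\<^sub>m (dim_col P)) = mat_unit 1 e 0 i \<otimes>\<^sub>K P" .
  show "(mat_unit 1 e 0 i \<otimes>\<^sub>K 1\<^sub>m (dim_row P)) * (mat_unit e e i i \<otimes>\<^sub>K P) = P * (mat_unit 1 e 0 i \<otimes>\<^sub>K 1\<^sub>m (dim_col P))"
    unfolding 1 using assms by (subst kron_mult) (auto simp: mat_unit_mult)
  show "(mat_unit 1 e 0 i \<otimes>\<^sub>K 1\<^sub>m (dim_row P)) * (1\<^sub>m e \<otimes>\<^sub>K P) = P * (mat_unit 1 e 0 i \<otimes>\<^sub>K 1\<^sub>m (dim_col P))"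
    unfolding 1 using assms by (subst kron_mult) auto
qed

lemma mat_unit_block_unit_vec:
  assumes "k < e * n"
  shows "(mat_unit e 1 (k div n) 0 \<otimes>\<^sub>K 1\<^sub>m n) *\<^sub>v unit_vec n (k mod n) = (unit_vec (e * n) k :: 'k::comm_ring_1 vec)"
proof (rule eq_vecI)
  fix r assume "r < dim_vec (unit_vec (e * n) k :: 'k vec)"
  hence r: "r < e * n" by simp
  have kd: "k div n < e" "k mod n < n" using assms div_mult_lt mod_mult_lt by blast+
  have rd: "r div n < e" "r mod n < n" using r div_mult_lt mod_mult_lt by blast+
  have "((mat_unit e 1 (k div n) 0 \<otimes>\<^sub>K 1\<^sub>m n) *\<^sub>v unit_vec n (k mod n)) $ r = (mat_unit e 1 (k div n) 0 \<otimes>\<^sub>K 1\<^sub>m n :: 'k mat) $$ (r, k mod n)"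
    using r kd by (simp add: scalar_prod_right_unit)
  also have "\<dots> = (if r div n = k div n \<and> r mod n = k mod n then 1 else 0)"
    using r kd rd by (auto simp: index_kron)
  also have "r div n = k div n \<and> r mod n = k mod n \<longleftrightarrow> r = k" by (metis div_mult_mod_eq)
  finally show "((mat_unit e 1 (k div n) 0 \<otimes>\<^sub>K 1\<^sub>m n) *\<^sub>v unit_vec n (k mod n)) $ r = (unit_vec (e * n) k :: 'k vec) $ r"
    using r assms by simp
qed simp

lemma mat_unit_block_row:
  assumes "k < e * n"
  shows "row (mat_unit 1 e 0 (k div n) \<otimes>\<^sub>K 1\<^sub>m n) (k mod n) = (unit_vec (e * n) k :: 'k::comm_ring_1 vec)"
proof (rule eq_vecI)
  fix r assume "r < dim_vec (unit_vec (e * n) k :: 'k vec)"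
  hence r: "r < e * n" by simp
  have kd: "k div n < e" "k mod n < n" using assms div_mult_lt mod_mult_lt by blast+
  have rd: "r div n < e" "r mod n < n" using r div_mult_lt mod_mult_lt by blast+
  have "row (mat_unit 1 e 0 (k div n) \<otimes>\<^sub>K 1\<^sub>m n) (k mod n) $ r = (if r div n = k div n \<and> r mod n = k mod n then (1::'k) else 0)"
    using r kd rd by (auto simp: index_kron row_def)
  also have "r div n = k div n \<and> r mod n = k mod n \<longleftrightarrow> r = k" by (metis div_mult_mod_eq)
  finally show "row (mat_unit 1 e 0 (k div n) \<otimes>\<^sub>K 1\<^sub>m n) (k mod n) $ r = (unit_vec (e * n) k :: 'k vec) $ r"
    using r assms by simp
qed simp

text \<open>Expansion at \<open>z\<close>: after amplification the constant term is the pencil at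
  \<open>z\<close>, and \<open>Q\<close>, in every use the inverse of that pencil, normalises it to
  1.\<close>

definition recentre :: "'i set \<Rightarrow> nat \<Rightarrow> ('i, 'k::field) descriptor \<Rightarrow> ('i \<Rightarrow> 'k mat) \<Rightarrow> 'k mat \<Rightarrow> ('i \<times> nat \<times> nat, 'k) descriptor" where
  "recentre I e S z Q = normalize_descr Q (amplify I e S z)"

context
  fixes I :: "'i set" and e p q :: nat and S :: "('i, 'k::field) descriptor" and z :: "'i \<Rightarrow> 'k mat" and Q :: "'k mat"
  assumes fin: "finite I" and wf: "wf_descr I p q S" and cen: "centered S"
    and z: "\<And>\<kappa>. \<kappa> \<in> I \<Longrightarrow> z \<kappa> \<in> carrier_mat e e"
    and Q: "inverse_pair (e * state_dim S) (pencil (*) I e S z) Q"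
begin

private abbreviation (input) "n \<equiv> state_dim S"
private abbreviation (input) "K \<equiv> grid I e"
private abbreviation (input) "\<Lambda> \<equiv> pencil (*) I e S z"
private abbreviation (input) "b \<equiv> input (*) I e S z"
private abbreviation (input) "amp \<equiv> \<lambda>P (\<kappa>, i, j). mat_unit e e i j \<otimes>\<^sub>K P \<kappa>"
text \<open>The entries of \<open>z\<close> as a point of size 1 in the entry variables. Evaluating
  there assembles the amplified coefficients into the linear part of \<open>S\<close> at
  \<open>z\<close>.\<close>

private abbreviation (input) "y0 \<equiv> \<lambda>(\<kappa>, i, j). entry_block e 1 (z \<kappa>) i j"

lemma recentre_simps:
  "pen_coeff (recentre I e S z Q) = (\<lambda>\<kappa>. Q * amp (pen_coeff S) \<kappa>)"
  "inp_coeff (recentre I e S z Q) = (\<lambda>\<kappa>. Q * amp (inp_coeff S) \<kappa> + - (Q * (amp (pen_coeff S) \<kappa> * (Q * b))))"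
  "outp (recentre I e S z Q) = 1\<^sub>m e \<otimes>\<^sub>K outp S" "state_dim (recentre I e S z Q) = e * n"
  "dim_col (inp_const (recentre I e S z Q)) = e * q"
  using wf_descr_dims(8)[OF wf] by (simp_all add: recentre_def normalize_descr_def amplify_def)

lemma amp_carrier:
  assumes "\<And>\<kappa>. \<kappa> \<in> I \<Longrightarrow> P \<kappa> \<in> carrier_mat a c" "k \<in> K"
  shows "amp P k \<in> carrier_mat (e * a) (e * c)"
proof -
  obtain \<kappa> i j where k: "k = (\<kappa>, i, j)" "\<kappa> \<in> I" using assms by auto
  show ?thesis using carrier_matD[OF assms(1)[OF k(2)]] k(1) by (auto intro!: carrier_matI)
qed

lemma amp_pen: "k \<in> K \<Longrightarrow> amp (pen_coeff S) k \<in> carrier_mat (e * n) (e * n)"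
  using amp_carrier[of "pen_coeff S" n n k] wf_descr_carrier(5)[OF wf] by blast

lemma amp_inp: "k \<in> K \<Longrightarrow> amp (inp_coeff S) k \<in> carrier_mat (e * n) (e * q)"
  using amp_carrier[of "inp_coeff S" n q k] wf_descr_carrier(6)[OF wf] by blast

lemma lin_amp:
  assumes "\<And>\<kappa>. \<kappa> \<in> I \<Longrightarrow> P \<kappa> \<in> carrier_mat a c"
  shows "lin (*) K 1 (e * a) (e * c) y0 (amp P) = lin (*) I e a c z P"
  using field_algebra.lin_entry_block[of I z 1 e P a c] z assms by simp

lemma pen_eq: "\<Lambda> = 1\<^sub>m (e * n) + lin (*) I e n n z (pen_coeff S)"
  by (rule field_algebra.pencil_centered[OF cen])

lemma inp_eq: "b = lin (*) I e n q z (inp_coeff S)"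
  using field_algebra.input_centered[OF cen] wf_descr_dims(8)[OF wf] by simp

lemma Q_carrier: "Q \<in> carrier_mat (e * n) (e * n)" "\<Lambda> \<in> carrier_mat (e * n) (e * n)" "b \<in> carrier_mat (e * n) (e * q)"
  using Q wf_descr_dims(8)[OF wf] by (auto simp: inverse_pair_def intro!: carrier_matI)

lemma one_kron_scalar_field: "dim_row A = a \<Longrightarrow> dim_col A = c \<Longrightarrow> kron_scalar (*) (1\<^sub>m (Suc 0)) A = (A :: 'k mat)"
  by (auto intro!: eq_matI simp: index_kron_scalar)

lemma lin_Q:
  assumes "\<And>\<kappa>. \<kappa> \<in> I \<Longrightarrow> P \<kappa> \<in> carrier_mat n c"
  shows "lin (*) K 1 (e * n) (e * c) y0 (\<lambda>k. Q * amp P k) = Q * lin (*) I e n c z P"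
proof -
  have "(kron_scalar (*) (1\<^sub>m 1) Q) * lin (*) K 1 (e * n) (e * c) y0 (amp P) = lin (*) K 1 (e * n) (e * c) y0 (\<lambda>k. Q * amp P k)"
    by (rule field_algebra.lin_mult_left) (use fin amp_carrier[of P, OF assms] Q_carrier in auto)
  moreover have "kron_scalar (*) (1\<^sub>m 1) Q = Q" using one_kron_scalar_field[of Q] by simp
  ultimately show ?thesis using lin_amp[of P, OF assms] by simp
qed

text \<open>Since \<open>S\<close> is centered, its linear part at \<open>z\<close> is \<Lambda> -
  1, where \<open>Q\<close> inverts \<Lambda>.\<close>

lemma Q_lin: "Q * lin (*) I e n n z (pen_coeff S) = 1\<^sub>m (e * n) + - Q"
proof -
  let ?l = "lin (*) I e n n z (pen_coeff S)"
  have "?l = - 1\<^sub>m (e * n) + \<Lambda>" unfolding pen_eq by (intro eq_matI) auto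
  hence "Q * ?l = - Q + 1\<^sub>m (e * n)" using Q_carrier inverse_pair_dims[OF Q]
    by (simp add: mat_mult_add_distrib mat_uminus_mult_right)
  thus ?thesis using inverse_pair_dims[OF Q] by (simp add: mat_add_comm)
qed

text \<open>The coefficients Q * (E_ij \<otimes> A), weighted by the entries of \<open>z\<close>,
  add up to 1 - Q. A subspace invariant under them is therefore invariant under \<open>Q\<close>,
  hence under the inverse \<Lambda>, and multiplication by \<Lambda> strips the factor
  \<open>Q\<close> from each coefficient.\<close>

lemma invariant_amp:
  assumes V: "lin_subspace (e * n) V" and VA: "\<And>k x. k \<in> K \<Longrightarrow> x \<in> V \<Longrightarrow> (Q * amp (pen_coeff S) k) *\<^sub>v x \<in> V"
  shows "\<And>x. x \<in> V \<Longrightarrow> Q *\<^sub>v x \<in> V" "\<And>x. x \<in> V \<Longrightarrow> \<Lambda> *\<^sub>v x \<in> V"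
    "\<And>k x. k \<in> K \<Longrightarrow> x \<in> V \<Longrightarrow> amp (pen_coeff S) k *\<^sub>v x \<in> V"
proof -
  note A = wf_descr_carrier(5)[OF wf]
  note ampc = amp_pen
  show QV: "Q *\<^sub>v x \<in> V" if x: "x \<in> V" for x
  proof -
    have xc: "x \<in> carrier_vec (e * n)" using x V lin_subspaceD by blast
    have "lin (*) K 1 (e * n) (e * n) y0 (\<lambda>k. Q * amp (pen_coeff S) k) *\<^sub>v x \<in> V"
    proof (rule lin_one_mem_subspace[OF _ V xc])
      fix k assume k: "k \<in> K"
      show "Q * amp (pen_coeff S) k \<in> carrier_mat (e * n) (e * n)" by (rule mult_carrier_mat[OF Q_carrier(1) ampc[OF k]])
      show "(Q * amp (pen_coeff S) k) *\<^sub>v x \<in> V" by (rule VA[OF k x])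
    qed (use fin in auto)
    hence 1: "(1\<^sub>m (e * n) + - Q) *\<^sub>v x \<in> V" using lin_Q[of "pen_coeff S" n, OF A] by (simp add: Q_lin)
    have "(1\<^sub>m (e * n) + - Q) *\<^sub>v x = 1\<^sub>m (e * n) *\<^sub>v x + (- Q) *\<^sub>v x"
      by (rule add_mult_distrib_mat_vec[of _ "e * n" "e * n"]) (use Q_carrier xc in auto)
    hence "x + - (Q *\<^sub>v x) \<in> V" using 1 xc inverse_pair_dims[OF Q] by simp
    hence "x - (x + - (Q *\<^sub>v x)) \<in> V" by (rule lin_subspace_minus[OF V x])
    moreover have "x - (x + - (Q *\<^sub>v x)) = Q *\<^sub>v x" using xc inverse_pair_dims[OF Q] by (intro eq_vecI) auto
    ultimately show ?thesis by simp
  qed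
  show LV: "\<Lambda> *\<^sub>v x \<in> V" if "x \<in> V" for x
    by (rule inverse_invariant_subspace[OF V inverse_pair_sym[OF Q] QV that])
  show "amp (pen_coeff S) k *\<^sub>v x \<in> V" if k: "k \<in> K" and x: "x \<in> V" for k x
  proof -
    have xc: "x \<in> carrier_vec (e * n)" using x V lin_subspaceD by blast
    have "\<Lambda> *\<^sub>v ((Q * amp (pen_coeff S) k) *\<^sub>v x) = (\<Lambda> * (Q * amp (pen_coeff S) k)) *\<^sub>v x"
      by (rule assoc_mult_mat_vec[symmetric, OF Q_carrier(2) mult_carrier_mat[OF Q_carrier(1) ampc[OF k]] xc])
    also have "\<Lambda> * (Q * amp (pen_coeff S) k) = amp (pen_coeff S) k"
      by (rule inverse_pair_cancel(1)[OF Q]) (use carrier_matD[OF ampc[OF k]] in simp)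
    finally show ?thesis using LV[OF VA[OF k x]] by simp
  qed
qed

text \<open>The inputs of the recentred system are those of \<open>S\<close>, multiplied by
  \<open>Q\<close>, minus a correction through Q * b, with b the input at \<open>z\<close>. Weighted
  by the entries of \<open>z\<close> they add up to Q * (Q * b), so the invariant subspace contains
  the range of Q * b, absorbs the correction and hence contains the amplified inputs. Reachability
  of \<open>S\<close> then fills each block.\<close>

lemma reachable_recentre:
  assumes reach: "reachable I n (pen_coeff S) (input_range I S)"
  shows "reachable K (state_dim (recentre I e S z Q)) (pen_coeff (recentre I e S z Q)) (input_range K (recentre I e S z Q))"
  unfolding reachable_def recentre_simps(4)
proof (intro allI impI, elim conjE)
  fix V assume V: "lin_subspace (e * n) V" and VA': "\<forall>k\<in>K. \<forall>x\<in>V. pen_coeff (recentre I e S z Q) k *\<^sub>v x \<in> V"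
    and VB: "input_range K (recentre I e S z Q) \<subseteq> V"
  note A = wf_descr_carrier(5)[OF wf] and B = wf_descr_carrier(6)[OF wf]
  note ampA = amp_pen and ampB = amp_inp
  have VA: "(Q * amp (pen_coeff S) k) *\<^sub>v x \<in> V" if "k \<in> K" "x \<in> V" for k x
    using VA' that unfolding recentre_simps by blast
  have inv: "\<And>x. x \<in> V \<Longrightarrow> Q *\<^sub>v x \<in> V" "\<And>x. x \<in> V \<Longrightarrow> \<Lambda> *\<^sub>v x \<in> V"
    "\<And>k x. k \<in> K \<Longrightarrow> x \<in> V \<Longrightarrow> amp (pen_coeff S) k *\<^sub>v x \<in> V"
    using invariant_amp[OF V VA] by blast+
  have VQb: "(Q * b) *\<^sub>v u \<in> V" if u: "u \<in> carrier_vec (e * q)" for u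
  proof -
    let ?P = "\<lambda>k. Q * amp (inp_coeff S) k + - (Q * (amp (pen_coeff S) k * (Q * b)))"
    have c1: "Q * amp (inp_coeff S) k \<in> carrier_mat (e * n) (e * q)" "Q * (amp (pen_coeff S) k * (Q * b)) \<in> carrier_mat (e * n) (e * q)"
      "- (Q * (amp (pen_coeff S) k * (Q * b))) \<in> carrier_mat (e * n) (e * q)"
      "Q * amp (pen_coeff S) k \<in> carrier_mat (e * n) (e * n)" if k: "k \<in> K" for k
      using mult_carrier_mat[OF Q_carrier(1) ampB[OF k]]
        mult_carrier_mat[OF Q_carrier(1) mult_carrier_mat[OF ampA[OF k] mult_carrier_mat[OF Q_carrier(1,3)]]]
        mult_carrier_mat[OF Q_carrier(1) ampA[OF k]] by auto
    have "lin (*) K 1 (e * n) (e * q) y0 ?P *\<^sub>v u \<in> V"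
    proof (rule lin_one_mem_subspace[OF _ V u])
      fix k assume k: "k \<in> K"
      show "?P k \<in> carrier_mat (e * n) (e * q)" using c1[OF k] by auto
      have "?P k *\<^sub>v u \<in> input_range K (recentre I e S z Q)"
        using k u by (auto simp: input_range_def recentre_simps)
      thus "?P k *\<^sub>v u \<in> V" using VB by blast
    qed (use fin in auto)
    moreover have "lin (*) K 1 (e * n) (e * q) y0 ?P = Q * (Q * b)"
    proof -
      have "lin (*) K 1 (e * n) (e * q) y0 ?P = lin (*) K 1 (e * n) (e * q) y0 (\<lambda>k. Q * amp (inp_coeff S) k)
         + lin (*) K 1 (e * n) (e * q) y0 (\<lambda>k. - (Q * (amp (pen_coeff S) k * (Q * b))))"
        by (rule lin_add_coeff[OF unital_algebra_field]) (use c1 in auto)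
      also have "lin (*) K 1 (e * n) (e * q) y0 (\<lambda>k. Q * amp (inp_coeff S) k) = Q * b"
        unfolding inp_eq by (rule lin_Q[of "inp_coeff S" q, OF B])
      also have "lin (*) K 1 (e * n) (e * q) y0 (\<lambda>k. - (Q * (amp (pen_coeff S) k * (Q * b)))) =
         - lin (*) K 1 (e * n) (e * q) y0 (\<lambda>k. Q * (amp (pen_coeff S) k * (Q * b)))"
        by (rule field_algebra.lin_uminus_coeff[of K _ "e * n" "e * q"]) (use c1 in auto)
      also have "lin (*) K 1 (e * n) (e * q) y0 (\<lambda>k. Q * (amp (pen_coeff S) k * (Q * b))) =
         lin (*) K 1 (e * n) (e * q) y0 (\<lambda>k. (Q * amp (pen_coeff S) k) * (Q * b))"
      proof (rule lin_cong)
        fix k assume k: "k \<in> K"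
        show "Q * (amp (pen_coeff S) k * (Q * b)) = (Q * amp (pen_coeff S) k) * (Q * b)"
          using carrier_matD[OF ampA[OF k]] carrier_matD[OF Q_carrier(1)] by (intro mat_mult_assoc[symmetric]) simp_all
      qed simp
      also have "\<dots> = lin (*) K 1 (e * n) (e * n) y0 (\<lambda>k. Q * amp (pen_coeff S) k) * kron_scalar (*) (1\<^sub>m 1) (Q * b)"
        by (rule field_algebra.lin_mult_right[symmetric]) (use fin c1 Q_carrier in auto)
      also have "kron_scalar (*) (1\<^sub>m 1) (Q * b) = Q * b" using one_kron_scalar_field[of "Q * b"] by simp
      also have "lin (*) K 1 (e * n) (e * n) y0 (\<lambda>k. Q * amp (pen_coeff S) k) = 1\<^sub>m (e * n) + - Q"
        using lin_Q[of "pen_coeff S" n] A Q_lin by simp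
      also have "Q * b + - ((1\<^sub>m (e * n) + - Q) * (Q * b)) = Q * (Q * b)"
        using carrier_matD[OF Q_carrier(1)] carrier_matD[OF Q_carrier(3)]
        by (simp add: mat_add_mult_distrib mat_uminus_mult_left mat_uminus_add mat_uminus_uminus mat_add_uminus_cancel)
      finally show ?thesis .
    qed
    ultimately have "(Q * (Q * b)) *\<^sub>v u \<in> V" by simp
    hence "\<Lambda> *\<^sub>v ((Q * (Q * b)) *\<^sub>v u) \<in> V" by (rule inv(2))
    moreover have "\<Lambda> *\<^sub>v ((Q * (Q * b)) *\<^sub>v u) = (\<Lambda> * (Q * (Q * b))) *\<^sub>v u"
      by (rule assoc_mult_mat_vec[symmetric, OF Q_carrier(2) mult_carrier_mat[OF Q_carrier(1) mult_carrier_mat[OF Q_carrier(1,3)]] u])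
    moreover have "\<Lambda> * (Q * (Q * b)) = Q * b" by (rule inverse_pair_cancel(1)[OF Q]) (use Q_carrier in simp)
    ultimately show ?thesis by simp
  qed
  have ampBV: "amp (inp_coeff S) k *\<^sub>v u \<in> V" if k: "k \<in> K" and u: "u \<in> carrier_vec (e * q)" for k u
  proof -
    let ?x = "(Q * b) *\<^sub>v u"
    have xc: "?x \<in> carrier_vec (e * n)" using lin_subspaceD(1)[OF V VQb[OF u]] .
    have d: "dim_row (amp (pen_coeff S) k) = e * n" "dim_col (amp (pen_coeff S) k) = e * n"
      "dim_row (amp (inp_coeff S) k) = e * n" "dim_col (amp (inp_coeff S) k) = e * q"
      using carrier_matD[OF ampA[OF k]] carrier_matD[OF ampB[OF k]] by simp_all
    note dQ = carrier_matD[OF Q_carrier(1)] carrier_matD[OF Q_carrier(3)] carrier_vecD[OF u] wf_descr_dims(8)[OF wf]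
    let ?P = "Q * amp (inp_coeff S) k + - (Q * (amp (pen_coeff S) k * (Q * b)))"
    have "?P *\<^sub>v u \<in> input_range K (recentre I e S z Q)"
      using k u by (auto simp: input_range_def recentre_simps)
    hence PV: "?P *\<^sub>v u \<in> V" using VB by blast
    have "?P *\<^sub>v u = (Q * amp (inp_coeff S) k) *\<^sub>v u + (- (Q * (amp (pen_coeff S) k * (Q * b)))) *\<^sub>v u"
      by (rule add_mult_distrib_mat_vec[of _ "e * n" "e * q"]) (use d dQ u in \<open>auto intro!: carrier_matI\<close>)
    also have "(- (Q * (amp (pen_coeff S) k * (Q * b)))) *\<^sub>v u = - ((Q * (amp (pen_coeff S) k * (Q * b))) *\<^sub>v u)"
      using d dQ by (intro uminus_mult_mat_vec) simp
    also have "(Q * (amp (pen_coeff S) k * (Q * b))) *\<^sub>v u = (Q * amp (pen_coeff S) k) *\<^sub>v ?x"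
      using d dQ by (simp add: mult_mat_vec_assoc)
    finally have "?P *\<^sub>v u + (Q * amp (pen_coeff S) k) *\<^sub>v ?x = (Q * amp (inp_coeff S) k) *\<^sub>v u"
      using d dQ by (intro eq_vecI) auto
    hence "(Q * amp (inp_coeff S) k) *\<^sub>v u \<in> V"
      using lin_subspaceD(3)[OF V PV VA[OF k VQb[OF u]]] by simp
    hence "\<Lambda> *\<^sub>v ((Q * amp (inp_coeff S) k) *\<^sub>v u) \<in> V" by (rule inv(2))
    moreover have "\<Lambda> *\<^sub>v ((Q * amp (inp_coeff S) k) *\<^sub>v u) = (\<Lambda> * (Q * amp (inp_coeff S) k)) *\<^sub>v u"
      by (rule assoc_mult_mat_vec[symmetric, OF Q_carrier(2) mult_carrier_mat[OF Q_carrier(1) ampB[OF k]] u])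
    moreover have "\<Lambda> * (Q * amp (inp_coeff S) k) = amp (inp_coeff S) k"
      by (rule inverse_pair_cancel(1)[OF Q]) (use d in simp)
    ultimately show ?thesis by simp
  qed
  define \<iota> :: "nat \<Rightarrow> nat \<Rightarrow> 'k mat" where "\<iota> i m = mat_unit e 1 i 0 \<otimes>\<^sub>K 1\<^sub>m m" for i m
  have \<iota>c: "\<iota> i m \<in> carrier_mat (e * m) m" for i m by (auto simp: \<iota>_def intro!: carrier_matI)
  have full: "\<iota> i n *\<^sub>v x \<in> V" if i: "i < e" and x: "x \<in> carrier_vec n" for i x
  proof -
    let ?W = "{x \<in> carrier_vec n. \<iota> i n *\<^sub>v x \<in> V}"
    have "?W = carrier_vec n"
    proof (rule reach[unfolded reachable_def, rule_format], intro conjI)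
      show "lin_subspace n ?W" by (rule lin_subspace_vimage[OF \<iota>c V])
      show "\<forall>\<kappa>\<in>I. \<forall>x\<in>?W. pen_coeff S \<kappa> *\<^sub>v x \<in> ?W"
      proof (intro ballI)
        fix \<kappa> x assume k: "\<kappa> \<in> I" and x: "x \<in> ?W"
        hence xc: "x \<in> carrier_vec n" and xV: "\<iota> i n *\<^sub>v x \<in> V" by auto
        have kk: "(\<kappa>, i, i) \<in> K" using k i by simp
        have "\<iota> i n *\<^sub>v (pen_coeff S \<kappa> *\<^sub>v x) = (\<iota> i n * pen_coeff S \<kappa>) *\<^sub>v x"
          by (rule assoc_mult_mat_vec[symmetric, OF \<iota>c A[OF k] xc])
        also have "\<iota> i n * pen_coeff S \<kappa> = amp (pen_coeff S) (\<kappa>, i, i) * \<iota> i n"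
          using mat_unit_block_left[OF i, of "pen_coeff S \<kappa>"] carrier_matD[OF A[OF k]] by (simp add: \<iota>_def)
        also have "(amp (pen_coeff S) (\<kappa>, i, i) * \<iota> i n) *\<^sub>v x = amp (pen_coeff S) (\<kappa>, i, i) *\<^sub>v (\<iota> i n *\<^sub>v x)"
          by (rule assoc_mult_mat_vec[OF ampA[OF kk] \<iota>c xc])
        finally show "pen_coeff S \<kappa> *\<^sub>v x \<in> ?W" using inv(3)[OF kk xV] mult_mat_vec_carrier[OF A[OF k] xc] by simp
      qed
      show "input_range I S \<subseteq> ?W"
      proof
        fix x assume xi: "x \<in> input_range I S"
        then obtain \<kappa> u where k: "\<kappa> \<in> I" and u: "u \<in> carrier_vec q" and x: "x = inp_coeff S \<kappa> *\<^sub>v u"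
          using wf_descr_dims(8)[OF wf] by (auto simp: input_range_def)
        have kk: "(\<kappa>, i, i) \<in> K" using k i by simp
        have "\<iota> i n *\<^sub>v x = (\<iota> i n * inp_coeff S \<kappa>) *\<^sub>v u"
          unfolding x by (rule assoc_mult_mat_vec[symmetric, OF \<iota>c B[OF k] u])
        also have "\<iota> i n * inp_coeff S \<kappa> = amp (inp_coeff S) (\<kappa>, i, i) * \<iota> i q"
          using mat_unit_block_left[OF i, of "inp_coeff S \<kappa>"] carrier_matD[OF B[OF k]] by (simp add: \<iota>_def)
        also have "(amp (inp_coeff S) (\<kappa>, i, i) * \<iota> i q) *\<^sub>v u = amp (inp_coeff S) (\<kappa>, i, i) *\<^sub>v (\<iota> i q *\<^sub>v u)"
          by (rule assoc_mult_mat_vec[OF ampB[OF kk] \<iota>c u])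
        finally show "x \<in> ?W"
          using ampBV[OF kk mult_mat_vec_carrier[OF \<iota>c u]] input_range_carrier[OF wf] xi by auto
      qed
    qed
    thus ?thesis using x by blast
  qed
  show "V = carrier_vec (e * n)"
  proof (rule lin_subspace_units[OF V])
    fix k assume k: "k < e * n"
    have "\<iota> (k div n) n *\<^sub>v unit_vec n (k mod n) \<in> V" using k by (intro full div_mult_lt) auto
    thus "unit_vec (e * n) k \<in> V" using mat_unit_block_unit_vec[OF k, where 'k = 'k] by (simp add: \<iota>_def)
  qed
qed

text \<open>Dual argument: the projection to a block of an invariant subspace with zero output is
  invariant with zero output for \<open>S\<close>, hence zero.\<close>

lemma distinguishable_recentre:
  assumes dist: "distinguishable I n p (outp S) (pen_coeff S)"
  shows "distinguishable K (state_dim (recentre I e S z Q)) (e * p) (outp (recentre I e S z Q)) (pen_coeff (recentre I e S z Q))"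
  unfolding distinguishable_def recentre_simps(4)
proof (intro allI impI, elim conjE)
  fix V assume V: "lin_subspace (e * n) V" and VA': "\<forall>k\<in>K. \<forall>x\<in>V. pen_coeff (recentre I e S z Q) k *\<^sub>v x \<in> V"
    and VC: "\<forall>x\<in>V. outp (recentre I e S z Q) *\<^sub>v x = 0\<^sub>v (e * p)"
  note A = wf_descr_carrier(5)[OF wf] and C = wf_descr_carrier(2)[OF wf]
  note ampA = amp_pen
  have VA: "(Q * amp (pen_coeff S) k) *\<^sub>v x \<in> V" if "k \<in> K" "x \<in> V" for k x
    using VA' that unfolding recentre_simps by blast
  have inv: "\<And>x. x \<in> V \<Longrightarrow> Q *\<^sub>v x \<in> V" "\<And>x. x \<in> V \<Longrightarrow> \<Lambda> *\<^sub>v x \<in> V"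
    "\<And>k x. k \<in> K \<Longrightarrow> x \<in> V \<Longrightarrow> amp (pen_coeff S) k *\<^sub>v x \<in> V"
    using invariant_amp[OF V VA] by blast+
  define \<pi> :: "nat \<Rightarrow> nat \<Rightarrow> 'k mat" where "\<pi> i m = mat_unit 1 e 0 i \<otimes>\<^sub>K 1\<^sub>m m" for i m
  have \<pi>c: "\<pi> i m \<in> carrier_mat m (e * m)" for i m by (auto simp: \<pi>_def intro!: carrier_matI)
  have null: "\<pi> i n *\<^sub>v x = 0\<^sub>v n" if i: "i < e" and x: "x \<in> V" for i x
  proof -
    let ?W = "(*\<^sub>v) (\<pi> i n) ` V"
    have "?W = {0\<^sub>v n}"
    proof (rule dist[unfolded distinguishable_def, rule_format], intro conjI)
      show "lin_subspace n ?W" by (rule lin_subspace_image[OF \<pi>c V])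
      show "\<forall>\<kappa>\<in>I. \<forall>x\<in>?W. pen_coeff S \<kappa> *\<^sub>v x \<in> ?W"
      proof (intro ballI)
        fix \<kappa> y assume k: "\<kappa> \<in> I" and "y \<in> ?W"
        then obtain x where x: "x \<in> V" and y: "y = \<pi> i n *\<^sub>v x" by auto
        have xc: "x \<in> carrier_vec (e * n)" using lin_subspaceD(1)[OF V x] .
        have kk: "(\<kappa>, i, i) \<in> K" using k i by simp
        have "pen_coeff S \<kappa> *\<^sub>v y = (pen_coeff S \<kappa> * \<pi> i n) *\<^sub>v x"
          unfolding y by (rule assoc_mult_mat_vec[symmetric, OF A[OF k] \<pi>c xc])
        also have "pen_coeff S \<kappa> * \<pi> i n = \<pi> i n * amp (pen_coeff S) (\<kappa>, i, i)"
          using mat_unit_block_right(1)[OF i, of "pen_coeff S \<kappa>"] carrier_matD[OF A[OF k]] by (simp add: \<pi>_def)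
        also have "\<dots> *\<^sub>v x = \<pi> i n *\<^sub>v (amp (pen_coeff S) (\<kappa>, i, i) *\<^sub>v x)"
          by (rule assoc_mult_mat_vec[OF \<pi>c ampA[OF kk] xc])
        finally show "pen_coeff S \<kappa> *\<^sub>v y \<in> ?W" using inv(3)[OF kk x] by auto
      qed
      show "\<forall>y\<in>?W. outp S *\<^sub>v y = 0\<^sub>v p"
      proof
        fix y assume "y \<in> ?W"
        then obtain x where x: "x \<in> V" and y: "y = \<pi> i n *\<^sub>v x" by auto
        have xc: "x \<in> carrier_vec (e * n)" using lin_subspaceD(1)[OF V x] .
        have "outp S *\<^sub>v y = (outp S * \<pi> i n) *\<^sub>v x"
          unfolding y by (rule assoc_mult_mat_vec[symmetric, OF C \<pi>c xc])
        also have "outp S * \<pi> i n = \<pi> i p * (1\<^sub>m e \<otimes>\<^sub>K outp S)"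
          using mat_unit_block_right(2)[OF i, of "outp S"] carrier_matD[OF C] by (simp add: \<pi>_def)
        also have "\<dots> *\<^sub>v x = \<pi> i p *\<^sub>v ((1\<^sub>m e \<otimes>\<^sub>K outp S) *\<^sub>v x)"
          by (rule assoc_mult_mat_vec[OF \<pi>c _ xc]) (use C in \<open>auto intro!: carrier_matI\<close>)
        also have "(1\<^sub>m e \<otimes>\<^sub>K outp S) *\<^sub>v x = 0\<^sub>v (e * p)" using VC x by (simp add: recentre_simps)
        also have "\<pi> i p *\<^sub>v 0\<^sub>v (e * p) = 0\<^sub>v p" by (rule mult_mat_zero_vec[OF \<pi>c])
        finally show "outp S *\<^sub>v y = 0\<^sub>v p" .
      qed
    qed
    thus ?thesis using x by blast
  qed
  have "x = 0\<^sub>v (e * n)" if x: "x \<in> V" for x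
  proof (rule eq_vecI)
    fix k assume "k < dim_vec (0\<^sub>v (e * n) :: 'k vec)"
    hence k: "k < e * n" by simp
    have xc: "x \<in> carrier_vec (e * n)" using lin_subspaceD(1)[OF V x] .
    have kd: "k div n < e" "k mod n < n" using k div_mult_lt mod_mult_lt by blast+
    have "(\<pi> (k div n) n *\<^sub>v x) $ (k mod n) = row (\<pi> (k div n) n) (k mod n) \<bullet> x"
      using carrier_matD[OF \<pi>c] kd by simp
    also have "\<dots> = x $ k" unfolding \<pi>_def mat_unit_block_row[OF k] using xc k by simp
    finally show "x $ k = 0\<^sub>v (e * n) $ k" using null[OF kd(1) x] kd k by simp
  qed (use lin_subspaceD(1)[OF V x] in auto)
  thus "V = {0\<^sub>v (e * n)}" using lin_subspaceD(2)[OF V] by blast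
qed

lemma minimal_recentre: "minimal I S \<Longrightarrow> minimal K (recentre I e S z Q)"
  using reachable_recentre distinguishable_recentre wf_descr_dims(3)[OF wf]
  by (simp add: minimal_def recentre_simps(3))

end

section \<open>Nilpotent points\<close>

lemma index_one_kron:
  fixes A :: "'a::semiring_1 mat"
  assumes "i < e * dim_row A" "j < e * dim_col A"
  shows "(1\<^sub>m e \<otimes>\<^sub>K A) $$ (i, j) = (if i div dim_row A = j div dim_col A then A $$ (i mod dim_row A, j mod dim_col A) else 0)"
  using assms by (simp add: index_kron div_mult_lt)

text \<open>The identity factor has entries 0 and 1, which commute with everything; so the mixed
  product rule holds here for noncommutative entries as well.\<close>

lemma one_kron_mult:
  fixes A :: "'a::semiring_1 mat"
  assumes "dim_col A = dim_row B"
  shows "(1\<^sub>m e \<otimes>\<^sub>K A) * (1\<^sub>m e \<otimes>\<^sub>K B) = 1\<^sub>m e \<otimes>\<^sub>K (A * B)"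
proof (rule eq_matI)
  fix i j assume "i < dim_row (1\<^sub>m e \<otimes>\<^sub>K (A * B))" "j < dim_col (1\<^sub>m e \<otimes>\<^sub>K (A * B))"
  hence ij: "i < e * dim_row A" "j < e * dim_col B" by auto
  let ?n = "dim_row B"
  have b: "i div dim_row A < e" "i mod dim_row A < dim_row A" "j div dim_col B < e" "j mod dim_col B < dim_col B"
    using ij div_mult_lt mod_mult_lt by blast+
  have "((1\<^sub>m e \<otimes>\<^sub>K A) * (1\<^sub>m e \<otimes>\<^sub>K B)) $$ (i, j) = (\<Sum>k<e * ?n. (1\<^sub>m e \<otimes>\<^sub>K A) $$ (i, k) * (1\<^sub>m e \<otimes>\<^sub>K B) $$ (k, j))"
    using ij assms by (subst index_mult_mat_sum) auto
  also have "\<dots> = (\<Sum>a<e. \<Sum>k<?n. (1\<^sub>m e \<otimes>\<^sub>K A) $$ (i, a * ?n + k) * (1\<^sub>m e \<otimes>\<^sub>K B) $$ (a * ?n + k, j))"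
    by (rule sum_mult_blocks)
  also have "\<dots> = (\<Sum>a<e. if a = i div dim_row A then
      (if a = j div dim_col B then (\<Sum>k<?n. A $$ (i mod dim_row A, k) * B $$ (k, j mod dim_col B)) else 0) else 0)"
  proof (rule sum.cong)
    fix a assume "a \<in> {..<e}"
    hence a: "a < e" by simp
    have k: "a * ?n + k < e * ?n" if "k < ?n" for k using a that by (rule block_index_lt)
    have "(\<Sum>k<?n. (1\<^sub>m e \<otimes>\<^sub>K A) $$ (i, a * ?n + k) * (1\<^sub>m e \<otimes>\<^sub>K B) $$ (a * ?n + k, j)) =
      (\<Sum>k<?n. if a = i div dim_row A \<and> a = j div dim_col B then A $$ (i mod dim_row A, k) * B $$ (k, j mod dim_col B) else 0)"
      using ij assms k by (intro sum.cong) (auto simp: index_one_kron)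
    thus "(\<Sum>k<?n. (1\<^sub>m e \<otimes>\<^sub>K A) $$ (i, a * ?n + k) * (1\<^sub>m e \<otimes>\<^sub>K B) $$ (a * ?n + k, j)) = (if a = i div dim_row A then
      (if a = j div dim_col B then (\<Sum>k<?n. A $$ (i mod dim_row A, k) * B $$ (k, j mod dim_col B)) else 0) else 0)"
      by auto
  qed simp
  also have "\<dots> = (1\<^sub>m e \<otimes>\<^sub>K (A * B)) $$ (i, j)"
    using ij b assms by (simp add: index_one_kron index_mult_mat_sum sum.delta del: index_mult_mat(1))
  finally show "((1\<^sub>m e \<otimes>\<^sub>K A) * (1\<^sub>m e \<otimes>\<^sub>K B)) $$ (i, j) = (1\<^sub>m e \<otimes>\<^sub>K (A * B)) $$ (i, j)" .
qed auto

lemma one_kron_add: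
  fixes A :: "'a::ring_1 mat"
  assumes "dim_row A = dim_row B" "dim_col A = dim_col B"
  shows "1\<^sub>m e \<otimes>\<^sub>K (A + B) = 1\<^sub>m e \<otimes>\<^sub>K A + 1\<^sub>m e \<otimes>\<^sub>K B"
proof (rule eq_matI)
  fix i j assume "i < dim_row (1\<^sub>m e \<otimes>\<^sub>K A + 1\<^sub>m e \<otimes>\<^sub>K B)" "j < dim_col (1\<^sub>m e \<otimes>\<^sub>K A + 1\<^sub>m e \<otimes>\<^sub>K B)"
  hence ij: "i < e * dim_row B" "j < e * dim_col B" by auto
  thus "(1\<^sub>m e \<otimes>\<^sub>K (A + B)) $$ (i, j) = (1\<^sub>m e \<otimes>\<^sub>K A + 1\<^sub>m e \<otimes>\<^sub>K B) $$ (i, j)"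
    using assms by (simp add: index_one_kron mod_mult_lt)
qed (use assms in auto)

lemma one_kron_zero: "1\<^sub>m e \<otimes>\<^sub>K 0\<^sub>m p q = (0\<^sub>m (e * p) (e * q) :: 'a::semiring_1 mat)"
  by (auto intro!: eq_matI simp: index_one_kron mod_mult_lt)

lemma one_kron_cancel:
  fixes A :: "'a::semiring_1 mat"
  assumes "1\<^sub>m e \<otimes>\<^sub>K A = 1\<^sub>m e \<otimes>\<^sub>K B" "e \<ge> 1" "A \<in> carrier_mat p q" "B \<in> carrier_mat p q"
  shows "A = B"
proof (rule eq_matI)
  fix i j assume "i < dim_row B" "j < dim_col B"
  hence ij: "i < p" "j < q" using assms by auto
  have l: "i < e * p" "j < e * q" using ij assms(2) by (auto intro: less_le_trans simp: Suc_le_eq)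
  have "(1\<^sub>m e \<otimes>\<^sub>K A) $$ (i, j) = (1\<^sub>m e \<otimes>\<^sub>K B) $$ (i, j)" using assms(1) by simp
  thus "A $$ (i, j) = B $$ (i, j)" using assms(3,4) ij l by (simp add: index_one_kron)
qed (use assms in auto)

lemma inverse_pair_one_kron:
  "inverse_pair n A B \<Longrightarrow> inverse_pair (e * n) (1\<^sub>m e \<otimes>\<^sub>K A) (1\<^sub>m e \<otimes>\<^sub>K B)"
  by (auto simp: inverse_pair_def one_kron_mult one_kron_one intro!: carrier_matI)

text \<open>The upper left n by n corner of \<open>M\<close> is the inverse, since the first block
  row and the first block column of 1 \<otimes> A have a single nonzero block each.\<close>

lemma inverse_pair_of_one_kron:
  fixes A :: "'a::semiring_1 mat"
  assumes M: "inverse_pair (e * n) (1\<^sub>m e \<otimes>\<^sub>K A) M" and A: "A \<in> carrier_mat n n" and e: "e \<ge> 1"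
  shows "\<exists>B. inverse_pair n A B"
proof -
  have Mc: "M \<in> carrier_mat (e * n) (e * n)" "(1\<^sub>m e \<otimes>\<^sub>K A) * M = 1\<^sub>m (e * n)" "M * (1\<^sub>m e \<otimes>\<^sub>K A) = 1\<^sub>m (e * n)"
    using M by (auto simp: inverse_pair_def)
  define B where "B = mat n n (\<lambda>(i, j). M $$ (i, j))"
  have Bc: "B \<in> carrier_mat n n" by (simp add: B_def)
  have le: "i < n \<Longrightarrow> i < e * n" for i using e by (auto intro: less_le_trans simp: Suc_le_eq)
  have bl: "a < e \<Longrightarrow> k < n \<Longrightarrow> a * n + k < e * n" for a k by (rule block_index_lt)
  have AB: "(A * B) $$ (i, j) = ((1\<^sub>m e \<otimes>\<^sub>K A) * M) $$ (i, j)" if ij: "i < n" "j < n" for i j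
  proof -
    have "((1\<^sub>m e \<otimes>\<^sub>K A) * M) $$ (i, j) = (\<Sum>k<e * n. (1\<^sub>m e \<otimes>\<^sub>K A) $$ (i, k) * M $$ (k, j))"
      using le ij A Mc by (subst index_mult_mat_sum) auto
    also have "\<dots> = (\<Sum>a<e. \<Sum>k<n. (1\<^sub>m e \<otimes>\<^sub>K A) $$ (i, a * n + k) * M $$ (a * n + k, j))"
      by (rule sum_mult_blocks)
    also have "\<dots> = (\<Sum>a<e. if a = 0 then \<Sum>k<n. A $$ (i, k) * M $$ (k, j) else 0)"
      using ij A le bl by (intro sum.cong refl) (auto simp: index_one_kron intro!: sum.cong sum.neutral)
    also have "\<dots> = (\<Sum>k<n. A $$ (i, k) * M $$ (k, j))" using e by (simp add: sum.delta)
    also have "\<dots> = (A * B) $$ (i, j)" using ij A Bc by (subst index_mult_mat_sum) (auto simp: B_def)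
    finally show ?thesis by simp
  qed
  have BA: "(B * A) $$ (i, j) = (M * (1\<^sub>m e \<otimes>\<^sub>K A)) $$ (i, j)" if ij: "i < n" "j < n" for i j
  proof -
    have "(M * (1\<^sub>m e \<otimes>\<^sub>K A)) $$ (i, j) = (\<Sum>k<e * n. M $$ (i, k) * (1\<^sub>m e \<otimes>\<^sub>K A) $$ (k, j))"
      using le ij A Mc by (subst index_mult_mat_sum) auto
    also have "\<dots> = (\<Sum>a<e. \<Sum>k<n. M $$ (i, a * n + k) * (1\<^sub>m e \<otimes>\<^sub>K A) $$ (a * n + k, j))"
      by (rule sum_mult_blocks)
    also have "\<dots> = (\<Sum>a<e. if a = 0 then \<Sum>k<n. M $$ (i, k) * A $$ (k, j) else 0)"
      using ij A le bl by (intro sum.cong refl) (auto simp: index_one_kron intro!: sum.cong sum.neutral)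
    also have "\<dots> = (\<Sum>k<n. M $$ (i, k) * A $$ (k, j))" using e by (simp add: sum.delta)
    also have "\<dots> = (B * A) $$ (i, j)" using ij A Bc by (subst index_mult_mat_sum) (auto simp: B_def)
    finally show ?thesis by simp
  qed
  have "A * B = 1\<^sub>m n" using AB A Bc le unfolding Mc(2) by (intro eq_matI) (simp_all del: index_mult_mat(1))
  moreover have "B * A = 1\<^sub>m n" using BA A Bc le unfolding Mc(3) by (intro eq_matI) (simp_all del: index_mult_mat(1))
  ultimately show ?thesis using A Bc by (auto simp: inverse_pair_def)
qed

context unital_algebra begin

lemma one_kron_kron_scalar: "(1\<^sub>m e \<otimes>\<^sub>K X) \<star> P = 1\<^sub>m e \<otimes>\<^sub>K (X \<star> P)"
proof (rule eq_matI)
  fix i j assume "i < dim_row (1\<^sub>m e \<otimes>\<^sub>K (X \<star> P))" "j < dim_col (1\<^sub>m e \<otimes>\<^sub>K (X \<star> P))"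
  hence ij: "i < e * dim_row X * dim_row P" "j < e * dim_col X * dim_col P"
    by (auto simp: mult.assoc)
  have m: "i mod (dim_row X * dim_row P) < dim_row X * dim_row P" "j mod (dim_col X * dim_col P) < dim_col X * dim_col P"
    using ij by (metis mod_mult_lt mult.assoc)+
  have mm: "i mod (a * b) mod b = i mod b" "i mod (a * b) div b = i div b mod a" "i div b div a = i div (a * b)"
    if "0 < b" for i a b :: nat
    using that by (auto simp: mod_mult2_eq mult.commute[of a] div_mult2_eq)
  have pos: "0 < dim_row P" "0 < dim_col P" using ij by (auto intro: gr0I)
  have dd: "i div dim_row P < e * dim_row X" "j div dim_col P < e * dim_col X" using ij div_mult_lt by blast+
  show "((1\<^sub>m e \<otimes>\<^sub>K X) \<star> P) $$ (i, j) = (1\<^sub>m e \<otimes>\<^sub>K (X \<star> P)) $$ (i, j)"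
    using ij m pos dd
    by (simp add: index_kron_scalar index_one_kron mm mult.assoc)
qed (auto simp: mult.assoc)

lemma lin_one_kron:
  assumes "finite I" "\<And>\<kappa>. \<kappa> \<in> I \<Longrightarrow> x \<kappa> \<in> carrier_mat m m" "\<And>\<kappa>. \<kappa> \<in> I \<Longrightarrow> P \<kappa> \<in> carrier_mat p q"
  shows "lin scale I (e * m) p q (\<lambda>\<kappa>. 1\<^sub>m e \<otimes>\<^sub>K x \<kappa>) P = 1\<^sub>m e \<otimes>\<^sub>K lin scale I m p q x P"
  using assms
proof (induction I rule: finite_induct)
  case empty
  then show ?case by (simp add: lin_empty one_kron_zero mult.assoc)
next
  case (insert \<kappa> I)
  have c: "x \<kappa> \<in> carrier_mat m m" "P \<kappa> \<in> carrier_mat p q" using insert by auto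
  have "1\<^sub>m e \<otimes>\<^sub>K x \<kappa> \<in> carrier_mat (e * m) (e * m)" using carrier_matD[OF c(1)] by (auto intro!: carrier_matI)
  with insert c carrier_matD[OF c(1)] carrier_matD[OF c(2)] show ?case
    by (simp add: lin_insert one_kron_add one_kron_kron_scalar)
qed

lemma const_one_kron: "1\<^sub>m (e * m) \<star> P = 1\<^sub>m e \<otimes>\<^sub>K (1\<^sub>m m \<star> P)"
  by (metis one_kron_kron_scalar one_kron_one)

lemma descr_one_kron:
  assumes "finite I" "\<And>\<kappa>. \<kappa> \<in> I \<Longrightarrow> x \<kappa> \<in> carrier_mat m m" "wf_descr I p q S"
  shows "pencil scale I (e * m) S (\<lambda>\<kappa>. 1\<^sub>m e \<otimes>\<^sub>K x \<kappa>) = 1\<^sub>m e \<otimes>\<^sub>K pencil scale I m S x"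
    and "input scale I (e * m) S (\<lambda>\<kappa>. 1\<^sub>m e \<otimes>\<^sub>K x \<kappa>) = 1\<^sub>m e \<otimes>\<^sub>K input scale I m S x"
proof -
  note c = wf_descr_carrier[OF assms(3)] and d = wf_descr_dims[OF assms(3)]
  have 1: "lin scale I (e * m) (state_dim S) (state_dim S) (\<lambda>\<kappa>. 1\<^sub>m e \<otimes>\<^sub>K x \<kappa>) (pen_coeff S) = 1\<^sub>m e \<otimes>\<^sub>K lin scale I m (state_dim S) (state_dim S) x (pen_coeff S)"
    by (rule lin_one_kron[OF assms(1)]) (use assms(2) c in auto)
  have 2: "lin scale I (e * m) (state_dim S) q (\<lambda>\<kappa>. 1\<^sub>m e \<otimes>\<^sub>K x \<kappa>) (inp_coeff S) = 1\<^sub>m e \<otimes>\<^sub>K lin scale I m (state_dim S) q x (inp_coeff S)"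
    by (rule lin_one_kron[OF assms(1)]) (use assms(2) c in auto)
  show "pencil scale I (e * m) S (\<lambda>\<kappa>. 1\<^sub>m e \<otimes>\<^sub>K x \<kappa>) = 1\<^sub>m e \<otimes>\<^sub>K pencil scale I m S x"
    using d by (simp add: pencil_def 1 const_one_kron one_kron_add)
  show "input scale I (e * m) S (\<lambda>\<kappa>. 1\<^sub>m e \<otimes>\<^sub>K x \<kappa>) = 1\<^sub>m e \<otimes>\<^sub>K input scale I m S x"
    using d by (simp add: input_def 2 const_one_kron one_kron_add)
qed

lemma descr_at_one_kron:
  assumes "finite I" "\<And>\<kappa>. \<kappa> \<in> I \<Longrightarrow> x \<kappa> \<in> carrier_mat m m" "wf_descr I p q S" "descr_at scale I m S x V"
  shows "descr_at scale I (e * m) S (\<lambda>\<kappa>. 1\<^sub>m e \<otimes>\<^sub>K x \<kappa>) (1\<^sub>m e \<otimes>\<^sub>K V)"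
proof -
  obtain M where M: "inverse_pair (m * state_dim S) (pencil scale I m S x) M"
    and V: "V = 1\<^sub>m m \<star> feed S + (1\<^sub>m m \<star> outp S) * (M * input scale I m S x)"
    using assms(4) by (auto simp: descr_at_def)
  note d = wf_descr_dims[OF assms(3)] inverse_pair_dims[OF M]
  have dk: "pencil scale I (e * m) S (\<lambda>\<kappa>. 1\<^sub>m e \<otimes>\<^sub>K x \<kappa>) = 1\<^sub>m e \<otimes>\<^sub>K pencil scale I m S x"
    "input scale I (e * m) S (\<lambda>\<kappa>. 1\<^sub>m e \<otimes>\<^sub>K x \<kappa>) = 1\<^sub>m e \<otimes>\<^sub>K input scale I m S x"
    using descr_one_kron[OF assms(1) _ assms(3)] assms(2) by blast+
  have "inverse_pair (e * m * state_dim S) (pencil scale I (e * m) S (\<lambda>\<kappa>. 1\<^sub>m e \<otimes>\<^sub>K x \<kappa>)) (1\<^sub>m e \<otimes>\<^sub>K M)"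
    using inverse_pair_one_kron[OF M, of e] dk by (simp add: mult.assoc)
  moreover have "1\<^sub>m e \<otimes>\<^sub>K V = 1\<^sub>m (e * m) \<star> feed S + (1\<^sub>m (e * m) \<star> outp S) * ((1\<^sub>m e \<otimes>\<^sub>K M) * input scale I (e * m) S (\<lambda>\<kappa>. 1\<^sub>m e \<otimes>\<^sub>K x \<kappa>))"
    using d by (simp add: V dk const_one_kron one_kron_add one_kron_mult)
  ultimately show ?thesis by (auto simp: descr_at_def)
qed

text \<open>Regularity descends by taking a corner of the inverse, and uniqueness of values then
  identifies \<open>W\<close>. This is the way back after all sizes have been multiplied by
  \<open>e\<close>.\<close>

lemma descr_at_of_one_kron:
  assumes "finite I" "\<And>\<kappa>. \<kappa> \<in> I \<Longrightarrow> x \<kappa> \<in> carrier_mat m m" "wf_descr I p q S" "e \<ge> 1"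
    "descr_at scale I (e * m) S (\<lambda>\<kappa>. 1\<^sub>m e \<otimes>\<^sub>K x \<kappa>) W"
  shows "\<exists>V. descr_at scale I m S x V \<and> W = 1\<^sub>m e \<otimes>\<^sub>K V"
proof -
  obtain M where M: "inverse_pair (e * m * state_dim S) (pencil scale I (e * m) S (\<lambda>\<kappa>. 1\<^sub>m e \<otimes>\<^sub>K x \<kappa>)) M"
    using assms(5) by (auto simp: descr_at_def)
  have "pencil scale I (e * m) S (\<lambda>\<kappa>. 1\<^sub>m e \<otimes>\<^sub>K x \<kappa>) = 1\<^sub>m e \<otimes>\<^sub>K pencil scale I m S x"
    using descr_one_kron(1)[OF assms(1) _ assms(3)] assms(2) by blast
  moreover have "pencil scale I m S x \<in> carrier_mat (m * state_dim S) (m * state_dim S)" by (rule carrier_matI) simp_all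
  ultimately obtain B where "inverse_pair (m * state_dim S) (pencil scale I m S x) B"
    using inverse_pair_of_one_kron[of e "m * state_dim S" "pencil scale I m S x" M] M assms(4)
    by (auto simp: mult.assoc)
  then obtain V where V: "descr_at scale I m S x V" by (auto simp: descr_at_def)
  have "descr_at scale I (e * m) S (\<lambda>\<kappa>. 1\<^sub>m e \<otimes>\<^sub>K x \<kappa>) (1\<^sub>m e \<otimes>\<^sub>K V)"
    using descr_at_one_kron[OF assms(1) _ assms(3) V] assms(2) by blast
  thus ?thesis using V descr_at_unique[OF assms(5)] by blast
qed

end

text \<open>The point of size m*e whose deviation from 1 \<otimes> z has the matrices
  \<open>y\<close> as coordinates; \<open>coords\<close> takes it back to \<open>y\<close>.\<close>

definition assemble :: "nat \<Rightarrow> nat \<Rightarrow> ('i \<Rightarrow> 'k::field mat) \<Rightarrow> ('i \<times> nat \<times> nat \<Rightarrow> 'k mat) \<Rightarrow> 'i \<Rightarrow> 'k mat" where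
  "assemble e m z y \<kappa> = 1\<^sub>m m \<otimes>\<^sub>K z \<kappa> + mat (m * e) (m * e) (\<lambda>(r, c). y (\<kappa>, r mod e, c mod e) $$ (r div e, c div e))"

lemma assemble_carrier [simp]: "assemble e m z y \<kappa> \<in> carrier_mat (m * e) (m * e)"
  by (auto simp: assemble_def)

lemma coords_assemble:
  assumes "z \<kappa> \<in> carrier_mat e e" "i < e" "j < e" "y (\<kappa>, i, j) \<in> carrier_mat m m"
  shows "coords (*) e m z (assemble e m z y) (\<kappa>, i, j) = y (\<kappa>, i, j)"
proof (rule eq_matI)
  fix a c assume "a < dim_row (y (\<kappa>, i, j))" "c < dim_col (y (\<kappa>, i, j))"
  hence ac: "a < m" "c < m" using assms by auto
  have "a * e + i < m * e" "c * e + j < m * e" using ac assms by (auto intro: block_index_lt)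
  thus "coords (*) e m z (assemble e m z y) (\<kappa>, i, j) $$ (a, c) = y (\<kappa>, i, j) $$ (a, c)"
    using ac assms by (simp add: coords_def assemble_def kron_scalar_field)
qed (use assms in \<open>auto simp: coords_def\<close>)

text \<open>A path with edges from a to a + 1, labelled by the letters of \<open>w\<close>. Among
  products of as many such matrices as \<open>w\<close> has letters, only the one that spells
  \<open>w\<close> has a nonzero upper right corner.\<close>

definition shift_point :: "'i list \<Rightarrow> 'i \<Rightarrow> 'k::field mat" where
  "shift_point w \<kappa> = mat (Suc (length w)) (Suc (length w)) (\<lambda>(a, b). if b = Suc a \<and> w ! a = \<kappa> then 1 else 0)"

definition block_vec :: "nat \<Rightarrow> nat \<Rightarrow> (nat \<Rightarrow> 'k vec) \<Rightarrow> 'k vec" where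
  "block_vec m n f = vec (m * n) (\<lambda>c. f (c div n) $ (c mod n))"

lemma block_vec_carrier [simp]: "block_vec m n f \<in> carrier_vec (m * n)" "dim_vec (block_vec m n f) = m * n"
  by (auto simp: block_vec_def)

lemma block_vec_cong: "(\<And>a. a < m \<Longrightarrow> f a = g a) \<Longrightarrow> block_vec m n f = block_vec m n g"
  by (auto simp: block_vec_def div_mult_lt intro!: eq_vecI)

lemma shift_point_carrier [simp]: "shift_point w \<kappa> \<in> carrier_mat (Suc (length w)) (Suc (length w))"
  by (simp add: shift_point_def)

lemma block_vec_zero: "block_vec m n (\<lambda>a. 0\<^sub>v n) = 0\<^sub>v (m * n)"
  by (auto simp: block_vec_def mod_mult_lt)

lemma block_vec_add:
  assumes "\<And>a. a < m \<Longrightarrow> g a \<in> carrier_vec n"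
  shows "block_vec m n f + block_vec m n g = block_vec m n (\<lambda>a. f a + g a)"
proof (rule eq_vecI)
  fix c assume "c < dim_vec (block_vec m n (\<lambda>a. f a + g a))"
  hence c: "c < m * n" by simp
  thus "(block_vec m n f + block_vec m n g) $ c = block_vec m n (\<lambda>a. f a + g a) $ c"
    using assms[OF div_mult_lt[OF c]] mod_mult_lt[OF c] by (simp add: block_vec_def)
qed auto

lemma lin_shift_block_vec:
  fixes P :: "'i \<Rightarrow> 'k::field mat"
  assumes fin: "finite K" and w: "w \<in> lists K" and P: "\<And>\<kappa>. \<kappa> \<in> K \<Longrightarrow> P \<kappa> \<in> carrier_mat p n"
    and f: "\<And>a. a < Suc (length w) \<Longrightarrow> f a \<in> carrier_vec n" and m: "m = Suc (length w)"
  shows "lin (*) K m p n (shift_point w) P *\<^sub>v block_vec m n f =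
    block_vec m p (\<lambda>a. if a < length w then P (w ! a) *\<^sub>v f (Suc a) else 0\<^sub>v p)"
proof (rule eq_vecI)
  fix r assume "r < dim_vec (block_vec m p (\<lambda>a. if a < length w then P (w ! a) *\<^sub>v f (Suc a) else 0\<^sub>v p))"
  hence r: "r < m * p" by simp
  define a i where "a = r div p" and "i = r mod p"
  have ai: "a < m" "i < p" using r div_mult_lt mod_mult_lt unfolding a_def i_def by blast+
  have bl: "b < m \<Longrightarrow> j < n \<Longrightarrow> b * n + j < m * n" for b j by (rule block_index_lt)
  have "(lin (*) K m p n (shift_point w) P *\<^sub>v block_vec m n f) $ r =
    (\<Sum>c<m * n. lin (*) K m p n (shift_point w) P $$ (r, c) * block_vec m n f $ c)"
    using r by (simp add: scalar_prod_def atLeast0LessThan)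
  also have "\<dots> = (\<Sum>b<m. \<Sum>j<n. lin (*) K m p n (shift_point w) P $$ (r, b * n + j) * block_vec m n f $ (b * n + j))"
    by (rule sum_mult_blocks)
  also have "\<dots> = (\<Sum>b<m. if b = Suc a then (\<Sum>j<n. P (w ! a) $$ (i, j) * f b $ j) else 0)"
  proof (rule sum.cong)
    fix b assume "b \<in> {..<m}"
    hence b: "b < m" by simp
    have "lin (*) K m p n (shift_point w) P $$ (r, b * n + j) = (if b = Suc a then P (w ! a) $$ (i, j) else 0)" if j: "j < n" for j
    proof -
      have "lin (*) K m p n (shift_point w) P $$ (r, b * n + j) = (\<Sum>\<kappa>\<in>K. P \<kappa> $$ (i, j) * shift_point w \<kappa> $$ (a, b))"
        using r bl[OF b j] j by (simp add: index_lin a_def i_def)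
      also have "\<dots> = (\<Sum>\<kappa>\<in>K. if \<kappa> = w ! a then (if b = Suc a then P \<kappa> $$ (i, j) else 0) else 0)"
        using ai b m by (intro sum.cong) (auto simp: shift_point_def)
      also have "\<dots> = (if b = Suc a then P (w ! a) $$ (i, j) else 0)"
        using fin w b m by (simp add: sum.delta) (use in_listsD nth_mem in fastforce)
      finally show ?thesis .
    qed
    thus "(\<Sum>j<n. lin (*) K m p n (shift_point w) P $$ (r, b * n + j) * block_vec m n f $ (b * n + j)) =
      (if b = Suc a then (\<Sum>j<n. P (w ! a) $$ (i, j) * f b $ j) else 0)"
      using bl[OF b] by (auto simp: block_vec_def intro!: sum.cong)
  qed simp
  also have "\<dots> = (if Suc a < m then (\<Sum>j<n. P (w ! a) $$ (i, j) * f (Suc a) $ j) else 0)"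
    by (simp add: sum.delta)
  also have "\<dots> = (if a < length w then P (w ! a) *\<^sub>v f (Suc a) else 0\<^sub>v p) $ i"
  proof (cases "a < length w")
    case True
    have "w ! a \<in> K" using w True by (meson in_listsD nth_mem)
    from carrier_matD[OF P[OF this]] carrier_vecD[OF f[of "Suc a"]] show ?thesis
      using True ai m by (simp add: scalar_prod_def atLeast0LessThan)
  qed (use ai m in simp)
  also have "\<dots> = block_vec m p (\<lambda>a. if a < length w then P (w ! a) *\<^sub>v f (Suc a) else 0\<^sub>v p) $ r"
    using r by (simp add: block_vec_def a_def i_def)
  finally show "(lin (*) K m p n (shift_point w) P *\<^sub>v block_vec m n f) $ r =
    block_vec m p (\<lambda>a. if a < length w then P (w ! a) *\<^sub>v f (Suc a) else 0\<^sub>v p) $ r" .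
qed auto

lemma one_kron_block_vec:
  fixes C :: "'k::field mat"
  assumes C: "C \<in> carrier_mat p n" and f: "\<And>a. a < m \<Longrightarrow> f a \<in> carrier_vec n"
  shows "(1\<^sub>m m \<otimes>\<^sub>K C) *\<^sub>v block_vec m n f = block_vec m p (\<lambda>a. C *\<^sub>v f a)"
proof (rule eq_vecI)
  fix r assume "r < dim_vec (block_vec m p (\<lambda>a. C *\<^sub>v f a))"
  hence r: "r < m * p" by simp
  have ai: "r div p < m" "r mod p < p" using r div_mult_lt mod_mult_lt by blast+
  have bl: "b < m \<Longrightarrow> j < n \<Longrightarrow> b * n + j < m * n" for b j by (rule block_index_lt)
  have "((1\<^sub>m m \<otimes>\<^sub>K C) *\<^sub>v block_vec m n f) $ r = (\<Sum>c<m * n. (1\<^sub>m m \<otimes>\<^sub>K C) $$ (r, c) * block_vec m n f $ c)"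
    using r C by (simp add: scalar_prod_def atLeast0LessThan)
  also have "\<dots> = (\<Sum>b<m. \<Sum>j<n. (1\<^sub>m m \<otimes>\<^sub>K C) $$ (r, b * n + j) * block_vec m n f $ (b * n + j))"
    by (rule sum_mult_blocks)
  also have "\<dots> = (\<Sum>b<m. if b = r div p then (\<Sum>j<n. C $$ (r mod p, j) * f b $ j) else 0)"
    using r C bl by (intro sum.cong refl) (auto simp: index_one_kron block_vec_def intro!: sum.cong sum.neutral)
  also have "\<dots> = (C *\<^sub>v f (r div p)) $ (r mod p)"
    using ai C f[OF ai(1)] by (simp add: sum.delta scalar_prod_def atLeast0LessThan)
  finally show "((1\<^sub>m m \<otimes>\<^sub>K C) *\<^sub>v block_vec m n f) $ r = block_vec m p (\<lambda>a. C *\<^sub>v f a) $ r"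
    using r by (simp add: block_vec_def)
qed (use C in auto)

lemma block_vec_eqD:
  assumes "block_vec m n f = block_vec m n g" "a < m" "f a \<in> carrier_vec n" "g a \<in> carrier_vec n"
  shows "f a = g a"
proof (rule eq_vecI)
  fix i assume "i < dim_vec (g a)"
  hence i: "i < n" using assms by simp
  have "block_vec m n f $ (a * n + i) = block_vec m n g $ (a * n + i)" using assms(1) by simp
  thus "f a $ i = g a $ i" using block_index_lt[OF assms(2) i] i by (simp add: block_vec_def)
qed (use assms in auto)

lemma block_vec_exists:
  assumes "v \<in> carrier_vec (m * n)"
  shows "\<exists>f. v = block_vec m n f \<and> (\<forall>a. f a \<in> carrier_vec n)"
proof (intro exI conjI allI)
  show "v = block_vec m n (\<lambda>a. vec n (\<lambda>i. v $ (a * n + i)))"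
    using assms by (intro eq_vecI) (auto simp: block_vec_def mod_mult_lt)
qed simp

text \<open>The pencil is block upper triangular with identity blocks on the diagonal: in a kernel
  vector the last block vanishes, and every other block is determined by the next one.\<close>

lemma shift_point_regular:
  fixes S :: "('i, 'k::field) descriptor"
  assumes fin: "finite K" and wf: "wf_descr K p q S" and cen: "centered S" and w: "w \<in> lists K"
  shows "\<exists>V. descr_at (*) K (Suc (length w)) S (shift_point w) V"
proof -
  let ?m = "Suc (length w)" and ?n = "state_dim S" and ?L = "pencil (*) K (Suc (length w)) S (shift_point w)"
  note A = wf_descr_carrier(5)[OF wf]
  have "\<exists>B. inverse_pair (?m * ?n) ?L B"
  proof (rule inverse_pair_kernel)
    show "?L \<in> carrier_mat (?m * ?n) (?m * ?n)" by (auto intro!: carrier_matI)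
    fix v assume v: "v \<in> carrier_vec (?m * ?n)" and Lv: "?L *\<^sub>v v = 0\<^sub>v (?m * ?n)"
    obtain f where f: "v = block_vec ?m ?n f" "\<And>a. f a \<in> carrier_vec ?n" using block_vec_exists[OF v] by blast
    let ?g = "\<lambda>a. if a < length w then pen_coeff S (w ! a) *\<^sub>v f (Suc a) else 0\<^sub>v ?n"
    have g: "?g a \<in> carrier_vec ?n" for a
    proof (cases "a < length w")
      case True
      hence "w ! a \<in> K" using w by (meson in_listsD nth_mem)
      thus ?thesis using True mult_mat_vec_carrier[OF A f(2)] by auto
    qed auto
    have "?L *\<^sub>v v = v + lin (*) K ?m ?n ?n (shift_point w) (pen_coeff S) *\<^sub>v v"
      unfolding field_algebra.pencil_centered[OF cen] using v
      by (subst add_mult_distrib_mat_vec[of _ "?m * ?n" "?m * ?n"]) (auto intro!: carrier_matI)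
    also have "lin (*) K ?m ?n ?n (shift_point w) (pen_coeff S) *\<^sub>v v = block_vec ?m ?n ?g"
      unfolding f(1) by (rule lin_shift_block_vec[OF fin w]) (use A f in auto)
    finally have "?L *\<^sub>v v = v + block_vec ?m ?n ?g" .
    also have "v + block_vec ?m ?n ?g = block_vec ?m ?n (\<lambda>a. f a + ?g a)"
      unfolding f(1) by (rule block_vec_add) (rule g)
    finally have eq: "block_vec ?m ?n (\<lambda>a. f a + ?g a) = block_vec ?m ?n (\<lambda>a. 0\<^sub>v ?n)"
      unfolding Lv block_vec_zero by (rule sym)
    have fg: "f a + ?g a = 0\<^sub>v ?n" if "a < ?m" for a
      using block_vec_eqD[OF eq that] g[of a] f(2)[of a] by auto
    have "f (length w - b) = 0\<^sub>v ?n" if "b \<le> length w" for b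
      using that
    proof (induction b)
      case 0
      show ?case using fg[of "length w"] f(2)[of "length w"] by simp
    next
      case (Suc b)
      let ?a = "length w - Suc b"
      have a: "?a < length w" "Suc ?a = length w - b" using Suc.prems by auto
      have k: "w ! ?a \<in> K" using w a by (meson in_listsD nth_mem)
      have "?g ?a = 0\<^sub>v ?n" using a Suc mult_mat_zero_vec[OF A[OF k]] by simp
      thus ?case using fg[of ?a] a f(2)[of ?a] by simp
    qed
    hence "f a = 0\<^sub>v ?n" if "a < ?m" for a using that
      by (metis diff_diff_cancel diff_le_self less_Suc_eq_le)
    hence "v = block_vec ?m ?n (\<lambda>a. 0\<^sub>v ?n)" unfolding f(1) by (intro block_vec_cong)
    thus "v = 0\<^sub>v (?m * ?n)" unfolding block_vec_zero .
  qed
  thus ?thesis by (auto simp: descr_at_def)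
qed

text \<open>
  At the strictly upper triangular point spelling the word \<open>w @ [\<kappa>]\<close>, the top right block of the value
  is up to sign the Markov parameter of that word: the vector \<open>\<xi>\<close> below solves the triangular system.
\<close>

lemma shift_point_value:
  fixes S :: "('i, 'k::field) descriptor"
  assumes fin: "finite K" and wf: "wf_descr K p q S" and cen: "centered S" and w: "w \<in> lists K" and k: "\<kappa> \<in> K"
    and u: "u \<in> carrier_vec q" and m: "m = Suc (length (w @ [\<kappa>]))"
    and V: "descr_at (*) K m S (shift_point (w @ [\<kappa>])) V"
  shows "V *\<^sub>v block_vec m q (\<lambda>a. if a = Suc (length w) then u else 0\<^sub>v q) =
    block_vec m p (\<lambda>a. feed S *\<^sub>v (if a = Suc (length w) then u else 0\<^sub>v q) + outp S *\<^sub>v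
      (if a \<le> length w then ((- 1) ^ (length w - a)) \<cdot>\<^sub>v run_word (pen_coeff S) (drop a w) (inp_coeff S \<kappa> *\<^sub>v u) else 0\<^sub>v (state_dim S)))"
proof -
  let ?n = "state_dim S" and ?w = "w @ [\<kappa>]" and ?l = "length w"
  let ?L = "pencil (*) K m S (shift_point ?w)" and ?b = "input (*) K m S (shift_point ?w)"
  note A = wf_descr_carrier(5)[OF wf] and B = wf_descr_carrier(6)[OF wf]
    and C = wf_descr_carrier(2)[OF wf] and D = wf_descr_carrier(1)[OF wf]
  have wl: "?w \<in> lists K" using w k by simp
  obtain M where M: "inverse_pair (m * ?n) ?L M"
    and Veq: "V = kron_scalar (*) (1\<^sub>m m) (feed S) + kron_scalar (*) (1\<^sub>m m) (outp S) * (M * ?b)"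
    using V by (auto simp: descr_at_def)
  define f where "f a = (if a \<le> ?l then ((- 1) ^ (?l - a)) \<cdot>\<^sub>v run_word (pen_coeff S) (drop a w) (inp_coeff S \<kappa> *\<^sub>v u) else 0\<^sub>v ?n)" for a
  define \<xi> where "\<xi> = block_vec m ?n f"
  let ?u = "\<lambda>a. if a = Suc ?l then u else 0\<^sub>v q"
  have Bu: "inp_coeff S \<kappa> *\<^sub>v u \<in> carrier_vec ?n" using B[OF k] u by simp
  have dw: "drop a w \<in> lists K" for a using w by (meson in_listsD in_listsI in_set_dropD)
  have rw: "run_word (pen_coeff S) (drop a w) (inp_coeff S \<kappa> *\<^sub>v u) \<in> carrier_vec ?n" for a
    by (rule run_word_carrier[where I = K, OF A dw Bu])
  have f: "f a \<in> carrier_vec ?n" for a using rw by (simp add: f_def)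
  have L\<xi>: "?L *\<^sub>v \<xi> = ?b *\<^sub>v block_vec m q ?u"
  proof -
    let ?g = "\<lambda>a. if a < length ?w then pen_coeff S (?w ! a) *\<^sub>v f (Suc a) else 0\<^sub>v ?n"
    have g: "?g a \<in> carrier_vec ?n" for a
    proof (cases "a < length ?w")
      case True
      hence "?w ! a \<in> K" using wl by (meson in_listsD nth_mem)
      from mult_mat_vec_carrier[OF A[OF this] f[of "Suc a"]] True show ?thesis by simp
    qed simp
    have "?L *\<^sub>v \<xi> = \<xi> + lin (*) K m ?n ?n (shift_point ?w) (pen_coeff S) *\<^sub>v \<xi>"
      unfolding field_algebra.pencil_centered[OF cen] \<xi>_def
      by (subst add_mult_distrib_mat_vec[of _ "m * ?n" "m * ?n"]) (auto intro!: carrier_matI)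
    also have "lin (*) K m ?n ?n (shift_point ?w) (pen_coeff S) *\<^sub>v \<xi> = block_vec m ?n ?g"
      unfolding \<xi>_def by (rule lin_shift_block_vec[OF fin wl]) (use A f m in auto)
    also have "\<xi> + block_vec m ?n ?g = block_vec m ?n (\<lambda>a. f a + ?g a)"
      unfolding \<xi>_def by (rule block_vec_add) (rule g)
    finally have 1: "?L *\<^sub>v \<xi> = block_vec m ?n (\<lambda>a. f a + ?g a)" .
    have 2: "?b *\<^sub>v block_vec m q ?u = block_vec m ?n (\<lambda>a. if a < length ?w then inp_coeff S (?w ! a) *\<^sub>v ?u (Suc a) else 0\<^sub>v ?n)"
      using field_algebra.input_centered[OF cen] wf_descr_dims(8)[OF wf]
        lin_shift_block_vec[OF fin wl, of "inp_coeff S" ?n q ?u m] B u m by simp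
    show ?thesis unfolding 1 2
    proof (rule block_vec_cong)
      fix a assume a: "a < m"
      \<comment> \<open>Before block \<open>?l\<close> the two terms cancel by their opposite signs;
        at \<open>?l\<close> the input through \<open>\<kappa>\<close> enters; the last block, which
        carries the input vector, has state 0.\<close>
      consider "a < ?l" | "a = ?l" | "a = Suc ?l" using a m by fastforce
      thus "f a + ?g a = (if a < length ?w then inp_coeff S (?w ! a) *\<^sub>v ?u (Suc a) else 0\<^sub>v ?n)"
      proof cases
        case 1
        have ka: "w ! a \<in> K" using w 1 by (meson in_listsD nth_mem)
        have "drop a w = w ! a # drop (Suc a) w" using 1 by (simp add: Cons_nth_drop_Suc)
        moreover have "?l - a = Suc (?l - Suc a)" using 1 by simp
        ultimately have fa: "f a = ((- 1) ^ Suc (?l - Suc a)) \<cdot>\<^sub>v (pen_coeff S (w ! a) *\<^sub>v run_word (pen_coeff S) (drop (Suc a) w) (inp_coeff S \<kappa> *\<^sub>v u))"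
          using 1 by (simp add: f_def)
        have ga: "?g a = ((- 1) ^ (?l - Suc a)) \<cdot>\<^sub>v (pen_coeff S (w ! a) *\<^sub>v run_word (pen_coeff S) (drop (Suc a) w) (inp_coeff S \<kappa> *\<^sub>v u))"
          using 1 mult_mat_vec[OF A[OF ka] rw[of "Suc a"]] by (simp add: f_def nth_append)
        define x where "x = pen_coeff S (w ! a) *\<^sub>v run_word (pen_coeff S) (drop (Suc a) w) (inp_coeff S \<kappa> *\<^sub>v u)"
        have x: "x \<in> carrier_vec ?n" unfolding x_def using mult_mat_vec_carrier[OF A[OF ka] rw] .
        have "f a + ?g a = 0\<^sub>v ?n" unfolding fa ga x_def[symmetric] using x by (intro eq_vecI) auto
        moreover have "inp_coeff S (w ! a) *\<^sub>v 0\<^sub>v q = 0\<^sub>v ?n" by (rule mult_mat_zero_vec[OF B[OF ka]])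
        ultimately show ?thesis using 1 by (simp add: nth_append)
      next
        case 2
        have "f (Suc ?l) = 0\<^sub>v ?n" "f ?l = inp_coeff S \<kappa> *\<^sub>v u" using Bu by (auto simp: f_def)
        thus ?thesis using 2 mult_mat_zero_vec[OF A[OF k]] Bu by (simp add: nth_append)
      next
        case 3
        thus ?thesis by (simp add: f_def)
      qed
    qed
  qed
  have \<xi>c: "\<xi> \<in> carrier_vec (m * ?n)" by (simp add: \<xi>_def)
  have Lc: "?L \<in> carrier_mat (m * ?n) (m * ?n)" "M \<in> carrier_mat (m * ?n) (m * ?n)" "?b \<in> carrier_mat (m * ?n) (m * q)"
    using M wf_descr_dims(8)[OF wf] by (auto simp: inverse_pair_def intro!: carrier_matI)
  have "(M * ?b) *\<^sub>v block_vec m q ?u = M *\<^sub>v (?L *\<^sub>v \<xi>)"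
    unfolding L\<xi> by (rule assoc_mult_mat_vec[OF Lc(2,3)]) simp
  also have "\<dots> = \<xi>"
    using assoc_mult_mat_vec[OF Lc(2,1) \<xi>c] M \<xi>c by (simp add: inverse_pair_def)
  finally have Mb: "(M * ?b) *\<^sub>v block_vec m q ?u = \<xi>" .
  have Cc: "1\<^sub>m m \<otimes>\<^sub>K outp S \<in> carrier_mat (m * p) (m * ?n)" "1\<^sub>m m \<otimes>\<^sub>K feed S \<in> carrier_mat (m * p) (m * q)"
    using C D by (auto intro!: carrier_matI)
  have "V *\<^sub>v block_vec m q ?u = (1\<^sub>m m \<otimes>\<^sub>K feed S) *\<^sub>v block_vec m q ?u + ((1\<^sub>m m \<otimes>\<^sub>K outp S) * (M * ?b)) *\<^sub>v block_vec m q ?u"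
    unfolding Veq kron_scalar_field
    by (rule add_mult_distrib_mat_vec[OF Cc(2) mult_carrier_mat[OF Cc(1) mult_carrier_mat[OF Lc(2,3)]]]) simp
  also have "((1\<^sub>m m \<otimes>\<^sub>K outp S) * (M * ?b)) *\<^sub>v block_vec m q ?u = (1\<^sub>m m \<otimes>\<^sub>K outp S) *\<^sub>v \<xi>"
    unfolding Mb[symmetric] by (rule assoc_mult_mat_vec[OF Cc(1) mult_carrier_mat[OF Lc(2,3)]]) simp
  also have "\<dots> = block_vec m p (\<lambda>a. outp S *\<^sub>v f a)" unfolding \<xi>_def by (rule one_kron_block_vec[OF C f])
  also have "(1\<^sub>m m \<otimes>\<^sub>K feed S) *\<^sub>v block_vec m q ?u = block_vec m p (\<lambda>a. feed S *\<^sub>v ?u a)"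
    by (rule one_kron_block_vec[OF D]) (use u in auto)
  also have "block_vec m p (\<lambda>a. feed S *\<^sub>v ?u a) + block_vec m p (\<lambda>a. outp S *\<^sub>v f a) = block_vec m p (\<lambda>a. feed S *\<^sub>v ?u a + outp S *\<^sub>v f a)"
    by (rule block_vec_add) (use C f in auto)
  finally show ?thesis unfolding f_def .
qed

text \<open>The empty word gives the value at 0, which is the feed term. For \<open>w\<close> and
  \<open>\<kappa>\<close> the point of \<open>w @ [\<kappa>]\<close> is used and block 0 is
  compared: the feed term contributes nothing there, because the input vector sits in the last
  block, of index \<open>Suc (length w)\<close>.\<close>

lemma same_markov_of_values:
  fixes S S' :: "('i, 'k::field) descriptor"
  assumes fin: "finite K" and wf: "wf_descr K p q S" "wf_descr K p q S'" and cen: "centered S" "centered S'"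
    and val: "\<And>w. w \<in> lists K \<Longrightarrow> \<exists>V. descr_at (*) K (Suc (length w)) S (shift_point w) V \<and> descr_at (*) K (Suc (length w)) S' (shift_point w) V"
  shows "same_markov K S S'"
  unfolding same_markov_def
proof (intro conjI ballI)
  have "V = feed S" if wf: "wf_descr K p q S" and cen: "centered S" and V: "descr_at (*) K (Suc 0) S (shift_point []) V"
    for S :: "('i, 'k) descriptor" and V
  proof -
    have "lin (*) K (Suc 0) (state_dim S) q (shift_point []) (inp_coeff S) = 0\<^sub>m (state_dim S) q"
      by (intro eq_matI) (auto simp: index_lin shift_point_def)
    hence "input (*) K (Suc 0) S (shift_point []) = 0\<^sub>m (state_dim S) q"
      using field_algebra.input_centered[OF cen] wf_descr_dims(8)[OF wf] by simp
    thus ?thesis using V wf_descr_dims[OF wf] by (auto simp: descr_at_def inverse_pair_def kron_scalar_field one_kron_left)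
  qed
  thus "feed S = feed S'" using val[of "[]"] wf cen by (metis list.size(3) lists.Nil)
  fix w \<kappa> and u :: "'k vec"
  assume w: "w \<in> lists K" and k: "\<kappa> \<in> K" and "u \<in> carrier_vec (dim_col (inp_const S))"
  hence u: "u \<in> carrier_vec q" using wf_descr_dims(8)[OF wf(1)] by simp
  let ?w = "w @ [\<kappa>]"
  define m where "m = Suc (length ?w)"
  have "?w \<in> lists K" using w k by simp
  from val[OF this] obtain V where V: "descr_at (*) K m S (shift_point ?w) V" "descr_at (*) K m S' (shift_point ?w) V"
    by (auto simp: m_def)
  define h where "h S a = feed S *\<^sub>v (if a = Suc (length w) then u else 0\<^sub>v q) + outp S *\<^sub>v
      (if a \<le> length w then ((- 1) ^ (length w - a)) \<cdot>\<^sub>v run_word (pen_coeff S) (drop a w) (inp_coeff S \<kappa> *\<^sub>v u) else 0\<^sub>v (state_dim S))"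
    for S :: "('i, 'k) descriptor" and a
  have eq: "block_vec m p (h S) = block_vec m p (h S')"
    using shift_point_value[OF fin wf(1) cen(1) w k u m_def V(1)] shift_point_value[OF fin wf(2) cen(2) w k u m_def V(2)]
    unfolding h_def by simp
  have h0: "h S 0 = ((- 1) ^ length w) \<cdot>\<^sub>v (outp S *\<^sub>v run_word (pen_coeff S) w (inp_coeff S \<kappa> *\<^sub>v u)) \<and>
     outp S *\<^sub>v run_word (pen_coeff S) w (inp_coeff S \<kappa> *\<^sub>v u) \<in> carrier_vec p"
    if wf: "wf_descr K p q S" for S :: "('i, 'k) descriptor"
  proof -
    note C = wf_descr_carrier(2)[OF wf] and D = wf_descr_carrier(1)[OF wf]
    have Bu: "inp_coeff S \<kappa> *\<^sub>v u \<in> carrier_vec (state_dim S)" using wf_descr_carrier(6)[OF wf k] u by simp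
    have rw: "run_word (pen_coeff S) w (inp_coeff S \<kappa> *\<^sub>v u) \<in> carrier_vec (state_dim S)"
      by (rule run_word_carrier[where I = K, OF wf_descr_carrier(5)[OF wf] w Bu])
    show ?thesis using mult_mat_zero_vec[OF D] mult_mat_vec[OF C rw] mult_mat_vec_carrier[OF C rw] by (simp add: h_def)
  qed
  have "h S 0 = h S' 0"
    by (rule block_vec_eqD[OF eq]) (use h0[OF wf(1)] h0[OF wf(2)] in \<open>auto simp: m_def\<close>)
  hence "((- 1) ^ length w) \<cdot>\<^sub>v h S 0 = ((- 1) ^ length w) \<cdot>\<^sub>v h S' 0" by simp
  thus "outp S *\<^sub>v run_word (pen_coeff S) w (inp_coeff S \<kappa> *\<^sub>v u) = outp S' *\<^sub>v run_word (pen_coeff S') w (inp_coeff S' \<kappa> *\<^sub>v u)"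
    using h0[OF wf(1)] h0[OF wf(2)] by (simp add: smult_smult_assoc power_mult_distrib[symmetric])
qed

section \<open>Common regular points\<close>

definition poly_pencil :: "nat \<Rightarrow> 'k::field mat \<Rightarrow> 'k mat \<Rightarrow> 'k poly mat" where
  "poly_pencil a G0 G1 = mat a a (\<lambda>(i, j). [:G0 $$ (i, j), G1 $$ (i, j):])"

text \<open>Multiplication by t on K[t]/(q) in the basis of powers of t: column j holds the
  coefficients of t^(j+1) reduced modulo q.\<close>

definition mod_shift :: "'k::field poly \<Rightarrow> 'k mat" where
  "mod_shift q = mat (degree q) (degree q) (\<lambda>(i, j). coeff (monom 1 (Suc j) mod q) i)"

lemma poly_mod_sum: "(\<Sum>k\<in>A. f k) mod q = (\<Sum>k\<in>A. f k mod (q :: 'k::field poly))"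
  by (induction A rule: infinite_finite_induct) (auto simp: poly_mod_add_left)

lemma poly_det_poly_pencil:
  assumes "G0 \<in> carrier_mat a a" "G1 \<in> carrier_mat a a"
  shows "poly (det (poly_pencil a G0 G1)) c = det (G0 + c \<cdot>\<^sub>m G1)"
proof -
  interpret comm_ring_hom "\<lambda>p. poly p c" by unfold_locales auto
  have "map_mat (\<lambda>p. poly p c) (poly_pencil a G0 G1) = G0 + c \<cdot>\<^sub>m G1"
    using assms by (auto simp: poly_pencil_def)
  thus ?thesis using hom_det[of "poly_pencil a G0 G1"] by simp
qed

text \<open>
  Let \<open>p = det (G0 + t G1)\<close> and \<open>q = 1 + t p r\<close>. A kernel vector of \<open>1 \<otimes> G0 + \<tau> \<otimes> G1\<close>, where \<open>\<tau>\<close> is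
  multiplication by \<open>t\<close> on \<open>K[t]/(q)\<close>, is a vector over \<open>K[t]/(q)\<close> annihilated by \<open>p\<close>, a unit modulo \<open>q\<close>.
\<close>

lemma mod_shift_regular:
  fixes G0 G1 :: "'k::field mat"
  assumes G: "G0 \<in> carrier_mat a a" "G1 \<in> carrier_mat a a"
    and q: "q = pCons 1 (det (poly_pencil a G0 G1) * r)" and e: "degree q \<ge> 1"
  shows "\<exists>B. inverse_pair (degree q * a) (1\<^sub>m (degree q) \<otimes>\<^sub>K G0 + mod_shift q \<otimes>\<^sub>K G1) B"
proof (rule inverse_pair_kernel)
  let ?e = "degree q" and ?T = "mod_shift q" and ?F = "poly_pencil a G0 G1" and ?X = "[:0, 1:] :: 'k poly"
  have Tc: "?T \<in> carrier_mat ?e ?e" by (simp add: mod_shift_def)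
  show "1\<^sub>m ?e \<otimes>\<^sub>K G0 + ?T \<otimes>\<^sub>K G1 \<in> carrier_mat (?e * a) (?e * a)" using G Tc by (auto intro!: carrier_matI)
  fix \<xi> :: "'k vec" assume \<xi>: "\<xi> \<in> carrier_vec (?e * a)" and zero: "(1\<^sub>m ?e \<otimes>\<^sub>K G0 + ?T \<otimes>\<^sub>K G1) *\<^sub>v \<xi> = 0\<^sub>v (?e * a)"
  have q0: "q \<noteq> 0" using e by auto
  \<comment> \<open>The kernel vector is read as \<open>a\<close> polynomials of degree below
    \<open>degree q\<close>, the block index being the power of t.\<close>
  define v where "v l = (\<Sum>k<?e. monom (\<xi> $ (k * a + l)) k)" for l
  have cv: "coeff (v l) i = (if i < ?e then \<xi> $ (i * a + l) else 0)" for l i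
    by (simp add: v_def coeff_sum sum.delta)
  have cXv: "coeff ((?X * v l) mod q) i = (\<Sum>k<?e. ?T $$ (i, k) * \<xi> $ (k * a + l))" if "i < ?e" for l i
  proof -
    have "?X * v l = (\<Sum>k<?e. Polynomial.smult (\<xi> $ (k * a + l)) (monom 1 (Suc k)))"
      unfolding v_def sum_distrib_left by (intro sum.cong) (auto simp: smult_monom monom_Suc)
    hence "(?X * v l) mod q = (\<Sum>k<?e. Polynomial.smult (\<xi> $ (k * a + l)) (monom 1 (Suc k) mod q))"
      by (simp add: poly_mod_sum mod_smult_left)
    thus ?thesis using that by (simp add: coeff_sum mod_shift_def mult.commute)
  qed
  define W where "W j = (\<Sum>l<a. Polynomial.smult (G0 $$ (j, l)) (v l) + Polynomial.smult (G1 $$ (j, l)) ((?X * v l) mod q))" for j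
  have W0: "W j = 0" if j: "j < a" for j
  proof (rule poly_eqI)
    fix i
    show "coeff (W j) i = coeff 0 i"
    proof (cases "i < ?e")
      case True
      have ij: "i * a + j < ?e * a" by (rule block_index_lt[OF True j])
      have "0 = ((1\<^sub>m ?e \<otimes>\<^sub>K G0 + ?T \<otimes>\<^sub>K G1) *\<^sub>v \<xi>) $ (i * a + j)" using zero ij by simp
      also have "\<dots> = (\<Sum>c<?e * a. (1\<^sub>m ?e \<otimes>\<^sub>K G0 + ?T \<otimes>\<^sub>K G1) $$ (i * a + j, c) * \<xi> $ c)"
        using ij \<xi> G Tc by (simp add: scalar_prod_def atLeast0LessThan)
      also have "\<dots> = (\<Sum>k<?e. \<Sum>l<a. (1\<^sub>m ?e \<otimes>\<^sub>K G0 + ?T \<otimes>\<^sub>K G1) $$ (i * a + j, k * a + l) * \<xi> $ (k * a + l))"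
        by (rule sum_mult_blocks)
      also have "\<dots> = (\<Sum>k<?e. \<Sum>l<a. (if k = i then G0 $$ (j, l) * \<xi> $ (k * a + l) else 0) + G1 $$ (j, l) * (?T $$ (i, k) * \<xi> $ (k * a + l)))"
      proof (intro sum.cong refl)
        fix k l assume "k \<in> {..<?e}" "l \<in> {..<a}"
        hence kl: "k < ?e" "l < a" "k * a + l < ?e * a" by (auto intro: block_index_lt)
        show "(1\<^sub>m ?e \<otimes>\<^sub>K G0 + ?T \<otimes>\<^sub>K G1) $$ (i * a + j, k * a + l) * \<xi> $ (k * a + l) =
          (if k = i then G0 $$ (j, l) * \<xi> $ (k * a + l) else 0) + G1 $$ (j, l) * (?T $$ (i, k) * \<xi> $ (k * a + l))"
          using kl ij True j G Tc by (auto simp: index_kron distrib_right)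
      qed
      also have "\<dots> = (\<Sum>l<a. \<Sum>k<?e. (if k = i then G0 $$ (j, l) * \<xi> $ (k * a + l) else 0) + G1 $$ (j, l) * (?T $$ (i, k) * \<xi> $ (k * a + l)))"
        by (rule sum.swap)
      also have "\<dots> = (\<Sum>l<a. G0 $$ (j, l) * \<xi> $ (i * a + l) + G1 $$ (j, l) * (\<Sum>k<?e. ?T $$ (i, k) * \<xi> $ (k * a + l)))"
        using True by (simp add: sum.distrib sum.delta sum_distrib_left)
      also have "\<dots> = coeff (W j) i" using True by (simp add: W_def coeff_sum cv cXv[OF True, symmetric])
      finally show ?thesis by simp
    next
      case False
      have "coeff (p mod q) i = 0" for p
        using degree_mod_less[OF q0, of p] False by (auto intro: coeff_eq_0)
      thus ?thesis using False by (simp add: W_def coeff_sum cv)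
    qed
  qed
  \<comment> \<open>\<open>s\<close> is the polynomial matrix applied to \<open>v\<close>; it agrees
    with \<open>W\<close>, which is zero, modulo \<open>q\<close>. The adjugate then makes det * v
    divisible by \<open>q\<close>.\<close>
  define s where "s j = (\<Sum>l<a. ?F $$ (j, l) * v l)" for j
  have qs: "q dvd s j" if j: "j < a" for j
  proof -
    have "s j - W j = (\<Sum>l<a. q * Polynomial.smult (G1 $$ (j, l)) ((?X * v l) div q))"
      unfolding s_def W_def sum_subtractf[symmetric]
    proof (intro sum.cong refl)
      fix l assume "l \<in> {..<a}"
      have "?F $$ (j, l) = [:G0 $$ (j, l):] + Polynomial.smult (G1 $$ (j, l)) ?X" using j \<open>l \<in> _\<close> by (simp add: poly_pencil_def)
      hence "?F $$ (j, l) * v l = Polynomial.smult (G0 $$ (j, l)) (v l) + Polynomial.smult (G1 $$ (j, l)) (?X * v l)"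
        by (simp add: distrib_right)
      moreover define y where "y = ?X * v l"
      moreover have "y = q * (y div q) + y mod q" by simp
      ultimately have F: "?F $$ (j, l) * v l = Polynomial.smult (G0 $$ (j, l)) (v l) + Polynomial.smult (G1 $$ (j, l)) (q * (y div q) + y mod q)"
        by metis
      show "?F $$ (j, l) * v l - (Polynomial.smult (G0 $$ (j, l)) (v l) + Polynomial.smult (G1 $$ (j, l)) ((?X * v l) mod q)) =
         q * Polynomial.smult (G1 $$ (j, l)) ((?X * v l) div q)"
        unfolding F y_def[symmetric] by (simp add: smult_diff_right[symmetric] minus_mod_eq_mult_div)
    qed
    also have "q dvd \<dots>" by (intro dvd_sum dvd_triv_left)
    finally show ?thesis using W0[OF j] by simp
  qed
  have Fc: "?F \<in> carrier_mat a a" by (simp add: poly_pencil_def)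
  have qd: "q dvd det ?F * v i" if i: "i < a" for i
  proof -
    note adj = adj_mat[OF Fc]
    have "(\<Sum>j<a. adj_mat ?F $$ (i, j) * s j) = (\<Sum>l<a. (\<Sum>j<a. adj_mat ?F $$ (i, j) * ?F $$ (j, l)) * v l)"
      unfolding s_def sum_distrib_left sum_distrib_right by (subst sum.swap) (simp add: mult.assoc)
    also have "\<dots> = (\<Sum>l<a. (adj_mat ?F * ?F) $$ (i, l) * v l)"
      using adj(1) Fc i by (intro sum.cong refl) (subst index_mult_mat_sum, auto)
    also have "\<dots> = (\<Sum>l<a. if l = i then det ?F * v l else 0)"
      using i unfolding adj(3) by (intro sum.cong refl) auto
    also have "\<dots> = det ?F * v i" using i by (simp add: sum.delta)
    finally have "det ?F * v i = (\<Sum>j<a. adj_mat ?F $$ (i, j) * s j)" by simp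
    also have "q dvd \<dots>" using qs by (intro dvd_sum dvd_mult) auto
    finally show ?thesis .
  qed
  have v0: "v i = 0" if i: "i < a" for i
  proof (rule ccontr)
    assume ne: "v i \<noteq> 0"
    \<comment> \<open>The shape of \<open>q\<close> makes the determinant a unit modulo
      \<open>q\<close>, so \<open>q\<close> divides \<open>v i\<close>, whose degree is too small
      unless it is zero.\<close>
    have "q = 1 + ?X * (det ?F * r)" unfolding q by (simp add: one_pCons)
    hence "v i = q * v i - ?X * r * (det ?F * v i)" by (simp add: algebra_simps)
    also have "q dvd \<dots>" by (rule dvd_diff[OF dvd_triv_left dvd_mult[OF qd[OF i]]])
    finally have "degree q \<le> degree (v i)" using ne by (rule dvd_imp_degree_le)
    moreover have "degree (v i) < degree q"
    proof -
      have "degree (v i) \<le> degree q - 1" by (rule degree_le) (use e in \<open>auto simp: cv\<close>)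
      thus ?thesis using e by simp
    qed
    ultimately show False by simp
  qed
  show "\<xi> = 0\<^sub>v (?e * a)"
  proof (rule eq_vecI)
    fix c assume "c < dim_vec (0\<^sub>v (?e * a) :: 'k vec)"
    hence c: "c < ?e * a" by simp
    have cd: "c div a < ?e" "c mod a < a" using c div_mult_lt mod_mult_lt by blast+
    have "\<xi> $ c = coeff (v (c mod a)) (c div a)" using cd by (simp add: cv)
    thus "\<xi> $ c = 0\<^sub>v (?e * a) $ c" using v0[OF cd(2)] c by simp
  qed (use \<xi> in auto)
qed

lemma lin_add_point:
  fixes x :: "'i \<Rightarrow> 'k::field mat"
  assumes "\<And>\<kappa>. \<kappa> \<in> I \<Longrightarrow> x \<kappa> \<in> carrier_mat m m" "\<And>\<kappa>. \<kappa> \<in> I \<Longrightarrow> x' \<kappa> \<in> carrier_mat m m"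
  shows "lin (*) I m p q (\<lambda>\<kappa>. x \<kappa> + x' \<kappa>) P = lin (*) I m p q x P + lin (*) I m p q x' P"
proof (rule eq_matI)
  fix i j assume "i < dim_row (lin (*) I m p q x P + lin (*) I m p q x' P)" "j < dim_col (lin (*) I m p q x P + lin (*) I m p q x' P)"
  hence ij: "i < m * p" "j < m * q" by auto
  have d: "dim_row (x \<kappa>) = m" "dim_col (x \<kappa>) = m" "dim_row (x' \<kappa>) = m" "dim_col (x' \<kappa>) = m" if "\<kappa> \<in> I" for \<kappa>
    using assms(1,2)[OF that] by auto
  have "(\<Sum>\<kappa>\<in>I. P \<kappa> $$ (i mod p, j mod q) * (x \<kappa> + x' \<kappa>) $$ (i div p, j div q)) =
    (\<Sum>\<kappa>\<in>I. P \<kappa> $$ (i mod p, j mod q) * x \<kappa> $$ (i div p, j div q) + P \<kappa> $$ (i mod p, j mod q) * x' \<kappa> $$ (i div p, j div q))"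
    using ij by (intro sum.cong) (auto simp: d div_mult_lt distrib_left)
  thus "lin (*) I m p q (\<lambda>\<kappa>. x \<kappa> + x' \<kappa>) P $$ (i, j) = (lin (*) I m p q x P + lin (*) I m p q x' P) $$ (i, j)"
    using ij by (simp add: index_lin sum.distrib)
qed auto

lemma lin_kron_point:
  fixes T :: "'k::field mat"
  assumes "finite I" "\<And>\<kappa>. \<kappa> \<in> I \<Longrightarrow> x \<kappa> \<in> carrier_mat m m" "\<And>\<kappa>. \<kappa> \<in> I \<Longrightarrow> P \<kappa> \<in> carrier_mat p q" "T \<in> carrier_mat e e"
  shows "lin (*) I (e * m) p q (\<lambda>\<kappa>. T \<otimes>\<^sub>K x \<kappa>) P = T \<otimes>\<^sub>K lin (*) I m p q x P"
  using assms(1-3)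
proof (induction I rule: finite_induct)
  case empty
  have "T \<otimes>\<^sub>K 0\<^sub>m (m * p) (m * q) = 0\<^sub>m (e * (m * p)) (e * (m * q))"
    using field_algebra.kron_scalar_zero_right[of T "m * p" "m * q"] assms(4) by (simp add: kron_scalar_field)
  then show ?case by (simp add: lin_empty mult.assoc)
next
  case (insert \<kappa> I)
  have c: "x \<kappa> \<in> carrier_mat m m" "P \<kappa> \<in> carrier_mat p q" using insert by auto
  have Tx: "T \<otimes>\<^sub>K x \<kappa> \<in> carrier_mat (e * m) (e * m)" using carrier_matD[OF c(1)] assms(4) by (auto intro!: carrier_matI)
  have IH: "lin (*) I (e * m) p q (\<lambda>\<kappa>. T \<otimes>\<^sub>K x \<kappa>) P = T \<otimes>\<^sub>K lin (*) I m p q x P" using insert by auto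
  have "lin (*) (insert \<kappa> I) (e * m) p q (\<lambda>\<kappa>. T \<otimes>\<^sub>K x \<kappa>) P = (T \<otimes>\<^sub>K x \<kappa>) \<otimes>\<^sub>K P \<kappa> + T \<otimes>\<^sub>K lin (*) I m p q x P"
    using insert(1,2) Tx c(2) IH by (subst lin_insert) (auto simp: kron_scalar_field)
  also have "(T \<otimes>\<^sub>K x \<kappa>) \<otimes>\<^sub>K P \<kappa> = T \<otimes>\<^sub>K (x \<kappa> \<otimes>\<^sub>K P \<kappa>)"
    using field_algebra.kron_scalar_assoc[of T "x \<kappa>" "P \<kappa>"] by (simp add: kron_scalar_field)
  also have "T \<otimes>\<^sub>K (x \<kappa> \<otimes>\<^sub>K P \<kappa>) + T \<otimes>\<^sub>K lin (*) I m p q x P = T \<otimes>\<^sub>K (x \<kappa> \<otimes>\<^sub>K P \<kappa> + lin (*) I m p q x P)"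
    using field_algebra.kron_scalar_add_right[of "x \<kappa> \<otimes>\<^sub>K P \<kappa>" "lin (*) I m p q x P" T] carrier_matD[OF c(1)] carrier_matD[OF c(2)]
    by (simp add: kron_scalar_field)
  also have "x \<kappa> \<otimes>\<^sub>K P \<kappa> + lin (*) I m p q x P = lin (*) (insert \<kappa> I) m p q x P"
    using insert(1,2) c by (subst lin_insert) (auto simp: kron_scalar_field)
  finally show ?case .
qed

text \<open>On the line through x and x' the determinant of the pencil of \<open>S\<close> is a
  polynomial that is nonzero at t = 0, and that of \<open>S'\<close> is nonzero at t = 1. Both are
  made units in one quotient of K[t], and t is replaced there by its matrix of
  multiplication.\<close>

lemma common_regular_point:
  fixes S S' :: "('i, 'k::field) descriptor"
  assumes fin: "finite I" and wf: "wf_descr I p q S" "wf_descr I p' q' S'"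
    and x: "\<And>\<kappa>. \<kappa> \<in> I \<Longrightarrow> x \<kappa> \<in> carrier_mat n n" "\<And>\<kappa>. \<kappa> \<in> I \<Longrightarrow> x' \<kappa> \<in> carrier_mat n n"
    and reg: "inverse_pair (n * state_dim S) (pencil (*) I n S x) M" "inverse_pair (n * state_dim S') (pencil (*) I n S' x') M'"
  obtains e z N N' where "e \<ge> 1" "\<And>\<kappa>. \<kappa> \<in> I \<Longrightarrow> z \<kappa> \<in> carrier_mat (e * n) (e * n)"
    "inverse_pair (e * n * state_dim S) (pencil (*) I (e * n) S z) N"
    "inverse_pair (e * n * state_dim S') (pencil (*) I (e * n) S' z) N'"
proof -
  define G where "G S = pencil (*) I n S x" for S :: "('i, 'k) descriptor"
  define H where "H S = pencil (*) I n S x' + - pencil (*) I n S x" for S :: "('i, 'k) descriptor"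
  have c: "G S \<in> carrier_mat (n * state_dim S) (n * state_dim S)" "H S \<in> carrier_mat (n * state_dim S) (n * state_dim S)" for S
    by (auto simp: G_def H_def intro!: carrier_matI)
  define f where "f S = det (poly_pencil (n * state_dim S) (G S) (H S))" for S
  have "G S + 0 \<cdot>\<^sub>m H S = pencil (*) I n S x" by (rule eq_matI) (auto simp: G_def H_def)
  hence "poly (f S) 0 = det (pencil (*) I n S x)" using poly_det_poly_pencil[OF c(1,2)[of S], of 0] by (simp add: f_def)
  moreover have "det (pencil (*) I n S x) \<noteq> 0"
    using reg(1) det_nonzero_iff_inverse_pair[of "pencil (*) I n S x" "n * state_dim S"] by (auto simp: inverse_pair_def)
  ultimately have f1: "f S \<noteq> 0" by auto
  have "G S' + 1 \<cdot>\<^sub>m H S' = pencil (*) I n S' x'" by (rule eq_matI) (auto simp: G_def H_def)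
  hence "poly (f S') 1 = det (pencil (*) I n S' x')" using poly_det_poly_pencil[OF c(1,2)[of S'], of 1] by (simp add: f_def)
  moreover have "det (pencil (*) I n S' x') \<noteq> 0"
    using reg(2) det_nonzero_iff_inverse_pair[of "pencil (*) I n S' x'" "n * state_dim S'"] by (auto simp: inverse_pair_def)
  ultimately have f2: "f S' \<noteq> 0" by auto
  \<comment> \<open>Q = 1 + t * f S * f S'. It has positive degree since both factors are nonzero,
    and each factor is a unit modulo \<open>Q\<close>; the cofactor r in
    \<open>mod_shift_regular\<close> is the respective other one.\<close>
  define Q where "Q = pCons 1 (f S * f S')"
  have dQ: "degree Q \<ge> 1" using f1 f2 by (simp add: Q_def)
  have Q2: "Q = pCons 1 (f S' * f S)" by (simp add: Q_def mult.commute)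
  define e where "e = degree Q"
  define T where "T = mod_shift Q"
  have T: "T \<in> carrier_mat e e" by (simp add: T_def e_def mod_shift_def)
  \<comment> \<open>The point x + t * (x' - x) of the line, with the matrix \<open>T\<close> in
    place of t.\<close>
  define z where "z \<kappa> = 1\<^sub>m e \<otimes>\<^sub>K x \<kappa> + T \<otimes>\<^sub>K (x' \<kappa> - x \<kappa>)" for \<kappa>
  have xd: "dim_row (x \<kappa>) = n" "dim_col (x \<kappa>) = n" "dim_row (x' \<kappa>) = n" "dim_col (x' \<kappa>) = n" if "\<kappa> \<in> I" for \<kappa>
    using x[OF that] by auto
  have zc: "z \<kappa> \<in> carrier_mat (e * n) (e * n)" if "\<kappa> \<in> I" for \<kappa>
    using xd[OF that] T by (auto simp: z_def intro!: carrier_matI)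
  have pen: "pencil (*) I (e * n) S z = 1\<^sub>m e \<otimes>\<^sub>K G S + T \<otimes>\<^sub>K H S" if wf: "wf_descr I p q S" for S p q
  proof -
    let ?N = "state_dim S"
    note P = wf_descr_carrier(5)[OF wf]
    have "lin (*) I (e * n) ?N ?N z (pen_coeff S) = lin (*) I (e * n) ?N ?N (\<lambda>\<kappa>. 1\<^sub>m e \<otimes>\<^sub>K x \<kappa>) (pen_coeff S)
       + lin (*) I (e * n) ?N ?N (\<lambda>\<kappa>. T \<otimes>\<^sub>K (x' \<kappa> - x \<kappa>)) (pen_coeff S)"
      unfolding z_def by (rule lin_add_point) (use xd T in \<open>auto intro!: carrier_matI\<close>)
    also have "lin (*) I (e * n) ?N ?N (\<lambda>\<kappa>. 1\<^sub>m e \<otimes>\<^sub>K x \<kappa>) (pen_coeff S) = 1\<^sub>m e \<otimes>\<^sub>K lin (*) I n ?N ?N x (pen_coeff S)"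
      by (rule lin_kron_point) (use fin x P in auto)
    also have "lin (*) I (e * n) ?N ?N (\<lambda>\<kappa>. T \<otimes>\<^sub>K (x' \<kappa> - x \<kappa>)) (pen_coeff S) = T \<otimes>\<^sub>K lin (*) I n ?N ?N (\<lambda>\<kappa>. x' \<kappa> - x \<kappa>) (pen_coeff S)"
      by (rule lin_kron_point) (use fin xd P T in \<open>auto intro!: carrier_matI\<close>)
    also have "lin (*) I n ?N ?N (\<lambda>\<kappa>. x' \<kappa> - x \<kappa>) (pen_coeff S) = lin (*) I n ?N ?N x' (pen_coeff S) - lin (*) I n ?N ?N x (pen_coeff S)"
      by (rule field_algebra.lin_minus_point) (use x in auto)
    also have "\<dots> = H S"
      using wf_descr_dims(5,6)[OF wf] by (intro eq_matI) (auto simp: H_def pencil_def)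
    finally have l: "lin (*) I (e * n) ?N ?N z (pen_coeff S) = 1\<^sub>m e \<otimes>\<^sub>K lin (*) I n ?N ?N x (pen_coeff S) + T \<otimes>\<^sub>K H S" .
    have "1\<^sub>m e \<otimes>\<^sub>K G S = 1\<^sub>m e \<otimes>\<^sub>K kron_scalar (*) (1\<^sub>m n) (pen_const S) + 1\<^sub>m e \<otimes>\<^sub>K lin (*) I n ?N ?N x (pen_coeff S)"
      unfolding G_def pencil_def by (rule one_kron_add) (use wf_descr_dims(5,6)[OF wf] in auto)
    also have "1\<^sub>m e \<otimes>\<^sub>K kron_scalar (*) (1\<^sub>m n) (pen_const S) = kron_scalar (*) (1\<^sub>m (e * n)) (pen_const S)"
      by (rule field_algebra.const_one_kron[symmetric])
    finally show ?thesis unfolding pencil_def l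
      using wf_descr_dims(5,6)[OF wf] T carrier_matD[OF c(2)[of S]] by (simp add: mat_add_assoc mult.assoc)
  qed
  have "\<exists>B. inverse_pair (e * (n * state_dim S)) (1\<^sub>m e \<otimes>\<^sub>K G S + T \<otimes>\<^sub>K H S) B"
    unfolding e_def T_def by (rule mod_shift_regular[OF c(1,2)[of S] Q_def[unfolded f_def[of S]] dQ])
  then obtain N where N: "inverse_pair (e * (n * state_dim S)) (pencil (*) I (e * n) S z) N"
    unfolding pen[OF wf(1)] by blast
  have "\<exists>B. inverse_pair (e * (n * state_dim S')) (1\<^sub>m e \<otimes>\<^sub>K G S' + T \<otimes>\<^sub>K H S') B"
    unfolding e_def T_def by (rule mod_shift_regular[OF c(1,2)[of S'] Q2[unfolded f_def[of S']] dQ])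
  then obtain N' where N': "inverse_pair (e * (n * state_dim S')) (pencil (*) I (e * n) S' z) N'"
    unfolding pen[OF wf(2)] by blast
  show ?thesis by (rule that[of e z N N']) (use dQ zc N N' in \<open>auto simp: e_def mult.assoc\<close>)
qed

section \<open>Sums, products and inverses of linear representations\<close>

definition inl_mat :: "nat \<Rightarrow> nat \<Rightarrow> 'k::zero_neq_one mat" where
  "inl_mat a b = mat (a + b) a (\<lambda>(i, j). if i = j then 1 else 0)"
definition inr_mat :: "nat \<Rightarrow> nat \<Rightarrow> 'k::zero_neq_one mat" where
  "inr_mat a b = mat (a + b) b (\<lambda>(i, j). if i = a + j then 1 else 0)"
definition prl_mat :: "nat \<Rightarrow> nat \<Rightarrow> 'k::zero_neq_one mat" where
  "prl_mat a b = mat a (a + b) (\<lambda>(i, j). if j = i then 1 else 0)"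
definition prr_mat :: "nat \<Rightarrow> nat \<Rightarrow> 'k::zero_neq_one mat" where
  "prr_mat a b = mat b (a + b) (\<lambda>(i, j). if j = a + i then 1 else 0)"

lemma dim_inj_mat [simp]:
  "dim_row (inl_mat a b) = a + b" "dim_col (inl_mat a b) = a" "dim_row (inr_mat a b) = a + b" "dim_col (inr_mat a b) = b"
  "dim_row (prl_mat a b) = a" "dim_col (prl_mat a b) = a + b" "dim_row (prr_mat a b) = b" "dim_col (prr_mat a b) = a + b"
  by (simp_all add: inl_mat_def inr_mat_def prl_mat_def prr_mat_def)

lemma sum_if_mult_if:
  fixes m u v :: nat
  shows "(\<Sum>k<m. (if k = u then 1 else 0) * (if k = v then 1 else (0::'k::semiring_1))) = (if u = v \<and> u < m then 1 else 0)"
  by (induction m) (auto simp: less_Suc_eq)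

lemma inj_mat_mult:
  "prl_mat a b * inl_mat a b = (1\<^sub>m a :: 'k::semiring_1 mat)" "prr_mat a b * inr_mat a b = (1\<^sub>m b :: 'k mat)"
  "prl_mat a b * inr_mat a b = (0\<^sub>m a b :: 'k mat)" "prr_mat a b * inl_mat a b = (0\<^sub>m b a :: 'k mat)"
proof -
  have l: "(prl_mat a b * inl_mat a b) $$ (i, j) = (if i = j then 1 else (0::'k))" if "i < a" "j < a" for i j
    using that by (subst index_mult_mat_sum) (auto simp: prl_mat_def inl_mat_def sum_if_mult_if cong: if_cong)
  have r: "(prr_mat a b * inr_mat a b) $$ (i, j) = (if i = j then 1 else (0::'k))" if "i < b" "j < b" for i j
    using that by (subst index_mult_mat_sum) (auto simp: prr_mat_def inr_mat_def sum_if_mult_if cong: if_cong)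
  have lr: "(prl_mat a b * inr_mat a b) $$ (i, j) = (0::'k)" if "i < a" "j < b" for i j
    using that by (subst index_mult_mat_sum) (auto simp: prl_mat_def inr_mat_def sum_if_mult_if cong: if_cong)
  have rl: "(prr_mat a b * inl_mat a b) $$ (i, j) = (0::'k)" if "i < b" "j < a" for i j
    using that by (subst index_mult_mat_sum) (auto simp: prr_mat_def inl_mat_def sum_if_mult_if cong: if_cong)
  show "prl_mat a b * inl_mat a b = (1\<^sub>m a :: 'k mat)" by (rule eq_matI) (use l in \<open>simp_all del: index_mult_mat(1)\<close>)
  show "prr_mat a b * inr_mat a b = (1\<^sub>m b :: 'k mat)" by (rule eq_matI) (use r in \<open>simp_all del: index_mult_mat(1)\<close>)
  show "prl_mat a b * inr_mat a b = (0\<^sub>m a b :: 'k mat)" by (rule eq_matI) (use lr in \<open>simp_all del: index_mult_mat(1)\<close>)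
  show "prr_mat a b * inl_mat a b = (0\<^sub>m b a :: 'k mat)" by (rule eq_matI) (use rl in \<open>simp_all del: index_mult_mat(1)\<close>)
qed

lemma inj_mat_sum: "inl_mat a b * prl_mat a b + inr_mat a b * prr_mat a b = (1\<^sub>m (a + b) :: 'k::semiring_1 mat)"
proof (rule eq_matI)
  fix i j assume "i < dim_row (1\<^sub>m (a + b) :: 'k mat)" "j < dim_col (1\<^sub>m (a + b) :: 'k mat)"
  hence ij: "i < a + b" "j < a + b" by auto
  have l: "(inl_mat a b * prl_mat a b) $$ (i, j) = (if i = j \<and> i < a then 1 else (0::'k))"
  proof -
    have "(inl_mat a b * prl_mat a b) $$ (i, j) = (\<Sum>k<a. (if k = i then 1 else 0) * (if k = j then 1 else (0::'k)))"
      using ij by (subst index_mult_mat_sum) (auto simp: prl_mat_def inl_mat_def intro!: sum.cong)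
    thus ?thesis by (simp add: sum_if_mult_if)
  qed
  have r: "(inr_mat a b * prr_mat a b) $$ (i, j) = (if i = j \<and> a \<le> i then 1 else (0::'k))"
  proof -
    have "(inr_mat a b * prr_mat a b) $$ (i, j) = (\<Sum>k<b. if k = i - a \<and> a \<le> i then (if i = j then 1 else 0) else (0::'k))"
      using ij by (subst index_mult_mat_sum) (auto simp: prr_mat_def inr_mat_def intro!: sum.cong)
    also have "\<dots> = (if i = j \<and> a \<le> i then 1 else 0)"
    proof (cases "a \<le> i")
      case True
      hence "i - a < b" using ij by simp
      thus ?thesis using True by (simp add: sum.delta)
    qed auto
    finally show ?thesis .
  qed
  show "(inl_mat a b * prl_mat a b + inr_mat a b * prr_mat a b) $$ (i, j) = (1\<^sub>m (a + b) :: 'k mat) $$ (i, j)"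
    using ij l r by (simp del: index_mult_mat(1))
qed auto

text \<open>Block decomposition by injections and projections. For the maps 1 \<otimes> inl and 1
  \<otimes> inr the two summands are interleaved, as \<open>m\<close> is the outer index; the
  equations hold all the same, and block calculations avoid permutations.\<close>

definition block_system :: "'a::ring_1 mat \<Rightarrow> 'a mat \<Rightarrow> 'a mat \<Rightarrow> 'a mat \<Rightarrow> nat \<Rightarrow> nat \<Rightarrow> nat \<Rightarrow> bool" where
  "block_system I1 I2 P1 P2 n1 n2 n \<longleftrightarrow>
     I1 \<in> carrier_mat n n1 \<and> I2 \<in> carrier_mat n n2 \<and> P1 \<in> carrier_mat n1 n \<and> P2 \<in> carrier_mat n2 n \<and>
     P1 * I1 = 1\<^sub>m n1 \<and> P2 * I2 = 1\<^sub>m n2 \<and> P1 * I2 = 0\<^sub>m n1 n2 \<and> P2 * I1 = 0\<^sub>m n2 n1 \<and> I1 * P1 + I2 * P2 = 1\<^sub>m n"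

context
  fixes I1 I2 P1 P2 :: "'a::ring_1 mat" and n1 n2 n :: nat
  assumes bs: "block_system I1 I2 P1 P2 n1 n2 n"
begin

lemma block_dims:
  "dim_row I1 = n" "dim_col I1 = n1" "dim_row I2 = n" "dim_col I2 = n2" "dim_row P1 = n1" "dim_col P1 = n" "dim_row P2 = n2" "dim_col P2 = n"
  using bs by (auto simp: block_system_def)

lemma block_eqs:
  "P1 * I1 = 1\<^sub>m n1" "P2 * I2 = 1\<^sub>m n2" "P1 * I2 = 0\<^sub>m n1 n2" "P2 * I1 = 0\<^sub>m n2 n1" "I1 * P1 + I2 * P2 = 1\<^sub>m n"
  using bs by (auto simp: block_system_def)

lemma block_eqs':
  "dim_row Z = n1 \<Longrightarrow> P1 * (I1 * Z) = Z" "dim_row Y = n2 \<Longrightarrow> P2 * (I2 * Y) = Y"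
  "dim_row Y = n2 \<Longrightarrow> P1 * (I2 * Y) = 0\<^sub>m n1 (dim_col Y)" "dim_row Z = n1 \<Longrightarrow> P2 * (I1 * Z) = 0\<^sub>m n2 (dim_col Z)"
  using mat_mult_assoc[of P1 I1 Z] mat_mult_assoc[of P2 I2 Y] mat_mult_assoc[of P1 I2 Y] mat_mult_assoc[of P2 I1 Z]
  by (auto simp: block_dims block_eqs)

text \<open>In block form the matrix is [[L1, U], [0, L2]] and its inverse is [[M1, - M1 U M2],
  [0, M2]].\<close>

lemma block_triangular_inverse:
  assumes L1: "inverse_pair n1 L1 M1" and L2: "inverse_pair n2 L2 M2" and U: "U \<in> carrier_mat n1 n2"
  shows "inverse_pair n (I1 * (L1 * P1) + (I2 * (L2 * P2) + I1 * (U * P2)))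
     (I1 * (M1 * P1) + (I2 * (M2 * P2) + - (I1 * (M1 * (U * (M2 * P2))))))" (is "inverse_pair n ?L ?M")
proof -
  note d = block_dims inverse_pair_dims[OF L1] inverse_pair_dims[OF L2] carrier_matD[OF U]
  have "?L * ?M = I1 * P1 + I2 * P2"
    using d by (simp add: mat_dim_simps block_eqs' inverse_pair_cancel[OF L1] inverse_pair_cancel[OF L2])
  moreover have "?M * ?L = I1 * P1 + I2 * P2"
    using d by (simp add: mat_dim_simps block_eqs' inverse_pair_cancel[OF L1] inverse_pair_cancel[OF L2])
  ultimately show ?thesis using d block_eqs by (auto simp: inverse_pair_def intro!: carrier_matI)
qed

lemma block_triangular_values:
  assumes L1: "inverse_pair n1 L1 M1" and L2: "inverse_pair n2 L2 M2" and U: "U \<in> carrier_mat n1 n2"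
  defines "M \<equiv> I1 * (M1 * P1) + (I2 * (M2 * P2) + - (I1 * (M1 * (U * (M2 * P2)))))"
  shows "dim_row Z = n1 \<Longrightarrow> P1 * (M * (I1 * Z)) = M1 * Z"
    and "dim_row Z = n2 \<Longrightarrow> P1 * (M * (I2 * Z)) = - (M1 * (U * (M2 * Z)))"
    and "dim_row Z = n1 \<Longrightarrow> P2 * (M * (I1 * Z)) = 0\<^sub>m n2 (dim_col Z)"
    and "dim_row Z = n2 \<Longrightarrow> P2 * (M * (I2 * Z)) = M2 * Z"
  unfolding M_def
  using block_dims inverse_pair_dims[OF L1] inverse_pair_dims[OF L2] carrier_matD[OF U]
  by (simp_all add: mat_dim_simps block_eqs')

text \<open>The zero block leaves a left inverse for the first diagonal block and a right inverse
  for the second. Over a general ring no more can be said; stable finiteness will make both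
  two-sided.\<close>

lemma block_triangular_left_right:
  assumes L1: "L1 \<in> carrier_mat n1 n1" and L2: "L2 \<in> carrier_mat n2 n2" and U: "U \<in> carrier_mat n1 n2"
    and M: "inverse_pair n (I1 * (L1 * P1) + (I2 * (L2 * P2) + I1 * (U * P2))) M"
  shows "(P1 * (M * I1)) * L1 = 1\<^sub>m n1" "L2 * (P2 * (M * I2)) = 1\<^sub>m n2"
proof -
  let ?L = "I1 * (L1 * P1) + (I2 * (L2 * P2) + I1 * (U * P2))"
  note d = block_dims inverse_pair_dims(3,4)[OF M] carrier_matD[OF U] carrier_matD[OF L1] carrier_matD[OF L2]
  have "I1 * L1 = ?L * I1" using d by (simp add: mat_dim_simps block_eqs' block_eqs)
  hence "(P1 * (M * I1)) * L1 = P1 * (M * (?L * I1))" using d by (simp add: mat_mult_assoc)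
  also have "M * (?L * I1) = I1" by (rule inverse_pair_cancel(2)[OF M]) (simp add: d)
  finally show "(P1 * (M * I1)) * L1 = 1\<^sub>m n1" by (simp add: block_eqs)
  have "L2 * P2 = P2 * ?L" using d by (simp add: mat_dim_simps block_eqs')
  moreover have "L2 * (P2 * (M * I2)) = (L2 * P2) * (M * I2)" using d by (intro mat_mult_assoc[symmetric]) auto
  ultimately have "L2 * (P2 * (M * I2)) = (P2 * ?L) * (M * I2)" by simp
  also have "\<dots> = P2 * (?L * (M * I2))" using d by (intro mat_mult_assoc) auto
  also have "?L * (M * I2) = I2" by (rule inverse_pair_cancel(1)[OF M]) (simp add: d)
  finally show "L2 * (P2 * (M * I2)) = 1\<^sub>m n2" by (simp add: block_eqs)
qed

text \<open>In block form the matrix is [[L, B], [-C, 0]]. Eliminating L leaves the Schur complement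
  C L^-1 B, whose inverse \<open>W\<close> is the lower right block of the inverse.\<close>

lemma schur_inverse:
  assumes L: "inverse_pair n1 L M" and B: "B \<in> carrier_mat n1 n2" and C: "C \<in> carrier_mat n2 n1"
    and W: "inverse_pair n2 (C * (M * B)) W"
  shows "inverse_pair n (I1 * (L * P1) + (I1 * (B * P2) + - (I2 * (C * P1))))
     (I1 * (M * P1) + (- (I1 * (M * (B * (W * (C * (M * P1)))))) + (- (I1 * (M * (B * (W * P2)))) +
       (I2 * (W * (C * (M * P1))) + I2 * (W * P2)))))" (is "inverse_pair n ?L ?M")
proof -
  note d = block_dims inverse_pair_dims[OF L] inverse_pair_dims(3,4)[OF W] carrier_matD[OF B] carrier_matD[OF C]
  have CMB: "C * (M * (B * (W * Z))) = Z" "W * (C * (M * (B * Z))) = Z" if "dim_row Z = n2" for Z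
    using inverse_pair_cancel[OF W that] d that by (simp_all add: mat_mult_assoc)
  have "?L * ?M = I1 * P1 + I2 * P2"
    using d by (simp add: mat_dim_simps block_eqs' inverse_pair_cancel[OF L] CMB)
      (simp add: mat_add_left_comm mat_add_comm mat_dim_simps)
  moreover have "?M * ?L = I1 * P1 + I2 * P2"
    using d by (simp add: mat_dim_simps block_eqs' inverse_pair_cancel[OF L] CMB)
      (simp add: mat_add_left_comm mat_add_comm mat_dim_simps)
  ultimately show ?thesis using d block_eqs by (auto simp: inverse_pair_def intro!: carrier_matI)
qed

lemma schur_value:
  assumes L: "inverse_pair n1 L M" and B: "B \<in> carrier_mat n1 n2" and C: "C \<in> carrier_mat n2 n1" and W: "W \<in> carrier_mat n2 n2"
  shows "P2 * ((I1 * (M * P1) + (- (I1 * (M * (B * (W * (C * (M * P1)))))) + (- (I1 * (M * (B * (W * P2)))) +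
       (I2 * (W * (C * (M * P1))) + I2 * (W * P2))))) * I2) = W"
  using block_dims inverse_pair_dims[OF L] carrier_matD[OF B] carrier_matD[OF C] carrier_matD[OF W]
  by (simp add: mat_dim_simps block_eqs' block_eqs)

text \<open>Let x and w be the blocks of the second block column of \<open>M'\<close>. That
  \<open>M'\<close> is a right inverse says L x + B w = 0 and - C x = 1; eliminating x gives C L^-1
  B w = 1.\<close>

lemma schur_right_inverse:
  assumes L: "inverse_pair n1 L M" and B: "B \<in> carrier_mat n1 n2" and C: "C \<in> carrier_mat n2 n1"
    and M': "inverse_pair n (I1 * (L * P1) + (I1 * (B * P2) + - (I2 * (C * P1)))) M'"
  shows "(C * (M * B)) * (P2 * (M' * I2)) = 1\<^sub>m n2"
proof -
  let ?L = "I1 * (L * P1) + (I1 * (B * P2) + - (I2 * (C * P1)))"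
  note d = block_dims inverse_pair_dims[OF L] inverse_pair_dims(3,4)[OF M'] carrier_matD[OF B] carrier_matD[OF C]
  let ?x = "P1 * (M' * I2)" and ?W = "P2 * (M' * I2)"
  have LM: "?L * (M' * I2) = I2" by (rule inverse_pair_cancel(1)[OF M']) (simp add: d)
  have P1L: "P1 * (?L * Z) = L * (P1 * Z) + B * (P2 * Z)" if "dim_row Z = n" for Z
    using d that by (simp add: mat_dim_simps block_eqs')
  have P2L: "P2 * (?L * Z) = - (C * (P1 * Z))" if "dim_row Z = n" for Z
    using d that by (simp add: mat_dim_simps block_eqs')
  have 1: "L * ?x + B * ?W = 0\<^sub>m n1 n2" using P1L[of "M' * I2"] d by (simp add: LM block_eqs)
  have 2: "- (C * ?x) = 1\<^sub>m n2" using P2L[of "M' * I2"] d by (simp add: LM block_eqs)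
  have "M * (L * ?x + B * ?W) = ?x + M * (B * ?W)" using d by (simp add: mat_mult_add_distrib inverse_pair_cancel[OF L])
  hence "?x + M * (B * ?W) = 0\<^sub>m n1 n2" using d by (simp add: 1)
  hence "C * (?x + M * (B * ?W)) = 0\<^sub>m n2 n2" using d by simp
  hence "C * ?x + C * (M * (B * ?W)) = 0\<^sub>m n2 n2" using d by (simp add: mat_mult_add_distrib)
  hence "- (C * ?x) + (C * ?x + C * (M * (B * ?W))) = - (C * ?x) + 0\<^sub>m n2 n2" by simp
  moreover have "- (C * ?x) + (C * ?x + C * (M * (B * ?W))) = C * (M * (B * ?W))"
    by (rule mat_add_uminus_cancel(2)) (simp_all add: d)
  moreover have "- (C * ?x) + 0\<^sub>m n2 n2 = - (C * ?x)" by (rule mat_add_zero(1)) (simp_all add: d)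
  ultimately have "C * (M * (B * ?W)) = 1\<^sub>m n2" using 2 by simp
  thus ?thesis using d by (simp add: mat_mult_assoc)
qed

end

text \<open>Systems whose value is c * pencil(x)^-1 * b with constant c and b, that is, classical
  linear representations. This form is closed under sums, products and inverses.\<close>

definition const_input :: "'i set \<Rightarrow> nat \<Rightarrow> nat \<Rightarrow> ('i, 'k::field) descriptor \<Rightarrow> bool" where
  "const_input I p q S \<longleftrightarrow> wf_descr I p q S \<and> feed S = 0\<^sub>m p q \<and> (\<forall>\<kappa>\<in>I. inp_coeff S \<kappa> = 0\<^sub>m (state_dim S) q)"

definition linear_rep :: "nat \<Rightarrow> 'k mat \<Rightarrow> 'k mat \<Rightarrow> ('i \<Rightarrow> 'k mat) \<Rightarrow> 'k mat \<Rightarrow> ('i, 'k::field) descriptor" where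
  "linear_rep N c PC P b = Descriptor N (0\<^sub>m (dim_row c) (dim_col b)) c PC P b (\<lambda>_. 0\<^sub>m N (dim_col b))"

lemma linear_rep_simps [simp]:
  "state_dim (linear_rep N c PC P b) = N" "outp (linear_rep N c PC P b) = c" "pen_const (linear_rep N c PC P b) = PC"
  "pen_coeff (linear_rep N c PC P b) = P" "inp_const (linear_rep N c PC P b) = b"
  by (simp_all add: linear_rep_def)

lemma const_input_linear_rep:
  assumes "c \<in> carrier_mat p N" "PC \<in> carrier_mat N N" "\<And>\<kappa>. \<kappa> \<in> I \<Longrightarrow> P \<kappa> \<in> carrier_mat N N" "b \<in> carrier_mat N q"
  shows "const_input I p q (linear_rep N c PC P b)"
  using assms by (auto simp: const_input_def wf_descr_def linear_rep_def)

text \<open>The pencil is [[P1, U], [0, P2]] with P1 and P2 the pencils of \<open>S1\<close> and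
  \<open>S2\<close> and a constant coupling U; \<open>c\<close> and \<open>b\<close> select what is
  read from its inverse.\<close>

definition couple :: "'k mat \<Rightarrow> 'k mat \<Rightarrow> 'k mat \<Rightarrow> ('i, 'k::field) descriptor \<Rightarrow> ('i, 'k) descriptor \<Rightarrow> ('i, 'k) descriptor" where
  "couple c b U S1 S2 = (let a = state_dim S1; d = state_dim S2 in linear_rep (a + d) c
     (inl_mat a d * (pen_const S1 * prl_mat a d) + (inr_mat a d * (pen_const S2 * prr_mat a d) + inl_mat a d * (U * prr_mat a d)))
     (\<lambda>\<kappa>. inl_mat a d * (pen_coeff S1 \<kappa> * prl_mat a d) + inr_mat a d * (pen_coeff S2 \<kappa> * prr_mat a d)) b)"

text \<open>The pencil is [[P, b], [-c, 0]], with Schur complement c P^-1 b, the value of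
  \<open>S\<close>. The corner read from its inverse is the inverse of that value.\<close>

definition schur_rep :: "('i, 'k::field) descriptor \<Rightarrow> ('i, 'k) descriptor" where
  "schur_rep S = (let a = state_dim S in linear_rep (a + 1) (prr_mat a 1)
     (inl_mat a 1 * (pen_const S * prl_mat a 1) + (inl_mat a 1 * (inp_const S * prr_mat a 1) + - (inr_mat a 1 * (outp S * prl_mat a 1))))
     (\<lambda>\<kappa>. inl_mat a 1 * (pen_coeff S \<kappa> * prl_mat a 1)) (inr_mat a 1))"

section \<open>Pencils of coupled systems: inverses, and regularity of the parts\<close>

context unital_algebra begin

definition rep_at :: "'i set \<Rightarrow> nat \<Rightarrow> ('i, 'k) descriptor \<Rightarrow> ('i \<Rightarrow> 'a mat) \<Rightarrow> 'a mat \<Rightarrow> bool" where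
  "rep_at I m S x V \<longleftrightarrow> (\<exists>M. inverse_pair (m * state_dim S) (pencil scale I m S x) M \<and>
     V = (1\<^sub>m m \<star> outp S) * (M * (1\<^sub>m m \<star> inp_const S)))"

lemma descr_at_iff_rep_at:
  assumes "const_input I p q S"
  shows "descr_at scale I m S x V \<longleftrightarrow> rep_at I m S x V"
proof -
  have wf: "wf_descr I p q S" using assms by (simp add: const_input_def)
  note d = wf_descr_dims[OF wf]
  have "lin scale I m (state_dim S) q x (inp_coeff S) = lin scale I m (state_dim S) q x (\<lambda>\<kappa>. 0\<^sub>m (state_dim S) q)"
    by (rule lin_cong) (use assms in \<open>auto simp: const_input_def\<close>)
  hence "input scale I m S x = 1\<^sub>m m \<star> inp_const S"
    using d by (simp add: input_def lin_zero_coeff mat_add_zero)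
  moreover have "1\<^sub>m m \<star> feed S = 0\<^sub>m (m * p) (m * q)" using assms by (simp add: const_input_def kron_scalar_zero_right)
  ultimately have "1\<^sub>m m \<star> feed S + (1\<^sub>m m \<star> outp S) * (M * input scale I m S x) = (1\<^sub>m m \<star> outp S) * (M * (1\<^sub>m m \<star> inp_const S))" for M
    using d by (simp add: mat_add_zero)
  thus ?thesis by (simp add: descr_at_def rep_at_def)
qed

lemma block_system_inj:
  "block_system (1\<^sub>m m \<star> inl_mat a b) (1\<^sub>m m \<star> inr_mat a b) (1\<^sub>m m \<star> prl_mat a b) (1\<^sub>m m \<star> prr_mat a b) (m * a) (m * b) (m * (a + b))"
  unfolding block_system_def
  by (auto simp: kron_scalar_mult inj_mat_mult kron_scalar_one kron_scalar_zero_right inj_mat_sum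
     kron_scalar_add_right[symmetric] intro!: carrier_matI)

context
  fixes I :: "'i set" and m :: nat and x :: "'i \<Rightarrow> 'a mat"
  assumes fin: "finite I" and x: "\<And>\<kappa>. \<kappa> \<in> I \<Longrightarrow> x \<kappa> \<in> carrier_mat m m"
begin

lemma lin_sandwich:
  assumes "\<And>\<kappa>. \<kappa> \<in> I \<Longrightarrow> P \<kappa> \<in> carrier_mat p q" "G \<in> carrier_mat r p" "H \<in> carrier_mat q t"
  shows "lin scale I m r t x (\<lambda>\<kappa>. G * (P \<kappa> * H)) = (1\<^sub>m m \<star> G) * (lin scale I m p q x P * (1\<^sub>m m \<star> H))"
proof -
  have "lin scale I m p q x P * (1\<^sub>m m \<star> H) = lin scale I m p t x (\<lambda>\<kappa>. P \<kappa> * H)"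
    by (rule lin_mult_right[OF fin x assms(1,3)])
  moreover have "(1\<^sub>m m \<star> G) * lin scale I m p t x (\<lambda>\<kappa>. P \<kappa> * H) = lin scale I m r t x (\<lambda>\<kappa>. G * (P \<kappa> * H))"
    by (rule lin_mult_left[OF fin x _ assms(2)]) (use mult_carrier_mat[OF assms(1) assms(3)] in auto)
  ultimately show ?thesis by simp
qed

lemma pencil_couple:
  assumes S1: "wf_descr I p q S1" and S2: "wf_descr I p' q' S2" and U: "U \<in> carrier_mat (state_dim S1) (state_dim S2)"
  defines "a \<equiv> state_dim S1" and "d \<equiv> state_dim S2"
  shows "pencil scale I m (couple c b U S1 S2) x =
     (1\<^sub>m m \<star> inl_mat a d) * (pencil scale I m S1 x * (1\<^sub>m m \<star> prl_mat a d)) +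
     ((1\<^sub>m m \<star> inr_mat a d) * (pencil scale I m S2 x * (1\<^sub>m m \<star> prr_mat a d)) +
      (1\<^sub>m m \<star> inl_mat a d) * ((1\<^sub>m m \<star> U) * (1\<^sub>m m \<star> prr_mat a d)))"
proof -
  note A1 = wf_descr_carrier[OF S1, folded a_def] and A2 = wf_descr_carrier[OF S2, folded d_def]
  note d1 = wf_descr_dims[OF S1, folded a_def] and d2 = wf_descr_dims[OF S2, folded d_def]
  have inj: "inl_mat a d \<in> carrier_mat (a + d) a" "inr_mat a d \<in> carrier_mat (a + d) d" "prl_mat a d \<in> carrier_mat a (a + d)" "prr_mat a d \<in> carrier_mat d (a + d)"
    by (auto intro!: carrier_matI)
  have "lin scale I m (a + d) (a + d) x (\<lambda>\<kappa>. inl_mat a d * (pen_coeff S1 \<kappa> * prl_mat a d) + inr_mat a d * (pen_coeff S2 \<kappa> * prr_mat a d)) =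
    lin scale I m (a + d) (a + d) x (\<lambda>\<kappa>. inl_mat a d * (pen_coeff S1 \<kappa> * prl_mat a d)) + lin scale I m (a + d) (a + d) x (\<lambda>\<kappa>. inr_mat a d * (pen_coeff S2 \<kappa> * prr_mat a d))"
    by (rule lin_add_coeff[OF unital_algebra_axioms]) (auto intro!: carrier_matI)
  also have "lin scale I m (a + d) (a + d) x (\<lambda>\<kappa>. inl_mat a d * (pen_coeff S1 \<kappa> * prl_mat a d)) =
    (1\<^sub>m m \<star> inl_mat a d) * (lin scale I m a a x (pen_coeff S1) * (1\<^sub>m m \<star> prl_mat a d))"
    by (rule lin_sandwich[OF A1(5) inj(1,3)])
  also have "lin scale I m (a + d) (a + d) x (\<lambda>\<kappa>. inr_mat a d * (pen_coeff S2 \<kappa> * prr_mat a d)) =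
    (1\<^sub>m m \<star> inr_mat a d) * (lin scale I m d d x (pen_coeff S2) * (1\<^sub>m m \<star> prr_mat a d))"
    by (rule lin_sandwich[OF A2(5) inj(2,4)])
  finally show ?thesis
    using d1(1-8) d2(1-8) carrier_matD[OF U, folded a_def d_def]
    by (simp add: couple_def Let_def pencil_def a_def[symmetric] d_def[symmetric] kron_scalar_add_right kron_scalar_mult mat_dim_simps)
      (simp add: mat_add_left_comm mat_add_comm mat_dim_simps)
qed

lemma pencil_schur:
  assumes S: "wf_descr I 1 1 S"
  defines "a \<equiv> state_dim S"
  shows "pencil scale I m (schur_rep S) x =
     (1\<^sub>m m \<star> inl_mat a 1) * (pencil scale I m S x * (1\<^sub>m m \<star> prl_mat a 1)) +
     ((1\<^sub>m m \<star> inl_mat a 1) * ((1\<^sub>m m \<star> inp_const S) * (1\<^sub>m m \<star> prr_mat a 1)) +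
      - ((1\<^sub>m m \<star> inr_mat a 1) * ((1\<^sub>m m \<star> outp S) * (1\<^sub>m m \<star> prl_mat a 1))))"
proof -
  note A = wf_descr_carrier[OF S, folded a_def] and d = wf_descr_dims[OF S, folded a_def]
  have inj: "inl_mat a 1 \<in> carrier_mat (a + 1) a" "prl_mat a 1 \<in> carrier_mat a (a + 1)"
    by (auto intro!: carrier_matI)
  have "lin scale I m (a + 1) (a + 1) x (\<lambda>\<kappa>. inl_mat a 1 * (pen_coeff S \<kappa> * prl_mat a 1)) =
    (1\<^sub>m m \<star> inl_mat a 1) * (lin scale I m a a x (pen_coeff S) * (1\<^sub>m m \<star> prl_mat a 1))"
    by (rule lin_sandwich[OF A(5) inj])
  thus ?thesis
    using d(1-8)
    by (simp add: schur_rep_def Let_def pencil_def a_def[symmetric] kron_scalar_add_right kron_scalar_uminus_right kron_scalar_mult mat_dim_simps)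
      (simp add: mat_add_left_comm mat_add_comm mat_dim_simps)
qed

lemma couple_inverse:
  assumes S1: "wf_descr I p q S1" and S2: "wf_descr I p' q' S2" and U: "U \<in> carrier_mat (state_dim S1) (state_dim S2)"
    and M1: "inverse_pair (m * state_dim S1) (pencil scale I m S1 x) M1" and M2: "inverse_pair (m * state_dim S2) (pencil scale I m S2 x) M2"
  defines "a \<equiv> state_dim S1" and "d \<equiv> state_dim S2"
  shows "\<exists>M. inverse_pair (m * (a + d)) (pencil scale I m (couple c b U S1 S2) x) M \<and>
    (\<forall>Z. dim_row Z = m * a \<longrightarrow> (1\<^sub>m m \<star> prl_mat a d) * (M * ((1\<^sub>m m \<star> inl_mat a d) * Z)) = M1 * Z) \<and>
    (\<forall>Z. dim_row Z = m * d \<longrightarrow> (1\<^sub>m m \<star> prl_mat a d) * (M * ((1\<^sub>m m \<star> inr_mat a d) * Z)) = - (M1 * ((1\<^sub>m m \<star> U) * (M2 * Z)))) \<and>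
    (\<forall>Z. dim_row Z = m * a \<longrightarrow> (1\<^sub>m m \<star> prr_mat a d) * (M * ((1\<^sub>m m \<star> inl_mat a d) * Z)) = 0\<^sub>m (m * d) (dim_col Z)) \<and>
    (\<forall>Z. dim_row Z = m * d \<longrightarrow> (1\<^sub>m m \<star> prr_mat a d) * (M * ((1\<^sub>m m \<star> inr_mat a d) * Z)) = M2 * Z)"
proof -
  have U': "1\<^sub>m m \<star> U \<in> carrier_mat (m * a) (m * d)" using carrier_matD[OF U] by (auto simp: a_def d_def intro!: carrier_matI)
  note bs = block_system_inj[of m a d]
  note L = block_triangular_inverse[OF bs M1[folded a_def] M2[folded d_def] U', folded pencil_couple[OF S1 S2 U, where c = c and b = b, folded a_def d_def]]
  note V = block_triangular_values[OF bs M1[folded a_def] M2[folded d_def] U']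
  show ?thesis by (rule exI, intro conjI allI impI, rule L) (rule V, assumption)+
qed

lemma couple_regular:
  assumes sf: "stably_finite TYPE('a)" and S1: "wf_descr I p q S1" and S2: "wf_descr I p' q' S2"
    and U: "U \<in> carrier_mat (state_dim S1) (state_dim S2)"
    and M: "inverse_pair (m * (state_dim S1 + state_dim S2)) (pencil scale I m (couple c b U S1 S2) x) M"
  shows "\<exists>M1. inverse_pair (m * state_dim S1) (pencil scale I m S1 x) M1" "\<exists>M2. inverse_pair (m * state_dim S2) (pencil scale I m S2 x) M2"
proof -
  let ?a = "state_dim S1" and ?d = "state_dim S2"
  have U': "1\<^sub>m m \<star> U \<in> carrier_mat (m * ?a) (m * ?d)" using carrier_matD[OF U] by (auto intro!: carrier_matI)
  have c1: "pencil scale I m S1 x \<in> carrier_mat (m * ?a) (m * ?a)" "pencil scale I m S2 x \<in> carrier_mat (m * ?d) (m * ?d)"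
    by (auto intro!: carrier_matI)
  note lr = block_triangular_left_right[OF block_system_inj[of m ?a ?d] c1 U' M[unfolded pencil_couple[OF S1 S2 U]]]
  have "inverse_pair (m * ?a) ((1\<^sub>m m \<star> prl_mat ?a ?d) * (M * (1\<^sub>m m \<star> inl_mat ?a ?d))) (pencil scale I m S1 x)"
    by (rule stably_finite_inverse_pair[OF sf _ c1(1) lr(1)]) (auto intro!: carrier_matI)
  thus "\<exists>M1. inverse_pair (m * ?a) (pencil scale I m S1 x) M1" by (blast intro: inverse_pair_sym)
  have "inverse_pair (m * ?d) (pencil scale I m S2 x) ((1\<^sub>m m \<star> prr_mat ?a ?d) * (M * (1\<^sub>m m \<star> inr_mat ?a ?d)))"
    by (rule stably_finite_inverse_pair[OF sf c1(2) _ lr(2)]) (auto intro!: carrier_matI)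
  thus "\<exists>M2. inverse_pair (m * ?d) (pencil scale I m S2 x) M2" by blast
qed

end

end

definition rep_add :: "('i, 'k::field) descriptor \<Rightarrow> ('i, 'k) descriptor \<Rightarrow> ('i, 'k) descriptor" where
  "rep_add S1 S2 = (let a = state_dim S1; d = state_dim S2 in
     couple (outp S1 * prl_mat a d + outp S2 * prr_mat a d) (inl_mat a d * inp_const S1 + inr_mat a d * inp_const S2) (0\<^sub>m a d) S1 S2)"

text \<open>With U = - b1 c2 the upper right block of the inverse is P1^-1 b1 c2 P2^-1; between c1
  and b2 it is the product of the two values.\<close>

definition rep_mul :: "('i, 'k::field) descriptor \<Rightarrow> ('i, 'k) descriptor \<Rightarrow> ('i, 'k) descriptor" where
  "rep_mul S1 S2 = (let a = state_dim S1; d = state_dim S2 in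
     couple (outp S1 * prl_mat a d) (inr_mat a d * inp_const S2) (- (inp_const S1 * outp S2)) S1 S2)"

text \<open>The value is read from the Schur part, yet \<open>S\<close> is kept as an uncoupled
  summand. The Schur pencil can be invertible where the pencil of \<open>S\<close> is singular; with
  the summand, regularity of the whole forces regularity of \<open>S\<close>, as the domain of an
  inverse demands.\<close>

definition rep_inv :: "('i, 'k::field) descriptor \<Rightarrow> ('i, 'k) descriptor" where
  "rep_inv S = (let a = state_dim S; d = a + 1 in
     couple (outp (schur_rep S) * prr_mat a d) (inr_mat a d * inp_const (schur_rep S)) (0\<^sub>m a d) S (schur_rep S))"

lemma state_dim_couple [simp]: "state_dim (couple c b U S1 S2) = state_dim S1 + state_dim S2"
  "outp (couple c b U S1 S2) = c" "inp_const (couple c b U S1 S2) = b"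
  by (simp_all add: couple_def Let_def)

lemma schur_rep_simps [simp]: "state_dim (schur_rep S) = state_dim S + 1" "outp (schur_rep S) = prr_mat (state_dim S) 1"
   "inp_const (schur_rep S) = inr_mat (state_dim S) 1"
  by (simp_all add: schur_rep_def Let_def)

lemma const_input_couple:
  assumes "wf_descr I p1 q1 S1" "wf_descr I p2 q2 S2" "c \<in> carrier_mat p (state_dim S1 + state_dim S2)"
    "b \<in> carrier_mat (state_dim S1 + state_dim S2) q"
  shows "const_input I p q (couple c b U S1 S2)"
  unfolding couple_def Let_def
  by (rule const_input_linear_rep) (use assms in \<open>auto intro!: carrier_matI\<close>)

lemma const_input_schur:
  assumes "wf_descr I 1 1 S"
  shows "const_input I 1 1 (schur_rep S)"
  unfolding schur_rep_def Let_def
  by (rule const_input_linear_rep) (use wf_descr_dims[OF assms] in \<open>auto intro!: carrier_matI\<close>)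

lemma const_input_wf: "const_input I p q S \<Longrightarrow> wf_descr I p q S"
  by (simp add: const_input_def)

lemma const_input_ops:
  "const_input I p q S1 \<Longrightarrow> const_input I p q S2 \<Longrightarrow> const_input I p q (rep_add S1 S2)"
  "const_input I p r S1 \<Longrightarrow> const_input I r q S2 \<Longrightarrow> const_input I p q (rep_mul S1 S2)"
  "const_input I 1 1 S \<Longrightarrow> const_input I 1 1 (rep_inv S)"
proof -
  assume 1: "const_input I p q S1" "const_input I p q S2"
  show "const_input I p q (rep_add S1 S2)" unfolding rep_add_def Let_def
    by (rule const_input_couple[OF const_input_wf[OF 1(1)] const_input_wf[OF 1(2)]])
      (use wf_descr_dims(3,4,7,8)[OF const_input_wf[OF 1(1)]] wf_descr_dims(3,4,7,8)[OF const_input_wf[OF 1(2)]] in \<open>auto intro!: carrier_matI\<close>)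
next
  assume 1: "const_input I p r S1" "const_input I r q S2"
  show "const_input I p q (rep_mul S1 S2)" unfolding rep_mul_def Let_def
    by (rule const_input_couple[OF const_input_wf[OF 1(1)] const_input_wf[OF 1(2)]])
      (use wf_descr_dims(3,4,7,8)[OF const_input_wf[OF 1(1)]] wf_descr_dims(3,4,7,8)[OF const_input_wf[OF 1(2)]] in \<open>auto intro!: carrier_matI\<close>)
next
  assume 1: "const_input I 1 1 S"
  show "const_input I 1 1 (rep_inv S)" unfolding rep_inv_def Let_def
    by (rule const_input_couple[OF const_input_wf[OF 1] const_input_wf[OF const_input_schur[OF const_input_wf[OF 1]]]])
      (auto intro!: carrier_matI)
qed

text \<open>With indices counted from 0, the pencil 1 - x E_01 has the inverse 1 + x E_01, whose
  upper right entry is x.\<close>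

definition rep_var :: "'i \<Rightarrow> ('i, 'k::field) descriptor" where
  "rep_var k = linear_rep 2 (mat_unit 1 2 0 0) (1\<^sub>m 2) (\<lambda>\<kappa>. if \<kappa> = k then - mat_unit 2 2 0 1 else 0\<^sub>m 2 2) (mat_unit 2 1 1 0)"

definition rep_const :: "'k \<Rightarrow> ('i, 'k::field) descriptor" where
  "rep_const c = linear_rep 1 (mat 1 1 (\<lambda>_. c)) (1\<^sub>m 1) (\<lambda>_. 0\<^sub>m 1 1) (1\<^sub>m 1)"

lemma const_input_var: "const_input I 1 1 (rep_var k)"
  unfolding rep_var_def by (rule const_input_linear_rep) auto

lemma const_input_const: "const_input I 1 1 (rep_const c)"
  unfolding rep_const_def by (rule const_input_linear_rep) auto

section \<open>Values of the combined representations\<close>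

context unital_algebra begin

context
  fixes I :: "'i set" and m :: nat and x :: "'i \<Rightarrow> 'a mat"
  assumes fin: "finite I" and x: "\<And>\<kappa>. \<kappa> \<in> I \<Longrightarrow> x \<kappa> \<in> carrier_mat m m"
begin

lemma rep_at_add:
  assumes S1: "const_input I p q S1" and S2: "const_input I p q S2" and V: "rep_at I m S1 x V1" "rep_at I m S2 x V2"
  shows "rep_at I m (rep_add S1 S2) x (V1 + V2)"
proof -
  let ?a = "state_dim S1" and ?d = "state_dim S2"
  note w1 = const_input_wf[OF S1] and w2 = const_input_wf[OF S2]
  obtain M1 where M1: "inverse_pair (m * ?a) (pencil scale I m S1 x) M1" and V1: "V1 = (1\<^sub>m m \<star> outp S1) * (M1 * (1\<^sub>m m \<star> inp_const S1))"
    using V(1) by (auto simp: rep_at_def)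
  obtain M2 where M2: "inverse_pair (m * ?d) (pencil scale I m S2 x) M2" and V2: "V2 = (1\<^sub>m m \<star> outp S2) * (M2 * (1\<^sub>m m \<star> inp_const S2))"
    using V(2) by (auto simp: rep_at_def)
  note dd = inverse_pair_dims(3,4)[OF M1] inverse_pair_dims(3,4)[OF M2] wf_descr_dims(3,4,7,8)[OF w1] wf_descr_dims(3,4,7,8)[OF w2]
  let ?c = "outp S1 * prl_mat ?a ?d + outp S2 * prr_mat ?a ?d" and ?b = "inl_mat ?a ?d * inp_const S1 + inr_mat ?a ?d * inp_const S2"
  have "\<exists>M. inverse_pair (m * (?a + ?d)) (pencil scale I m (couple ?c ?b (0\<^sub>m ?a ?d) S1 S2) x) M \<and>
    (\<forall>Z. dim_row Z = m * ?a \<longrightarrow> (1\<^sub>m m \<star> prl_mat ?a ?d) * (M * ((1\<^sub>m m \<star> inl_mat ?a ?d) * Z)) = M1 * Z) \<and>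
    (\<forall>Z. dim_row Z = m * ?d \<longrightarrow> (1\<^sub>m m \<star> prl_mat ?a ?d) * (M * ((1\<^sub>m m \<star> inr_mat ?a ?d) * Z)) = - (M1 * ((1\<^sub>m m \<star> 0\<^sub>m ?a ?d) * (M2 * Z)))) \<and>
    (\<forall>Z. dim_row Z = m * ?a \<longrightarrow> (1\<^sub>m m \<star> prr_mat ?a ?d) * (M * ((1\<^sub>m m \<star> inl_mat ?a ?d) * Z)) = 0\<^sub>m (m * ?d) (dim_col Z)) \<and>
    (\<forall>Z. dim_row Z = m * ?d \<longrightarrow> (1\<^sub>m m \<star> prr_mat ?a ?d) * (M * ((1\<^sub>m m \<star> inr_mat ?a ?d) * Z)) = M2 * Z)"
    by (rule couple_inverse[OF fin x w1 w2 _ M1 M2]) auto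
  then obtain M where M: "inverse_pair (m * (?a + ?d)) (pencil scale I m (couple ?c ?b (0\<^sub>m ?a ?d) S1 S2) x) M"
    and ll: "\<And>Z. dim_row Z = m * ?a \<Longrightarrow> (1\<^sub>m m \<star> prl_mat ?a ?d) * (M * ((1\<^sub>m m \<star> inl_mat ?a ?d) * Z)) = M1 * Z"
    and lr: "\<And>Z. dim_row Z = m * ?d \<Longrightarrow> (1\<^sub>m m \<star> prl_mat ?a ?d) * (M * ((1\<^sub>m m \<star> inr_mat ?a ?d) * Z)) = - (M1 * ((1\<^sub>m m \<star> 0\<^sub>m ?a ?d) * (M2 * Z)))"
    and rl: "\<And>Z. dim_row Z = m * ?a \<Longrightarrow> (1\<^sub>m m \<star> prr_mat ?a ?d) * (M * ((1\<^sub>m m \<star> inl_mat ?a ?d) * Z)) = 0\<^sub>m (m * ?d) (dim_col Z)"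
    and rr: "\<And>Z. dim_row Z = m * ?d \<Longrightarrow> (1\<^sub>m m \<star> prr_mat ?a ?d) * (M * ((1\<^sub>m m \<star> inr_mat ?a ?d) * Z)) = M2 * Z"
    by metis
  have c: "1\<^sub>m m \<star> ?c = (1\<^sub>m m \<star> outp S1) * (1\<^sub>m m \<star> prl_mat ?a ?d) + (1\<^sub>m m \<star> outp S2) * (1\<^sub>m m \<star> prr_mat ?a ?d)"
    using dd by (simp add: kron_scalar_add_right kron_scalar_mult)
  have b: "1\<^sub>m m \<star> ?b = (1\<^sub>m m \<star> inl_mat ?a ?d) * (1\<^sub>m m \<star> inp_const S1) + (1\<^sub>m m \<star> inr_mat ?a ?d) * (1\<^sub>m m \<star> inp_const S2)"
    using dd by (simp add: kron_scalar_add_right kron_scalar_mult)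
  have "(1\<^sub>m m \<star> ?c) * (M * (1\<^sub>m m \<star> ?b)) = V1 + V2"
    unfolding c b V1 V2 using dd inverse_pair_dims(3,4)[OF M]
    by (simp add: mat_dim_simps ll lr rl rr kron_scalar_zero_right)
  thus ?thesis using M by (auto simp: rep_at_def rep_add_def Let_def)
qed

lemma rep_at_mul:
  assumes S1: "const_input I p r S1" and S2: "const_input I r q S2" and V: "rep_at I m S1 x V1" "rep_at I m S2 x V2"
  shows "rep_at I m (rep_mul S1 S2) x (V1 * V2)"
proof -
  let ?a = "state_dim S1" and ?d = "state_dim S2"
  note w1 = const_input_wf[OF S1] and w2 = const_input_wf[OF S2]
  obtain M1 where M1: "inverse_pair (m * ?a) (pencil scale I m S1 x) M1" and V1: "V1 = (1\<^sub>m m \<star> outp S1) * (M1 * (1\<^sub>m m \<star> inp_const S1))"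
    using V(1) by (auto simp: rep_at_def)
  obtain M2 where M2: "inverse_pair (m * ?d) (pencil scale I m S2 x) M2" and V2: "V2 = (1\<^sub>m m \<star> outp S2) * (M2 * (1\<^sub>m m \<star> inp_const S2))"
    using V(2) by (auto simp: rep_at_def)
  note dd = inverse_pair_dims(3,4)[OF M1] inverse_pair_dims(3,4)[OF M2] wf_descr_dims(3,4,7,8)[OF w1] wf_descr_dims(3,4,7,8)[OF w2]
  let ?c = "outp S1 * prl_mat ?a ?d" and ?b = "inr_mat ?a ?d * inp_const S2" and ?U = "- (inp_const S1 * outp S2)"
  have U: "?U \<in> carrier_mat ?a ?d" using dd by (auto intro!: carrier_matI)
  have "\<exists>M. inverse_pair (m * (?a + ?d)) (pencil scale I m (couple ?c ?b ?U S1 S2) x) M \<and>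
    (\<forall>Z. dim_row Z = m * ?a \<longrightarrow> (1\<^sub>m m \<star> prl_mat ?a ?d) * (M * ((1\<^sub>m m \<star> inl_mat ?a ?d) * Z)) = M1 * Z) \<and>
    (\<forall>Z. dim_row Z = m * ?d \<longrightarrow> (1\<^sub>m m \<star> prl_mat ?a ?d) * (M * ((1\<^sub>m m \<star> inr_mat ?a ?d) * Z)) = - (M1 * ((1\<^sub>m m \<star> ?U) * (M2 * Z)))) \<and>
    (\<forall>Z. dim_row Z = m * ?a \<longrightarrow> (1\<^sub>m m \<star> prr_mat ?a ?d) * (M * ((1\<^sub>m m \<star> inl_mat ?a ?d) * Z)) = 0\<^sub>m (m * ?d) (dim_col Z)) \<and>
    (\<forall>Z. dim_row Z = m * ?d \<longrightarrow> (1\<^sub>m m \<star> prr_mat ?a ?d) * (M * ((1\<^sub>m m \<star> inr_mat ?a ?d) * Z)) = M2 * Z)"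
    by (rule couple_inverse[OF fin x w1 w2 U M1 M2])
  then obtain M where M: "inverse_pair (m * (?a + ?d)) (pencil scale I m (couple ?c ?b ?U S1 S2) x) M"
    and lr: "\<And>Z. dim_row Z = m * ?d \<Longrightarrow> (1\<^sub>m m \<star> prl_mat ?a ?d) * (M * ((1\<^sub>m m \<star> inr_mat ?a ?d) * Z)) = - (M1 * ((1\<^sub>m m \<star> ?U) * (M2 * Z)))"
    by metis
  have c: "1\<^sub>m m \<star> ?c = (1\<^sub>m m \<star> outp S1) * (1\<^sub>m m \<star> prl_mat ?a ?d)"
    using dd by (simp add: kron_scalar_mult)
  have b: "1\<^sub>m m \<star> ?b = (1\<^sub>m m \<star> inr_mat ?a ?d) * (1\<^sub>m m \<star> inp_const S2)"
    using dd by (simp add: kron_scalar_mult)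
  have u: "1\<^sub>m m \<star> ?U = - ((1\<^sub>m m \<star> inp_const S1) * (1\<^sub>m m \<star> outp S2))"
    using dd by (simp add: kron_scalar_mult kron_scalar_uminus_right)
  have "(1\<^sub>m m \<star> ?c) * (M * (1\<^sub>m m \<star> ?b)) = V1 * V2"
    unfolding c b V1 V2 using dd inverse_pair_dims(3,4)[OF M] by (simp add: mat_dim_simps lr u)
  thus ?thesis using M by (auto simp: rep_at_def rep_mul_def Let_def)
qed

lemma rep_at_schur:
  assumes S: "const_input I 1 1 S" and V: "rep_at I m S x V" and W: "inverse_pair m V W"
  shows "rep_at I m (schur_rep S) x W"
proof -
  let ?a = "state_dim S"
  note w = const_input_wf[OF S]
  obtain M where M: "inverse_pair (m * ?a) (pencil scale I m S x) M" and V: "V = (1\<^sub>m m \<star> outp S) * (M * (1\<^sub>m m \<star> inp_const S))"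
    using V by (auto simp: rep_at_def)
  have B: "1\<^sub>m m \<star> inp_const S \<in> carrier_mat (m * ?a) (m * 1)" and C: "1\<^sub>m m \<star> outp S \<in> carrier_mat (m * 1) (m * ?a)"
    using wf_descr_dims(3,4,7,8)[OF w] by (auto intro!: carrier_matI)
  have W': "inverse_pair (m * 1) ((1\<^sub>m m \<star> outp S) * (M * (1\<^sub>m m \<star> inp_const S))) W" using W V by simp
  have Wc: "W \<in> carrier_mat (m * 1) (m * 1)" using W by (simp add: inverse_pair_def)
  note bs = block_system_inj[of m ?a 1]
  have pen: "pencil scale I m (schur_rep S) x =
     (1\<^sub>m m \<star> inl_mat ?a 1) * (pencil scale I m S x * (1\<^sub>m m \<star> prl_mat ?a 1)) +
     ((1\<^sub>m m \<star> inl_mat ?a 1) * ((1\<^sub>m m \<star> inp_const S) * (1\<^sub>m m \<star> prr_mat ?a 1)) +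
      - ((1\<^sub>m m \<star> inr_mat ?a 1) * ((1\<^sub>m m \<star> outp S) * (1\<^sub>m m \<star> prl_mat ?a 1))))"
    by (rule pencil_schur[OF fin x w])
  show ?thesis unfolding rep_at_def pen schur_rep_simps
    by (rule exI, rule conjI, rule schur_inverse[OF bs M B C W'], rule schur_value[OF bs M B C Wc, symmetric])
qed

text \<open>Invertibility of the Schur pencil provides a right inverse of the value of
  \<open>S\<close>, and stable finiteness makes it two-sided.\<close>

lemma schur_regular:
  assumes sf: "stably_finite TYPE('a)" and S: "const_input I 1 1 S" and V: "rep_at I m S x V"
    and M': "inverse_pair (m * (state_dim S + 1)) (pencil scale I m (schur_rep S) x) M'"
  shows "\<exists>W. inverse_pair m V W"
proof -
  let ?a = "state_dim S"
  note w = const_input_wf[OF S]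
  obtain M where M: "inverse_pair (m * ?a) (pencil scale I m S x) M" and V: "V = (1\<^sub>m m \<star> outp S) * (M * (1\<^sub>m m \<star> inp_const S))"
    using V by (auto simp: rep_at_def)
  have B: "1\<^sub>m m \<star> inp_const S \<in> carrier_mat (m * ?a) (m * 1)" and C: "1\<^sub>m m \<star> outp S \<in> carrier_mat (m * 1) (m * ?a)"
    using wf_descr_dims(3,4,7,8)[OF w] by (auto intro!: carrier_matI)
  have pen: "pencil scale I m (schur_rep S) x =
     (1\<^sub>m m \<star> inl_mat ?a 1) * (pencil scale I m S x * (1\<^sub>m m \<star> prl_mat ?a 1)) +
     ((1\<^sub>m m \<star> inl_mat ?a 1) * ((1\<^sub>m m \<star> inp_const S) * (1\<^sub>m m \<star> prr_mat ?a 1)) +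
      - ((1\<^sub>m m \<star> inr_mat ?a 1) * ((1\<^sub>m m \<star> outp S) * (1\<^sub>m m \<star> prl_mat ?a 1))))"
    by (rule pencil_schur[OF fin x w])
  have "V * ((1\<^sub>m m \<star> prr_mat ?a 1) * (M' * (1\<^sub>m m \<star> inr_mat ?a 1))) = 1\<^sub>m (m * 1)"
    unfolding V by (rule schur_right_inverse[OF block_system_inj[of m ?a 1] M B C M'[unfolded pen]])
  hence "inverse_pair (m * 1) V ((1\<^sub>m m \<star> prr_mat ?a 1) * (M' * (1\<^sub>m m \<star> inr_mat ?a 1)))"
    using B C by (intro stably_finite_inverse_pair[OF sf]) (auto simp: V intro!: carrier_matI)
  thus ?thesis by auto
qed

lemma rep_at_inv:
  assumes S: "const_input I 1 1 S" and V: "rep_at I m S x V" and W: "inverse_pair m V W"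
  shows "rep_at I m (rep_inv S) x W"
proof -
  let ?a = "state_dim S" and ?d = "state_dim S + 1"
  note w1 = const_input_wf[OF S] and w2 = const_input_wf[OF const_input_schur[OF const_input_wf[OF S]]]
  obtain M1 where M1: "inverse_pair (m * ?a) (pencil scale I m S x) M1" using V by (auto simp: rep_at_def)
  obtain M2 where M2: "inverse_pair (m * state_dim (schur_rep S)) (pencil scale I m (schur_rep S) x) M2"
    and V2: "W = (1\<^sub>m m \<star> outp (schur_rep S)) * (M2 * (1\<^sub>m m \<star> inp_const (schur_rep S)))"
    using rep_at_schur[OF assms] by (auto simp: rep_at_def)
  note dd = inverse_pair_dims(3,4)[OF M1] inverse_pair_dims(3,4)[OF M2] wf_descr_dims(3,4,7,8)[OF w1] wf_descr_dims(3,4,7,8)[OF w2]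
  let ?c = "outp (schur_rep S) * prr_mat ?a ?d" and ?b = "inr_mat ?a ?d * inp_const (schur_rep S)"
  obtain M where M: "inverse_pair (m * (?a + state_dim (schur_rep S))) (pencil scale I m (couple ?c ?b (0\<^sub>m ?a (state_dim (schur_rep S))) S (schur_rep S)) x) M"
    and rr: "\<And>Z. dim_row Z = m * state_dim (schur_rep S) \<Longrightarrow> (1\<^sub>m m \<star> prr_mat ?a (state_dim (schur_rep S))) * (M * ((1\<^sub>m m \<star> inr_mat ?a (state_dim (schur_rep S))) * Z)) = M2 * Z"
    using couple_inverse[OF fin x w1 w2 zero_carrier_mat M1 M2, of ?c ?b] by blast
  have c: "1\<^sub>m m \<star> ?c = (1\<^sub>m m \<star> outp (schur_rep S)) * (1\<^sub>m m \<star> prr_mat ?a (state_dim (schur_rep S)))"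
    using dd by (simp add: kron_scalar_mult)
  have b: "1\<^sub>m m \<star> ?b = (1\<^sub>m m \<star> inr_mat ?a (state_dim (schur_rep S))) * (1\<^sub>m m \<star> inp_const (schur_rep S))"
    using dd by (simp add: kron_scalar_mult)
  have "(1\<^sub>m m \<star> ?c) * (M * (1\<^sub>m m \<star> ?b)) = (1\<^sub>m m \<star> outp (schur_rep S)) * ((1\<^sub>m m \<star> prr_mat ?a (state_dim (schur_rep S))) * (M * (1\<^sub>m m \<star> ?b)))"
    unfolding c using inverse_pair_dims(3,4)[OF M] by (intro mat_mult_assoc) auto
  also have "\<dots> = W" unfolding b V2 by (subst rr) simp_all
  finally have "(1\<^sub>m m \<star> ?c) * (M * (1\<^sub>m m \<star> ?b)) = W" .
  thus ?thesis using M by (auto simp: rep_at_def rep_inv_def Let_def)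
qed

lemma rep_at_var:
  assumes k: "k \<in> I"
  shows "rep_at I m (rep_var k) x (x k)"
proof -
  let ?P = "\<lambda>\<kappa>. if \<kappa> = k then - mat_unit 2 2 0 1 else 0\<^sub>m 2 2 :: 'k mat"
  have xk: "x k \<in> carrier_mat m m" using x k by blast
  have "lin scale I m 2 2 x ?P = lin scale (insert k (I - {k})) m 2 2 x ?P" using k by (simp add: insert_absorb)
  also have "\<dots> = x k \<star> (- mat_unit 2 2 0 1) + lin scale (I - {k}) m 2 2 x ?P"
    using fin xk by (subst lin_insert) auto
  also have "lin scale (I - {k}) m 2 2 x ?P = lin scale (I - {k}) m 2 2 x (\<lambda>\<kappa>. 0\<^sub>m 2 2)" by (rule lin_cong) auto
  also have "\<dots> = 0\<^sub>m (m * 2) (m * 2)" by (rule lin_zero_coeff)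
  finally have l: "lin scale I m 2 2 x ?P = - (x k \<star> mat_unit 2 2 0 1)"
    using xk by (simp add: mat_add_zero kron_scalar_uminus_right)
  have pen: "pencil scale I m (rep_var k) x = 1\<^sub>m (m * 2) + - (x k \<star> mat_unit 2 2 0 1)"
    by (simp add: pencil_def rep_var_def l kron_scalar_one)
  have sq: "(x k \<star> mat_unit 2 2 0 1) * (x k \<star> mat_unit 2 2 0 1) = 0\<^sub>m (m * 2) (m * 2)"
    using xk by (simp add: kron_scalar_mult mat_unit_mult kron_scalar_zero_right)
  have M: "inverse_pair (m * 2) (pencil scale I m (rep_var k) x) (1\<^sub>m (m * 2) + x k \<star> mat_unit 2 2 0 1)"
    unfolding pen inverse_pair_def using xk
    by (auto simp: mat_dim_simps sq[unfolded One_nat_def] intro!: carrier_matI)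
  have "(1\<^sub>m m \<star> mat_unit 1 2 0 0) * ((1\<^sub>m (m * 2) + x k \<star> mat_unit 2 2 0 1) * (1\<^sub>m m \<star> mat_unit 2 1 1 0)) =
     (1\<^sub>m m \<star> mat_unit 1 2 0 0) * (1\<^sub>m m \<star> mat_unit 2 1 1 0) + (1\<^sub>m m \<star> mat_unit 1 2 0 0) * ((x k \<star> mat_unit 2 2 0 1) * (1\<^sub>m m \<star> mat_unit 2 1 1 0))"
    using xk by (simp add: mat_dim_simps)
  also have "\<dots> = x k \<star> mat_unit 1 1 0 0"
    using xk by (simp add: kron_scalar_mult mat_unit_mult kron_scalar_zero_right mat_add_zero)
  also have "mat_unit 1 1 0 0 = (1\<^sub>m (Suc 0) :: 'k mat)" by (auto simp: mat_unit_def)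
  finally show ?thesis using M by (auto simp: rep_at_def rep_var_def)
qed

lemma rep_at_const: "rep_at I m (rep_const c) x (1\<^sub>m m \<star> mat 1 1 (\<lambda>_. c))"
proof -
  have "lin scale I m (Suc 0) (Suc 0) x (\<lambda>_. 0\<^sub>m (Suc 0) (Suc 0)) = 0\<^sub>m m m"
    using lin_zero_coeff[of I m 1 1 x] by simp
  hence "pencil scale I m (rep_const c) x = 1\<^sub>m m"
    by (simp add: pencil_def rep_const_def mat_add_zero)
  thus ?thesis by (auto simp: rep_at_def rep_const_def inverse_pair_def intro!: exI[of _ "1\<^sub>m m"])
qed

end

lemma const_mult:
  assumes "A \<in> carrier_mat m m"
  shows "(1\<^sub>m m \<star> mat 1 1 (\<lambda>_. c)) * A = map_mat (scale c) A"
proof -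
  have "(1\<^sub>m m \<star> mat 1 1 (\<lambda>_. c)) * (A \<star> 1\<^sub>m (Suc 0)) = (1\<^sub>m m * A) \<star> (mat 1 1 (\<lambda>_. c) * 1\<^sub>m (Suc 0))"
    using assms by (intro kron_scalar_mult) auto
  also have "\<dots> = map_mat (scale c) A"
    using assms by (auto intro!: eq_matI simp: index_kron_scalar)
  finally show ?thesis by simp
qed

lemma const_one: "1\<^sub>m m \<star> mat 1 1 (\<lambda>_. 1) = 1\<^sub>m m"
  by (auto intro!: eq_matI simp: index_kron_scalar)

lemma const_zero: "1\<^sub>m m \<star> mat 1 1 (\<lambda>_. 0) = 0\<^sub>m m m"
  by (auto intro!: eq_matI simp: index_kron_scalar)

end

section \<open>Expressions\<close>

text \<open>Matrices over the algebra with scalars from the field. In \<open>mat_algebra\<close>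
  scalars and entries share one type, so it does not serve here; over the field itself the two
  records coincide.\<close>

definition mat_alg :: "('k \<Rightarrow> 'a \<Rightarrow> 'a) \<Rightarrow> nat \<Rightarrow> ('k, 'a::ring_1 mat) module" where
  "mat_alg scale n = \<lparr>carrier = carrier_mat n n, mult = (*), one = 1\<^sub>m n, zero = 0\<^sub>m n n, add = (+), smult = (\<lambda>c. map_mat (scale c))\<rparr>"

lemma mat_alg_simps [simp]:
  "carrier (mat_alg scale n) = carrier_mat n n" "mult (mat_alg scale n) = (*)" "one (mat_alg scale n) = 1\<^sub>m n"
  "zero (mat_alg scale n) = 0\<^sub>m n n" "add (mat_alg scale n) = (+)" "smult (mat_alg scale n) = (\<lambda>c. map_mat (scale c))"
  by (simp_all add: mat_alg_def)

lemma mat_alg_field: "mat_alg (*) n = (mat_algebra n :: ('k::field, 'k mat) module)"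
  by (auto simp: mat_alg_def module_mat_def smult_mat_def fun_eq_iff)

lemma Units_mat_alg: "A \<in> Units (mat_alg scale n) \<longleftrightarrow> (\<exists>B. inverse_pair n A B)"
  by (auto simp: Units_def inverse_pair_def)

lemma inv_mat_alg:
  assumes "inverse_pair n A B"
  shows "inv\<^bsub>mat_alg scale n\<^esub> A = B"
proof -
  have "Group.monoid (mat_alg scale n)" by (rule Group.monoidI) auto
  from Group.monoid.inv_unique'[OF this, of A B] assms show ?thesis by (auto simp: inverse_pair_def)
qed

lemma abelian_monoid_mat_alg: "abelian_monoid (mat_alg scale n)"
  by (rule abelian_monoidI) (auto simp: mat_add_comm)

lemma finsum_foldr:
  assumes "abelian_monoid A" "distinct ws" "f \<in> set ws \<rightarrow> carrier A"
  shows "finsum A f (set ws) = foldr (\<lambda>w v. f w \<oplus>\<^bsub>A\<^esub> v) ws \<zero>\<^bsub>A\<^esub>"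
  using assms(2,3)
proof (induction ws)
  case Nil
  thus ?case using abelian_monoid.finsum_empty[OF assms(1)] by simp
next
  case (Cons w ws)
  thus ?case using abelian_monoid.finsum_insert[OF assms(1), of "set ws" w f] by auto
qed

definition rep_word :: "'i list \<Rightarrow> ('i, 'k::field) descriptor" where
  "rep_word w = foldr (\<lambda>k S. rep_mul (rep_var k) S) w (rep_const 1)"

text \<open>An arbitrary fixed enumeration of the support. It turns the finite sum over words into
  an iterated \<open>rep_add\<close>; the value does not depend on the order.\<close>

definition words_of :: "('d list \<Rightarrow>\<^sub>0 'k::zero) \<Rightarrow> 'd list list" where
  "words_of p = (SOME ws. distinct ws \<and> set ws = Poly_Mapping.keys p)"

definition rep_poly :: "('i list \<Rightarrow>\<^sub>0 'k::field) \<Rightarrow> ('i, 'k) descriptor" where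
  "rep_poly p = foldr (\<lambda>w S. rep_add (rep_mul (rep_const (Poly_Mapping.lookup p w)) (rep_word w)) S) (words_of p) (rep_const 0)"

primrec expr_rep :: "('d, 'k::field) nc_expr \<Rightarrow> ('d, 'k) descriptor" where
  "expr_rep (Poly p) = rep_poly p"
| "expr_rep (Add R1 R2) = rep_add (expr_rep R1) (expr_rep R2)"
| "expr_rep (Mul R1 R2) = rep_mul (expr_rep R1) (expr_rep R2)"
| "expr_rep (Inv R) = rep_inv (expr_rep R)"

lemma words_of: "distinct (words_of p)" "set (words_of p) = Poly_Mapping.keys p"
  using someI_ex[OF finite_distinct_list[OF finite_keys[of p]]] by (auto simp: words_of_def conj_commute)

lemma const_input_word: "const_input I 1 1 (rep_word w)"
proof (induction w)
  case Nil
  show ?case using const_input_const[of I 1] by (simp add: rep_word_def del: One_nat_def)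
next
  case (Cons k w)
  show ?case using const_input_ops(2)[OF const_input_var[of I k] Cons] by (simp add: rep_word_def del: One_nat_def)
qed

lemma const_input_poly: "const_input I 1 1 (rep_poly p)"
proof -
  have "const_input I 1 1 (foldr (\<lambda>w S. rep_add (rep_mul (rep_const (Poly_Mapping.lookup p w)) (rep_word w)) S) ws (rep_const 0))" for ws
  proof (induction ws)
    case Nil
    show ?case using const_input_const[of I 0] by (simp del: One_nat_def)
  next
    case (Cons w ws)
    show ?case using const_input_ops(1)[OF const_input_ops(2)[OF const_input_const const_input_word] Cons, of "Poly_Mapping.lookup p w" w]
      by (simp del: One_nat_def)
  qed
  thus ?thesis unfolding rep_poly_def .
qed

lemma const_input_expr: "const_input I 1 1 (expr_rep R)"
proof (induction R)
  case (Poly p)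
  show ?case unfolding expr_rep.simps by (rule const_input_poly)
next
  case (Add R1 R2)
  thus ?case unfolding expr_rep.simps by (rule const_input_ops(1))
next
  case (Mul R1 R2)
  thus ?case unfolding expr_rep.simps by (rule const_input_ops(2))
next
  case (Inv R)
  thus ?case unfolding expr_rep.simps by (rule const_input_ops(3))
qed

lemma wf_expr_rep: "wf_descr I 1 1 (expr_rep R)"
  by (rule const_input_wf[OF const_input_expr])

lemma expr_dom_carrier: "a \<in> expr_dom A R \<Longrightarrow> a k \<in> carrier A"
  by (induction R) auto

section \<open>Domains of expressions as regularity sets of pencils\<close>

context unital_algebra begin

context
  fixes m :: nat and x :: "'d::finite \<Rightarrow> 'a mat"
  assumes x: "\<And>\<kappa>. x \<kappa> \<in> carrier_mat m m"
begin

lemma rep_at_word: "rep_at UNIV m (rep_word w) x (word_eval (mat_alg scale m) w x)"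
proof (induction w)
  case Nil
  have "rep_at UNIV m (rep_const 1) x (1\<^sub>m m \<star> mat 1 1 (\<lambda>_. 1))" by (rule rep_at_const) (use x in auto)
  thus ?case unfolding const_one by (simp add: rep_word_def word_eval_def)
next
  case (Cons k w)
  have "rep_at UNIV m (rep_mul (rep_var k) (rep_word w)) x (x k * word_eval (mat_alg scale m) w x)"
    by (rule rep_at_mul[OF _ _ const_input_var const_input_word rep_at_var Cons]) (use x in auto)
  thus ?case by (simp add: rep_word_def word_eval_def)
qed

lemma word_eval_carrier: "word_eval (mat_alg scale m) w x \<in> carrier_mat m m"
  by (induction w) (auto simp: word_eval_def x intro: mult_carrier_mat[OF x])

lemma rep_at_poly: "rep_at UNIV m (rep_poly p) x (poly_eval (mat_alg scale m) p x)"
proof -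
  let ?f = "\<lambda>w. map_mat (scale (Poly_Mapping.lookup p w)) (word_eval (mat_alg scale m) w x)"
  have "rep_at UNIV m (foldr (\<lambda>w S. rep_add (rep_mul (rep_const (Poly_Mapping.lookup p w)) (rep_word w)) S) ws (rep_const 0)) x
    (foldr (\<lambda>w v. ?f w + v) ws (0\<^sub>m m m)) \<and>
    const_input UNIV 1 1 (foldr (\<lambda>w S. rep_add (rep_mul (rep_const (Poly_Mapping.lookup p w)) (rep_word w)) S) ws (rep_const 0 :: ('d, 'k) descriptor))" for ws
  proof (induction ws)
    case Nil
    have "rep_at UNIV m (rep_const 0) x (1\<^sub>m m \<star> mat 1 1 (\<lambda>_. 0))" by (rule rep_at_const) (use x in auto)
    thus ?case using const_input_const[of UNIV 0] unfolding const_zero by (simp del: One_nat_def)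
  next
    case (Cons w ws)
    have "rep_at UNIV m (rep_mul (rep_const (Poly_Mapping.lookup p w)) (rep_word w)) x
      ((1\<^sub>m m \<star> mat 1 1 (\<lambda>_. Poly_Mapping.lookup p w)) * word_eval (mat_alg scale m) w x)"
      by (rule rep_at_mul[OF _ _ const_input_const const_input_word rep_at_const rep_at_word]) (use x in auto)
    hence 1: "rep_at UNIV m (rep_mul (rep_const (Poly_Mapping.lookup p w)) (rep_word w)) x (?f w)"
      using const_mult[OF word_eval_carrier[of w]] by simp
    have c: "const_input UNIV 1 1 (rep_mul (rep_const (Poly_Mapping.lookup p w)) (rep_word w) :: ('d, 'k) descriptor)"
      by (rule const_input_ops(2)[OF const_input_const const_input_word])
    show ?case
      using rep_at_add[OF _ _ c conjunct2[OF Cons] 1 conjunct1[OF Cons]] const_input_ops(1)[OF c conjunct2[OF Cons]] x by simp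
  qed
  hence "rep_at UNIV m (rep_poly p) x (foldr (\<lambda>w v. ?f w + v) (words_of p) (0\<^sub>m m m))"
    unfolding rep_poly_def by blast
  moreover have "poly_eval (mat_alg scale m) p x = foldr (\<lambda>w v. ?f w + v) (words_of p) (0\<^sub>m m m)"
    using finsum_foldr[OF abelian_monoid_mat_alg words_of(1)[of p], of ?f scale m] word_eval_carrier
    by (simp add: poly_eval_def words_of(2) Pi_def)
  ultimately show ?thesis by simp
qed

lemma rep_at_expr: "x \<in> expr_dom (mat_alg scale m) R \<Longrightarrow> rep_at UNIV m (expr_rep R) x (expr_eval (mat_alg scale m) R x)"
proof (induction R)
  case (Poly p)
  show ?case using rep_at_poly by simp
next
  case (Add R1 R2)
  have "rep_at UNIV m (rep_add (expr_rep R1) (expr_rep R2)) x (expr_eval (mat_alg scale m) R1 x + expr_eval (mat_alg scale m) R2 x)"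
    by (rule rep_at_add[OF _ _ const_input_expr const_input_expr]) (use Add x in auto)
  thus ?case by simp
next
  case (Mul R1 R2)
  have "rep_at UNIV m (rep_mul (expr_rep R1) (expr_rep R2)) x (expr_eval (mat_alg scale m) R1 x * expr_eval (mat_alg scale m) R2 x)"
    by (rule rep_at_mul[OF _ _ const_input_expr const_input_expr]) (use Mul x in auto)
  thus ?case by simp
next
  case (Inv R)
  then obtain W where W: "inverse_pair m (expr_eval (mat_alg scale m) R x) W" by (auto simp: Units_mat_alg)
  have "rep_at UNIV m (rep_inv (expr_rep R)) x W"
    by (rule rep_at_inv[OF _ _ const_input_expr _ W]) (use Inv x in auto)
  thus ?case using inv_mat_alg[OF W, of scale] by simp
qed

text \<open>Converse of \<open>rep_at_expr\<close>. Stable finiteness splits an invertible coupled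
  pencil into invertible diagonal parts; in the case of an inverse the first part shows the inner
  expression to be defined, and the Schur part its value to be invertible. Points found by pencil
  arguments enter domains in this way.\<close>

lemma expr_dom_of_regular:
  assumes sf: "stably_finite TYPE('a)"
  shows "inverse_pair (m * state_dim (expr_rep R)) (pencil scale UNIV m (expr_rep R) x) M \<Longrightarrow> x \<in> expr_dom (mat_alg scale m) R"
proof (induction R arbitrary: M)
  case (Poly p)
  show ?case using x by simp
next
  case (Add R1 R2)
  have "inverse_pair (m * (state_dim (expr_rep R1) + state_dim (expr_rep R2))) (pencil scale UNIV m (rep_add (expr_rep R1) (expr_rep R2)) x) M"
    using Add.prems by (simp add: rep_add_def Let_def)
  from couple_regular[OF _ _ sf wf_expr_rep wf_expr_rep _ this[unfolded rep_add_def Let_def]] x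
  show ?case using Add.IH by auto
next
  case (Mul R1 R2)
  have "inverse_pair (m * (state_dim (expr_rep R1) + state_dim (expr_rep R2))) (pencil scale UNIV m (rep_mul (expr_rep R1) (expr_rep R2)) x) M"
    using Mul.prems by (simp add: rep_mul_def Let_def)
  moreover have "- (inp_const (expr_rep R1) * outp (expr_rep R2)) \<in> carrier_mat (state_dim (expr_rep R1)) (state_dim (expr_rep R2))"
    using wf_descr_dims(3,4,7,8)[OF wf_expr_rep[of UNIV R1]] wf_descr_dims(3,4,7,8)[OF wf_expr_rep[of UNIV R2]]
    by (auto intro!: carrier_matI)
  ultimately show ?case
    using couple_regular[OF _ _ sf wf_expr_rep wf_expr_rep, where x = x and m = m] x Mul.IH unfolding rep_mul_def Let_def
    by (metis Int_iff UNIV_I expr_dom.simps(3) finite)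
next
  case (Inv R)
  let ?S = "expr_rep R"
  have w2: "wf_descr UNIV 1 1 (schur_rep ?S)" by (rule const_input_wf[OF const_input_schur[OF wf_expr_rep]])
  have "inverse_pair (m * (state_dim ?S + state_dim (schur_rep ?S))) (pencil scale UNIV m (rep_inv ?S) x) M"
    using Inv.prems by (simp add: rep_inv_def Let_def)
  hence *: "inverse_pair (m * (state_dim ?S + state_dim (schur_rep ?S))) (pencil scale UNIV m
    (couple (outp (schur_rep ?S) * prr_mat (state_dim ?S) (state_dim ?S + 1)) (inr_mat (state_dim ?S) (state_dim ?S + 1) * inp_const (schur_rep ?S))
      (0\<^sub>m (state_dim ?S) (state_dim (schur_rep ?S))) ?S (schur_rep ?S)) x) M"
    by (simp add: rep_inv_def Let_def)
  obtain M1 where "inverse_pair (m * state_dim ?S) (pencil scale UNIV m ?S x) M1"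
    using couple_regular(1)[OF _ _ sf wf_expr_rep w2 _ *] x by auto
  hence dom: "x \<in> expr_dom (mat_alg scale m) R" by (rule Inv.IH)
  obtain M2 where M2: "inverse_pair (m * state_dim (schur_rep ?S)) (pencil scale UNIV m (schur_rep ?S) x) M2"
    using couple_regular(2)[OF _ _ sf wf_expr_rep w2 _ *] x by auto
  have "\<exists>W. inverse_pair m (expr_eval (mat_alg scale m) R x) W"
    by (rule schur_regular[OF _ _ sf const_input_expr rep_at_expr[OF dom] M2[unfolded schur_rep_simps]]) (use x in auto)
  thus ?case using dom by (simp add: Units_mat_alg)
qed

end

lemma descr_at_expr:
  fixes x :: "'d::finite \<Rightarrow> 'a mat"
  assumes "x \<in> expr_dom (mat_alg scale m) R"
  shows "descr_at scale UNIV m (expr_rep R) x (expr_eval (mat_alg scale m) R x)"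
  unfolding descr_at_iff_rep_at[OF const_input_expr]
  by (rule rep_at_expr) (use assms expr_dom_carrier[OF assms] in auto)

lemma expr_eval_carrier:
  fixes x :: "'d::finite \<Rightarrow> 'a mat"
  assumes "x \<in> expr_dom (mat_alg scale m) R"
  shows "expr_eval (mat_alg scale m) R x \<in> carrier_mat m m"
  using descr_at_carrier[OF wf_expr_rep descr_at_expr[OF assms]] by simp

end

section \<open>Unital homomorphisms between evaluation algebras\<close>

definition unital_hom :: "('k, 'a, 'm) module_scheme \<Rightarrow> ('k, 'b, 'n) module_scheme \<Rightarrow> ('a \<Rightarrow> 'b) \<Rightarrow> bool" where
  "unital_hom A B h \<longleftrightarrow> (\<forall>x\<in>carrier A. h x \<in> carrier B) \<and> h \<one>\<^bsub>A\<^esub> = \<one>\<^bsub>B\<^esub> \<and> h \<zero>\<^bsub>A\<^esub> = \<zero>\<^bsub>B\<^esub> \<and>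
     (\<forall>x\<in>carrier A. \<forall>y\<in>carrier A. h (x \<otimes>\<^bsub>A\<^esub> y) = h x \<otimes>\<^bsub>B\<^esub> h y \<and> h (x \<oplus>\<^bsub>A\<^esub> y) = h x \<oplus>\<^bsub>B\<^esub> h y) \<and>
     (\<forall>c. \<forall>x\<in>carrier A. h (c \<odot>\<^bsub>A\<^esub> x) = c \<odot>\<^bsub>B\<^esub> h x)"

definition closed_algebra :: "('k, 'a, 'm) module_scheme \<Rightarrow> bool" where
  "closed_algebra A \<longleftrightarrow> abelian_monoid A \<and> Group.monoid A \<and> (\<forall>c. \<forall>x\<in>carrier A. c \<odot>\<^bsub>A\<^esub> x \<in> carrier A)"

text \<open>A unital homomorphism preserves units and their inverses. It is applied to the inflation
  X \<mapsto> 1 \<otimes> X, which adjusts sizes, and to the embedding of an algebra into its s by s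
  matrices as scalar diagonal matrices.\<close>

lemma expr_eval_hom:
  fixes A :: "('k::field, 'a, 'm) module_scheme" and B :: "('k, 'b, 'n) module_scheme"
  assumes A: "closed_algebra A" and B: "closed_algebra B" and h: "unital_hom A B h"
  shows "a \<in> expr_dom A R \<Longrightarrow> expr_eval A R a \<in> carrier A \<and> (\<lambda>k. h (a k)) \<in> expr_dom B R \<and> expr_eval B R (\<lambda>k. h (a k)) = h (expr_eval A R a)"
proof (induction R)
  case (Poly p)
  interpret A: abelian_monoid A using A by (simp add: closed_algebra_def)
  interpret A': Group.monoid A using A by (simp add: closed_algebra_def)
  interpret B: abelian_monoid B using B by (simp add: closed_algebra_def)
  have hadd: "h (u \<oplus>\<^bsub>A\<^esub> v) = h u \<oplus>\<^bsub>B\<^esub> h v" if "u \<in> carrier A" "v \<in> carrier A" for u v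
    using h that by (simp add: unital_hom_def)
  have a: "a k \<in> carrier A" for k using Poly by simp
  have ha: "h (a k) \<in> carrier B" for k using a h by (simp add: unital_hom_def)
  have w: "word_eval A w a \<in> carrier A \<and> word_eval B w (\<lambda>k. h (a k)) = h (word_eval A w a)" for w
    by (induction w) (use a h in \<open>auto simp: word_eval_def unital_hom_def\<close>)
  let ?f = "\<lambda>w. Poly_Mapping.lookup p w \<odot>\<^bsub>A\<^esub> word_eval A w a" and ?g = "\<lambda>w. Poly_Mapping.lookup p w \<odot>\<^bsub>B\<^esub> word_eval B w (\<lambda>k. h (a k))"
  have f: "?f w \<in> carrier A" for w using w A by (simp add: closed_algebra_def)
  have g: "?g w = h (?f w)" for w using w h by (simp add: unital_hom_def)
  have gc: "?g w \<in> carrier B" for w unfolding g using f h by (simp add: unital_hom_def)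
  have "foldr (\<lambda>w v. ?f w \<oplus>\<^bsub>A\<^esub> v) ws \<zero>\<^bsub>A\<^esub> \<in> carrier A \<and>
    foldr (\<lambda>w v. ?g w \<oplus>\<^bsub>B\<^esub> v) ws \<zero>\<^bsub>B\<^esub> = h (foldr (\<lambda>w v. ?f w \<oplus>\<^bsub>A\<^esub> v) ws \<zero>\<^bsub>A\<^esub>)" for ws
  proof (induction ws)
    case Nil
    show ?case using h by (simp add: unital_hom_def)
  next
    case (Cons w ws)
    let ?FA = "foldr (\<lambda>w v. ?f w \<oplus>\<^bsub>A\<^esub> v) ws \<zero>\<^bsub>A\<^esub>" and ?FB = "foldr (\<lambda>w v. ?g w \<oplus>\<^bsub>B\<^esub> v) ws \<zero>\<^bsub>B\<^esub>"
    have "?f w \<oplus>\<^bsub>A\<^esub> ?FA \<in> carrier A" using f[of w] Cons by blast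
    moreover have "?g w \<oplus>\<^bsub>B\<^esub> ?FB = h (?f w \<oplus>\<^bsub>A\<^esub> ?FA)"
      by (simp only: hadd[OF f[of w] conjunct1[OF Cons]] g[of w] conjunct2[OF Cons])
    ultimately show ?case unfolding foldr.simps o_apply by blast
  qed
  note folds = this[of "words_of p"]
  have pA: "poly_eval A p a = foldr (\<lambda>w v. ?f w \<oplus>\<^bsub>A\<^esub> v) (words_of p) \<zero>\<^bsub>A\<^esub>"
    unfolding poly_eval_def words_of(2)[symmetric] by (rule finsum_foldr[OF A.abelian_monoid_axioms words_of(1)]) (use f in auto)
  have pB: "poly_eval B p (\<lambda>k. h (a k)) = foldr (\<lambda>w v. ?g w \<oplus>\<^bsub>B\<^esub> v) (words_of p) \<zero>\<^bsub>B\<^esub>"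
    unfolding poly_eval_def words_of(2)[symmetric] by (rule finsum_foldr[OF B.abelian_monoid_axioms words_of(1)]) (use gc in auto)
  have "poly_eval A p a \<in> carrier A \<and> poly_eval B p (\<lambda>k. h (a k)) = h (poly_eval A p a)"
    unfolding pA pB by (rule folds)
  moreover have "(\<lambda>k. h (a k)) \<in> expr_dom B (Poly p)" using ha by simp
  ultimately show ?case unfolding expr_eval.simps by blast
next
  case (Add R1 R2)
  interpret A: abelian_monoid A using A by (simp add: closed_algebra_def)
  have IH: "expr_eval A R1 a \<in> carrier A" "(\<lambda>k. h (a k)) \<in> expr_dom B R1" "expr_eval B R1 (\<lambda>k. h (a k)) = h (expr_eval A R1 a)"
    "expr_eval A R2 a \<in> carrier A" "(\<lambda>k. h (a k)) \<in> expr_dom B R2" "expr_eval B R2 (\<lambda>k. h (a k)) = h (expr_eval A R2 a)"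
    using Add by auto
  have "h (expr_eval A R1 a \<oplus>\<^bsub>A\<^esub> expr_eval A R2 a) = h (expr_eval A R1 a) \<oplus>\<^bsub>B\<^esub> h (expr_eval A R2 a)"
    using h IH by (simp add: unital_hom_def)
  thus ?case unfolding expr_eval.simps expr_dom.simps IH using IH A.a_closed by auto
next
  case (Mul R1 R2)
  interpret A': Group.monoid A using A by (simp add: closed_algebra_def)
  have IH: "expr_eval A R1 a \<in> carrier A" "(\<lambda>k. h (a k)) \<in> expr_dom B R1" "expr_eval B R1 (\<lambda>k. h (a k)) = h (expr_eval A R1 a)"
    "expr_eval A R2 a \<in> carrier A" "(\<lambda>k. h (a k)) \<in> expr_dom B R2" "expr_eval B R2 (\<lambda>k. h (a k)) = h (expr_eval A R2 a)"
    using Mul by auto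
  have "h (expr_eval A R1 a \<otimes>\<^bsub>A\<^esub> expr_eval A R2 a) = h (expr_eval A R1 a) \<otimes>\<^bsub>B\<^esub> h (expr_eval A R2 a)"
    using h IH by (simp add: unital_hom_def)
  thus ?case unfolding expr_eval.simps expr_dom.simps IH using IH A'.m_closed by auto
next
  case (Inv R)
  interpret A': Group.monoid A using A by (simp add: closed_algebra_def)
  interpret B': Group.monoid B using B by (simp add: closed_algebra_def)
  have IH: "expr_eval A R a \<in> carrier A" "(\<lambda>k. h (a k)) \<in> expr_dom B R" "expr_eval B R (\<lambda>k. h (a k)) = h (expr_eval A R a)"
    using Inv by auto
  have hmul: "h (u \<otimes>\<^bsub>A\<^esub> v) = h u \<otimes>\<^bsub>B\<^esub> h v" if "u \<in> carrier A" "v \<in> carrier A" for u v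
    using h that by (simp add: unital_hom_def)
  let ?v = "expr_eval A R a"
  have u: "?v \<in> Units A" using Inv by simp
  have i: "inv\<^bsub>A\<^esub> ?v \<in> carrier A" "?v \<otimes>\<^bsub>A\<^esub> inv\<^bsub>A\<^esub> ?v = \<one>\<^bsub>A\<^esub>" "inv\<^bsub>A\<^esub> ?v \<otimes>\<^bsub>A\<^esub> ?v = \<one>\<^bsub>A\<^esub>"
    using u by auto
  have hi: "h (inv\<^bsub>A\<^esub> ?v) \<in> carrier B" "h ?v \<in> carrier B" using i IH h by (auto simp: unital_hom_def)
  have e: "h ?v \<otimes>\<^bsub>B\<^esub> h (inv\<^bsub>A\<^esub> ?v) = \<one>\<^bsub>B\<^esub>" "h (inv\<^bsub>A\<^esub> ?v) \<otimes>\<^bsub>B\<^esub> h ?v = \<one>\<^bsub>B\<^esub>"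
    using hmul[OF IH(1) i(1)] hmul[OF i(1) IH(1)] i h by (simp_all add: unital_hom_def)
  have "h ?v \<in> Units B" unfolding Units_def using hi e by blast
  moreover have "inv\<^bsub>B\<^esub> (h ?v) = h (inv\<^bsub>A\<^esub> ?v)" using B'.inv_unique'[OF hi(2,1) e] by simp
  ultimately show ?case using IH i by simp
qed

lemma (in unital_algebra) closed_algebra_mat_alg: "closed_algebra (mat_alg scale n)"
  unfolding closed_algebra_def
  by (intro conjI abelian_monoid_mat_alg Group.monoidI) auto

lemma (in unital_algebra) closed_algebra_type: "closed_algebra (type_algebra scale)"
  unfolding closed_algebra_def
  by (intro conjI abelian_monoidI Group.monoidI) (auto simp: type_algebra_def algebra_simps)

lemma (in unital_algebra) unital_hom_one_kron: "unital_hom (mat_alg scale n) (mat_alg scale (e * n)) (\<lambda>X. 1\<^sub>m e \<otimes>\<^sub>K X)"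
proof -
  have "1\<^sub>m e \<otimes>\<^sub>K map_mat (scale c) X = map_mat (scale c) (1\<^sub>m e \<otimes>\<^sub>K X)" for c X
    by (rule eq_matI) (auto simp: index_one_kron mod_mult_lt)
  thus ?thesis
    by (auto simp: unital_hom_def one_kron_mult one_kron_add one_kron_one one_kron_zero intro!: carrier_matI)
qed

lemma (in unital_algebra) unital_hom_scalar_tensor: "unital_hom (type_algebra scale) (mat_alg scale s) (scalar_tensor scale (1\<^sub>m s))"
proof -
  have m: "scalar_tensor scale (1\<^sub>m s) (a * b) = scalar_tensor scale (1\<^sub>m s) a * scalar_tensor scale (1\<^sub>m s) b" for a b
  proof (rule eq_matI)
    fix i j assume "i < dim_row (scalar_tensor scale (1\<^sub>m s) a * scalar_tensor scale (1\<^sub>m s) b)"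
      "j < dim_col (scalar_tensor scale (1\<^sub>m s) a * scalar_tensor scale (1\<^sub>m s) b)"
    hence ij: "i < s" "j < s" by (auto simp: scalar_tensor_def)
    have "(scalar_tensor scale (1\<^sub>m s) a * scalar_tensor scale (1\<^sub>m s) b) $$ (i, j) =
      (\<Sum>k<s. scalar_tensor scale (1\<^sub>m s) a $$ (i, k) * scalar_tensor scale (1\<^sub>m s) b $$ (k, j))"
      using ij by (subst index_mult_mat_sum) (auto simp: scalar_tensor_def)
    also have "\<dots> = (\<Sum>k<s. if k = i then (if i = j then a * b else 0) else 0)"
      using ij by (intro sum.cong) (auto simp: scalar_tensor_def)
    also have "\<dots> = scalar_tensor scale (1\<^sub>m s) (a * b) $$ (i, j)" using ij by (simp add: sum.delta scalar_tensor_def)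
    finally show "scalar_tensor scale (1\<^sub>m s) (a * b) $$ (i, j) = (scalar_tensor scale (1\<^sub>m s) a * scalar_tensor scale (1\<^sub>m s) b) $$ (i, j)" by simp
  qed (auto simp: scalar_tensor_def)
  have c: "scalar_tensor scale (1\<^sub>m s) a \<in> carrier_mat s s" for a by (auto simp: scalar_tensor_def)
  have o: "scalar_tensor scale (1\<^sub>m s) 1 = 1\<^sub>m s" "scalar_tensor scale (1\<^sub>m s) 0 = 0\<^sub>m s s"
    by (auto simp: scalar_tensor_def)
  have p: "scalar_tensor scale (1\<^sub>m s) (a + b) = scalar_tensor scale (1\<^sub>m s) a + scalar_tensor scale (1\<^sub>m s) b" for a b
    by (auto simp: scalar_tensor_def)
  have sc: "scalar_tensor scale (1\<^sub>m s) (scale d a) = map_mat (scale d) (scalar_tensor scale (1\<^sub>m s) a)" for a d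
    by (auto simp: scalar_tensor_def)
  show ?thesis unfolding unital_hom_def type_algebra_def by (simp add: c o p m sc)
qed

section \<open>Matrices of expressions\<close>

text \<open>Unit vectors multiplied to output and input move a scalar function to the entry (i, j)
  of a p by q matrix of functions.\<close>

definition place :: "nat \<Rightarrow> nat \<Rightarrow> nat \<Rightarrow> nat \<Rightarrow> ('i, 'k::field) descriptor \<Rightarrow> ('i, 'k) descriptor" where
  "place p q i j S = linear_rep (state_dim S) (mat_unit p 1 i 0 * outp S) (pen_const S) (pen_coeff S) (inp_const S * mat_unit 1 q 0 j)"

definition zero_rep :: "nat \<Rightarrow> nat \<Rightarrow> ('i, 'k::field) descriptor" where
  "zero_rep p q = linear_rep 0 (0\<^sub>m p 0) (1\<^sub>m 0) (\<lambda>_. 0\<^sub>m 0 0) (0\<^sub>m 0 q)"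

definition mat_rep :: "nat \<Rightarrow> nat \<Rightarrow> (nat \<Rightarrow> nat \<Rightarrow> ('d, 'k::field) nc_expr) \<Rightarrow> (nat \<times> nat) list \<Rightarrow> ('d, 'k) descriptor" where
  "mat_rep p q F ps = foldr (\<lambda>(i, j) S. rep_add (place p q i j (expr_rep (F i j))) S) ps (zero_rep p q)"

text \<open>The sum of V_ij \<otimes> E_ij, in the tensor order of \<open>rat_mat_value\<close>. It
  is a fold so as to run parallel to \<open>mat_rep\<close>.\<close>

definition mat_val :: "('k::field \<Rightarrow> 'a \<Rightarrow> 'a) \<Rightarrow> nat \<Rightarrow> nat \<Rightarrow> nat \<Rightarrow> (nat \<Rightarrow> nat \<Rightarrow> 'a::ring_1 mat) \<Rightarrow> (nat \<times> nat) list \<Rightarrow> 'a mat" where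
  "mat_val scale p q n V ps = foldr (\<lambda>(i, j) W. kron_scalar scale (V i j) (mat_unit p q i j) + W) ps (0\<^sub>m (n * p) (n * q))"

lemma mat_rep_simps [simp]:
  "mat_rep p q F [] = zero_rep p q"
  "mat_rep p q F ((i, j) # ps) = rep_add (place p q i j (expr_rep (F i j))) (mat_rep p q F ps)"
  by (simp_all add: mat_rep_def)

lemma mat_val_simps [simp]:
  "mat_val scale p q n V [] = 0\<^sub>m (n * p) (n * q)"
  "mat_val scale p q n V ((i, j) # ps) = kron_scalar scale (V i j) (mat_unit p q i j) + mat_val scale p q n V ps"
  by (simp_all add: mat_val_def)

lemma mat_val_cong: "(\<And>i j. (i, j) \<in> set ps \<Longrightarrow> V i j = V' i j) \<Longrightarrow> mat_val scale p q n V ps = mat_val scale p q n V' ps"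
  by (induction ps) auto

lemma const_input_place:
  assumes "wf_descr I 1 1 S"
  shows "const_input I p q (place p q i j S)"
  unfolding place_def
  by (rule const_input_linear_rep) (use wf_descr_dims[OF assms] in \<open>auto intro!: carrier_matI\<close>)

lemma const_input_mat_rep: "const_input I p q (mat_rep p q F ps)"
proof (induction ps)
  case Nil
  show ?case unfolding mat_rep_simps zero_rep_def by (rule const_input_linear_rep) auto
next
  case (Cons ij ps)
  obtain i j where ij: "ij = (i, j)" by (cases ij)
  show ?case unfolding ij mat_rep_simps by (rule const_input_ops(1)[OF const_input_place[OF wf_expr_rep] Cons])
qed

lemma wf_mat_rep: "wf_descr I p q (mat_rep p q F ps)"
  by (rule const_input_wf[OF const_input_mat_rep])

context unital_algebra begin

lemma rep_at_place:
  assumes x: "\<And>\<kappa>. \<kappa> \<in> I \<Longrightarrow> x \<kappa> \<in> carrier_mat m m" and w: "wf_descr I 1 1 S" and V: "rep_at I m S x V"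
  shows "rep_at I m (place p q i j S) x (V \<star> mat_unit p q i j)"
proof -
  obtain M where M: "inverse_pair (m * state_dim S) (pencil scale I m S x) M"
    and V: "V = (1\<^sub>m m \<star> outp S) * (M * (1\<^sub>m m \<star> inp_const S))"
    using V by (auto simp: rep_at_def)
  note d = wf_descr_dims(3,4,7,8)[OF w] inverse_pair_dims(3,4)[OF M]
  have dV: "dim_row V = m" "dim_col V = m" using d by (auto simp: V)
  hence Vc: "V \<in> carrier_mat m m" by (rule carrier_matI)
  have "(1\<^sub>m m \<star> (mat_unit p 1 i 0 * outp S)) * (M * (1\<^sub>m m \<star> (inp_const S * mat_unit 1 q 0 j))) =
    ((1\<^sub>m m \<star> mat_unit p 1 i 0) * (1\<^sub>m m \<star> outp S)) * (M * ((1\<^sub>m m \<star> inp_const S) * (1\<^sub>m m \<star> mat_unit 1 q 0 j)))"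
    using d by (simp add: kron_scalar_mult)
  also have "\<dots> = (1\<^sub>m m \<star> mat_unit p 1 i 0) * (V * (1\<^sub>m m \<star> mat_unit 1 q 0 j))"
    unfolding V using d by (simp add: mat_dim_simps)
  also have "\<dots> = (1\<^sub>m m \<star> mat_unit p 1 i 0) * ((V \<star> 1\<^sub>m (Suc 0)) * (1\<^sub>m m \<star> mat_unit 1 q 0 j))" by simp
  also have "(V \<star> 1\<^sub>m (Suc 0)) * (1\<^sub>m m \<star> mat_unit 1 q 0 j) = (V * 1\<^sub>m m) \<star> (1\<^sub>m (Suc 0) * mat_unit 1 q 0 j)"
    using dV by (intro kron_scalar_mult) auto
  also have "(1\<^sub>m m \<star> mat_unit p 1 i 0) * \<dots> = (1\<^sub>m m * (V * 1\<^sub>m m)) \<star> (mat_unit p 1 i 0 * (1\<^sub>m (Suc 0) * mat_unit 1 q 0 j))"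
    using dV by (intro kron_scalar_mult) auto
  also have "1\<^sub>m m * (V * 1\<^sub>m m) = V" by (simp only: left_mult_one_mat[OF Vc] right_mult_one_mat[OF Vc])
  also have "mat_unit p 1 i 0 * (1\<^sub>m (Suc 0) * mat_unit 1 q 0 j) = (mat_unit p q i j :: 'k mat)"
    by (simp add: mat_unit_mult left_mult_one_mat[OF mat_unit_carrier])
  finally show ?thesis using M by (auto simp: rep_at_def place_def pencil_def)
qed

lemma rep_at_zero:
  "rep_at I m (zero_rep p q) x (0\<^sub>m (m * p) (m * q))"
proof -
  have "inverse_pair (m * 0) (pencil scale I m (zero_rep p q) x) (0\<^sub>m 0 0)"
    by (auto simp: inverse_pair_def pencil_def zero_rep_def intro!: carrier_matI eq_matI)
  moreover have "(1\<^sub>m m \<star> 0\<^sub>m p 0) * (0\<^sub>m 0 0 * (1\<^sub>m m \<star> 0\<^sub>m 0 q)) = 0\<^sub>m (m * p) (m * q)"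
    by (rule eq_matI) (auto simp: kron_scalar_zero_right)
  ultimately show ?thesis by (auto simp: rep_at_def zero_rep_def)
qed

lemma rep_at_mat_rep:
  fixes x :: "'d::finite \<Rightarrow> 'a mat"
  assumes x: "\<And>\<kappa>. x \<kappa> \<in> carrier_mat m m" and dom: "\<And>i j. (i, j) \<in> set ps \<Longrightarrow> x \<in> expr_dom (mat_alg scale m) (F i j)"
  shows "rep_at UNIV m (mat_rep p q F ps) x (mat_val scale p q m (\<lambda>i j. expr_eval (mat_alg scale m) (F i j) x) ps)"
  using dom
proof (induction ps)
  case Nil
  show ?case using rep_at_zero by simp
next
  case (Cons ij ps)
  obtain i j where ij: "ij = (i, j)" by (cases ij)
  have 1: "rep_at UNIV m (place p q i j (expr_rep (F i j))) x (expr_eval (mat_alg scale m) (F i j) x \<star> mat_unit p q i j)"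
    by (rule rep_at_place[OF _ wf_expr_rep rep_at_expr]) (use Cons.prems x ij in auto)
  have 2: "rep_at UNIV m (mat_rep p q F ps) x (mat_val scale p q m (\<lambda>i j. expr_eval (mat_alg scale m) (F i j) x) ps)"
    using Cons by auto
  show ?case unfolding ij mat_rep_simps mat_val_simps
    by (rule rep_at_add[OF _ _ const_input_place[OF wf_expr_rep] const_input_mat_rep 1 2]) (use x in auto)
qed

lemma descr_at_mat_rep:
  fixes x :: "'d::finite \<Rightarrow> 'a mat"
  assumes x: "\<And>\<kappa>. x \<kappa> \<in> carrier_mat m m" and dom: "\<And>i j. (i, j) \<in> set ps \<Longrightarrow> x \<in> expr_dom (mat_alg scale m) (F i j)"
  shows "descr_at scale UNIV m (mat_rep p q F ps) x (mat_val scale p q m (\<lambda>i j. expr_eval (mat_alg scale m) (F i j) x) ps)"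
  unfolding descr_at_iff_rep_at[OF const_input_mat_rep] by (rule rep_at_mat_rep) (use x dom in auto)

lemma descr_at_recentre:
  assumes fin: "finite I" and z: "\<And>\<kappa>. \<kappa> \<in> I \<Longrightarrow> z \<kappa> \<in> carrier_mat e e"
    and x: "\<And>\<kappa>. \<kappa> \<in> I \<Longrightarrow> x \<kappa> \<in> carrier_mat (m * e) (m * e)"
    and wf: "wf_descr I p q S" and Q: "inverse_pair (e * state_dim S) (pencil (*) I e S z) Q"
  shows "descr_at scale (grid I e) m (recentre I e S z Q) (coords scale e m z x) V \<longleftrightarrow> descr_at scale I (m * e) S x V"
proof -
  have f: "finite (grid I e)" using fin by simp
  have c: "coords scale e m z x \<kappa> \<in> carrier_mat m m" for \<kappa> by (cases \<kappa>) (auto simp: coords_def entry_block_def)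
  have Q': "inverse_pair (state_dim (amplify I e S z)) (pen_const (amplify I e S z)) Q" using Q by (simp add: amplify_def)
  have "descr_at scale (grid I e) m (recentre I e S z Q) (coords scale e m z x) V \<longleftrightarrow>
    descr_at scale (grid I e) m (amplify I e S z) (coords scale e m z x) V"
    unfolding recentre_def by (rule descr_at_normalize[OF f c wf_amplify[OF wf] Q'])
  also have "\<dots> \<longleftrightarrow> descr_at scale I (m * e) S x V" by (rule descr_at_amplify[OF fin _ _ wf]) (use z x in auto)
  finally show ?thesis .
qed

lemma coords_one_kron:
  assumes "X \<kappa> \<in> carrier_mat (m * s) (m * s)" "Y \<kappa> \<in> carrier_mat s s" "i < s" "j < s"
  shows "coords scale s (e * m) Y (\<lambda>\<kappa>. 1\<^sub>m e \<otimes>\<^sub>K X \<kappa>) (\<kappa>, i, j) = 1\<^sub>m e \<otimes>\<^sub>K coords scale s m Y X (\<kappa>, i, j)"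
proof (rule eq_matI)
  fix a b assume "a < dim_row (1\<^sub>m e \<otimes>\<^sub>K coords scale s m Y X (\<kappa>, i, j))" "b < dim_col (1\<^sub>m e \<otimes>\<^sub>K coords scale s m Y X (\<kappa>, i, j))"
  hence ab: "a < e * m" "b < e * m" by (auto simp: coords_def entry_block_def)
  have bd: "a * s + i < e * m * s" "b * s + j < e * m * s" "a mod m * s + i < m * s" "b mod m * s + j < m * s"
    using ab assms block_index_lt by (auto intro!: block_index_lt mod_mult_lt)
  have dm: "(a * s + i) div (m * s) = a div m" "(b * s + j) div (m * s) = b div m"
    "(a * s + i) mod (m * s) = a mod m * s + i" "(b * s + j) mod (m * s) = b mod m * s + j"
    using assms by (auto simp: div_mult2_eq[of _ s m] mod_mult2_eq[of _ s m] mult.commute[of m s])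
  have dab: "a = b \<longleftrightarrow> a div m = b div m \<and> a mod m = b mod m" by (metis div_mod_decomp)
  show "coords scale s (e * m) Y (\<lambda>\<kappa>. 1\<^sub>m e \<otimes>\<^sub>K X \<kappa>) (\<kappa>, i, j) $$ (a, b) = (1\<^sub>m e \<otimes>\<^sub>K coords scale s m Y X (\<kappa>, i, j)) $$ (a, b)"
    using assms ab bd dm dab
    by (simp add: coords_def entry_block_def index_one_kron index_kron_scalar mod_mult_lt mult.assoc)
qed (auto simp: coords_def entry_block_def)

end

lemma centered_recentre [simp]: "wf_descr I p q S \<Longrightarrow> centered (recentre I e S z Q)"
  by (simp add: centered_def recentre_def normalize_descr_def)

lemma wf_recentre:
  assumes "wf_descr I p q S" "inverse_pair (e * state_dim S) (pencil (*) I e S z) Q"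
  shows "wf_descr (grid I e) (e * p) (e * q) (recentre I e S z Q)"
  unfolding recentre_def
  by (rule wf_normalize_descr[OF wf_amplify[OF assms(1)]]) (use assms(2) in \<open>simp add: amplify_def inverse_pair_def\<close>)

section \<open>Points at which several expressions are defined\<close>

lemma regular_of_expr_dom:
  fixes x :: "'d::finite \<Rightarrow> 'k::field mat"
  assumes "x \<in> expr_dom (mat_algebra n) R"
  shows "\<exists>M. inverse_pair (n * state_dim (expr_rep R)) (pencil (*) UNIV n (expr_rep R) x) M"
  using field_algebra.descr_at_expr[of x n R] assms by (auto simp: mat_alg_field descr_at_def)

lemma field_expr_dom_carrier: "x \<in> expr_dom (mat_algebra n) R \<Longrightarrow> x \<kappa> \<in> carrier_mat n n"
  using expr_dom_carrier[of x "mat_algebra n" R \<kappa>] by (simp add: module_mat_simps)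

lemma expr_dom_one_kron:
  fixes x :: "'d::finite \<Rightarrow> 'k::field mat"
  assumes "x \<in> expr_dom (mat_algebra n) R"
  shows "(\<lambda>\<kappa>. 1\<^sub>m e \<otimes>\<^sub>K x \<kappa>) \<in> expr_dom (mat_algebra (e * n)) R"
    "expr_eval (mat_algebra (e * n)) R (\<lambda>\<kappa>. 1\<^sub>m e \<otimes>\<^sub>K x \<kappa>) = 1\<^sub>m e \<otimes>\<^sub>K expr_eval (mat_algebra n) R x"
  using expr_eval_hom[OF field_algebra.closed_algebra_mat_alg field_algebra.closed_algebra_mat_alg field_algebra.unital_hom_one_kron, of x n R e] assms
  by (simp_all add: mat_alg_field)

text \<open>The two given points are inflated to the common size n*s, where both pencils are regular
  at one of them each. A common regular point on the line joining them is a common domain point,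
  since regularity of the pencil is definedness of the expression.\<close>

lemma common_domain_point:
  fixes Y :: "'d::finite \<Rightarrow> 'k::field mat"
  assumes Y: "Y \<in> expr_dom (mat_algebra s) R1" and s: "s \<ge> 1" and R2: "nondegenerate R2"
  shows "\<exists>e\<ge>1. \<exists>Z. Z \<in> expr_dom (mat_algebra (e * s)) R1 \<and> Z \<in> expr_dom (mat_algebra (e * s)) R2"
proof -
  obtain n Y2 where n: "n \<ge> 1" and Y2: "Y2 \<in> expr_dom (mat_algebra n) R2"
    using R2 by (auto simp: nondegenerate_def)
  note k1 = expr_dom_one_kron(1)[OF Y, of n] and k2 = expr_dom_one_kron(1)[OF Y2, of s, unfolded mult.commute[of s n]]
  obtain M1 where M1: "inverse_pair (n * s * state_dim (expr_rep R1)) (pencil (*) UNIV (n * s) (expr_rep R1) (\<lambda>\<kappa>. 1\<^sub>m n \<otimes>\<^sub>K Y \<kappa>)) M1"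
    using regular_of_expr_dom[OF k1] by blast
  obtain M2 where M2: "inverse_pair (n * s * state_dim (expr_rep R2)) (pencil (*) UNIV (n * s) (expr_rep R2) (\<lambda>\<kappa>. 1\<^sub>m s \<otimes>\<^sub>K Y2 \<kappa>)) M2"
    using regular_of_expr_dom[OF k2] by blast
  note c = field_expr_dom_carrier[OF k1] field_expr_dom_carrier[OF k2]
  obtain e Z N N' where e: "e \<ge> 1" and Z: "\<And>\<kappa>. \<kappa> \<in> UNIV \<Longrightarrow> Z \<kappa> \<in> carrier_mat (e * (n * s)) (e * (n * s))"
    and N: "inverse_pair (e * (n * s) * state_dim (expr_rep R1)) (pencil (*) UNIV (e * (n * s)) (expr_rep R1) Z) N"
      "inverse_pair (e * (n * s) * state_dim (expr_rep R2)) (pencil (*) UNIV (e * (n * s)) (expr_rep R2) Z) N'"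
    by (rule common_regular_point[OF finite_UNIV wf_expr_rep wf_expr_rep c M1 M2]) blast
  have "Z \<in> expr_dom (mat_algebra (e * (n * s))) R1" "Z \<in> expr_dom (mat_algebra (e * (n * s))) R2"
    using field_algebra.expr_dom_of_regular[OF Z stably_finite_field N(1)] field_algebra.expr_dom_of_regular[OF Z stably_finite_field N(2)]
    by (simp_all add: mat_alg_field)
  thus ?thesis using e n by (intro exI[of _ "e * n"]) (auto simp: mult.assoc)
qed

text \<open>It serves through its domain, the intersection of the domains of the summands: a finite
  family of expressions can be handled as one.\<close>

definition sum_expr :: "('d, 'k::field) nc_expr list \<Rightarrow> ('d, 'k) nc_expr" where
  "sum_expr Rs = foldr Add Rs (Poly 0)"

lemma expr_dom_sum_expr: "x \<in> expr_dom A (sum_expr Rs) \<longleftrightarrow> (\<forall>k. x k \<in> carrier A) \<and> (\<forall>R\<in>set Rs. x \<in> expr_dom A R)"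
  by (induction Rs) (auto simp: sum_expr_def)

lemma nondegenerate_sum_expr:
  fixes Rs :: "('d::finite, 'k::field) nc_expr list"
  assumes "\<And>R. R \<in> set Rs \<Longrightarrow> nondegenerate R"
  shows "nondegenerate (sum_expr Rs)"
  using assms
proof (induction Rs)
  case Nil
  have "(\<lambda>_. 0\<^sub>m 1 1) \<in> expr_dom (mat_algebra 1) (sum_expr [] :: ('d, 'k) nc_expr)"
    by (simp add: sum_expr_def module_mat_simps)
  thus ?case unfolding nondegenerate_def by blast
next
  case (Cons R Rs)
  obtain n Y where n: "n \<ge> 1" and Y: "Y \<in> expr_dom (mat_algebra n) R" using Cons.prems[of R] by (auto simp: nondegenerate_def)
  have "nondegenerate (sum_expr Rs)" using Cons by auto
  then obtain e Z where eZ: "e \<ge> 1" "Z \<in> expr_dom (mat_algebra (e * n)) R" "Z \<in> expr_dom (mat_algebra (e * n)) (sum_expr Rs)"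
    using common_domain_point[OF Y n] by blast
  have "Z \<in> expr_dom (mat_algebra (e * n)) (sum_expr (R # Rs))" using eZ by (simp add: sum_expr_def)
  moreover have "e * n \<ge> 1" using eZ n by simp
  ultimately show ?case unfolding nondegenerate_def by blast
qed

section \<open>Extension of the domain\<close>

text \<open>A minimal system for the chosen representatives \<open>F\<close>, tied to them by the
  Markov parameters of their expansion at \<open>Y\<close>. This is the common description of
  constructed and given realizations.\<close>

definition minimal_for ::
  "nat \<Rightarrow> nat \<Rightarrow> nat \<Rightarrow> (nat \<times> nat) list \<Rightarrow> (nat \<Rightarrow> nat \<Rightarrow> ('d, 'k::field) nc_expr) \<Rightarrow> ('d \<Rightarrow> 'k mat) \<Rightarrow>
   ('d \<times> nat \<times> nat, 'k) descriptor \<Rightarrow> bool" where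
  "minimal_for s p q ps F Y M \<longleftrightarrow>
     wf_descr (grid UNIV s) (s * p) (s * q) M \<and> centered M \<and> minimal (grid UNIV s) M \<and>
     (\<exists>Q. inverse_pair (s * state_dim (mat_rep p q F ps)) (pencil (*) UNIV s (mat_rep p q F ps) Y) Q \<and>
        same_markov (grid UNIV s) (recentre UNIV s (mat_rep p q F ps) Y Q) M)"

lemma descr_at_cong:
  assumes "\<And>\<kappa>. \<kappa> \<in> I \<Longrightarrow> x \<kappa> = x' \<kappa>"
  shows "descr_at scale I m S x V \<longleftrightarrow> descr_at scale I m S x' V"
proof -
  have "pencil scale I m S x = pencil scale I m S x'" "input scale I m S x = input scale I m S x'"
    unfolding pencil_def input_def using assms by (simp_all cong: lin_cong)
  thus ?thesis by (simp add: descr_at_def)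
qed

text \<open>The representatives chosen at \<open>Y\<close> have an expansion there whose Markov
  parameters are those of \<open>M\<close>, so \<open>descr_at_minimal\<close> applies directly at
  every point where they are defined.\<close>

lemma (in unital_algebra) descr_at_minimal_for_self:
  fixes X :: "'d::finite \<Rightarrow> 'a mat"
  assumes sf: "stably_finite TYPE('a)" and M: "minimal_for s p q ps F Y M" and Y: "\<And>\<kappa>. Y \<kappa> \<in> carrier_mat s s"
    and X: "\<And>\<kappa>. X \<kappa> \<in> carrier_mat (m * s) (m * s)"
    and dom: "\<And>i j. (i, j) \<in> set ps \<Longrightarrow> X \<in> expr_dom (mat_alg scale (m * s)) (F i j)"
  shows "descr_at scale (grid UNIV s) m M (coords scale s m Y X)
    (mat_val scale p q (m * s) (\<lambda>i j. expr_eval (mat_alg scale (m * s)) (F i j) X) ps)"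
proof -
  let ?S = "mat_rep p q F ps"
  obtain Q where Q: "inverse_pair (s * state_dim ?S) (pencil (*) UNIV s ?S Y) Q"
    and mk: "same_markov (grid UNIV s) (recentre UNIV s ?S Y Q) M"
    and M': "wf_descr (grid UNIV s) (s * p) (s * q) M" "centered M" "minimal (grid UNIV s) M"
    using M by (auto simp: minimal_for_def)
  have "descr_at scale UNIV (m * s) ?S X (mat_val scale p q (m * s) (\<lambda>i j. expr_eval (mat_alg scale (m * s)) (F i j) X) ps)"
    by (rule descr_at_mat_rep) (use X dom in auto)
  hence "descr_at scale (grid UNIV s) m (recentre UNIV s ?S Y Q) (coords scale s m Y X)
    (mat_val scale p q (m * s) (\<lambda>i j. expr_eval (mat_alg scale (m * s)) (F i j) X) ps)"
    by (subst descr_at_recentre[OF finite_UNIV _ _ wf_mat_rep Q]) (use X Y in auto)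
  from descr_at_minimal[OF sf _ _ wf_recentre[OF wf_mat_rep Q] M'(1) centered_recentre[OF wf_mat_rep] M'(2) mk M'(3) this]
  show ?thesis by simp
qed

text \<open>The point whose coordinates around \<open>Y\<close>, and then around \<open>z\<close>,
  are the matrices of \<open>shift_point w\<close>. If \<open>z\<close> consists of the coordinates
  of Z, it differs from 1 \<otimes> Z by a strictly block upper triangular matrix.\<close>

definition lifted_shift ::
  "nat \<Rightarrow> nat \<Rightarrow> ('d \<Rightarrow> 'k::field mat) \<Rightarrow> ('d \<times> nat \<times> nat \<Rightarrow> 'k mat) \<Rightarrow> (('d \<times> nat \<times> nat) \<times> nat \<times> nat) list \<Rightarrow> 'd \<Rightarrow> 'k mat" where
  "lifted_shift s e Y z w = assemble s (Suc (length w) * e) Y (assemble e (Suc (length w)) z (shift_point w))"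

lemma lifted_shift_carrier [simp]: "lifted_shift s e Y z w \<kappa> \<in> carrier_mat (Suc (length w) * e * s) (Suc (length w) * e * s)"
  by (simp add: lifted_shift_def del: mult_Suc)

lemma coords_lifted_shift:
  assumes "\<And>\<kappa>. Y \<kappa> \<in> carrier_mat s s" "\<kappa> \<in> grid UNIV s"
  shows "coords (*) s (Suc (length w) * e) Y (lifted_shift s e Y z w) \<kappa> = assemble e (Suc (length w)) z (shift_point w) \<kappa>"
  using assms by (cases \<kappa>) (auto simp: lifted_shift_def coords_assemble simp del: mult_Suc)

lemma coords_shift:
  assumes "\<And>\<kappa>. z \<kappa> \<in> carrier_mat e e" "\<kappa> \<in> grid I e"
  shows "coords (*) e (Suc (length w)) z (assemble e (Suc (length w)) z (shift_point w)) \<kappa> = shift_point w \<kappa>"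
  using assms by (cases \<kappa>) (auto simp: coords_assemble)

lemma descr_at_shift:
  fixes z :: "'d::finite \<times> nat \<times> nat \<Rightarrow> 'k::field mat"
  assumes z: "\<And>\<kappa>. z \<kappa> \<in> carrier_mat e e" and wf: "wf_descr (grid UNIV s) p q S"
    and N: "inverse_pair (e * state_dim S) (pencil (*) (grid UNIV s) e S z) N"
  shows "descr_at (*) (grid (grid UNIV s) e) (Suc (length w)) (recentre (grid UNIV s) e S z N) (shift_point w) V \<longleftrightarrow>
    descr_at (*) (grid UNIV s) (Suc (length w) * e) S (assemble e (Suc (length w)) z (shift_point w :: _ \<Rightarrow> 'k mat)) V"
proof -
  have "descr_at (*) (grid (grid UNIV s) e) (Suc (length w)) (recentre (grid UNIV s) e S z N) (shift_point w) V \<longleftrightarrow>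
    descr_at (*) (grid (grid UNIV s) e) (Suc (length w)) (recentre (grid UNIV s) e S z N)
      (coords (*) e (Suc (length w)) z (assemble e (Suc (length w)) z (shift_point w))) V"
    by (rule descr_at_cong, rule coords_shift[OF z, symmetric]) assumption
  also have "\<dots> \<longleftrightarrow> descr_at (*) (grid UNIV s) (Suc (length w) * e) S (assemble e (Suc (length w)) z (shift_point w)) V"
    by (rule field_algebra.descr_at_recentre[OF _ _ _ wf N]) (use z in \<open>auto simp del: mult_Suc\<close>)
  finally show ?thesis .
qed

lemma descr_at_lifted_shift:
  fixes Y :: "'d::finite \<Rightarrow> 'k::field mat"
  assumes Y: "\<And>\<kappa>. Y \<kappa> \<in> carrier_mat s s" and wf: "wf_descr UNIV p q S"
  shows "descr_at (*) (grid UNIV s) (Suc (length w) * e) (amplify UNIV s S Y) (assemble e (Suc (length w)) z (shift_point w)) V \<longleftrightarrow>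
    descr_at (*) UNIV (Suc (length w) * e * s) S (lifted_shift s e Y z w) V"
proof -
  have "descr_at (*) (grid UNIV s) (Suc (length w) * e) (amplify UNIV s S Y) (assemble e (Suc (length w)) z (shift_point w)) V \<longleftrightarrow>
    descr_at (*) (grid UNIV s) (Suc (length w) * e) (amplify UNIV s S Y) (coords (*) s (Suc (length w) * e) Y (lifted_shift s e Y z w)) V"
    by (rule descr_at_cong) (rule coords_lifted_shift[OF Y, symmetric])
  also have "\<dots> \<longleftrightarrow> descr_at (*) UNIV (Suc (length w) * e * s) S (lifted_shift s e Y z w) V"
    by (rule field_algebra.descr_at_amplify[OF finite_UNIV _ _ wf]) (use Y in \<open>auto simp del: mult_Suc\<close>)
  finally show ?thesis .
qed

lemma amplified_pencil_regular:
  fixes Y :: "'d::finite \<Rightarrow> 'k::field mat"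
  assumes Y: "\<And>\<kappa>. Y \<kappa> \<in> carrier_mat s s" and Z: "\<And>\<kappa>. Z \<kappa> \<in> carrier_mat (e * s) (e * s)" and wf: "wf_descr UNIV p q S"
    and N: "inverse_pair (e * s * state_dim S) (pencil (*) UNIV (e * s) S Z) N"
  shows "inverse_pair (e * state_dim (amplify UNIV s S Y)) (pencil (*) (grid UNIV s) e (amplify UNIV s S Y) (coords (*) s e Y Z)) N"
proof -
  have "pencil (*) (grid UNIV s) e (amplify UNIV s S Y) (coords (*) s e Y Z) = pencil (*) UNIV (e * s) S Z"
    by (rule field_algebra.pencil_amplify[OF finite_UNIV _ _ wf]) (use Y Z in auto)
  moreover have "e * state_dim (amplify UNIV s S Y) = e * s * state_dim S" by (simp add: amplify_def)
  ultimately show ?thesis using N by (simp only:)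
qed

text \<open>Expanded at \<open>Z\<close> the pencil has constant term 1, so it stays invertible at a
  strictly triangular point, and invertibility of the pencil is definedness of
  \<open>G\<close>.\<close>

lemma lifted_shift_in_dom:
  fixes Y :: "'d::finite \<Rightarrow> 'k::field mat"
  assumes Y: "\<And>\<kappa>. Y \<kappa> \<in> carrier_mat s s" and Z: "Z \<in> expr_dom (mat_algebra (e * s)) G"
    and w: "w \<in> lists (grid (grid UNIV s) e)"
  shows "lifted_shift s e Y (coords (*) s e Y Z) w \<in> expr_dom (mat_algebra (Suc (length w) * e * s)) G"
proof -
  let ?I = "grid UNIV s :: ('d \<times> nat \<times> nat) set" and ?z = "coords (*) s e Y Z" and ?S = "expr_rep G"
  obtain N where N: "inverse_pair (e * s * state_dim ?S) (pencil (*) UNIV (e * s) ?S Z) N"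
    using regular_of_expr_dom[OF Z] by blast
  note N' = amplified_pencil_regular[OF Y field_expr_dom_carrier[OF Z] wf_expr_rep N]
  have wa: "wf_descr ?I (s * 1) (s * 1) (amplify UNIV s ?S Y)" by (rule wf_amplify[OF wf_expr_rep])
  have "\<exists>V. descr_at (*) (grid ?I e) (Suc (length w)) (recentre ?I e (amplify UNIV s ?S Y) ?z N) (shift_point w) V"
    by (rule shift_point_regular[OF _ wf_recentre[OF wa N'] centered_recentre[OF wa] w]) simp
  then obtain V where "descr_at (*) UNIV (Suc (length w) * e * s) ?S (lifted_shift s e Y ?z w) V"
    using descr_at_shift[OF coords_carrier wa N'] descr_at_lifted_shift[where Y = Y, OF Y wf_expr_rep] by blast
  then obtain N2 where "inverse_pair (Suc (length w) * e * s * state_dim ?S) (pencil (*) UNIV (Suc (length w) * e * s) ?S (lifted_shift s e Y ?z w)) N2"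
    unfolding descr_at_def by blast
  from field_algebra.expr_dom_of_regular[OF lifted_shift_carrier stably_finite_field this]
  show ?thesis unfolding mat_alg_field .
qed

text \<open>\<open>R\<close> and \<open>R'\<close> are compared through \<open>R0\<close>, which
  restricts the comparison to points where \<open>R0\<close> is defined as well.\<close>

lemma expr_equiv_values:
  assumes "(R0, R) \<in> expr_equiv" "(R0, R') \<in> expr_equiv" "n \<ge> 1"
    "x \<in> expr_dom (mat_algebra n) R0" "x \<in> expr_dom (mat_algebra n) R" "x \<in> expr_dom (mat_algebra n) R'"
  shows "expr_eval (mat_algebra n) R x = expr_eval (mat_algebra n) R' x"
proof -
  have "expr_eval (mat_algebra n) R0 x = expr_eval (mat_algebra n) R x" "expr_eval (mat_algebra n) R0 x = expr_eval (mat_algebra n) R' x"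
    using assms unfolding expr_equiv_def by blast+
  thus ?thesis by simp
qed

text \<open>Values at nilpotent points around \<open>Z\<close> show that the system of
  \<open>R'\<close> and the minimal system have the same Markov parameters at \<open>Z\<close>. The
  recentred minimal system is still minimal, hence regular wherever the system of \<open>R'\<close>
  is, in particular at \<open>X\<close> inflated by \<open>e\<close>; the factor \<open>e\<close> is
  divided out at the end.\<close>

theorem (in unital_algebra) descr_at_minimal_for:
  fixes X :: "'d::finite \<Rightarrow> 'a mat"
  assumes sf: "stably_finite TYPE('a)" and s: "s \<ge> 1" and M: "minimal_for s p q ps R Y M" and Yc: "\<And>\<kappa>. Y \<kappa> \<in> carrier_mat s s"
    and Y: "\<And>i j. (i, j) \<in> set ps \<Longrightarrow> Y \<in> expr_dom (mat_algebra s) (R i j)"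
    and eq: "\<And>i j. (i, j) \<in> set ps \<Longrightarrow> (R0 i j, R i j) \<in> expr_equiv" "\<And>i j. (i, j) \<in> set ps \<Longrightarrow> (R0 i j, R' i j) \<in> expr_equiv"
    and Xc: "\<And>\<kappa>. X \<kappa> \<in> carrier_mat (m * s) (m * s)"
    and X: "\<And>i j. (i, j) \<in> set ps \<Longrightarrow> X \<in> expr_dom (mat_alg scale (m * s)) (R' i j)"
  shows "descr_at scale (grid UNIV s) m M (coords scale s m Y X)
    (mat_val scale p q (m * s) (\<lambda>i j. expr_eval (mat_alg scale (m * s)) (R' i j) X) ps)"
proof -
  let ?I = "grid UNIV s :: ('d \<times> nat \<times> nat) set" and ?S' = "mat_rep p q R' ps"
  \<comment> \<open>\<open>?G1\<close> collects the expressions known to be defined at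
    \<open>Y\<close>. For those in \<open>?G2\<close> only nondegeneracy is at hand.\<close>
  let ?G1 = "sum_expr (map (\<lambda>(i, j). R i j) ps)" and ?G2 = "sum_expr (map (\<lambda>(i, j). R0 i j) ps @ map (\<lambda>(i, j). R' i j) ps)"
  have fI: "finite ?I" by simp
  have M': "wf_descr ?I (s * p) (s * q) M" "centered M" "minimal ?I M" using M by (auto simp: minimal_for_def)
  have G1: "Y \<in> expr_dom (mat_algebra s) ?G1" using Y Yc by (auto simp: expr_dom_sum_expr module_mat_simps)
  have "nondegenerate ?G2" by (rule nondegenerate_sum_expr) (use eq in \<open>auto simp: expr_equiv_def\<close>)
  then obtain e Z where e: "e \<ge> 1" and Z: "Z \<in> expr_dom (mat_algebra (e * s)) ?G1" "Z \<in> expr_dom (mat_algebra (e * s)) ?G2"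
    using common_domain_point[OF G1 s] by blast
  have Zc: "Z \<kappa> \<in> carrier_mat (e * s) (e * s)" for \<kappa> by (rule field_expr_dom_carrier[OF Z(1)])
  have ZR: "Z \<in> expr_dom (mat_algebra (e * s)) (R i j)" "Z \<in> expr_dom (mat_algebra (e * s)) (R0 i j)" "Z \<in> expr_dom (mat_algebra (e * s)) (R' i j)"
    if "(i, j) \<in> set ps" for i j using Z that by (auto simp: expr_dom_sum_expr)
  define z where "z = coords (*) s e Y Z"
  have zc: "z \<kappa> \<in> carrier_mat e e" for \<kappa> by (simp add: z_def)
  have "descr_at (*) ?I e M z (mat_val (*) p q (e * s) (\<lambda>i j. expr_eval (mat_alg (*) (e * s)) (R i j) Z) ps)"
    unfolding z_def by (rule field_algebra.descr_at_minimal_for_self[OF stably_finite_field M]) (use Yc Zc ZR in \<open>auto simp: mat_alg_field\<close>)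
  then obtain NM where NM: "inverse_pair (e * state_dim M) (pencil (*) ?I e M z) NM" by (auto simp: descr_at_def)
  have "descr_at (*) UNIV (e * s) ?S' Z (mat_val (*) p q (e * s) (\<lambda>i j. expr_eval (mat_alg (*) (e * s)) (R' i j) Z) ps)"
    by (rule field_algebra.descr_at_mat_rep) (use Zc ZR in \<open>auto simp: mat_alg_field\<close>)
  then obtain N where "inverse_pair (e * s * state_dim ?S') (pencil (*) UNIV (e * s) ?S' Z) N" by (auto simp: descr_at_def)
  \<comment> \<open>The system of \<open>R'\<close> is amplified at \<open>Y\<close> without
    normalisation, since its pencil may be singular at \<open>Y\<close>; its first inverse is taken
    at \<open>Z\<close>.\<close>
  from amplified_pencil_regular[OF Yc Zc wf_mat_rep this]
  have N: "inverse_pair (e * state_dim (amplify UNIV s ?S' Y)) (pencil (*) ?I e (amplify UNIV s ?S' Y) z) N" unfolding z_def .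
  have wa: "wf_descr ?I (s * p) (s * q) (amplify UNIV s ?S' Y)" by (rule wf_amplify[OF wf_mat_rep])
  let ?Mz = "recentre ?I e M z NM" and ?Sz = "recentre ?I e (amplify UNIV s ?S' Y) z N"
  have mk: "same_markov (grid ?I e) ?Sz ?Mz"
  proof (rule same_markov_of_values[OF _ wf_recentre[OF wa N] wf_recentre[OF M'(1) NM] centered_recentre[OF wa] centered_recentre[OF M'(1)]])
    fix w :: "(('d \<times> nat \<times> nat) \<times> nat \<times> nat) list" assume w: "w \<in> lists (grid ?I e)"
    let ?l = "Suc (length w) * e" and ?x = "lifted_shift s e Y z w"
    have xG: "?x \<in> expr_dom (mat_algebra (?l * s)) ?G1" "?x \<in> expr_dom (mat_algebra (?l * s)) ?G2"
      unfolding z_def by (rule lifted_shift_in_dom[OF Yc Z(1) w], rule lifted_shift_in_dom[OF Yc Z(2) w])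
    have x: "?x \<in> expr_dom (mat_algebra (?l * s)) (R i j)" "?x \<in> expr_dom (mat_algebra (?l * s)) (R0 i j)" "?x \<in> expr_dom (mat_algebra (?l * s)) (R' i j)"
      if "(i, j) \<in> set ps" for i j using xG that by (auto simp: expr_dom_sum_expr simp del: mult_Suc)
    have ls: "?l * s \<ge> 1" using e s by simp
    define V where "V = mat_val (*) p q (?l * s) (\<lambda>i j. expr_eval (mat_alg (*) (?l * s)) (R i j) ?x) ps"
    have V': "V = mat_val (*) p q (?l * s) (\<lambda>i j. expr_eval (mat_alg (*) (?l * s)) (R' i j) ?x) ps"
      unfolding V_def mat_alg_field
      by (rule mat_val_cong, rule expr_equiv_values[OF eq(1) eq(2) ls]) (use x in blast)+
    have "descr_at (*) ?I ?l M (coords (*) s ?l Y ?x) V"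
      unfolding V_def by (rule field_algebra.descr_at_minimal_for_self[OF stably_finite_field M]) (use Yc x in \<open>auto simp: mat_alg_field simp del: mult_Suc\<close>)
    hence "descr_at (*) ?I ?l M (assemble e (Suc (length w)) z (shift_point w)) V"
      using descr_at_cong[of ?I "coords (*) s ?l Y ?x" "assemble e (Suc (length w)) z (shift_point w)"] coords_lifted_shift[where Y = Y, OF Yc] by blast
    hence 1: "descr_at (*) (grid ?I e) (Suc (length w)) ?Mz (shift_point w) V"
      using descr_at_shift[where z = z, OF zc M'(1) NM] by blast
    have "descr_at (*) UNIV (?l * s) ?S' ?x V"
      unfolding V' by (rule field_algebra.descr_at_mat_rep) (use x in \<open>auto simp: mat_alg_field simp del: mult_Suc\<close>)
    hence "descr_at (*) (grid ?I e) (Suc (length w)) ?Sz (shift_point w) V"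
      using descr_at_shift[where z = z, OF zc wa N] descr_at_lifted_shift[where Y = Y, OF Yc wf_mat_rep] by blast
    with 1 show "\<exists>V. descr_at (*) (grid ?I e) (Suc (length w)) ?Sz (shift_point w) V \<and>
      descr_at (*) (grid ?I e) (Suc (length w)) ?Mz (shift_point w) V" by blast
  qed simp
  have minz: "minimal (grid ?I e) ?Mz" by (rule minimal_recentre[OF fI M'(1,2) zc NM M'(3)])
  \<comment> \<open>The centre \<open>z\<close> consists of e by e matrices, so a point must be cut
    into blocks of that size; inflating \<open>X\<close> by \<open>e\<close> makes this
    possible.\<close>
  let ?X = "\<lambda>\<kappa>. 1\<^sub>m e \<otimes>\<^sub>K X \<kappa>" and ?V = "mat_val scale p q (m * s) (\<lambda>i j. expr_eval (mat_alg scale (m * s)) (R' i j) X) ps"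
  have XX: "?X \<kappa> \<in> carrier_mat (m * e * s) (m * e * s)" for \<kappa> using Xc[of \<kappa>] by (auto intro!: carrier_matI)
  have dX: "descr_at scale UNIV (m * s) ?S' X ?V" by (rule descr_at_mat_rep) (use Xc X in auto)
  hence "descr_at scale UNIV (e * (m * s)) ?S' ?X (1\<^sub>m e \<otimes>\<^sub>K ?V)"
    by (intro descr_at_one_kron[OF finite_UNIV _ wf_mat_rep]) (use Xc in auto)
  hence dXX: "descr_at scale UNIV (m * e * s) ?S' ?X (1\<^sub>m e \<otimes>\<^sub>K ?V)" by (simp add: ac_simps)
  let ?y = "coords scale s (m * e) Y ?X"
  have "descr_at scale ?I (m * e) (amplify UNIV s ?S' Y) ?y (1\<^sub>m e \<otimes>\<^sub>K ?V)"
    using descr_at_amplify[where I = UNIV and z = Y and x = ?X, OF finite_UNIV Yc XX wf_mat_rep] dXX by blast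
  hence "descr_at scale (grid ?I e) m ?Sz (coords scale e m z ?y) (1\<^sub>m e \<otimes>\<^sub>K ?V)"
    by (subst descr_at_recentre[OF fI zc coords_carrier wa N])
  hence "descr_at scale (grid ?I e) m ?Mz (coords scale e m z ?y) (1\<^sub>m e \<otimes>\<^sub>K ?V)"
    by (intro descr_at_minimal[OF sf _ coords_carrier wf_recentre[OF wa N] wf_recentre[OF M'(1) NM] centered_recentre[OF wa] centered_recentre[OF M'(1)] mk minz]) auto
  hence "descr_at scale ?I (m * e) M ?y (1\<^sub>m e \<otimes>\<^sub>K ?V)"
    by (subst (asm) descr_at_recentre[OF fI zc coords_carrier M'(1) NM])
  hence c1: "descr_at scale ?I (e * m) M (coords scale s (e * m) Y ?X) (1\<^sub>m e \<otimes>\<^sub>K ?V)" by (simp add: mult.commute)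
  have c2: "coords scale s (e * m) Y ?X \<kappa> = 1\<^sub>m e \<otimes>\<^sub>K coords scale s m Y X \<kappa>" if "\<kappa> \<in> ?I" for \<kappa>
    using that coords_one_kron[of X _ m s Y] Xc Yc by auto
  have "descr_at scale ?I (e * m) M (\<lambda>\<kappa>. 1\<^sub>m e \<otimes>\<^sub>K coords scale s m Y X \<kappa>) (1\<^sub>m e \<otimes>\<^sub>K ?V)"
    by (rule iffD1[OF descr_at_cong c1]) (rule c2)
  from descr_at_of_one_kron[OF fI coords_carrier M'(1) e this]
  obtain V where V: "descr_at scale ?I m M (coords scale s m Y X) V" "1\<^sub>m e \<otimes>\<^sub>K ?V = 1\<^sub>m e \<otimes>\<^sub>K V" by blast
  have "V \<in> carrier_mat (m * s * p) (m * s * q)" using descr_at_carrier[OF M'(1) V(1)] by (simp add: mult.assoc)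
  hence "?V = V" by (rule one_kron_cancel[OF V(2) e descr_at_carrier[OF wf_mat_rep dX]])
  with V(1) show ?thesis by simp
qed

section \<open>Fornasini--Marchesini systems\<close>

lemma linear_mat_mapD:
  assumes "linear_mat_map s p q T"
  shows "X \<in> carrier_mat s s \<Longrightarrow> T X \<in> carrier_mat p q"
    "X \<in> carrier_mat s s \<Longrightarrow> X' \<in> carrier_mat s s \<Longrightarrow> T (X + X') = T X + T X'"
    "X \<in> carrier_mat s s \<Longrightarrow> T (c \<cdot>\<^sub>m X) = c \<cdot>\<^sub>m T X"
  using assms by (auto simp: linear_mat_map_def LinearCombinations.module_hom_def module_mat_simps)

text \<open>A matrix is built up entry by entry; statements about linear maps are reduced in this
  way to their values at matrix units.\<close>

lemma mat_unit_induct [consumes 1, case_names zero step]: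
  fixes X :: "'k::field mat"
  assumes X: "X \<in> carrier_mat s s" and zero: "P (0\<^sub>m s s)"
    and step: "\<And>X u v c. X \<in> carrier_mat s s \<Longrightarrow> u < s \<Longrightarrow> v < s \<Longrightarrow> P X \<Longrightarrow> P (X + c \<cdot>\<^sub>m mat_unit s s u v)"
  shows "P X"
proof -
  let ?R = "\<lambda>I. mat s s (\<lambda>ij. if ij \<in> I then X $$ ij else 0)"
  have "P (?R I)" if "finite I" "I \<subseteq> {..<s} \<times> {..<s}" for I
    using that
  proof (induction I)
    case empty
    have "?R {} = 0\<^sub>m s s" by auto
    thus ?case using zero by simp
  next
    case (insert ij I)
    obtain u v where ij: "ij = (u, v)" by (cases ij)
    have uv: "u < s" "v < s" using insert ij by auto
    have "?R (insert ij I) = ?R I + X $$ (u, v) \<cdot>\<^sub>m mat_unit s s u v"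
      using insert.hyps uv by (auto simp: ij intro!: eq_matI)
    thus ?case using step[OF _ uv, of "?R I" "X $$ (u, v)"] insert by simp
  qed
  moreover have "?R ({..<s} \<times> {..<s}) = X" using X by (auto intro!: eq_matI)
  ultimately show ?thesis by (metis finite_SigmaI finite_lessThan order_refl)
qed

lemma linear_map_zero:
  assumes "linear_mat_map s p q T"
  shows "T (0\<^sub>m s s) = 0\<^sub>m p q"
proof -
  have "T (0 \<cdot>\<^sub>m 0\<^sub>m s s) = 0 \<cdot>\<^sub>m T (0\<^sub>m s s)" by (rule linear_mat_mapD(3)[OF assms]) simp
  moreover have "0 \<cdot>\<^sub>m 0\<^sub>m s s = (0\<^sub>m s s :: 'a mat)" by auto
  moreover have "0 \<cdot>\<^sub>m T (0\<^sub>m s s) = 0\<^sub>m p q" using linear_mat_mapD(1)[OF assms, of "0\<^sub>m s s"] by auto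
  ultimately show ?thesis by simp
qed

lemma index_linear_map:
  assumes T: "linear_mat_map s p q T" and X: "X \<in> carrier_mat s s" and ab: "a < p" "b < q"
  shows "T X $$ (a, b) = (\<Sum>uv\<in>{..<s} \<times> {..<s}. X $$ uv * T (mat_unit s s (fst uv) (snd uv)) $$ (a, b))"
  using X
proof (induction rule: mat_unit_induct)
  case zero
  show ?case using ab by (subst sum.neutral) (auto simp: linear_map_zero[OF T])
next
  case (step X u v c)
  let ?E = "mat_unit s s u v"
  have c: "T X \<in> carrier_mat p q" "T ?E \<in> carrier_mat p q" using linear_mat_mapD(1)[OF T] step by auto
  have "T (X + c \<cdot>\<^sub>m ?E) = T X + c \<cdot>\<^sub>m T ?E" using linear_mat_mapD[OF T] step by simp
  hence "T (X + c \<cdot>\<^sub>m ?E) $$ (a, b) = T X $$ (a, b) + c * T ?E $$ (a, b)" using c ab by simp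
  also have "c * T ?E $$ (a, b) = (\<Sum>uv\<in>{..<s} \<times> {..<s}. if uv = (u, v) then c * T (mat_unit s s (fst uv) (snd uv)) $$ (a, b) else 0)"
    using step by (subst sum.delta) auto
  also have "T X $$ (a, b) + \<dots> = (\<Sum>uv\<in>{..<s} \<times> {..<s}. (X + c \<cdot>\<^sub>m ?E) $$ uv * T (mat_unit s s (fst uv) (snd uv)) $$ (a, b))"
    unfolding step(4) sum.distrib[symmetric] using step by (intro sum.cong) (auto simp: algebra_simps split: if_splits)
  finally show ?case .
qed

lemma smult_mat_mult_vec:
  fixes M :: "'k::comm_ring_1 mat"
  assumes "M \<in> carrier_mat p q" "x \<in> carrier_vec q"
  shows "(c \<cdot>\<^sub>m M) *\<^sub>v x = c \<cdot>\<^sub>v (M *\<^sub>v x)"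
  using assms by (intro eq_vecI) (auto simp: scalar_prod_def sum_distrib_left mult.assoc)

lemma linear_map_mem_subspace:
  assumes T: "linear_mat_map s p q T" and V: "lin_subspace p V" and x: "x \<in> carrier_vec q"
    and E: "\<And>u v. u < s \<Longrightarrow> v < s \<Longrightarrow> T (mat_unit s s u v) *\<^sub>v x \<in> V" and X: "X \<in> carrier_mat s s"
  shows "T X *\<^sub>v x \<in> V"
  using X
proof (induction rule: mat_unit_induct)
  case zero
  have "T (0\<^sub>m s s) *\<^sub>v x = 0\<^sub>v p" unfolding linear_map_zero[OF T] using x by (intro eq_vecI) auto
  thus ?case using V by (simp add: lin_subspace_def)
next
  case (step X u v c)
  let ?E = "mat_unit s s u v"
  have c: "T X \<in> carrier_mat p q" "T ?E \<in> carrier_mat p q" using linear_mat_mapD(1)[OF T] step by auto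
  have "(c \<cdot>\<^sub>m T ?E) *\<^sub>v x = c \<cdot>\<^sub>v (T ?E *\<^sub>v x)"
    by (rule smult_mat_mult_vec[OF c(2) x])
  moreover have "(T X + c \<cdot>\<^sub>m T ?E) *\<^sub>v x = T X *\<^sub>v x + (c \<cdot>\<^sub>m T ?E) *\<^sub>v x"
    by (rule add_mult_distrib_mat_vec[OF c(1) smult_carrier_mat[OF c(2)] x])
  moreover have "T (X + c \<cdot>\<^sub>m ?E) = T X + c \<cdot>\<^sub>m T ?E"
    using linear_mat_mapD(2)[OF T step(1), of "c \<cdot>\<^sub>m ?E"] linear_mat_mapD(3)[OF T mat_unit_carrier] by simp
  ultimately have "T (X + c \<cdot>\<^sub>m ?E) *\<^sub>v x = T X *\<^sub>v x + c \<cdot>\<^sub>v (T ?E *\<^sub>v x)"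
    by simp
  thus ?case using V E step by (simp add: lin_subspace_def)
qed

lemma abelian_monoid_module_mat: "abelian_monoid (module_mat TYPE('a::ring_1) p q)"
  by (rule abelian_monoidI) (auto simp: module_mat_simps mat_add_comm)

lemma finsum_mat_index:
  fixes f :: "'i \<Rightarrow> 'a::ring_1 mat"
  assumes "finite K" "\<And>k. k \<in> K \<Longrightarrow> f k \<in> carrier_mat p q"
  shows "finsum (module_mat TYPE('a) p q) f K \<in> carrier_mat p q \<and>
    (\<forall>i<p. \<forall>j<q. finsum (module_mat TYPE('a) p q) f K $$ (i, j) = (\<Sum>k\<in>K. f k $$ (i, j)))"
proof -
  interpret abelian_monoid "module_mat TYPE('a) p q" by (rule abelian_monoid_module_mat)
  show ?thesis using assms
  proof (induction K)
    case empty
    show ?case using finsum_empty[of f] by (simp add: module_mat_simps)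
  next
    case (insert k K)
    have "finsum (module_mat TYPE('a) p q) f (insert k K) = f k + finsum (module_mat TYPE('a) p q) f K"
      using finsum_insert[OF insert(1,2), of f] insert(4) by (auto simp: module_mat_simps)
    thus ?case using insert by auto
  qed
qed

text \<open>By linearity \<open>T\<close> applied to a block is the sum of its entries times
  T(E_uv). The blockwise extension is therefore a linear pencil in the coordinates around
  \<open>Y\<close>, with coefficients T(E_uv).\<close>

lemma ext_map_sum:
  fixes X Y :: "'d::finite \<Rightarrow> 'k::field mat"
  assumes T: "\<And>k. linear_mat_map s p q (T k)" and X: "\<And>k. X k \<in> carrier_mat (m * s) (m * s)" and Y: "\<And>k. Y k \<in> carrier_mat s s"
  shows "finsum (module_mat TYPE('k) (m * p) (m * q)) (\<lambda>k. ext_map s p q m (T k) (X k - 1\<^sub>m m \<otimes>\<^sub>K Y k)) UNIV =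
    lin (*) (grid UNIV s) m p q (coords (*) s m Y X) (\<lambda>(k, u, v). T k (mat_unit s s u v))"
    (is "?F = ?L")
proof -
  have f: "?F \<in> carrier_mat (m * p) (m * q) \<and> (\<forall>i<m * p. \<forall>j<m * q. ?F $$ (i, j) = (\<Sum>k\<in>UNIV. ext_map s p q m (T k) (X k - 1\<^sub>m m \<otimes>\<^sub>K Y k) $$ (i, j)))"
    by (rule finsum_mat_index) (auto simp: ext_map_def)
  show ?thesis
  proof (rule eq_matI)
    fix i j assume "i < dim_row ?L" "j < dim_col ?L"
    hence ij: "i < m * p" "j < m * q" by (auto simp: lin_def)
    hence b: "i div p < m" "j div q < m" "i mod p < p" "j mod q < q" by (auto intro: div_mult_lt mod_mult_lt)
    have 1: "ext_map s p q m (T k) (X k - 1\<^sub>m m \<otimes>\<^sub>K Y k) $$ (i, j) = (\<Sum>uv\<in>{..<s} \<times> {..<s}.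
      T k (mat_unit s s (fst uv) (snd uv)) $$ (i mod p, j mod q) * coords (*) s m Y X (k, fst uv, snd uv) $$ (i div p, j div q))" for k
    proof -
      have "T k (mat_block s (X k - 1\<^sub>m m \<otimes>\<^sub>K Y k) (i div p) (j div q)) $$ (i mod p, j mod q) =
        (\<Sum>uv\<in>{..<s} \<times> {..<s}. mat_block s (X k - 1\<^sub>m m \<otimes>\<^sub>K Y k) (i div p) (j div q) $$ uv * T k (mat_unit s s (fst uv) (snd uv)) $$ (i mod p, j mod q))"
        by (rule index_linear_map[OF T _ b(3,4)]) (simp add: mat_block_def)
      also have "\<dots> = (\<Sum>uv\<in>{..<s} \<times> {..<s}. T k (mat_unit s s (fst uv) (snd uv)) $$ (i mod p, j mod q) * coords (*) s m Y X (k, fst uv, snd uv) $$ (i div p, j div q))"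
        using b by (intro sum.cong) (auto simp: coords_def mat_block_def kron_scalar_field)
      finally show ?thesis using ij by (simp add: ext_map_def)
    qed
    have "?F $$ (i, j) = (\<Sum>k\<in>UNIV. ext_map s p q m (T k) (X k - 1\<^sub>m m \<otimes>\<^sub>K Y k) $$ (i, j))" using f ij by blast
    also have "\<dots> = ?L $$ (i, j)" using ij by (simp add: 1 index_lin sum.cartesian_product' split_beta)
    finally show "?F $$ (i, j) = ?L $$ (i, j)" .
  qed (use f in \<open>auto simp: lin_def\<close>)
qed

lemma (in unital_algebra) ext_map_alg_sum:
  fixes Y :: "'d::finite \<Rightarrow> 'k mat"
  assumes T: "\<And>k u v. u < s \<Longrightarrow> v < s \<Longrightarrow> T k (mat_unit s s u v) \<in> carrier_mat p q"
    and X: "\<And>k. X k \<in> carrier_mat s s" and Y: "\<And>k. Y k \<in> carrier_mat s s"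
  shows "finsum (module_mat TYPE('a) p q) (\<lambda>k. ext_map_alg scale s p q (T k) (X k - scalar_tensor scale (Y k) 1)) UNIV =
    lin scale (grid UNIV s) 1 p q (coords scale s 1 Y X) (\<lambda>(k, u, v). T k (mat_unit s s u v))"
    (is "?F = ?L")
proof -
  let ?g = "\<lambda>k (i, j). scalar_tensor scale (T k (mat_unit s s i j)) ((X k - scalar_tensor scale (Y k) 1) $$ (i, j))"
  have g: "ext_map_alg scale s p q (T k) (X k - scalar_tensor scale (Y k) 1) \<in> carrier_mat p q \<and>
    (\<forall>i<p. \<forall>j<q. ext_map_alg scale s p q (T k) (X k - scalar_tensor scale (Y k) 1) $$ (i, j) = (\<Sum>uv\<in>{..<s} \<times> {..<s}. ?g k uv $$ (i, j)))" for k
    unfolding ext_map_alg_def by (rule finsum_mat_index) (use T[of _ _ k] in \<open>auto simp: scalar_tensor_def\<close>)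
  have f: "?F \<in> carrier_mat p q \<and> (\<forall>i<p. \<forall>j<q. ?F $$ (i, j) = (\<Sum>k\<in>UNIV. ext_map_alg scale s p q (T k) (X k - scalar_tensor scale (Y k) 1) $$ (i, j)))"
    by (rule finsum_mat_index) (use g in auto)
  show ?thesis
  proof (rule eq_matI)
    fix i j assume "i < dim_row ?L" "j < dim_col ?L"
    hence ij: "i < p" "j < q" by (auto simp: lin_def)
    have 1: "(\<Sum>uv\<in>{..<s} \<times> {..<s}. ?g k uv $$ (i, j)) = (\<Sum>uv\<in>{..<s} \<times> {..<s}.
      scale (T k (mat_unit s s (fst uv) (snd uv)) $$ (i, j)) (coords scale s 1 Y X (k, fst uv, snd uv) $$ (0, 0)))" for k
    proof (rule sum.cong)
      fix uv assume uv: "uv \<in> {..<s} \<times> {..<s}"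
      obtain u v where e: "uv = (u, v)" by (cases uv)
      have "u < s" "v < s" using uv e by auto
      thus "?g k uv $$ (i, j) = scale (T k (mat_unit s s (fst uv) (snd uv)) $$ (i, j)) (coords scale s 1 Y X (k, fst uv, snd uv) $$ (0, 0))"
        using T[of u v k] X[of k] Y[of k] ij by (simp add: e scalar_tensor_def coords_def index_kron_scalar)
    qed simp
    have "?F $$ (i, j) = (\<Sum>k\<in>UNIV. \<Sum>uv\<in>{..<s} \<times> {..<s}. ?g k uv $$ (i, j))" using f g ij by simp
    also have "\<dots> = ?L $$ (i, j)" unfolding 1 using ij by (simp add: index_lin sum.cartesian_product' split_beta)
    finally show "?F $$ (i, j) = ?L $$ (i, j)" .
  qed (use f in \<open>auto simp: lin_def\<close>)
qed

text \<open>The centered descriptor in the entry variables that belongs to a system. The minus sign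
  reconciles the pencil 1 - sum of the theorem with the convention 1 + sum for descriptors.\<close>

definition represents ::
  "nat \<Rightarrow> nat \<Rightarrow> ('d \<times> nat \<times> nat, 'k::field) descriptor \<Rightarrow> nat \<Rightarrow> 'k mat \<Rightarrow> 'k mat \<Rightarrow>
   ('d \<Rightarrow> 'k mat \<Rightarrow> 'k mat) \<Rightarrow> ('d \<Rightarrow> 'k mat \<Rightarrow> 'k mat) \<Rightarrow> bool" where
  "represents \<beta> s S L D C A B \<longleftrightarrow>
     state_dim S = L \<and> feed S = D \<and> outp S = C \<and> pen_const S = 1\<^sub>m L \<and> inp_const S = 0\<^sub>m L (\<beta> * s) \<and>
     (\<forall>k. \<forall>u<s. \<forall>v<s. pen_coeff S (k, u, v) = - A k (mat_unit s s u v) \<and> inp_coeff S (k, u, v) = B k (mat_unit s s u v))"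

section \<open>Controllability and observability in terms of invariant subspaces\<close>

lemma span_lin_subspace:
  fixes G :: "'k::field vec set"
  assumes "G \<subseteq> carrier_vec n"
  shows "lin_subspace n (LinearCombinations.module.span class_ring (module_vec TYPE('k) n) G)"
    "G \<subseteq> LinearCombinations.module.span class_ring (module_vec TYPE('k) n) G"
proof -
  interpret vec_space "TYPE('k)" n .
  from span_is_submodule[OF assms] show "lin_subspace n (span G)"
    by (auto simp: LinearCombinations.submodule_def lin_subspace_def module_vec_simps)
  show "G \<subseteq> span G" by (rule in_own_span[OF assms])
qed

lemma span_least:
  fixes V :: "'k::field vec set"
  assumes "lin_subspace n V" "G \<subseteq> V"
  shows "LinearCombinations.module.span class_ring (module_vec TYPE('k) n) G \<subseteq> V"
proof -
  interpret vec_space "TYPE('k)" n .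
  have "submodule class_ring V (module_vec TYPE('k) n)"
    using assms(1) module_axioms by (auto simp: LinearCombinations.submodule_def lin_subspace_def module_vec_simps)
  thus ?thesis by (rule span_is_subset[OF assms(2)])
qed

context
  fixes \<alpha> \<beta> s L :: nat and D C :: "'k::field mat" and A B :: "'d::finite \<Rightarrow> 'k mat \<Rightarrow> 'k mat"
    and S :: "('d \<times> nat \<times> nat, 'k) descriptor"
  assumes sys: "fm_system \<alpha> \<beta> s L D C A B" and rep: "represents \<beta> s S L D C A B"
begin

lemma sysD: "D \<in> carrier_mat (\<alpha> * s) (\<beta> * s)" "C \<in> carrier_mat (\<alpha> * s) L"
  "linear_mat_map s L L (A k)" "linear_mat_map s L (\<beta> * s) (B k)"
  using sys by (auto simp: fm_system_def)

lemma repD: "state_dim S = L" "feed S = D" "outp S = C" "pen_const S = 1\<^sub>m L" "inp_const S = 0\<^sub>m L (\<beta> * s)"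
  "u < s \<Longrightarrow> v < s \<Longrightarrow> pen_coeff S (k, u, v) = - A k (mat_unit s s u v)"
  "u < s \<Longrightarrow> v < s \<Longrightarrow> inp_coeff S (k, u, v) = B k (mat_unit s s u v)"
  using rep by (auto simp: represents_def)

lemma A_unit: "A k (mat_unit s s u v) \<in> carrier_mat L L" and B_unit: "B k (mat_unit s s u v) \<in> carrier_mat L (\<beta> * s)"
  using linear_mat_mapD(1)[OF sysD(3)] linear_mat_mapD(1)[OF sysD(4)] by auto

lemma represents_wf: "wf_descr (grid UNIV s) (\<alpha> * s) (\<beta> * s) S"
  unfolding wf_descr_def using sysD(1,2) A_unit B_unit by (auto simp: repD intro!: uminus_carrier_mat)

lemma represents_centered: "centered S"
  by (simp add: centered_def repD)

lemma represents_lin: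
  "lin scale (grid UNIV s) m L L x (pen_coeff S) = lin scale (grid UNIV s) m L L x (\<lambda>\<kappa>. - (\<lambda>(k, u, v). A k (mat_unit s s u v)) \<kappa>)"
  "lin scale (grid UNIV s) m L (\<beta> * s) x (inp_coeff S) = lin scale (grid UNIV s) m L (\<beta> * s) x (\<lambda>(k, u, v). B k (mat_unit s s u v))"
  by (rule lin_cong; auto simp: repD)+

lemma word_prod_carrier: "w \<in> lists (UNIV \<times> carrier_mat s s) \<Longrightarrow> word_prod L A w \<in> carrier_mat L L"
  by (induction w) (auto simp: word_prod_def intro!: mult_carrier_mat linear_mat_mapD(1)[OF sysD(3)])

lemma word_prod_Cons: "word_prod L A ((k, X) # w) = A k X * word_prod L A w"
  by (simp add: word_prod_def)

lemma word_prod_append: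
  "w \<in> lists (UNIV \<times> carrier_mat s s) \<Longrightarrow> X \<in> carrier_mat s s \<Longrightarrow> word_prod L A (w @ [(k, X)]) = word_prod L A w * A k X"
proof (induction w)
  case Nil
  have "A k X \<in> carrier_mat L L" using linear_mat_mapD(1)[OF sysD(3)] Nil by blast
  thus ?case by (simp add: word_prod_def)
next
  case (Cons x w)
  obtain j Z where x: "x = (j, Z)" by (cases x)
  have c: "A j Z \<in> carrier_mat L L" "word_prod L A w \<in> carrier_mat L L" "A k X \<in> carrier_mat L L"
    using Cons.prems linear_mat_mapD(1)[OF sysD(3)] word_prod_carrier[of w] by (auto simp: x)
  show ?case using Cons assoc_mult_mat[OF c] by (simp add: x word_prod_Cons)
qed

lemma neg_unit_mem:
  assumes V: "lin_subspace L V" and x: "x \<in> carrier_vec L" and uv: "u < s" "v < s"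
  shows "pen_coeff S (k, u, v) *\<^sub>v x \<in> V \<longleftrightarrow> A k (mat_unit s s u v) *\<^sub>v x \<in> V"
proof -
  let ?y = "A k (mat_unit s s u v) *\<^sub>v x"
  have y: "?y \<in> carrier_vec L" using mult_mat_vec_carrier[OF A_unit x] .
  have 1: "pen_coeff S (k, u, v) *\<^sub>v x = (-1) \<cdot>\<^sub>v ?y"
    unfolding repD(6)[OF uv] using A_unit[of k u v] x by (intro eq_vecI) (auto simp: scalar_prod_def sum_negf[symmetric])
  moreover have "(-1) \<cdot>\<^sub>v ((-1) \<cdot>\<^sub>v ?y) = ?y" by (simp add: smult_smult_assoc)
  ultimately show ?thesis using lin_subspaceD(4)[OF V] by metis
qed

lemma invariant_all:
  assumes V: "lin_subspace L V" and inv: "\<forall>\<kappa>\<in>grid UNIV s. \<forall>x\<in>V. pen_coeff S \<kappa> *\<^sub>v x \<in> V"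
    and x: "x \<in> V" and X: "X \<in> carrier_mat s s"
  shows "A k X *\<^sub>v x \<in> V"
proof (rule linear_map_mem_subspace[OF sysD(3) V _ _ X])
  show xc: "x \<in> carrier_vec L" using lin_subspaceD(1)[OF V x] .
  fix u v assume uv: "u < s" "v < s"
  show "A k (mat_unit s s u v) *\<^sub>v x \<in> V"
    unfolding neg_unit_mem[OF V xc uv, symmetric] using inv x uv by auto
qed

lemma word_invariant:
  assumes V: "lin_subspace L V" and inv: "\<forall>\<kappa>\<in>grid UNIV s. \<forall>x\<in>V. pen_coeff S \<kappa> *\<^sub>v x \<in> V"
    and x: "x \<in> V" and w: "w \<in> lists (UNIV \<times> carrier_mat s s)"
  shows "word_prod L A w *\<^sub>v x \<in> V"
  using w
proof (induction w)
  case Nil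
  show ?case using x lin_subspaceD(1)[OF V x] by (simp add: word_prod_def)
next
  case (Cons y w)
  obtain k X where y: "y = (k, X)" by (cases y)
  have c: "A k X \<in> carrier_mat L L" "word_prod L A w \<in> carrier_mat L L"
    using Cons linear_mat_mapD(1)[OF sysD(3)] word_prod_carrier[of w] by (auto simp: y)
  have "word_prod L A (y # w) *\<^sub>v x = A k X *\<^sub>v (word_prod L A w *\<^sub>v x)"
    using c lin_subspaceD(1)[OF V x] by (simp add: y word_prod_Cons assoc_mult_mat_vec)
  also have "\<dots> \<in> V" by (rule invariant_all[OF V inv]) (use Cons y in auto)
  finally show ?case .
qed

text \<open>The span in the definition of \<open>controllable\<close> is invariant and contains the
  inputs; conversely every invariant subspace that contains the inputs absorbs its generators.
  Linearity passes from matrix units to arbitrary arguments.\<close>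

lemma controllable_iff:
  "controllable \<beta> s L A B \<longleftrightarrow> reachable (grid UNIV s) L (pen_coeff S) (input_range (grid UNIV s) S)"
proof -
  let ?K = "grid UNIV s :: ('d \<times> nat \<times> nat) set"
  let ?G = "{(word_prod L A w * B k X) *\<^sub>v u | w k X u.
    w \<in> lists (UNIV \<times> carrier_mat s s) \<and> X \<in> carrier_mat s s \<and> u \<in> carrier_vec (\<beta> * s)}"
  let ?sp = "LinearCombinations.module.span class_ring (module_vec TYPE('k) L)"
  have Bc: "B k X \<in> carrier_mat L (\<beta> * s)" if "X \<in> carrier_mat s s" for k X using linear_mat_mapD(1)[OF sysD(4) that] .
  have Gc: "?G \<subseteq> carrier_vec L"
    using word_prod_carrier Bc by (auto intro!: mult_mat_vec_carrier[of _ L "\<beta> * s"] mult_carrier_mat)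
  show ?thesis
  proof
    assume c: "controllable \<beta> s L A B"
    show "reachable ?K L (pen_coeff S) (input_range ?K S)"
      unfolding reachable_def
    proof (intro allI impI, elim conjE)
      fix V assume V: "lin_subspace L V" and inv: "\<forall>\<kappa>\<in>?K. \<forall>x\<in>V. pen_coeff S \<kappa> *\<^sub>v x \<in> V" and inp: "input_range ?K S \<subseteq> V"
      have "?G \<subseteq> V"
      proof
        fix y assume "y \<in> ?G"
        then obtain w k X u where y: "y = (word_prod L A w * B k X) *\<^sub>v u" and w: "w \<in> lists (UNIV \<times> carrier_mat s s)"
          and X: "X \<in> carrier_mat s s" and u: "u \<in> carrier_vec (\<beta> * s)" by blast
        have "B k X *\<^sub>v u \<in> V"
        proof (rule linear_map_mem_subspace[OF sysD(4) V u _ X])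
          fix a b assume ab: "a < s" "b < s"
          have "B k (mat_unit s s a b) *\<^sub>v u \<in> input_range ?K S"
            unfolding input_range_def mem_Collect_eq
            by (rule exI[of _ "(k, a, b)"], rule exI[of _ u]) (use ab u in \<open>simp add: repD\<close>)
          thus "B k (mat_unit s s a b) *\<^sub>v u \<in> V" using inp by blast
        qed
        from word_invariant[OF V inv this w]
        show "y \<in> V" unfolding y using assoc_mult_mat_vec[OF word_prod_carrier[OF w] Bc[OF X] u] by simp
      qed
      hence "carrier_vec L \<subseteq> V" using span_least[OF V] c unfolding controllable_def by blast
      thus "V = carrier_vec L" using lin_subspaceD(1)[OF V] by blast
    qed
  next
    assume r: "reachable ?K L (pen_coeff S) (input_range ?K S)"
    have V: "lin_subspace L (?sp ?G)" and GV: "?G \<subseteq> ?sp ?G" using span_lin_subspace[OF Gc] by blast+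
    have inv: "\<forall>\<kappa>\<in>?K. \<forall>x\<in>?sp ?G. pen_coeff S \<kappa> *\<^sub>v x \<in> ?sp ?G"
    proof (intro ballI)
      fix \<kappa> x assume k: "\<kappa> \<in> ?K" and x: "x \<in> ?sp ?G"
      obtain k a b where e: "\<kappa> = (k, a, b)" by (cases \<kappa>)
      have ab: "a < s" "b < s" using k e by auto
      let ?E = "mat_unit s s a b"
      have "?G \<subseteq> {x \<in> carrier_vec L. A k ?E *\<^sub>v x \<in> ?sp ?G}"
      proof
        fix y assume yG: "y \<in> ?G"
        then obtain w j X u where y: "y = (word_prod L A w * B j X) *\<^sub>v u" and w: "w \<in> lists (UNIV \<times> carrier_mat s s)"
          and X: "X \<in> carrier_mat s s" and u: "u \<in> carrier_vec (\<beta> * s)" by blast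
        note wc = word_prod_carrier[OF w]
        have "A k ?E *\<^sub>v y = (A k ?E * (word_prod L A w * B j X)) *\<^sub>v u"
          unfolding y by (rule assoc_mult_mat_vec[OF A_unit mult_carrier_mat[OF wc Bc[OF X]] u, symmetric])
        also have "A k ?E * (word_prod L A w * B j X) = word_prod L A ((k, ?E) # w) * B j X"
          unfolding word_prod_Cons by (rule assoc_mult_mat[OF A_unit wc Bc[OF X], symmetric])
        finally have "A k ?E *\<^sub>v y = (word_prod L A ((k, ?E) # w) * B j X) *\<^sub>v u" .
        moreover have "(k, ?E) # w \<in> lists (UNIV \<times> carrier_mat s s)" using w by auto
        ultimately have "A k ?E *\<^sub>v y \<in> ?G" using X u by blast
        thus "y \<in> {x \<in> carrier_vec L. A k ?E *\<^sub>v x \<in> ?sp ?G}" using GV Gc yG by blast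
      qed
      hence "?sp ?G \<subseteq> {x \<in> carrier_vec L. A k ?E *\<^sub>v x \<in> ?sp ?G}"
        by (rule span_least[OF lin_subspace_vimage[OF A_unit V]])
      hence "x \<in> carrier_vec L" "A k ?E *\<^sub>v x \<in> ?sp ?G" using x by blast+
      thus "pen_coeff S \<kappa> *\<^sub>v x \<in> ?sp ?G" unfolding e using neg_unit_mem[OF V _ ab] by blast
    qed
    have inp: "input_range ?K S \<subseteq> ?sp ?G"
    proof
      fix y assume "y \<in> input_range ?K S"
      then obtain k a b u where y: "y = inp_coeff S (k, a, b) *\<^sub>v u" and ab: "a < s" "b < s" and u: "u \<in> carrier_vec (\<beta> * s)"
        by (auto simp: input_range_def repD)
      have "y = (word_prod L A [] * B k (mat_unit s s a b)) *\<^sub>v u"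
        using left_mult_one_mat[OF B_unit] by (simp add: y repD ab word_prod_def)
      moreover have "[] \<in> lists (UNIV \<times> carrier_mat s s)" "mat_unit s s a b \<in> carrier_mat s s" by auto
      ultimately have "y \<in> ?G" using u by blast
      thus "y \<in> ?sp ?G" using GV by blast
    qed
    have "?sp ?G = carrier_vec L" by (rule mp[OF spec[OF r[unfolded reachable_def], of "?sp ?G"]]) (intro conjI V inv inp)
    thus "controllable \<beta> s L A B" unfolding controllable_def .
  qed
qed

text \<open>The common kernel is the largest invariant subspace inside the kernel of
  \<open>C\<close>. Its invariance amounts to appending a letter at the right end of a word.\<close>

lemma observable_iff:
  "observable s L C A \<longleftrightarrow> distinguishable (grid UNIV s) L (\<alpha> * s) C (pen_coeff S)"
proof -
  let ?K = "grid UNIV s :: ('d \<times> nat \<times> nat) set" and ?W = "lists (UNIV \<times> carrier_mat s s) :: ('d \<times> 'k mat) list set"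
  let ?N = "\<Inter>w\<in>?W. mat_kernel (C * word_prod L A w)"
  have wc: "word_prod L A w \<in> carrier_mat L L" if "w \<in> ?W" for w using word_prod_carrier that .
  have N: "x \<in> ?N \<longleftrightarrow> x \<in> carrier_vec L \<and> (\<forall>w\<in>?W. C *\<^sub>v (word_prod L A w *\<^sub>v x) = 0\<^sub>v (\<alpha> * s))" for x
  proof -
    have "x \<in> mat_kernel (C * word_prod L A w) \<longleftrightarrow> x \<in> carrier_vec L \<and> C *\<^sub>v (word_prod L A w *\<^sub>v x) = 0\<^sub>v (\<alpha> * s)" if "w \<in> ?W" for w
      using wc[OF that] sysD(2) assoc_mult_mat_vec[OF sysD(2) wc[OF that]] by (auto simp: mat_kernel_def)
    moreover have "[] \<in> ?W" by simp
    ultimately show ?thesis by blast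
  qed
  show ?thesis
  proof
    assume o: "observable s L C A"
    show "distinguishable ?K L (\<alpha> * s) C (pen_coeff S)" unfolding distinguishable_def
    proof (intro allI impI, elim conjE)
      fix V assume V: "lin_subspace L V" and inv: "\<forall>\<kappa>\<in>?K. \<forall>x\<in>V. pen_coeff S \<kappa> *\<^sub>v x \<in> V" and C: "\<forall>x\<in>V. C *\<^sub>v x = 0\<^sub>v (\<alpha> * s)"
      have "V \<subseteq> ?N"
      proof
        fix x assume x: "x \<in> V"
        show "x \<in> ?N" unfolding N using lin_subspaceD(1)[OF V x] word_invariant[OF V inv x] C by blast
      qed
      hence "V \<subseteq> {0\<^sub>v L}" using o unfolding observable_def by simp
      thus "V = {0\<^sub>v L}" using lin_subspaceD(2)[OF V] by blast
    qed
  next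
    assume d: "distinguishable ?K L (\<alpha> * s) C (pen_coeff S)"
    have V: "lin_subspace L ?N"
      unfolding lin_subspace_def
    proof (intro conjI ballI allI)
      show "?N \<subseteq> carrier_vec L" using N by blast
      show "0\<^sub>v L \<in> ?N" unfolding N by (auto simp: mult_mat_zero_vec[OF wc] mult_mat_zero_vec[OF sysD(2)])
      fix x y c assume x: "x \<in> ?N"
      show "c \<cdot>\<^sub>v x \<in> ?N" using x unfolding N
        by (auto simp: mult_mat_vec[OF wc] mult_mat_vec[OF sysD(2) mult_mat_vec_carrier[OF wc]])
      assume y: "y \<in> ?N"
      show "x + y \<in> ?N" using x y unfolding N
        by (auto simp: mult_add_distrib_mat_vec[OF wc] mult_add_distrib_mat_vec[OF sysD(2) mult_mat_vec_carrier[OF wc] mult_mat_vec_carrier[OF wc]])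
    qed
    have inv: "\<forall>\<kappa>\<in>?K. \<forall>x\<in>?N. pen_coeff S \<kappa> *\<^sub>v x \<in> ?N"
    proof (intro ballI)
      fix \<kappa> x assume k: "\<kappa> \<in> ?K" and x: "x \<in> ?N"
      obtain k a b where e: "\<kappa> = (k, a, b)" by (cases \<kappa>)
      have ab: "a < s" "b < s" using k e by auto
      let ?E = "mat_unit s s a b"
      have xc: "x \<in> carrier_vec L" using x N by blast
      have "A k ?E *\<^sub>v x \<in> ?N" unfolding N
      proof (intro conjI ballI)
        show "A k ?E *\<^sub>v x \<in> carrier_vec L" by (rule mult_mat_vec_carrier[OF A_unit xc])
        fix w assume w: "w \<in> ?W"
        have "word_prod L A w *\<^sub>v (A k ?E *\<^sub>v x) = word_prod L A (w @ [(k, ?E)]) *\<^sub>v x"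
          using word_prod_append[OF w mat_unit_carrier, of k a b] assoc_mult_mat_vec[OF wc[OF w] A_unit xc] by simp
        moreover have "w @ [(k, ?E)] \<in> ?W" using w by simp
        ultimately show "C *\<^sub>v (word_prod L A w *\<^sub>v (A k ?E *\<^sub>v x)) = 0\<^sub>v (\<alpha> * s)" using x N by metis
      qed
      thus "pen_coeff S \<kappa> *\<^sub>v x \<in> ?N" unfolding e using neg_unit_mem[OF V xc ab] by blast
    qed
    have ker: "\<forall>x\<in>?N. C *\<^sub>v x = 0\<^sub>v (\<alpha> * s)"
    proof
      fix x assume x: "x \<in> ?N"
      have "C *\<^sub>v (word_prod L A [] *\<^sub>v x) = 0\<^sub>v (\<alpha> * s)" "x \<in> carrier_vec L" using x N by blast+
      thus "C *\<^sub>v x = 0\<^sub>v (\<alpha> * s)" by (simp add: word_prod_def)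
    qed
    have "?N = {0\<^sub>v L}" by (rule mp[OF spec[OF d[unfolded distinguishable_def], of ?N]]) (intro conjI V inv ker)
    thus "observable s L C A" unfolding observable_def .
  qed
qed

lemma represents_minimal_iff:
  "minimal (grid UNIV s) S \<longleftrightarrow> controllable \<beta> s L A B \<and> observable s L C A"
  using sysD(2) by (simp add: minimal_def controllable_iff observable_iff repD)

end

lemma (in unital_algebra) represents_pencil:
  fixes A B :: "'d::finite \<Rightarrow> 'k mat \<Rightarrow> 'k mat"
  assumes sys: "fm_system \<alpha> \<beta> s L D C A B" and rep: "represents \<beta> s S L D C A B"
  shows "pencil scale (grid UNIV s) m S x = 1\<^sub>m (m * L) - lin scale (grid UNIV s) m L L x (\<lambda>(k, u, v). A k (mat_unit s s u v))"
    "input scale (grid UNIV s) m S x = lin scale (grid UNIV s) m L (\<beta> * s) x (\<lambda>(k, u, v). B k (mat_unit s s u v))"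
proof -
  let ?P = "\<lambda>(k, u, v). A k (mat_unit s s u v)"
  have l: "lin scale (grid UNIV s) m L L x ?P \<in> carrier_mat (m * L) (m * L)" by (simp add: lin_def)
  have "lin scale (grid UNIV s) m L L x (\<lambda>\<kappa>. - ?P \<kappa>) = - lin scale (grid UNIV s) m L L x ?P"
    by (rule lin_uminus_coeff) (auto intro: A_unit[OF sys rep])
  thus "pencil scale (grid UNIV s) m S x = 1\<^sub>m (m * L) - lin scale (grid UNIV s) m L L x ?P"
    unfolding pencil_def repD[OF sys rep] represents_lin[OF sys rep] kron_scalar_one
    using minus_add_uminus_mat[OF one_carrier_mat l] by simp
  have "lin scale (grid UNIV s) m L (\<beta> * s) x (\<lambda>(k, u, v). B k (mat_unit s s u v)) \<in> carrier_mat (m * L) (m * (\<beta> * s))"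
    by (simp add: lin_def)
  thus "input scale (grid UNIV s) m S x = lin scale (grid UNIV s) m L (\<beta> * s) x (\<lambda>(k, u, v). B k (mat_unit s s u v))"
    unfolding input_def repD[OF sys rep] by (simp add: represents_lin[OF sys rep] kron_scalar_zero_right)
qed

text \<open>Under \<open>represents\<close> the pencil and the input of the descriptor equal those
  in the formula of the theorem, and over a field invertibility is a nonzero determinant.\<close>

lemma descr_at_iff_fm_value:
  fixes A B :: "'d::finite \<Rightarrow> 'k::field mat \<Rightarrow> 'k mat"
  assumes sys: "fm_system \<alpha> \<beta> s L D C A B" and rep: "represents \<beta> s S L D C A B"
    and X: "\<And>k. X k \<in> carrier_mat (m * s) (m * s)" and Y: "\<And>k. Y k \<in> carrier_mat s s"
  shows "descr_at (*) (grid UNIV s) m S (coords (*) s m Y X) W \<longleftrightarrow>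
    det (fm_pencil s Y L A m X) \<noteq> 0 \<and> W = fm_value \<beta> s Y L D C A B m X"
proof -
  let ?K = "grid UNIV s :: ('d \<times> nat \<times> nat) set" and ?x = "coords (*) s m Y X"
  have P: "pencil (*) ?K m S ?x = fm_pencil s Y L A m X"
    unfolding field_algebra.represents_pencil(1)[OF sys rep] fm_pencil_def ext_map_sum[OF sysD(3)[OF sys rep] X Y] ..
  have I: "input (*) ?K m S ?x = finsum (module_mat TYPE('k) (m * L) (m * (\<beta> * s))) (\<lambda>k. ext_map s L (\<beta> * s) m (B k) (X k - 1\<^sub>m m \<otimes>\<^sub>K Y k)) UNIV"
    unfolding field_algebra.represents_pencil(2)[OF sys rep] ext_map_sum[OF sysD(4)[OF sys rep] X Y] ..
  have Ic: "input (*) ?K m S ?x \<in> carrier_mat (m * L) (m * (\<beta> * s))"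
    unfolding field_algebra.represents_pencil(2)[OF sys rep] by (simp add: lin_def)
  have Pc: "fm_pencil s Y L A m X \<in> carrier_mat (m * L) (m * L)"
    unfolding P[symmetric] field_algebra.represents_pencil(1)[OF sys rep] by (rule minus_carrier_mat) (simp add: lin_def)
  have Cc: "1\<^sub>m m \<otimes>\<^sub>K C \<in> carrier_mat (m * (\<alpha> * s)) (m * L)" using sysD(2)[OF sys rep] by (auto intro!: carrier_matI)
  have v: "fm_value \<beta> s Y L D C A B m X = 1\<^sub>m m \<otimes>\<^sub>K D + (1\<^sub>m m \<otimes>\<^sub>K C) * (M * input (*) ?K m S ?x)"
    if M: "inverse_pair (m * L) (fm_pencil s Y L A m X) M" for M
    unfolding fm_value_def inv_mat_algebra[OF M] I[symmetric]
    using assoc_mult_mat[OF Cc _ Ic, of M] M by (simp add: inverse_pair_def)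
  show ?thesis
    unfolding descr_at_def P repD[OF sys rep] det_nonzero_iff_inverse_pair[OF Pc] kron_scalar_field using v by auto
qed

text \<open>An s by s matrix over the algebra is a point of size 1 in the entry variables, each of
  its entries being one variable; hence \<open>m\<close> is 1 here.\<close>

lemma (in unital_algebra) descr_at_iff_fm_value_alg:
  fixes A B :: "'d::finite \<Rightarrow> 'k mat \<Rightarrow> 'k mat"
  assumes sys: "fm_system \<alpha> \<beta> s L D C A B" and rep: "represents \<beta> s S L D C A B"
    and X: "\<And>k. X k \<in> carrier_mat s s" and Y: "\<And>k. Y k \<in> carrier_mat s s"
  shows "descr_at scale (grid UNIV s) 1 S (coords scale s 1 Y X) W \<longleftrightarrow>
    fm_pencil_alg scale s Y L A X \<in> Units (mat_algebra L) \<and> W = fm_value_alg scale \<beta> s Y L D C A B X"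
proof -
  let ?K = "grid UNIV s :: ('d \<times> nat \<times> nat) set" and ?x = "coords scale s 1 Y X"
  have st: "scalar_tensor scale P 1 = 1\<^sub>m 1 \<star> P" for P by (auto simp: scalar_tensor_def index_kron_scalar intro!: eq_matI)
  have P: "pencil scale ?K 1 S ?x = fm_pencil_alg scale s Y L A X"
    unfolding represents_pencil(1)[OF sys rep] fm_pencil_alg_def ext_map_alg_sum[where T = A and X = X and Y = Y, OF A_unit[OF sys rep] X Y]
      st[of "1\<^sub>m L"] kron_scalar_one by simp
  have I: "input scale ?K 1 S ?x = finsum (module_mat TYPE('a) L (\<beta> * s)) (\<lambda>k. ext_map_alg scale s L (\<beta> * s) (B k) (X k - scalar_tensor scale (Y k) 1)) UNIV"
    unfolding represents_pencil(2)[OF sys rep] ext_map_alg_sum[where T = B and X = X and Y = Y, OF B_unit[OF sys rep] X Y] ..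
  have Ic: "input scale ?K 1 S ?x \<in> carrier_mat L (\<beta> * s)"
    unfolding represents_pencil(2)[OF sys rep] by (simp add: lin_def)
  have Cc: "1\<^sub>m 1 \<star> C \<in> carrier_mat (\<alpha> * s) L" using sysD(2)[OF sys rep] by (auto intro!: carrier_matI)
  have v: "fm_value_alg scale \<beta> s Y L D C A B X = 1\<^sub>m 1 \<star> D + (1\<^sub>m 1 \<star> C) * (M * input scale ?K 1 S ?x)"
    if M: "inverse_pair L (fm_pencil_alg scale s Y L A X) M" for M
    unfolding fm_value_alg_def inv_mat_algebra[OF M] I[symmetric] st[of C] st[of D]
    using assoc_mult_mat[OF Cc _ Ic, of M] M by (simp add: inverse_pair_def)
  show ?thesis
    unfolding descr_at_def P repD[OF sys rep] Units_mat_algebra_iff mult_1 using v by auto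
qed

section \<open>Evaluation of rational functions\<close>

lemma minimal_for_exists:
  fixes Y :: "'d::finite \<Rightarrow> 'k::field mat"
  assumes Yc: "\<And>\<kappa>. Y \<kappa> \<in> carrier_mat s s" and Y: "\<And>i j. (i, j) \<in> set ps \<Longrightarrow> Y \<in> expr_dom (mat_algebra s) (F i j)"
  shows "\<exists>M. minimal_for s p q ps F Y M"
proof -
  have "descr_at (*) UNIV s (mat_rep p q F ps) Y (mat_val (*) p q s (\<lambda>i j. expr_eval (mat_alg (*) s) (F i j) Y) ps)"
    by (rule field_algebra.descr_at_mat_rep) (use Yc Y in \<open>auto simp: mat_alg_field\<close>)
  then obtain Q where Q: "inverse_pair (s * state_dim (mat_rep p q F ps)) (pencil (*) UNIV s (mat_rep p q F ps) Y) Q"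
    by (auto simp: descr_at_def)
  obtain M where "wf_descr (grid UNIV s) (s * p) (s * q) M" "centered M"
    "same_markov (grid UNIV s) (recentre UNIV s (mat_rep p q F ps) Y Q) M" "minimal (grid UNIV s) M"
    by (rule minimal_realization_exists[OF wf_recentre[OF wf_mat_rep Q]])
  thus ?thesis using Q unfolding minimal_for_def by blast
qed

context unital_algebra begin

text \<open>A minimal system built at a domain point of \<open>R\<close> takes, at the inflated
  point, the value of every equivalent expression defined there. Since its value is unique,
  \<open>R\<close> and \<open>R'\<close> agree, also at points where \<open>R0\<close> is undefined
  and over algebras about which \<open>expr_equiv\<close> says nothing.\<close>

lemma equivalent_values:
  fixes X :: "'d::finite \<Rightarrow> 'a mat"
  assumes sf: "stably_finite TYPE('a)" and eq: "(R0, R) \<in> expr_equiv" "(R0, R') \<in> expr_equiv"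
    and X: "X \<in> expr_dom (mat_alg scale n) R" "X \<in> expr_dom (mat_alg scale n) R'"
  shows "expr_eval (mat_alg scale n) R X = expr_eval (mat_alg scale n) R' X"
proof -
  obtain s Y where s: "s \<ge> 1" and Y: "Y \<in> expr_dom (mat_algebra s) R" using eq by (auto simp: expr_equiv_def nondegenerate_def)
  note Yc = field_expr_dom_carrier[OF Y]
  obtain M where M: "minimal_for s 1 1 [(0, 0)] (\<lambda>_ _. R) Y M" using minimal_for_exists[where Y = Y and ps = "[(0, 0)]" and F = "\<lambda>_ _. R", OF Yc Y] by blast
  let ?X = "\<lambda>k. 1\<^sub>m s \<otimes>\<^sub>K X k"
  have h: "?X \<in> expr_dom (mat_alg scale (n * s)) G \<and> expr_eval (mat_alg scale (n * s)) G ?X = 1\<^sub>m s \<otimes>\<^sub>K expr_eval (mat_alg scale n) G X"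
    if "X \<in> expr_dom (mat_alg scale n) G" for G
    using expr_eval_hom[OF closed_algebra_mat_alg closed_algebra_mat_alg unital_hom_one_kron that, of s] by (simp add: mult.commute)
  have Xc: "?X \<kappa> \<in> carrier_mat (n * s) (n * s)" for \<kappa> using expr_dom_carrier[of ?X "mat_alg scale (n * s)" R \<kappa>] h[OF X(1)] by simp
  have d: "descr_at scale (grid UNIV s) n M (coords scale s n Y ?X) (expr_eval (mat_alg scale (n * s)) G ?X)"
    if G: "(R0, G) \<in> expr_equiv" "X \<in> expr_dom (mat_alg scale n) G" for G
  proof -
    have "descr_at scale (grid UNIV s) n M (coords scale s n Y ?X)
      (mat_val scale 1 1 (n * s) (\<lambda>i j. expr_eval (mat_alg scale (n * s)) G ?X) [(0, 0)])"
      by (rule descr_at_minimal_for[where R = "\<lambda>_ _. R" and R' = "\<lambda>_ _. G" and ?R0.0 = "\<lambda>_ _. R0", OF sf s M Yc]) (use Y eq G h[OF G(2)] Xc in auto)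
    moreover have "mat_unit 1 1 0 0 = (1\<^sub>m (Suc 0) :: 'k mat)" by (auto simp: mat_unit_def)
    moreover have "expr_eval (mat_alg scale (n * s)) G ?X \<in> carrier_mat (n * s) (n * s)"
      using expr_eval_carrier h[OF G(2)] by blast
    ultimately show ?thesis by simp
  qed
  have "1\<^sub>m s \<otimes>\<^sub>K expr_eval (mat_alg scale n) R X = 1\<^sub>m s \<otimes>\<^sub>K expr_eval (mat_alg scale n) R' X"
    using descr_at_unique[OF d[OF eq(1) X(1)] d[OF eq(2) X(2)]] h[OF X(1)] h[OF X(2)] by simp
  thus ?thesis by (rule one_kron_cancel[OF _ s expr_eval_carrier[OF X(1)] expr_eval_carrier[OF X(2)]])
qed

lemma expr_eval_scalar_tensor:
  assumes "a \<in> expr_dom (type_algebra scale) R"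
  shows "(\<lambda>k. scalar_tensor scale (1\<^sub>m s) (a k)) \<in> expr_dom (mat_alg scale s) R"
    "expr_eval (mat_alg scale s) R (\<lambda>k. scalar_tensor scale (1\<^sub>m s) (a k)) = scalar_tensor scale (1\<^sub>m s) (expr_eval (type_algebra scale) R a)"
  using expr_eval_hom[OF closed_algebra_type closed_algebra_mat_alg unital_hom_scalar_tensor assms, of s] by auto

lemma equivalent_values_type:
  fixes a :: "'d::finite \<Rightarrow> 'a"
  assumes sf: "stably_finite TYPE('a)" and eq: "(R0, R) \<in> expr_equiv" "(R0, R') \<in> expr_equiv"
    and a: "a \<in> expr_dom (type_algebra scale) R" "a \<in> expr_dom (type_algebra scale) R'"
  shows "expr_eval (type_algebra scale) R a = expr_eval (type_algebra scale) R' a"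
proof -
  have "scalar_tensor scale (1\<^sub>m 1) (expr_eval (type_algebra scale) R a) = scalar_tensor scale (1\<^sub>m 1) (expr_eval (type_algebra scale) R' a)"
    using equivalent_values[OF sf eq expr_eval_scalar_tensor(1)[OF a(1), of 1] expr_eval_scalar_tensor(1)[OF a(2), of 1]]
      expr_eval_scalar_tensor(2)[OF a(1), of 1] expr_eval_scalar_tensor(2)[OF a(2), of 1] by simp
  hence "scalar_tensor scale (1\<^sub>m 1) (expr_eval (type_algebra scale) R a) $$ (0, 0) = scalar_tensor scale (1\<^sub>m 1) (expr_eval (type_algebra scale) R' a) $$ (0, 0)"
    by simp
  thus ?thesis by (simp add: scalar_tensor_def)
qed

end

section \<open>Choice of representatives and evaluation of classes\<close>

lemma rat_eval_eq:
  assumes "R0 \<in> \<RR>" "a \<in> expr_dom A R0" "\<And>R. R \<in> \<RR> \<Longrightarrow> a \<in> expr_dom A R \<Longrightarrow> expr_eval A R a = expr_eval A R0 a"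
  shows "rat_eval A \<RR> a = expr_eval A R0 a"
  unfolding rat_eval_def
proof (rule the_equality)
  show "\<exists>R\<in>\<RR>. a \<in> expr_dom A R \<and> expr_eval A R0 a = expr_eval A R a" using assms by blast
  show "v = expr_eval A R0 a" if "\<exists>R\<in>\<RR>. a \<in> expr_dom A R \<and> v = expr_eval A R a" for v using that assms(3) by blast
qed

text \<open>A class in the quotient is the set of all expressions related to one fixed
  \<open>R0\<close>. The relation to \<open>R0\<close>, rather than between two arbitrary members,
  is what membership directly provides.\<close>

lemma rational_class_rep:
  assumes "r \<in> nc_rational_matrices \<alpha> \<beta>"
  shows "\<exists>R0. \<forall>i<\<alpha>. \<forall>j<\<beta>. \<forall>R \<in> r $$ (i, j). (R0 i j, R) \<in> expr_equiv"
proof -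
  have "\<exists>R0. \<forall>R \<in> r $$ (i, j). (R0, R) \<in> expr_equiv" if "i < \<alpha>" "j < \<beta>" for i j
  proof -
    have "r $$ (i, j) \<in> nc_rational_functions"
      using assms elements_matI[of r \<alpha> \<beta> i j] that by (auto simp: nc_rational_matrices_def)
    thus ?thesis by (auto simp: nc_rational_functions_def quotient_def)
  qed
  hence "\<forall>i j. \<exists>R0. i < \<alpha> \<longrightarrow> j < \<beta> \<longrightarrow> (\<forall>R \<in> r $$ (i, j). (R0, R) \<in> expr_equiv)" by blast
  then obtain f where "\<forall>i j. i < \<alpha> \<longrightarrow> j < \<beta> \<longrightarrow> (\<forall>R \<in> r $$ (i, j). (f i j, R) \<in> expr_equiv)" by metis
  thus ?thesis by blast
qed

lemma rat_mat_dom_iff: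
  assumes "r \<in> carrier_mat \<alpha> \<beta>"
  shows "a \<in> rat_mat_dom A r \<longleftrightarrow> (\<exists>R. \<forall>i<\<alpha>. \<forall>j<\<beta>. R i j \<in> r $$ (i, j) \<and> a \<in> expr_dom A (R i j))"
proof
  assume a: "a \<in> rat_mat_dom A r"
  have "\<exists>R. i < \<alpha> \<longrightarrow> j < \<beta> \<longrightarrow> R \<in> r $$ (i, j) \<and> a \<in> expr_dom A R" for i j
    using a elements_matI[OF assms, of i j] by (auto simp: rat_mat_dom_def rat_dom_def)
  hence "\<forall>i j. \<exists>R. i < \<alpha> \<longrightarrow> j < \<beta> \<longrightarrow> R \<in> r $$ (i, j) \<and> a \<in> expr_dom A R" by blast
  then obtain f where "\<forall>i j. i < \<alpha> \<longrightarrow> j < \<beta> \<longrightarrow> f i j \<in> r $$ (i, j) \<and> a \<in> expr_dom A (f i j)" by metis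
  thus "\<exists>R. \<forall>i<\<alpha>. \<forall>j<\<beta>. R i j \<in> r $$ (i, j) \<and> a \<in> expr_dom A (R i j)" by blast
next
  assume "\<exists>R. \<forall>i<\<alpha>. \<forall>j<\<beta>. R i j \<in> r $$ (i, j) \<and> a \<in> expr_dom A (R i j)"
  thus "a \<in> rat_mat_dom A r" using assms by (fastforce simp: rat_mat_dom_def rat_dom_def dest!: elements_matD)
qed

lemma mat_val_finsum:
  fixes V :: "nat \<Rightarrow> nat \<Rightarrow> 'k::field mat"
  assumes "distinct ps" "\<And>i j. (i, j) \<in> set ps \<Longrightarrow> V i j \<in> carrier_mat n n"
  shows "finsum (module_mat TYPE('k) (n * p) (n * q)) (\<lambda>(i, j). V i j \<otimes>\<^sub>K mat_unit p q i j) (set ps) = mat_val (*) p q n V ps"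
proof -
  have "finsum (module_mat TYPE('k) (n * p) (n * q)) (\<lambda>(i, j). V i j \<otimes>\<^sub>K mat_unit p q i j) (set ps) =
    foldr (\<lambda>w v. (case w of (i, j) \<Rightarrow> V i j \<otimes>\<^sub>K mat_unit p q i j) + v) ps (0\<^sub>m (n * p) (n * q))"
    using finsum_foldr[OF abelian_monoid_module_mat assms(1), of "\<lambda>(i, j). V i j \<otimes>\<^sub>K mat_unit p q i j" "n * p" "n * q"] assms(2)
    by (force simp: module_mat_simps intro!: carrier_matI)
  also have "\<dots> = mat_val (*) p q n V ps"
    by (induction ps) (auto simp: kron_scalar_field)
  finally show ?thesis .
qed

definition entry_list :: "nat \<Rightarrow> nat \<Rightarrow> (nat \<times> nat) list" where
  "entry_list p q = List.product [0..<p] [0..<q]"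

lemma entry_list: "distinct (entry_list p q)" "set (entry_list p q) = {..<p} \<times> {..<q}"
  by (auto simp: entry_list_def distinct_product)

lemma (in unital_algebra) index_mat_val:
  assumes "distinct ps" "set ps \<subseteq> {..<p} \<times> {..<q}" "\<And>i j. (i, j) \<in> set ps \<Longrightarrow> V i j \<in> carrier_mat n n" "x < n * p" "y < n * q"
  shows "mat_val scale p q n V ps $$ (x, y) =
      (if (x mod p, y mod q) \<in> set ps then V (x mod p) (y mod q) $$ (x div p, y div q) else 0) \<and>
    mat_val scale p q n V ps \<in> carrier_mat (n * p) (n * q)"
  using assms(1,2,3)
proof (induction ps)
  case Nil
  show ?case using assms(4,5) by simp
next
  case (Cons ij ps)
  obtain i j where ij: "ij = (i, j)" by (cases ij)
  have IH: "mat_val scale p q n V ps $$ (x, y) = (if (x mod p, y mod q) \<in> set ps then V (x mod p) (y mod q) $$ (x div p, y div q) else 0)"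
    "mat_val scale p q n V ps \<in> carrier_mat (n * p) (n * q)" using Cons by auto
  have V: "V i j \<in> carrier_mat n n" using Cons.prems(3)[of i j] ij by simp
  have "mat_val scale p q n V (ij # ps) $$ (x, y) = (V i j \<star> mat_unit p q i j) $$ (x, y) + mat_val scale p q n V ps $$ (x, y)"
    using IH(2) assms(4,5) by (simp add: ij)
  also have "(V i j \<star> mat_unit p q i j) $$ (x, y) = (if x mod p = i \<and> y mod q = j then V i j $$ (x div p, y div q) else 0)"
    using V assms(4,5) by (simp add: index_kron_scalar mod_mult_lt)
  finally show ?case using IH Cons.prems(1) V by (auto simp: ij intro!: carrier_matI)
qed

text \<open>One-stage version of \<open>lifted_shift_in_dom\<close>, with perturbations of
  \<open>Y\<close> itself.\<close>

lemma shift_in_dom: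
  fixes Y :: "'d::finite \<Rightarrow> 'k::field mat"
  assumes Y: "Y \<in> expr_dom (mat_algebra s) G" and w: "w \<in> lists (grid UNIV s)"
  shows "assemble s (Suc (length w)) Y (shift_point w) \<in> expr_dom (mat_algebra (Suc (length w) * s)) G"
proof -
  let ?l = "Suc (length w)" and ?S = "expr_rep G" and ?x = "assemble s (Suc (length w)) Y (shift_point w)"
  have Yc: "Y \<kappa> \<in> carrier_mat s s" for \<kappa> by (rule field_expr_dom_carrier[OF Y])
  obtain N where N: "inverse_pair (s * state_dim ?S) (pencil (*) UNIV s ?S Y) N" using regular_of_expr_dom[OF Y] by blast
  obtain V where V: "descr_at (*) (grid UNIV s) ?l (recentre UNIV s ?S Y N) (shift_point w) V"
    using shift_point_regular[OF _ wf_recentre[OF wf_expr_rep N] centered_recentre[OF wf_expr_rep] w] by auto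
  have "descr_at (*) (grid UNIV s) ?l (recentre UNIV s ?S Y N) (coords (*) s ?l Y ?x) V"
    by (rule iffD1[OF descr_at_cong V], rule coords_shift[symmetric]) (use Yc in auto)
  hence "descr_at (*) UNIV (?l * s) ?S ?x V"
    by (subst (asm) field_algebra.descr_at_recentre[OF finite_UNIV _ _ wf_expr_rep N]) (use Yc in \<open>auto simp del: mult_Suc\<close>)
  then obtain N2 where "inverse_pair (?l * s * state_dim ?S) (pencil (*) UNIV (?l * s) ?S ?x) N2"
    unfolding descr_at_def by blast
  from field_algebra.expr_dom_of_regular[OF assemble_carrier stably_finite_field this]
  show ?thesis unfolding mat_alg_field .
qed

text \<open>\<open>rat_eval\<close> is a definite description, so all members of a class that are
  defined at \<open>X\<close> must agree there; \<open>equivalent_values\<close> over the field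
  supplies this.\<close>

lemma rat_mat_value_eq:
  fixes X :: "'d::finite \<Rightarrow> 'k::field mat"
  assumes r: "r \<in> carrier_mat \<alpha> \<beta>"
    and R0: "\<And>i j R. i < \<alpha> \<Longrightarrow> j < \<beta> \<Longrightarrow> R \<in> r $$ (i, j) \<Longrightarrow> (R0 i j, R) \<in> expr_equiv"
    and R: "\<And>i j. i < \<alpha> \<Longrightarrow> j < \<beta> \<Longrightarrow> R i j \<in> r $$ (i, j)" "\<And>i j. i < \<alpha> \<Longrightarrow> j < \<beta> \<Longrightarrow> X \<in> expr_dom (mat_algebra n) (R i j)"
  shows "rat_mat_value n r X = mat_val (*) \<alpha> \<beta> n (\<lambda>i j. expr_eval (mat_algebra n) (R i j) X) (entry_list \<alpha> \<beta>)"
proof -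
  have e: "rat_mat_eval (mat_algebra n) r X $$ (i, j) = expr_eval (mat_algebra n) (R i j) X" if ij: "i < \<alpha>" "j < \<beta>" for i j
  proof -
    have "rat_eval (mat_algebra n) (r $$ (i, j)) X = expr_eval (mat_algebra n) (R i j) X"
      by (rule rat_eval_eq[OF R(1)[OF ij] R(2)[OF ij]])
        (use field_algebra.equivalent_values[OF stably_finite_field R0[OF ij] R0[OF ij R(1)[OF ij]], of _ X n] R(2)[OF ij] in \<open>auto simp: mat_alg_field\<close>)
    thus ?thesis using r ij by (simp add: rat_mat_eval_def)
  qed
  have c: "expr_eval (mat_algebra n) (R i j) X \<in> carrier_mat n n" if ij: "i < \<alpha>" "j < \<beta>" for i j
    using field_algebra.expr_eval_carrier[of X n "R i j"] R(2)[OF ij] by (simp add: mat_alg_field)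
  have d: "dim_row r = \<alpha>" "dim_col r = \<beta>" using r by auto
  have "rat_mat_value n r X = mat_val (*) \<alpha> \<beta> n (\<lambda>i j. rat_mat_eval (mat_algebra n) r X $$ (i, j)) (entry_list \<alpha> \<beta>)"
    unfolding rat_mat_value_def d entry_list(2)[symmetric] by (rule mat_val_finsum[OF entry_list(1)]) (use e c in \<open>auto simp: entry_list\<close>)
  also have "\<dots> = mat_val (*) \<alpha> \<beta> n (\<lambda>i j. expr_eval (mat_algebra n) (R i j) X) (entry_list \<alpha> \<beta>)"
    by (rule mat_val_cong) (use e in \<open>auto simp: entry_list\<close>)
  finally show ?thesis .
qed

section \<open>Existence\<close>

text \<open>A realization is compared with \<open>r\<close> only on the domain of \<open>r\<close>,
  but the nilpotent points around \<open>Y\<close> lie in that domain through the representatives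
  chosen at \<open>Y\<close>, and they determine all Markov parameters. Uniqueness thus becomes a
  statement about minimal systems with equal Markov parameters.\<close>

lemma minimal_realization_minimal_for:
  fixes Y :: "'d::finite \<Rightarrow> 'k::field mat"
  assumes r: "r \<in> carrier_mat \<alpha> \<beta>"
    and R0: "\<And>i j R. i < \<alpha> \<Longrightarrow> j < \<beta> \<Longrightarrow> R \<in> r $$ (i, j) \<Longrightarrow> (R0 i j, R) \<in> expr_equiv"
    and Yc: "\<And>\<kappa>. Y \<kappa> \<in> carrier_mat s s"
    and R: "\<And>i j. i < \<alpha> \<Longrightarrow> j < \<beta> \<Longrightarrow> R i j \<in> r $$ (i, j)" "\<And>i j. i < \<alpha> \<Longrightarrow> j < \<beta> \<Longrightarrow> Y \<in> expr_dom (mat_algebra s) (R i j)"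
    and real: "minimal_realization \<alpha> \<beta> s r Y L D C A B" and rep: "represents \<beta> s S L D C A B"
  shows "minimal_for s \<alpha> \<beta> (entry_list \<alpha> \<beta>) R Y S"
proof -
  let ?K = "grid UNIV s :: ('d \<times> nat \<times> nat) set" and ?S = "mat_rep \<alpha> \<beta> R (entry_list \<alpha> \<beta>)"
  have sys: "fm_system \<alpha> \<beta> s L D C A B" and co: "controllable \<beta> s L A B" "observable s L C A"
    and val: "\<And>m X. m \<ge> 1 \<Longrightarrow> X \<in> rat_mat_dom (mat_algebra (s * m)) r \<Longrightarrow>
      det (fm_pencil s Y L A m X) \<noteq> 0 \<and> rat_mat_value (s * m) r X = fm_value \<beta> s Y L D C A B m X"
    using real by (auto simp: minimal_realization_def)
  have wf: "wf_descr ?K (s * \<alpha>) (s * \<beta>) S" using represents_wf[OF sys rep] by (simp add: mult.commute)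
  have cen: "centered S" by (rule represents_centered[OF sys rep])
  have "descr_at (*) UNIV s ?S Y (mat_val (*) \<alpha> \<beta> s (\<lambda>i j. expr_eval (mat_alg (*) s) (R i j) Y) (entry_list \<alpha> \<beta>))"
    by (rule field_algebra.descr_at_mat_rep) (use Yc R in \<open>auto simp: mat_alg_field entry_list\<close>)
  then obtain Q where Q: "inverse_pair (s * state_dim ?S) (pencil (*) UNIV s ?S Y) Q" by (auto simp: descr_at_def)
  have "same_markov ?K (recentre UNIV s ?S Y Q) S"
  proof (rule same_markov_of_values[OF _ wf_recentre[OF wf_mat_rep Q] wf centered_recentre[OF wf_mat_rep] cen])
    fix w :: "('d \<times> nat \<times> nat) list" assume w: "w \<in> lists ?K"
    obtain l where l: "l = Suc (length w)" by simp
    let ?x = "assemble s l Y (shift_point w)" and ?V = "rat_mat_value (l * s) r (assemble s l Y (shift_point w))"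
    have d: "?x \<in> expr_dom (mat_algebra (l * s)) (R i j)" if "i < \<alpha>" "j < \<beta>" for i j
      unfolding l by (rule shift_in_dom[OF R(2)[OF that] w])
    hence "?x \<in> rat_mat_dom (mat_algebra (s * l)) r"
      unfolding rat_mat_dom_iff[OF r] mult.commute[of s l] using R(1) by blast
    hence "det (fm_pencil s Y L A l ?x) \<noteq> 0 \<and> ?V = fm_value \<beta> s Y L D C A B l ?x"
      using val[of l ?x] l by (simp add: mult.commute)
    hence 1: "descr_at (*) ?K l S (coords (*) s l Y ?x) ?V"
      using descr_at_iff_fm_value[where X = ?x and Y = Y and m = l, OF sys rep assemble_carrier Yc] by blast
    have "?V = mat_val (*) \<alpha> \<beta> (l * s) (\<lambda>i j. expr_eval (mat_algebra (l * s)) (R i j) ?x) (entry_list \<alpha> \<beta>)"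
      by (rule rat_mat_value_eq[OF r R0 R(1) d])
    moreover have "descr_at (*) UNIV (l * s) ?S ?x (mat_val (*) \<alpha> \<beta> (l * s) (\<lambda>i j. expr_eval (mat_alg (*) (l * s)) (R i j) ?x) (entry_list \<alpha> \<beta>))"
      by (rule field_algebra.descr_at_mat_rep) (use d in \<open>auto simp: mat_alg_field entry_list\<close>)
    ultimately have "descr_at (*) UNIV (l * s) ?S ?x ?V" by (simp add: mat_alg_field)
    hence 2: "descr_at (*) ?K l (recentre UNIV s ?S Y Q) (coords (*) s l Y ?x) ?V"
      by (subst field_algebra.descr_at_recentre[OF finite_UNIV _ _ wf_mat_rep Q]) (use Yc in auto)
    have c: "coords (*) s l Y ?x \<kappa> = shift_point w \<kappa>" if "\<kappa> \<in> ?K" for \<kappa>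
      unfolding l by (rule coords_shift[OF Yc that])
    have "descr_at (*) ?K l (recentre UNIV s ?S Y Q) (shift_point w) ?V" by (rule iffD1[OF descr_at_cong 2]) (rule c)
    moreover have "descr_at (*) ?K l S (shift_point w) ?V" by (rule iffD1[OF descr_at_cong 1]) (rule c)
    ultimately show "\<exists>V. descr_at (*) ?K (Suc (length w)) (recentre UNIV s ?S Y Q) (shift_point w) V \<and>
      descr_at (*) ?K (Suc (length w)) S (shift_point w) V" unfolding l by blast
  qed simp
  thus ?thesis unfolding minimal_for_def using wf cen Q represents_minimal_iff[OF sys rep] co by blast
qed

lemma linear_map_of_units:
  fixes P :: "nat \<Rightarrow> nat \<Rightarrow> 'k::field mat"
  assumes "\<And>u v. u < s \<Longrightarrow> v < s \<Longrightarrow> P u v \<in> carrier_mat p q"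
  shows "\<exists>T. linear_mat_map s p q T \<and> (\<forall>u<s. \<forall>v<s. T (mat_unit s s u v) = P u v)"
proof -
  let ?T = "\<lambda>W. mat p q (\<lambda>ab. \<Sum>uv\<in>{..<s} \<times> {..<s}. W $$ uv * P (fst uv) (snd uv) $$ ab)"
  have "linear_mat_map s p q ?T"
    unfolding linear_mat_map_def LinearCombinations.module_hom_def module_mat_simps
  proof (intro CollectI conjI allI impI, goal_cases)
    case 1
    show ?case by auto
  next
    case (2 X X')
    have "(\<Sum>uv\<in>{..<s} \<times> {..<s}. (X + X') $$ uv * P (fst uv) (snd uv) $$ ab) =
      (\<Sum>uv\<in>{..<s} \<times> {..<s}. X $$ uv * P (fst uv) (snd uv) $$ ab) + (\<Sum>uv\<in>{..<s} \<times> {..<s}. X' $$ uv * P (fst uv) (snd uv) $$ ab)" for ab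
      unfolding sum.distrib[symmetric] by (rule sum.cong) (use 2 in \<open>auto simp: distrib_right\<close>)
    thus ?case by (intro eq_matI) simp_all
  next
    case (3 c X)
    have "(\<Sum>uv\<in>{..<s} \<times> {..<s}. (c \<cdot>\<^sub>m X) $$ uv * P (fst uv) (snd uv) $$ ab) =
      c * (\<Sum>uv\<in>{..<s} \<times> {..<s}. X $$ uv * P (fst uv) (snd uv) $$ ab)" for ab
      unfolding sum_distrib_left by (rule sum.cong) (use 3 in auto)
    thus ?case by (intro eq_matI) simp_all
  qed
  moreover have "?T (mat_unit s s u v) = P u v" if uv: "u < s" "v < s" for u v
  proof (rule eq_matI)
    fix a b assume "a < dim_row (P u v)" "b < dim_col (P u v)"
    hence ab: "a < p" "b < q" using assms[OF uv] by auto
    have "(\<Sum>x\<in>{..<s} \<times> {..<s}. mat_unit s s u v $$ x * P (fst x) (snd x) $$ (a, b)) =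
      (\<Sum>x\<in>{..<s} \<times> {..<s}. if x = (u, v) then P u v $$ (a, b) else 0)"
      by (rule sum.cong) (auto split: if_splits)
    also have "\<dots> = P u v $$ (a, b)" using uv by (simp add: sum.delta)
    finally show "?T (mat_unit s s u v) $$ (a, b) = P u v $$ (a, b)" using ab by simp
  qed (use assms[OF uv] in auto)
  ultimately show ?thesis by blast
qed

text \<open>A linear map may be prescribed freely on matrix units, so the coefficients of a centered
  descriptor in the entry variables are the values of linear maps there.\<close>

lemma system_of_descriptor:
  fixes S :: "('d::finite \<times> nat \<times> nat, 'k::field) descriptor"
  assumes wf: "wf_descr (grid UNIV s) (s * \<alpha>) (s * \<beta>) S" and cen: "centered S"
  shows "\<exists>A B. fm_system \<alpha> \<beta> s (state_dim S) (feed S) (outp S) A B \<and> represents \<beta> s S (state_dim S) (feed S) (outp S) A B"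
proof -
  let ?n = "state_dim S"
  have "\<forall>k. \<exists>T. linear_mat_map s ?n ?n T \<and> (\<forall>u<s. \<forall>v<s. T (mat_unit s s u v) = - pen_coeff S (k, u, v))"
    by (intro allI linear_map_of_units) (use wf_descr_carrier(5)[OF wf] in auto)
  then obtain A where A: "\<And>k. linear_mat_map s ?n ?n (A k)" "\<And>k u v. u < s \<Longrightarrow> v < s \<Longrightarrow> A k (mat_unit s s u v) = - pen_coeff S (k, u, v)"
    by metis
  have "\<forall>k. \<exists>T. linear_mat_map s ?n (\<beta> * s) T \<and> (\<forall>u<s. \<forall>v<s. T (mat_unit s s u v) = inp_coeff S (k, u, v))"
    by (intro allI linear_map_of_units) (use wf_descr_carrier(6)[OF wf] in \<open>auto simp: mult.commute\<close>)
  then obtain B where B: "\<And>k. linear_mat_map s ?n (\<beta> * s) (B k)" "\<And>k u v. u < s \<Longrightarrow> v < s \<Longrightarrow> B k (mat_unit s s u v) = inp_coeff S (k, u, v)"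
    by metis
  have "fm_system \<alpha> \<beta> s ?n (feed S) (outp S) A B"
    unfolding fm_system_def using A(1) B(1) wf_descr_carrier(1,2)[OF wf] by (simp add: mult.commute)
  moreover have "represents \<beta> s S ?n (feed S) (outp S) A B"
    unfolding represents_def using A(2) B(2) cen wf_descr_dims(8)[OF wf] by (simp add: centered_def mult.commute mat_uminus_uminus)
  ultimately show ?thesis by blast
qed

lemma mat_val_one_kron:
  fixes V :: "nat \<Rightarrow> nat \<Rightarrow> 'k::field mat"
  assumes "\<And>i j. (i, j) \<in> set ps \<Longrightarrow> V i j \<in> carrier_mat n n"
  shows "mat_val (*) p q (s * n) (\<lambda>i j. 1\<^sub>m s \<otimes>\<^sub>K V i j) ps = 1\<^sub>m s \<otimes>\<^sub>K mat_val (*) p q n V ps \<and>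
    mat_val (*) p q n V ps \<in> carrier_mat (n * p) (n * q)"
  using assms
proof (induction ps)
  case Nil
  show ?case by (simp add: one_kron_zero mult.assoc)
next
  case (Cons ij ps)
  obtain i j where ij: "ij = (i, j)" by (cases ij)
  have V: "V i j \<in> carrier_mat n n" using Cons.prems[of i j] ij by simp
  have IH: "mat_val (*) p q (s * n) (\<lambda>i j. 1\<^sub>m s \<otimes>\<^sub>K V i j) ps = 1\<^sub>m s \<otimes>\<^sub>K mat_val (*) p q n V ps"
    "mat_val (*) p q n V ps \<in> carrier_mat (n * p) (n * q)" using Cons by auto
  have "1\<^sub>m s \<otimes>\<^sub>K V i j \<otimes>\<^sub>K mat_unit p q i j = 1\<^sub>m s \<otimes>\<^sub>K (V i j \<otimes>\<^sub>K mat_unit p q i j)"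
    using field_algebra.kron_scalar_assoc[of "1\<^sub>m s" "V i j" "mat_unit p q i j"] by (simp add: kron_scalar_field)
  moreover have "V i j \<otimes>\<^sub>K mat_unit p q i j \<in> carrier_mat (n * p) (n * q)" using V by (auto intro!: carrier_matI)
  moreover have "1\<^sub>m s \<otimes>\<^sub>K (V i j \<otimes>\<^sub>K mat_unit p q i j + mat_val (*) p q n V ps) =
    1\<^sub>m s \<otimes>\<^sub>K (V i j \<otimes>\<^sub>K mat_unit p q i j) + 1\<^sub>m s \<otimes>\<^sub>K mat_val (*) p q n V ps"
    using V IH(2) by (intro one_kron_add) auto
  ultimately show ?case using IH by (simp add: ij kron_scalar_field)
qed

section \<open>Values of the minimal system at matrix points of both kinds and over algebras\<close>

context
  fixes \<alpha> \<beta> s :: nat and r :: "('d::finite, 'k::field) nc_expr set mat" and R0 R :: "nat \<Rightarrow> nat \<Rightarrow> ('d, 'k) nc_expr"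
    and Y :: "'d \<Rightarrow> 'k mat" and M :: "('d \<times> nat \<times> nat, 'k) descriptor"
  assumes s: "s \<ge> 1" and r: "r \<in> carrier_mat \<alpha> \<beta>"
    and R0: "\<And>i j R. i < \<alpha> \<Longrightarrow> j < \<beta> \<Longrightarrow> R \<in> r $$ (i, j) \<Longrightarrow> (R0 i j, R) \<in> expr_equiv"
    and Yc: "\<And>\<kappa>. Y \<kappa> \<in> carrier_mat s s"
    and R: "\<And>i j. i < \<alpha> \<Longrightarrow> j < \<beta> \<Longrightarrow> R i j \<in> r $$ (i, j)" "\<And>i j. i < \<alpha> \<Longrightarrow> j < \<beta> \<Longrightarrow> Y \<in> expr_dom (mat_algebra s) (R i j)"
    and M: "minimal_for s \<alpha> \<beta> (entry_list \<alpha> \<beta>) R Y M" and pos: "\<alpha> \<ge> 1" "\<beta> \<ge> 1"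
begin

lemma rat_mat_dom_carrier:
  assumes "a \<in> rat_mat_dom A r"
  shows "a k \<in> carrier A"
proof -
  obtain R' where "\<forall>i<\<alpha>. \<forall>j<\<beta>. R' i j \<in> r $$ (i, j) \<and> a \<in> expr_dom A (R' i j)"
    using assms unfolding rat_mat_dom_iff[OF r] by blast
  hence "a \<in> expr_dom A (R' 0 0)" using pos by simp
  thus ?thesis by (rule expr_dom_carrier)
qed

lemma minimal_value:
  assumes X: "X \<in> rat_mat_dom (mat_algebra (m * s)) r"
  shows "descr_at (*) (grid UNIV s) m M (coords (*) s m Y X) (rat_mat_value (m * s) r X)"
proof -
  obtain R' where R': "\<forall>i<\<alpha>. \<forall>j<\<beta>. R' i j \<in> r $$ (i, j) \<and> X \<in> expr_dom (mat_algebra (m * s)) (R' i j)"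
    using X unfolding rat_mat_dom_iff[OF r] by blast
  have Xc: "X \<kappa> \<in> carrier_mat (m * s) (m * s)" for \<kappa> using rat_mat_dom_carrier[OF X, of \<kappa>] by (simp add: module_mat_simps)
  have "rat_mat_value (m * s) r X = mat_val (*) \<alpha> \<beta> (m * s) (\<lambda>i j. expr_eval (mat_algebra (m * s)) (R' i j) X) (entry_list \<alpha> \<beta>)"
    by (rule rat_mat_value_eq[OF r R0]) (use R' in auto)
  moreover have "descr_at (*) (grid UNIV s) m M (coords (*) s m Y X)
    (mat_val (*) \<alpha> \<beta> (m * s) (\<lambda>i j. expr_eval (mat_alg (*) (m * s)) (R' i j) X) (entry_list \<alpha> \<beta>))"
    by (rule field_algebra.descr_at_minimal_for[where R = R and ?R0.0 = R0, OF stably_finite_field s M Yc])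
      (use R R' R0 Xc in \<open>auto simp: entry_list mat_alg_field\<close>)
  ultimately show ?thesis by (simp add: mat_alg_field)
qed

text \<open>The inflated point has size s*n, so the preceding case applies; inflation is a
  homomorphism, so it commutes with the evaluation of every entry.\<close>

lemma minimal_value_one_kron:
  assumes X: "X \<in> rat_mat_dom (mat_algebra n) r"
  shows "descr_at (*) (grid UNIV s) n M (coords (*) s n Y (\<lambda>k. 1\<^sub>m s \<otimes>\<^sub>K X k)) (1\<^sub>m s \<otimes>\<^sub>K rat_mat_value n r X)"
proof -
  obtain R' where R': "\<forall>i<\<alpha>. \<forall>j<\<beta>. R' i j \<in> r $$ (i, j) \<and> X \<in> expr_dom (mat_algebra n) (R' i j)"
    using X unfolding rat_mat_dom_iff[OF r] by blast
  let ?X = "\<lambda>k. 1\<^sub>m s \<otimes>\<^sub>K X k"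
  have XX: "?X \<in> expr_dom (mat_algebra (s * n)) (R' i j)"
    "expr_eval (mat_algebra (s * n)) (R' i j) ?X = 1\<^sub>m s \<otimes>\<^sub>K expr_eval (mat_algebra n) (R' i j) X" if "i < \<alpha>" "j < \<beta>" for i j
    using expr_dom_one_kron[of X n "R' i j" s] R' that by auto
  have "?X \<in> rat_mat_dom (mat_algebra (n * s)) r"
    unfolding rat_mat_dom_iff[OF r] mult.commute[of n s] using R' XX by blast
  note v = minimal_value[OF this]
  have c: "expr_eval (mat_algebra n) (R' i j) X \<in> carrier_mat n n" if "i < \<alpha>" "j < \<beta>" for i j
    using field_algebra.expr_eval_carrier[of X n "R' i j"] R' that by (simp add: mat_alg_field)
  have "rat_mat_value (s * n) r ?X = mat_val (*) \<alpha> \<beta> (s * n) (\<lambda>i j. expr_eval (mat_algebra (s * n)) (R' i j) ?X) (entry_list \<alpha> \<beta>)"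
    by (rule rat_mat_value_eq[OF r R0]) (use R' XX in auto)
  also have "\<dots> = mat_val (*) \<alpha> \<beta> (s * n) (\<lambda>i j. 1\<^sub>m s \<otimes>\<^sub>K expr_eval (mat_algebra n) (R' i j) X) (entry_list \<alpha> \<beta>)"
    by (rule mat_val_cong) (use XX in \<open>auto simp: entry_list\<close>)
  also have "\<dots> = 1\<^sub>m s \<otimes>\<^sub>K mat_val (*) \<alpha> \<beta> n (\<lambda>i j. expr_eval (mat_algebra n) (R' i j) X) (entry_list \<alpha> \<beta>)"
    by (rule conjunct1[OF mat_val_one_kron]) (use c in \<open>auto simp: entry_list\<close>)
  also have "mat_val (*) \<alpha> \<beta> n (\<lambda>i j. expr_eval (mat_algebra n) (R' i j) X) (entry_list \<alpha> \<beta>) = rat_mat_value n r X"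
    by (rule rat_mat_value_eq[OF r R0, symmetric]) (use R' in auto)
  finally show ?thesis using v by (simp add: mult.commute)
qed

text \<open>The tuple is embedded as scalar diagonal matrices of size s, that is, 1 \<otimes> a with
  the identity as the outer factor. The sum of 1 \<otimes> v_ij \<otimes> E_ij then regroups as 1
  \<otimes> [v_ij].\<close>

lemma minimal_value_alg:
  fixes scale :: "'k \<Rightarrow> 'a::ring_1 \<Rightarrow> 'a"
  assumes alg: "unital_algebra scale" and sf: "stably_finite TYPE('a)" and a: "a \<in> rat_mat_dom (type_algebra scale) r"
  shows "descr_at scale (grid UNIV s) 1 M (coords scale s 1 Y (\<lambda>k. scalar_tensor scale (1\<^sub>m s) (a k)))
    (1\<^sub>m s \<otimes>\<^sub>K rat_mat_eval (type_algebra scale) r a)"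
proof -
  interpret unital_algebra scale by (rule alg)
  obtain R' where R': "\<forall>i<\<alpha>. \<forall>j<\<beta>. R' i j \<in> r $$ (i, j) \<and> a \<in> expr_dom (type_algebra scale) (R' i j)"
    using a unfolding rat_mat_dom_iff[OF r] by blast
  let ?X = "\<lambda>k. scalar_tensor scale (1\<^sub>m s) (a k)" and ?v = "\<lambda>i j. expr_eval (type_algebra scale) (R' i j) a"
  have XX: "?X \<in> expr_dom (mat_alg scale s) (R' i j)" "expr_eval (mat_alg scale s) (R' i j) ?X = scalar_tensor scale (1\<^sub>m s) (?v i j)"
    if "i < \<alpha>" "j < \<beta>" for i j
    using expr_eval_scalar_tensor[of a "R' i j" s] R' that by auto
  have e: "rat_mat_eval (type_algebra scale) r a $$ (i, j) = ?v i j" if ij: "i < \<alpha>" "j < \<beta>" for i j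
  proof -
    have R'ij: "R' i j \<in> r $$ (i, j)" "a \<in> expr_dom (type_algebra scale) (R' i j)" using R' ij by auto
    have "rat_eval (type_algebra scale) (r $$ (i, j)) a = ?v i j"
      by (rule rat_eval_eq[OF R'ij]) (rule equivalent_values_type[OF sf R0[OF ij] R0[OF ij R'ij(1)] _ R'ij(2)])
    thus ?thesis using r ij by (simp add: rat_mat_eval_def)
  qed
  have d: "dim_row (rat_mat_eval (type_algebra scale) r a) = \<alpha>" "dim_col (rat_mat_eval (type_algebra scale) r a) = \<beta>"
    using r by (auto simp: rat_mat_eval_def)
  have "descr_at scale (grid UNIV s) 1 M (coords scale s 1 Y ?X)
    (mat_val scale \<alpha> \<beta> (1 * s) (\<lambda>i j. expr_eval (mat_alg scale (1 * s)) (R' i j) ?X) (entry_list \<alpha> \<beta>))"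
    by (rule descr_at_minimal_for[where R = R and ?R0.0 = R0, OF sf s M Yc])
      (use R R' R0 XX in \<open>auto simp: entry_list scalar_tensor_def\<close>)
  moreover have "mat_val scale \<alpha> \<beta> (1 * s) (\<lambda>i j. expr_eval (mat_alg scale (1 * s)) (R' i j) ?X) (entry_list \<alpha> \<beta>) =
    mat_val scale \<alpha> \<beta> s (\<lambda>i j. scalar_tensor scale (1\<^sub>m s) (?v i j)) (entry_list \<alpha> \<beta>)"
    unfolding mult_1 by (rule mat_val_cong) (use XX in \<open>auto simp: entry_list\<close>)
  moreover have "mat_val scale \<alpha> \<beta> s (\<lambda>i j. scalar_tensor scale (1\<^sub>m s) (?v i j)) (entry_list \<alpha> \<beta>) = 1\<^sub>m s \<otimes>\<^sub>K rat_mat_eval (type_algebra scale) r a"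
    (is "?L = ?P")
  proof -
    have iv: "?L $$ (x, y) = (if (x mod \<alpha>, y mod \<beta>) \<in> set (entry_list \<alpha> \<beta>) then scalar_tensor scale (1\<^sub>m s) (?v (x mod \<alpha>) (y mod \<beta>)) $$ (x div \<alpha>, y div \<beta>) else 0) \<and>
      ?L \<in> carrier_mat (s * \<alpha>) (s * \<beta>)" if "x < s * \<alpha>" "y < s * \<beta>" for x y
      by (rule index_mat_val[OF entry_list(1) _ _ that]) (auto simp: entry_list scalar_tensor_def)
    have "?L \<in> carrier_mat (s * \<alpha>) (s * \<beta>)" using iv[of 0 0] s pos by simp
    thus ?thesis
    proof (intro eq_matI)
      fix x y assume "x < dim_row ?P" "y < dim_col ?P"
      hence xy: "x < s * \<alpha>" "y < s * \<beta>" by (auto simp: d)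
      have b: "x mod \<alpha> < \<alpha>" "y mod \<beta> < \<beta>" "x div \<alpha> < s" "y div \<beta> < s" using xy by (auto intro: div_mult_lt mod_mult_lt)
      show "?L $$ (x, y) = ?P $$ (x, y)"
        using conjunct1[OF iv[OF xy]] xy b by (simp add: entry_list scalar_tensor_def index_one_kron d e)
    qed (auto simp: d)
  qed
  ultimately show ?thesis by simp
qed

end

section \<open>Uniqueness\<close>

lemma mat_eq_of_mult_vec:
  fixes M N :: "'k::field mat"
  assumes "M \<in> carrier_mat p n" "N \<in> carrier_mat p n" "\<And>x. x \<in> carrier_vec n \<Longrightarrow> M *\<^sub>v x = N *\<^sub>v x"
  shows "M = N"
proof (rule eq_matI)
  fix i j assume "i < dim_row N" "j < dim_col N"
  hence ij: "i < p" "j < n" using assms(2) by auto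
  have "(M *\<^sub>v unit_vec n j) $ i = (N *\<^sub>v unit_vec n j) $ i" using assms(3)[of "unit_vec n j"] by simp
  thus "M $$ (i, j) = N $$ (i, j)" using ij assms(1,2) by simp
qed (use assms in auto)

lemma linear_maps_eq:
  assumes T: "linear_mat_map s p q T" "linear_mat_map s p q T'"
    and E: "\<And>u v. u < s \<Longrightarrow> v < s \<Longrightarrow> T (mat_unit s s u v) = T' (mat_unit s s u v)" and X: "X \<in> carrier_mat s s"
  shows "T X = T' X"
  using X
proof (induction rule: mat_unit_induct)
  case zero
  show ?case using linear_map_zero[OF T(1)] linear_map_zero[OF T(2)] by simp
next
  case (step X u v c)
  have "T (X + c \<cdot>\<^sub>m mat_unit s s u v) = T X + c \<cdot>\<^sub>m T (mat_unit s s u v)" "T' (X + c \<cdot>\<^sub>m mat_unit s s u v) = T' X + c \<cdot>\<^sub>m T' (mat_unit s s u v)"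
    using linear_mat_mapD(2)[OF T(1) step(1), of "c \<cdot>\<^sub>m mat_unit s s u v"] linear_mat_mapD(3)[OF T(1) mat_unit_carrier]
      linear_mat_mapD(2)[OF T(2) step(1), of "c \<cdot>\<^sub>m mat_unit s s u v"] linear_mat_mapD(3)[OF T(2) mat_unit_carrier] by simp_all
  thus ?case using step E by simp
qed

lemma linear_map_mult_left:
  assumes T: "linear_mat_map s p q T" and G: "G \<in> carrier_mat r p"
  shows "linear_mat_map s r q (\<lambda>X. G * T X)"
proof -
  have "G * T X \<in> carrier_mat r q" if "X \<in> carrier_mat s s" for X using mult_carrier_mat[OF G linear_mat_mapD(1)[OF T that]] .
  moreover have "G * T (X + X') = G * T X + G * T X'" if "X \<in> carrier_mat s s" "X' \<in> carrier_mat s s" for X X'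
    unfolding linear_mat_mapD(2)[OF T that] by (rule mult_add_distrib_mat[OF G linear_mat_mapD(1)[OF T that(1)] linear_mat_mapD(1)[OF T that(2)]])
  moreover have "G * T (c \<cdot>\<^sub>m X) = c \<cdot>\<^sub>m (G * T X)" if "X \<in> carrier_mat s s" for c X
    unfolding linear_mat_mapD(3)[OF T that] by (rule mult_smult_distrib[OF G linear_mat_mapD(1)[OF T that]])
  ultimately show ?thesis
    by (simp add: linear_mat_map_def LinearCombinations.module_hom_def module_mat_simps)
qed

lemma linear_map_mult_right:
  assumes T: "linear_mat_map s p q T" and G: "G \<in> carrier_mat q r"
  shows "linear_mat_map s p r (\<lambda>X. T X * G)"
proof -
  have "T X * G \<in> carrier_mat p r" if "X \<in> carrier_mat s s" for X using mult_carrier_mat[OF linear_mat_mapD(1)[OF T that] G] .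
  moreover have "T (X + X') * G = T X * G + T X' * G" if "X \<in> carrier_mat s s" "X' \<in> carrier_mat s s" for X X'
    unfolding linear_mat_mapD(2)[OF T that] by (rule add_mult_distrib_mat[OF linear_mat_mapD(1)[OF T that(1)] linear_mat_mapD(1)[OF T that(2)] G])
  moreover have "T (c \<cdot>\<^sub>m X) * G = c \<cdot>\<^sub>m (T X * G)" if "X \<in> carrier_mat s s" for c X
    unfolding linear_mat_mapD(3)[OF T that] by (rule mult_smult_assoc_mat[OF linear_mat_mapD(1)[OF T that] G])
  ultimately show ?thesis
    by (simp add: linear_mat_map_def LinearCombinations.module_hom_def module_mat_simps)
qed

text \<open>The vectors on which two intertwiners agree form an invariant subspace containing
  \<open>X\<close>.\<close>

lemma reachable_intertwiner_unique:
  fixes T F :: "'k::field mat"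
  assumes reach: "reachable I n A X" and X: "X \<subseteq> carrier_vec n" and T: "T \<in> carrier_mat p n" "F \<in> carrier_mat p n"
    and A: "\<And>\<kappa>. \<kappa> \<in> I \<Longrightarrow> A \<kappa> \<in> carrier_mat n n" "\<And>\<kappa>. \<kappa> \<in> I \<Longrightarrow> A' \<kappa> \<in> carrier_mat p p"
    and TA: "\<And>\<kappa>. \<kappa> \<in> I \<Longrightarrow> T * A \<kappa> = A' \<kappa> * T" and FA: "\<And>\<kappa>. \<kappa> \<in> I \<Longrightarrow> F * A \<kappa> = A' \<kappa> * F"
    and TX: "\<And>x. x \<in> X \<Longrightarrow> T *\<^sub>v x = F *\<^sub>v x"
  shows "T = F"
proof (rule mat_eq_of_mult_vec[OF T])
  let ?V = "{x \<in> carrier_vec n. T *\<^sub>v x = F *\<^sub>v x}"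
  have V: "lin_subspace n ?V"
    unfolding lin_subspace_def using T
    by (auto simp: mult_mat_zero_vec[OF T(1)] mult_mat_zero_vec[OF T(2)] mult_add_distrib_mat_vec[OF T(1)] mult_add_distrib_mat_vec[OF T(2)]
      mult_mat_vec[OF T(1)] mult_mat_vec[OF T(2)])
  have inv: "\<forall>\<kappa>\<in>I. \<forall>x\<in>?V. A \<kappa> *\<^sub>v x \<in> ?V"
  proof (intro ballI)
    fix \<kappa> x assume k: "\<kappa> \<in> I" and x: "x \<in> ?V"
    have xc: "x \<in> carrier_vec n" and e: "T *\<^sub>v x = F *\<^sub>v x" using x by auto
    have "T *\<^sub>v (A \<kappa> *\<^sub>v x) = A' \<kappa> *\<^sub>v (T *\<^sub>v x)"
      using assoc_mult_mat_vec[OF T(1) A(1)[OF k] xc] assoc_mult_mat_vec[OF A(2)[OF k] T(1) xc] TA[OF k] by simp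
    also have "\<dots> = F *\<^sub>v (A \<kappa> *\<^sub>v x)"
      unfolding e using assoc_mult_mat_vec[OF T(2) A(1)[OF k] xc] assoc_mult_mat_vec[OF A(2)[OF k] T(2) xc] FA[OF k] by simp
    finally show "A \<kappa> *\<^sub>v x \<in> ?V" using mult_mat_vec_carrier[OF A(1)[OF k] xc] by simp
  qed
  have "X \<subseteq> ?V" using X TX by blast
  hence "?V = carrier_vec n" by (intro mp[OF spec[OF reach[unfolded reachable_def], of ?V]] conjI V inv)
  thus "T *\<^sub>v x = F *\<^sub>v x" if "x \<in> carrier_vec n" for x using that by blast
qed

text \<open>Both systems have the Markov parameters of the same expansion at \<open>Y\<close>, so
  they are similar; the relations found at matrix units extend by linearity. Any other similarity
  agrees with this one on inputs and intertwines the same coefficients, so reachability identifies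
  the two.\<close>

lemma minimal_for_unique:
  fixes Y :: "'d::finite \<Rightarrow> 'k::field mat"
  assumes sys: "fm_system \<alpha> \<beta> s L D C A B" "fm_system \<alpha> \<beta> s L' D' C' A' B'"
    and rep: "represents \<beta> s S L D C A B" "represents \<beta> s S' L' D' C' A' B'"
    and M: "minimal_for s \<alpha> \<beta> ps R Y S" "minimal_for s \<alpha> \<beta> ps R Y S'"
  shows "uniquely_similar s L D C A B L' D' C' A' B'"
proof -
  let ?K = "grid UNIV s :: ('d \<times> nat \<times> nat) set" and ?S = "mat_rep \<alpha> \<beta> R ps"
  note w = represents_wf[OF sys(1) rep(1)] and w' = represents_wf[OF sys(2) rep(2)]
  obtain Q where Q: "inverse_pair (s * state_dim ?S) (pencil (*) UNIV s ?S Y) Q" "same_markov ?K (recentre UNIV s ?S Y Q) S"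
    using M(1) unfolding minimal_for_def by blast
  obtain Q' where Q': "inverse_pair (s * state_dim ?S) (pencil (*) UNIV s ?S Y) Q'" "same_markov ?K (recentre UNIV s ?S Y Q') S'"
    using M(2) unfolding minimal_for_def by blast
  \<comment> \<open>The inverse of the pencil at \<open>Y\<close> is unique, so the two definitions
    of \<open>minimal_for\<close> refer to one and the same expansion.\<close>
  have QQ: "Q' = Q" by (rule inverse_pair_unique[OF Q(1) Q'(1)])
  have wr: "wf_descr ?K (\<alpha> * s) (\<beta> * s) (recentre UNIV s ?S Y Q)"
    using wf_recentre[OF wf_mat_rep Q(1)] by (simp add: mult.commute)
  have mk: "same_markov ?K S S'"
    by (rule same_markov_trans[OF w wr same_markov_sym[OF wr w Q(2)] Q'(2)[unfolded QQ]])
  have min: "minimal ?K S" "minimal ?K S'" using M by (auto simp: minimal_for_def)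
  obtain F G where F: "intertwines ?K F S S'" and FG: "inverse_pair (state_dim S) F G" and dim: "state_dim S' = state_dim S"
    by (rule minimal_unique[OF w w' mk min])
  note rD = repD[OF sys(1) rep(1)] and rD' = repD[OF sys(2) rep(2)]
  have LL: "L' = L" using dim rD rD' by simp
  have DD: "D' = D" using F rD rD' by (simp add: intertwines_def)
  have FGL: "inverse_pair L F G" using FG rD by simp
  note fg = FGL[unfolded inverse_pair_def]
  have Fc: "F \<in> carrier_mat L L" and Gc: "G \<in> carrier_mat L L" using fg by auto
  note A = sysD(3)[OF sys(1) rep(1)] and A' = sysD(3)[OF sys(2) rep(2), unfolded LL]
  note B = sysD(4)[OF sys(1) rep(1)] and B' = sysD(4)[OF sys(2) rep(2), unfolded LL]
  have C'c: "C' \<in> carrier_mat (\<alpha> * s) L" using sysD(2)[OF sys(2) rep(2)] LL by simp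
  have C'F: "C' * F = C" using F rD rD' by (simp add: intertwines_def)
  have "C' = C' * (F * G)" using fg C'c by simp
  also have "\<dots> = C * G" using assoc_mult_mat[OF C'c Fc Gc] C'F by simp
  finally have CG: "C' = C * G" .
  have pen: "A' k (mat_unit s s u v) * F = F * A k (mat_unit s s u v)" if "u < s" "v < s" for k u v
  proof -
    have "pen_coeff S' (k, u, v) * F = F * pen_coeff S (k, u, v)" using F that by (simp add: intertwines_def)
    hence "- (A' k (mat_unit s s u v) * F) = - (F * A k (mat_unit s s u v))"
      unfolding rD(6)[OF that] rD'(6)[OF that]
      using linear_mat_mapD(1)[OF A[of k] mat_unit_carrier, of u v] linear_mat_mapD(1)[OF A'[of k] mat_unit_carrier, of u v] Fc by auto
    thus ?thesis by simp
  qed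
  have AF: "A' k X * F = F * A k X" if X: "X \<in> carrier_mat s s" for k X
    by (rule linear_maps_eq[OF linear_map_mult_right[OF A' Fc] linear_map_mult_left[OF A Fc] pen X])
  have BF: "B' k X = F * B k X" if X: "X \<in> carrier_mat s s" for k X
  proof (rule linear_maps_eq[OF B' linear_map_mult_left[OF B Fc] _ X])
    fix u v assume uv: "u < s" "v < s"
    have "F * inp_coeff S (k, u, v) = inp_coeff S' (k, u, v)" using F uv by (simp add: intertwines_def)
    thus "B' k (mat_unit s s u v) = F * B k (mat_unit s s u v)" unfolding rD(7)[OF uv] rD'(7)[OF uv] by simp
  qed
  have AFG: "A' k X = F * A k X * G" if X: "X \<in> carrier_mat s s" for k X
  proof -
    have c: "A' k X \<in> carrier_mat L L" using linear_mat_mapD(1)[OF A' X] .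
    have "A' k X = A' k X * (F * G)" using fg c by simp
    also have "\<dots> = F * A k X * G" using assoc_mult_mat[OF c Fc Gc] AF[OF X] by simp
    finally show ?thesis .
  qed
  have ex: "F \<in> Units (mat_algebra L)" "inv\<^bsub>mat_algebra L\<^esub> F = G"
    using FGL inv_mat_algebra[OF FGL] unfolding Units_mat_algebra_iff by blast+
  have uniq: "T = F" if T: "T \<in> Units (mat_algebra L)"
    and TBA: "\<forall>k. \<forall>X\<in>carrier_mat s s. B' k X = T * B k X \<and> A' k X = T * A k X * inv\<^bsub>mat_algebra L\<^esub> T" for T
  proof -
    obtain Ti where Ti: "inverse_pair L T Ti" using T unfolding Units_mat_algebra_iff by blast
    note t = Ti[unfolded inverse_pair_def]
    have Tc: "T \<in> carrier_mat L L" and Tic: "Ti \<in> carrier_mat L L" using t by auto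
    have TA: "T * A k X = A' k X * T" if X: "X \<in> carrier_mat s s" for k X
    proof -
      have c: "A k X \<in> carrier_mat L L" using linear_mat_mapD(1)[OF A X] .
      have "A' k X * T = T * A k X * Ti * T" using TBA X inv_mat_algebra[OF Ti] by simp
      also have "\<dots> = T * A k X * (Ti * T)" by (rule assoc_mult_mat[OF mult_carrier_mat[OF Tc c] Tic Tc])
      also have "\<dots> = T * A k X" using t right_mult_one_mat[OF mult_carrier_mat[OF Tc c]] by simp
      finally show ?thesis by simp
    qed
    have reach: "reachable ?K L (pen_coeff S) (input_range ?K S)" using min(1) rD by (simp add: minimal_def)
    show ?thesis
    proof (rule reachable_intertwiner_unique[OF reach _ Tc Fc, where A' = "pen_coeff S'"])
      show "input_range ?K S \<subseteq> carrier_vec L"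
      proof
        fix y assume "y \<in> input_range ?K S"
        then obtain \<kappa> u where k: "\<kappa> \<in> ?K" and y: "y = inp_coeff S \<kappa> *\<^sub>v u" and u: "u \<in> carrier_vec (\<beta> * s)"
          unfolding input_range_def rD(5) by auto
        show "y \<in> carrier_vec L" unfolding y using mult_mat_vec_carrier[OF wf_descr_carrier(6)[OF w k] u] rD(1) by simp
      qed
      fix \<kappa> assume k: "\<kappa> \<in> ?K"
      obtain j u v where kk: "\<kappa> = (j, u, v)" and uv: "u < s" "v < s" using k by auto
      show pc: "pen_coeff S \<kappa> \<in> carrier_mat L L" "pen_coeff S' \<kappa> \<in> carrier_mat L L"
        using wf_descr_carrier(5)[OF w k] wf_descr_carrier(5)[OF w' k] rD(1) rD'(1) LL by simp_all
      have "pen_coeff S' \<kappa> * F = F * pen_coeff S \<kappa>" using F k unfolding intertwines_def by blast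
      thus "F * pen_coeff S \<kappa> = pen_coeff S' \<kappa> * F" by (rule sym)
      show "T * pen_coeff S \<kappa> = pen_coeff S' \<kappa> * T"
        unfolding kk rD(6)[OF uv] rD'(6)[OF uv] using TA[OF mat_unit_carrier, of j u v] Tc
          linear_mat_mapD(1)[OF A[of j] mat_unit_carrier, of u v] linear_mat_mapD(1)[OF A'[of j] mat_unit_carrier, of u v] by auto
    next
      fix y assume "y \<in> input_range ?K S"
      then obtain j u v x where y: "y = inp_coeff S (j, u, v) *\<^sub>v x" and uv: "u < s" "v < s" and x: "x \<in> carrier_vec (\<beta> * s)"
        unfolding input_range_def rD(5) by auto
      have Bc: "B j (mat_unit s s u v) \<in> carrier_mat L (\<beta> * s)" using linear_mat_mapD(1)[OF B mat_unit_carrier] .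
      have "T * B j (mat_unit s s u v) = F * B j (mat_unit s s u v)"
        using TBA BF[OF mat_unit_carrier, of j u v] mat_unit_carrier[of s s u v] by metis
      thus "T *\<^sub>v y = F *\<^sub>v y"
        unfolding y rD(7)[OF uv] using assoc_mult_mat_vec[OF Tc Bc x] assoc_mult_mat_vec[OF Fc Bc x] by simp
    qed
  qed
  show ?thesis
    unfolding uniquely_similar_def
  proof (intro conjI LL DD ex1I[of _ F])
    show "F \<in> Units (mat_algebra L)" "C' = C * inv\<^bsub>mat_algebra L\<^esub> F" using ex CG by simp_all
    show "\<forall>k. \<forall>X\<in>carrier_mat s s. B' k X = F * B k X \<and> A' k X = F * A k X * inv\<^bsub>mat_algebra L\<^esub> F"
      unfolding ex(2) using BF AFG by blast
  qed (use uniq in blast)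
qed

theorem theorem4p2:
  fixes \<alpha> \<beta> s :: nat
    and r :: "('d::finite, 'k::field) nc_expr set mat"
    and Y :: "'d \<Rightarrow> 'k mat"
  assumes "\<alpha> \<ge> 1" and "\<beta> \<ge> 1" and "s \<ge> 1"
    and "r \<in> nc_rational_matrices \<alpha> \<beta>"
    and "Y \<in> rat_mat_dom (mat_algebra s) r"
  shows
    "(\<exists>L D C A B. minimal_realization \<alpha> \<beta> s r Y L D C A B) \<and>
     (\<forall>L D C A B. minimal_realization \<alpha> \<beta> s r Y L D C A B \<longrightarrow>
        (\<forall>L' D' C' A' B'. minimal_realization \<alpha> \<beta> s r Y L' D' C' A' B' \<longrightarrow>
           uniquely_similar s L D C A B L' D' C' A' B') \<and>
        (\<forall>n\<ge>1. \<forall>X \<in> rat_mat_dom (mat_algebra n) r.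
           det (fm_pencil s Y L A n (\<lambda>k. 1\<^sub>m s \<otimes>\<^sub>K X k)) \<noteq> 0 \<and>
           1\<^sub>m s \<otimes>\<^sub>K rat_mat_value n r X = fm_value \<beta> s Y L D C A B n (\<lambda>k. 1\<^sub>m s \<otimes>\<^sub>K X k)) \<and>
        (\<forall>scale :: 'k \<Rightarrow> 'a::ring_1 \<Rightarrow> 'a. unital_algebra scale \<longrightarrow> stably_finite TYPE('a) \<longrightarrow>
           (\<forall>a \<in> rat_mat_dom (type_algebra scale) r.
              fm_pencil_alg scale s Y L A (\<lambda>k. scalar_tensor scale (1\<^sub>m s) (a k)) \<in> Units (mat_algebra L) \<and>
              1\<^sub>m s \<otimes>\<^sub>K rat_mat_eval (type_algebra scale) r a =
                fm_value_alg scale \<beta> s Y L D C A B (\<lambda>k. scalar_tensor scale (1\<^sub>m s) (a k)))))"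
proof -
  have r: "r \<in> carrier_mat \<alpha> \<beta>" using assms(4) by (simp add: nc_rational_matrices_def)
  obtain R0 where "\<forall>i<\<alpha>. \<forall>j<\<beta>. \<forall>R \<in> r $$ (i, j). (R0 i j, R) \<in> expr_equiv"
    using rational_class_rep[OF assms(4)] by blast
  hence R0: "\<And>i j R. i < \<alpha> \<Longrightarrow> j < \<beta> \<Longrightarrow> R \<in> r $$ (i, j) \<Longrightarrow> (R0 i j, R) \<in> expr_equiv" by blast
  obtain R where "\<forall>i<\<alpha>. \<forall>j<\<beta>. R i j \<in> r $$ (i, j) \<and> Y \<in> expr_dom (mat_algebra s) (R i j)"
    using assms(5) unfolding rat_mat_dom_iff[OF r] by blast
  hence R: "\<And>i j. i < \<alpha> \<Longrightarrow> j < \<beta> \<Longrightarrow> R i j \<in> r $$ (i, j)" "\<And>i j. i < \<alpha> \<Longrightarrow> j < \<beta> \<Longrightarrow> Y \<in> expr_dom (mat_algebra s) (R i j)"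
    by blast+
  \<comment> \<open>Sizes are read off the entry (0, 0), which exists because \<alpha> and \<beta>
    are positive.\<close>
  have Yc: "Y \<kappa> \<in> carrier_mat s s" for \<kappa> using field_expr_dom_carrier[OF R(2)[of 0 0]] assms(1,2) by simp
  let ?K = "grid UNIV s :: ('d \<times> nat \<times> nat) set" and ?F = "minimal_for s \<alpha> \<beta> (entry_list \<alpha> \<beta>) R Y"
  have carr: "X \<kappa> \<in> carrier_mat n n" if X: "X \<in> rat_mat_dom (mat_algebra n) r" for n X \<kappa>
  proof -
    obtain R' where "\<forall>i<\<alpha>. \<forall>j<\<beta>. R' i j \<in> r $$ (i, j) \<and> X \<in> expr_dom (mat_algebra n) (R' i j)"
      using X unfolding rat_mat_dom_iff[OF r] by blast
    hence "X \<in> expr_dom (mat_algebra n) (R' 0 0)" using assms(1,2) by simp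
    thus ?thesis by (rule field_expr_dom_carrier)
  qed
  have "\<exists>M. ?F M" by (rule minimal_for_exists[OF Yc]) (use R in \<open>auto simp: entry_list\<close>)
  then obtain M where M: "?F M" ..
  have wM: "wf_descr ?K (s * \<alpha>) (s * \<beta>) M" "centered M" and mM: "minimal ?K M" using M by (auto simp: minimal_for_def)
  obtain A B where sysM: "fm_system \<alpha> \<beta> s (state_dim M) (feed M) (outp M) A B"
    and repM: "represents \<beta> s M (state_dim M) (feed M) (outp M) A B"
    using system_of_descriptor[OF wM] by blast
  have "det (fm_pencil s Y (state_dim M) A m X) \<noteq> 0 \<and> rat_mat_value (s * m) r X = fm_value \<beta> s Y (state_dim M) (feed M) (outp M) A B m X"
    if X: "X \<in> rat_mat_dom (mat_algebra (s * m)) r" for m X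
  proof -
    have "descr_at (*) ?K m M (coords (*) s m Y X) (rat_mat_value (m * s) r X)"
      by (rule minimal_value[where ?R0.0 = R0 and R = R and Y = Y, OF assms(3) r _ Yc _ _ M assms(1,2) X[unfolded mult.commute[of s m]]])
        (simp_all add: R0 R)
    thus ?thesis
      using descr_at_iff_fm_value[where X = X and Y = Y and m = m, OF sysM repM carr[OF X[unfolded mult.commute[of s m]]] Yc]
      by (simp add: mult.commute)
  qed
  hence "minimal_realization \<alpha> \<beta> s r Y (state_dim M) (feed M) (outp M) A B"
    unfolding minimal_realization_def using sysM represents_minimal_iff[OF sysM repM] mM by blast
  hence existence: "\<exists>L D C A B. minimal_realization \<alpha> \<beta> s r Y L D C A B" by blast
  \<comment> \<open>Every minimal realization, not only the one constructed, is a minimal system for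
    the representatives \<open>R\<close> at \<open>Y\<close>. Hence the remaining claims can be
    proved for an arbitrary one.\<close>
  have descr: "\<exists>S. represents \<beta> s S L D C A B \<and> ?F S" if real: "minimal_realization \<alpha> \<beta> s r Y L D C A B" for L D C A B
  proof -
    have rep: "represents \<beta> s (Descriptor L D C (1\<^sub>m L) (\<lambda>(k, u, v). - A k (mat_unit s s u v)) (0\<^sub>m L (\<beta> * s)) (\<lambda>(k, u, v). B k (mat_unit s s u v))) L D C A B"
      by (simp add: represents_def)
    show ?thesis
      by (rule exI, rule conjI[OF rep], rule minimal_realization_minimal_for[where ?R0.0 = R0 and R = R, OF r _ _ _ _ real rep])
        (simp_all add: R0 Yc R)
  qed
  show ?thesis
  proof (intro conjI existence allI impI ballI)
    fix L D C A B assume real: "minimal_realization \<alpha> \<beta> s r Y L D C A B"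
    obtain S where rep: "represents \<beta> s S L D C A B" and S: "?F S" using descr[OF real] by blast
    have sys: "fm_system \<alpha> \<beta> s L D C A B" using real by (simp add: minimal_realization_def)
    {
      fix L' D' C' A' B' assume real': "minimal_realization \<alpha> \<beta> s r Y L' D' C' A' B'"
      obtain S' where rep': "represents \<beta> s S' L' D' C' A' B'" and S': "?F S'" using descr[OF real'] by blast
      have sys': "fm_system \<alpha> \<beta> s L' D' C' A' B'" using real' by (simp add: minimal_realization_def)
      show "uniquely_similar s L D C A B L' D' C' A' B'" by (rule minimal_for_unique[OF sys sys' rep rep' S S'])
    }
    {
      fix n :: nat and X assume X: "X \<in> rat_mat_dom (mat_algebra n) r"
      have XX: "1\<^sub>m s \<otimes>\<^sub>K X \<kappa> \<in> carrier_mat (n * s) (n * s)" for \<kappa>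
        using carr[OF X, of \<kappa>] by (auto simp: mult.commute intro!: carrier_matI)
      have v: "descr_at (*) ?K n S (coords (*) s n Y (\<lambda>k. 1\<^sub>m s \<otimes>\<^sub>K X k)) (1\<^sub>m s \<otimes>\<^sub>K rat_mat_value n r X)"
        by (rule minimal_value_one_kron[where ?R0.0 = R0 and R = R and Y = Y, OF assms(3) r _ Yc _ _ S assms(1,2) X]) (simp_all add: R0 R)
      have "det (fm_pencil s Y L A n (\<lambda>k. 1\<^sub>m s \<otimes>\<^sub>K X k)) \<noteq> 0 \<and>
        1\<^sub>m s \<otimes>\<^sub>K rat_mat_value n r X = fm_value \<beta> s Y L D C A B n (\<lambda>k. 1\<^sub>m s \<otimes>\<^sub>K X k)"
        using descr_at_iff_fm_value[where X = "\<lambda>k. 1\<^sub>m s \<otimes>\<^sub>K X k" and Y = Y and m = n, OF sys rep XX Yc] v by blast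
      thus "det (fm_pencil s Y L A n (\<lambda>k. 1\<^sub>m s \<otimes>\<^sub>K X k)) \<noteq> 0"
        "1\<^sub>m s \<otimes>\<^sub>K rat_mat_value n r X = fm_value \<beta> s Y L D C A B n (\<lambda>k. 1\<^sub>m s \<otimes>\<^sub>K X k)" by blast+
    }
    {
      fix scale :: "'k \<Rightarrow> 'a \<Rightarrow> 'a" and a
      assume alg: "unital_algebra scale" and sf: "stably_finite TYPE('a)" and a: "a \<in> rat_mat_dom (type_algebra scale) r"
      have Xc: "scalar_tensor scale (1\<^sub>m s) (a k) \<in> carrier_mat s s" for k by (simp add: scalar_tensor_def)
      have v: "descr_at scale ?K 1 S (coords scale s 1 Y (\<lambda>k. scalar_tensor scale (1\<^sub>m s) (a k)))
        (1\<^sub>m s \<otimes>\<^sub>K rat_mat_eval (type_algebra scale) r a)"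
        by (rule minimal_value_alg[where ?R0.0 = R0 and R = R and Y = Y, OF assms(3) r _ Yc _ _ S assms(1,2) alg sf a]) (simp_all add: R0 R)
      have "fm_pencil_alg scale s Y L A (\<lambda>k. scalar_tensor scale (1\<^sub>m s) (a k)) \<in> Units (mat_algebra L) \<and>
        1\<^sub>m s \<otimes>\<^sub>K rat_mat_eval (type_algebra scale) r a =
          fm_value_alg scale \<beta> s Y L D C A B (\<lambda>k. scalar_tensor scale (1\<^sub>m s) (a k))"
        using unital_algebra.descr_at_iff_fm_value_alg[where X = "\<lambda>k. scalar_tensor scale (1\<^sub>m s) (a k)" and Y = Y, OF alg sys rep Xc Yc] v by blast
      thus "fm_pencil_alg scale s Y L A (\<lambda>k. scalar_tensor scale (1\<^sub>m s) (a k)) \<in> Units (mat_algebra L)"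
        "1\<^sub>m s \<otimes>\<^sub>K rat_mat_eval (type_algebra scale) r a =
          fm_value_alg scale \<beta> s Y L D C A B (\<lambda>k. scalar_tensor scale (1\<^sub>m s) (a k))" by blast+
    }
  qed
qed

end
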